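(* Let $A$ be a dg algebra over $\mathbb{C}$ which is proper. Suppose that it carries an action of $\mathbb{C}^*$. Let $M$ be a perfect dg module over $A$ which is rigid and simple. Then $M$ is quasi-isomorphic to a $\mathbb{C}^*$-equivariant dg module.
   Context: Proper means that the cohomology $H(A)$ has finite total dimension. An action of $\mathbb{C}^*$ on $A$ is a linear action, compatible with the grading, differential, product and unit, which is rational, i.e. a direct sum of finite-dimensional (algebraic) representations of $\mathbb{C}^*$. Modules are right modules. $A^{\mathrm{perf}}$ is the (dg) derived category of perfect dg modules: those which, in the derived category of dg $A$-modules, are direct summands of objects obtained from the free module $A$ by finitely many shifts and mapping cones. An object $M$ of $A^{\mathrm{perf}}$ is rigid and simple if $H^1(\mathrm{hom}_{A^{\mathrm{perf}}}(M,M)) = 0$ and $H^0(\mathrm{hom}_{A^{\mathrm{perf}}}(M,M)) \cong \mathbb{C}$, where $\mathrm{hom}$ is the derived morphism complex. A $\mathbb{C}^*$-equivariant dg module is a dg module which carries a rational action of $\mathbb{C}^*$ compatible with the other structures (grading, differential, and module multiplication with respect to the given action on $A$). *)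

theory Defs
  imports
    Complex_Main
    "HOL-Library.FuncSet"
    "HOL-Computational_Algebra.Polynomial"
    "HOL-Algebra.AbelCoset"
    "HOL-Algebra.Module"
    "HOL-Algebra.Algebraic_Closure_Type"
begin

text \<open>The letter X is notation in the algebra library; we use it as a variable name.\<close>

no_notation var (\<open>X\<index>\<close>)


section \<open>Complex vector spaces\<close>

text \<open>
  Complex vector spaces are modules, in the sense of HOL-Algebra, over the field of complex
  numbers. The record type of modules extends that of rings, and its fields for the product and
  the unit play no role in the locale of modules; we leave them undefined.
\<close>

abbreviation complex_field :: "complex ring" where
  "complex_field \<equiv> ring_of_type_algebra"

abbreviation complex_vector_space :: "(complex, 'u) module \<Rightarrow> bool" where
  "complex_vector_space V \<equiv> Module.module complex_field V"

definition make_space ::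
  "'u set \<Rightarrow> 'u \<Rightarrow> ('u \<Rightarrow> 'u \<Rightarrow> 'u) \<Rightarrow> (complex \<Rightarrow> 'u \<Rightarrow> 'u) \<Rightarrow> (complex, 'u) module"
where
  "make_space S z p s =
     \<lparr>carrier = S, monoid.mult = undefined, one = undefined, ring.zero = z, add = p, module.smult = s\<rparr>"

definition complex_line :: "(complex, complex) module" where
  "complex_line = make_space UNIV 0 (+) (*)"

definition linear_maps ::
  "(complex, 'u) module \<Rightarrow> (complex, 'v) module \<Rightarrow> ('u \<Rightarrow> 'v) set"
where
  "linear_maps V W = {f \<in> carrier V \<rightarrow> carrier W.
     (\<forall>x\<in>carrier V. \<forall>y\<in>carrier V. f (x \<oplus>\<^bsub>V\<^esub> y) = f x \<oplus>\<^bsub>W\<^esub> f y) \<and>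
     (\<forall>c. \<forall>x\<in>carrier V. f (c \<odot>\<^bsub>V\<^esub> x) = c \<odot>\<^bsub>W\<^esub> f x)}"

definition linearly_isomorphic :: "(complex, 'u) module \<Rightarrow> (complex, 'v) module \<Rightarrow> bool" where
  "linearly_isomorphic V W \<longleftrightarrow>
     (\<exists>f \<in> linear_maps V W. bij_betw f (carrier V) (carrier W))"

definition finite_dimensional :: "(complex, 'u) module \<Rightarrow> bool" where
  "finite_dimensional V \<longleftrightarrow>
     (\<exists>S. finite S \<and> S \<subseteq> carrier V \<and>
          (\<forall>v\<in>carrier V. \<exists>c. v = (\<Oplus>\<^bsub>V\<^esub>s\<in>S. c s \<odot>\<^bsub>V\<^esub> s)))"

definition zero_space :: "(complex, 'u) module \<Rightarrow> bool" where
  "zero_space V \<longleftrightarrow> carrier V = {\<zero>\<^bsub>V\<^esub>}"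

definition product_space ::
  "(complex, 'u) module \<Rightarrow> (complex, 'v) module \<Rightarrow> (complex, 'u \<times> 'v) module"
where
  "product_space V W = make_space (carrier V \<times> carrier W) (\<zero>\<^bsub>V\<^esub>, \<zero>\<^bsub>W\<^esub>)
     (\<lambda>(x, y) (x', y'). (x \<oplus>\<^bsub>V\<^esub> x', y \<oplus>\<^bsub>W\<^esub> y'))
     (\<lambda>c (x, y). (c \<odot>\<^bsub>V\<^esub> x, c \<odot>\<^bsub>W\<^esub> y))"

text \<open>
  The scalar multiple of a coset is the coset obtained by adding the subspace again; without
  this, multiplication by 0 would give the set of the zero vector instead of the zero coset.
\<close>

definition quotient_space :: "(complex, 'u) module \<Rightarrow> 'u set \<Rightarrow> (complex, 'u set) module" where
  "quotient_space V B = make_space {B +>\<^bsub>V\<^esub> x | x. x \<in> carrier V} B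
     (set_add V) (\<lambda>c X. set_add V B ((\<lambda>x. c \<odot>\<^bsub>V\<^esub> x) ` X))"

definition internal_direct_sum :: "(complex, 'u) module \<Rightarrow> 'u set set \<Rightarrow> bool" where
  "internal_direct_sum V \<W> \<longleftrightarrow>
     (\<forall>W\<in>\<W>. submodule W complex_field V) \<and>
     (\<forall>v\<in>carrier V. \<exists>!f. f \<in> (\<Pi>\<^sub>E W\<in>\<W>. W) \<and> finite {W\<in>\<W>. f W \<noteq> \<zero>\<^bsub>V\<^esub>} \<and>
        v = (\<Oplus>\<^bsub>V\<^esub>W\<in>{W\<in>\<W>. f W \<noteq> \<zero>\<^bsub>V\<^esub>}. f W))"


section \<open>Rational representations of the multiplicative group\<close>

text \<open>
  A representation is a function on all complex numbers, whose value at 0 is irrelevant.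
\<close>

definition representation :: "(complex, 'u) module \<Rightarrow> (complex \<Rightarrow> 'u \<Rightarrow> 'u) \<Rightarrow> bool" where
  "representation V r \<longleftrightarrow>
     (\<forall>z. z \<noteq> 0 \<longrightarrow> r z \<in> linear_maps V V) \<and>
     (\<forall>x\<in>carrier V. r 1 x = x) \<and>
     (\<forall>z w. z \<noteq> 0 \<longrightarrow> w \<noteq> 0 \<longrightarrow> (\<forall>x\<in>carrier V. r (z * w) x = r z (r w x)))"

text \<open>The regular functions on the algebraic group, i.e. the Laurent polynomials.\<close>

definition regular_function :: "(complex \<Rightarrow> complex) \<Rightarrow> bool" where
  "regular_function g \<longleftrightarrow>
     (\<exists>(p :: complex poly) (m :: nat). \<forall>z. z \<noteq> 0 \<longrightarrow> g z = poly p z / z ^ m)"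

text \<open>
  A finite-dimensional representation is algebraic if its matrix coefficients are regular
  functions.
\<close>

definition algebraic_representation ::
  "(complex, 'u) module \<Rightarrow> (complex \<Rightarrow> 'u \<Rightarrow> 'u) \<Rightarrow> bool"
where
  "algebraic_representation V r \<longleftrightarrow>
     representation V r \<and> finite_dimensional V \<and>
     (\<forall>\<phi> \<in> linear_maps V complex_line. \<forall>x\<in>carrier V. regular_function (\<lambda>z. \<phi> (r z x)))"

definition rational_representation ::
  "(complex, 'u) module \<Rightarrow> (complex \<Rightarrow> 'u \<Rightarrow> 'u) \<Rightarrow> bool"
where
  "rational_representation V r \<longleftrightarrow>
     representation V r \<and>
     (\<exists>\<W>. internal_direct_sum V \<W> \<and>
           (\<forall>W\<in>\<W>. algebraic_representation (V\<lparr>carrier := W\<rparr>) r))"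


section \<open>Cochain complexes\<close>

text \<open>
  A graded space is the family of its homogeneous parts, which need not be disjoint as sets.
  All gradings are by the integers, and differentials have degree 1. The functions in the records
  are only relevant on the carriers of the homogeneous parts.
\<close>

record 'u cochain_complex =
  gr :: "int \<Rightarrow> (complex, 'u) module"
  dif :: "int \<Rightarrow> 'u \<Rightarrow> 'u"

locale cochain_complex =
  fixes C :: "('u, 'z) cochain_complex_scheme"
  assumes vector_space: "complex_vector_space (gr C i)"
    and dif_linear: "dif C i \<in> linear_maps (gr C i) (gr C (i + 1))"
    and dif_dif: "x \<in> carrier (gr C i) \<Longrightarrow> dif C (i + 1) (dif C i x) = \<zero>\<^bsub>gr C (i + 2)\<^esub>"

abbreviation sign :: "int \<Rightarrow> complex" where
  "sign n \<equiv> (- 1) powi n"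

definition cocycles :: "('u, 'z) cochain_complex_scheme \<Rightarrow> int \<Rightarrow> 'u set" where
  "cocycles C i = {x \<in> carrier (gr C i). dif C i x = \<zero>\<^bsub>gr C (i + 1)\<^esub>}"

definition coboundaries :: "('u, 'z) cochain_complex_scheme \<Rightarrow> int \<Rightarrow> 'u set" where
  "coboundaries C i = dif C (i - 1) ` carrier (gr C (i - 1))"

definition cohomology ::
  "('u, 'z) cochain_complex_scheme \<Rightarrow> int \<Rightarrow> (complex, 'u set) module"
where
  "cohomology C i = quotient_space ((gr C i)\<lparr>carrier := cocycles C i\<rparr>) (coboundaries C i)"

definition cohomology_map ::
  "('v, 'y) cochain_complex_scheme \<Rightarrow> (int \<Rightarrow> 'u \<Rightarrow> 'v) \<Rightarrow> int \<Rightarrow> 'u set \<Rightarrow> 'v set"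
where
  "cohomology_map D f i X = set_add (gr D i) (coboundaries D i) (f i ` X)"

definition acyclic_complex :: "('u, 'z) cochain_complex_scheme \<Rightarrow> bool" where
  "acyclic_complex C \<longleftrightarrow> (\<forall>i. zero_space (cohomology C i))"

definition finite_total_cohomology :: "('u, 'z) cochain_complex_scheme \<Rightarrow> bool" where
  "finite_total_cohomology C \<longleftrightarrow>
     (\<forall>i. finite_dimensional (cohomology C i)) \<and> finite {i. \<not> zero_space (cohomology C i)}"


section \<open>Differential graded algebras and right modules\<close>

record 'a dg_algebra = "'a cochain_complex" +
  mul :: "int \<Rightarrow> int \<Rightarrow> 'a \<Rightarrow> 'a \<Rightarrow> 'a"
  unt :: 'a

locale dg_algebra = cochain_complex A for A :: "('a, 'z) dg_algebra_scheme" +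
  assumes mul_linear_left:
      "b \<in> carrier (gr A j) \<Longrightarrow> (\<lambda>a. mul A i j a b) \<in> linear_maps (gr A i) (gr A (i + j))"
    and mul_linear_right:
      "a \<in> carrier (gr A i) \<Longrightarrow> mul A i j a \<in> linear_maps (gr A j) (gr A (i + j))"
    and mul_assoc:
      "a \<in> carrier (gr A i) \<Longrightarrow> b \<in> carrier (gr A j) \<Longrightarrow> c \<in> carrier (gr A k) \<Longrightarrow>
       mul A (i + j) k (mul A i j a b) c = mul A i (j + k) a (mul A j k b c)"
    and unt_closed: "unt A \<in> carrier (gr A 0)"
    and unt_left: "a \<in> carrier (gr A i) \<Longrightarrow> mul A 0 i (unt A) a = a"
    and unt_right: "a \<in> carrier (gr A i) \<Longrightarrow> mul A i 0 a (unt A) = a"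
    and leibniz:
      "a \<in> carrier (gr A i) \<Longrightarrow> b \<in> carrier (gr A j) \<Longrightarrow>
       dif A (i + j) (mul A i j a b) =
         mul A (i + 1) j (dif A i a) b
           \<oplus>\<^bsub>gr A (i + j + 1)\<^esub> sign i \<odot>\<^bsub>gr A (i + j + 1)\<^esub> mul A i (j + 1) a (dif A j b)"

definition proper :: "('a, 'z) dg_algebra_scheme \<Rightarrow> bool" where
  "proper A \<longleftrightarrow> finite_total_cohomology A"

record ('a, 'u) dg_module = "'u cochain_complex" +
  act :: "int \<Rightarrow> int \<Rightarrow> 'u \<Rightarrow> 'a \<Rightarrow> 'u"

locale dg_module = dg_algebra A + M: cochain_complex M
  for A :: "'a dg_algebra" and M :: "('a, 'u) dg_module" +
  assumes act_linear_left:
      "a \<in> carrier (gr A j) \<Longrightarrow> (\<lambda>x. act M i j x a) \<in> linear_maps (gr M i) (gr M (i + j))"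
    and act_linear_right:
      "x \<in> carrier (gr M i) \<Longrightarrow> act M i j x \<in> linear_maps (gr A j) (gr M (i + j))"
    and act_assoc:
      "x \<in> carrier (gr M i) \<Longrightarrow> a \<in> carrier (gr A j) \<Longrightarrow> b \<in> carrier (gr A k) \<Longrightarrow>
       act M (i + j) k (act M i j x a) b = act M i (j + k) x (mul A j k a b)"
    and act_unt: "x \<in> carrier (gr M i) \<Longrightarrow> act M i 0 x (unt A) = x"
    and act_leibniz:
      "x \<in> carrier (gr M i) \<Longrightarrow> a \<in> carrier (gr A j) \<Longrightarrow>
       dif M (i + j) (act M i j x a) =
         act M (i + 1) j (dif M i x) a
           \<oplus>\<^bsub>gr M (i + j + 1)\<^esub> sign i \<odot>\<^bsub>gr M (i + j + 1)\<^esub> act M i (j + 1) x (dif A j a)"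

definition dg_hom ::
  "'a dg_algebra \<Rightarrow> ('a, 'u) dg_module \<Rightarrow> ('a, 'v) dg_module \<Rightarrow> (int \<Rightarrow> 'u \<Rightarrow> 'v) \<Rightarrow> bool"
where
  "dg_hom A X Y f \<longleftrightarrow>
     (\<forall>i. f i \<in> linear_maps (gr X i) (gr Y i)) \<and>
     (\<forall>i. \<forall>x\<in>carrier (gr X i). f (i + 1) (dif X i x) = dif Y i (f i x)) \<and>
     (\<forall>i j. \<forall>x\<in>carrier (gr X i). \<forall>a\<in>carrier (gr A j).
        f (i + j) (act X i j x a) = act Y i j (f i x) a)"

definition dg_isomorphic ::
  "'a dg_algebra \<Rightarrow> ('a, 'u) dg_module \<Rightarrow> ('a, 'v) dg_module \<Rightarrow> bool"
where
  "dg_isomorphic A X Y \<longleftrightarrow>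
     (\<exists>f. dg_hom A X Y f \<and> (\<forall>i. bij_betw (f i) (carrier (gr X i)) (carrier (gr Y i))))"

definition quasi_isomorphism ::
  "'a dg_algebra \<Rightarrow> ('a, 'u) dg_module \<Rightarrow> ('a, 'v) dg_module \<Rightarrow> (int \<Rightarrow> 'u \<Rightarrow> 'v) \<Rightarrow> bool"
where
  "quasi_isomorphism A X Y f \<longleftrightarrow>
     dg_hom A X Y f \<and>
     (\<forall>i. bij_betw (cohomology_map Y f i) (carrier (cohomology X i)) (carrier (cohomology Y i)))"

text \<open>
  Two dg modules are isomorphic in the derived category if and only if they are connected by a
  finite zigzag of quasi-isomorphisms.

  The objects of the derived category are the dg modules whose homogeneous parts have carriers in
  a fixed type. In the notions below and in the theorem this is also the type of the dg algebra,
  and both an algebra and a module over it can be transported to a common type, such as the sum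
  of their types. This is no restriction: if the algebra is nonzero, then the type is infinite and
  at least as large as the complex numbers and the algebra, so that, up to isomorphism, sums,
  cones, and semi-free resolutions exist in it; if the algebra is zero, then so are all modules.
\<close>

definition quasi_isomorphic ::
  "'a dg_algebra \<Rightarrow> ('a, 'u) dg_module \<Rightarrow> ('a, 'u) dg_module \<Rightarrow> bool"
where
  "quasi_isomorphic A =
     equivclp (\<lambda>X Y. dg_module A X \<and> dg_module A Y \<and> (\<exists>f. quasi_isomorphism A X Y f))"


section \<open>Perfect modules\<close>

definition free_module :: "'a dg_algebra \<Rightarrow> ('a, 'a) dg_module" where
  "free_module A = \<lparr>gr = gr A, dif = dif A, act = mul A\<rparr>"

text \<open>No sign appears in the action on a shift, since the modules are right modules.\<close>

definition shift :: "int \<Rightarrow> ('a, 'u) dg_module \<Rightarrow> ('a, 'u) dg_module" where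
  "shift n X =
     \<lparr>gr = \<lambda>i. gr X (i + n),
      dif = \<lambda>i x. sign n \<odot>\<^bsub>gr X (i + n + 1)\<^esub> dif X (i + n) x,
      act = \<lambda>i j. act X (i + n) j\<rparr>"

definition direct_sum ::
  "('a, 'u) dg_module \<Rightarrow> ('a, 'v) dg_module \<Rightarrow> ('a, 'u \<times> 'v) dg_module"
where
  "direct_sum X Y =
     \<lparr>gr = \<lambda>i. product_space (gr X i) (gr Y i),
      dif = \<lambda>i (x, y). (dif X i x, dif Y i y),
      act = \<lambda>i j (x, y) a. (act X i j x a, act Y i j y a)\<rparr>"

definition mapping_cone ::
  "('a, 'u) dg_module \<Rightarrow> ('a, 'v) dg_module \<Rightarrow> (int \<Rightarrow> 'u \<Rightarrow> 'v) \<Rightarrow> ('a, 'u \<times> 'v) dg_module"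
where
  "mapping_cone X Y f =
     \<lparr>gr = \<lambda>i. product_space (gr X (i + 1)) (gr Y i),
      dif = \<lambda>i (x, y). (\<ominus>\<^bsub>gr X (i + 2)\<^esub> dif X (i + 1) x, f (i + 1) x \<oplus>\<^bsub>gr Y (i + 1)\<^esub> dif Y i y),
      act = \<lambda>i j (x, y) a. (act X (i + 1) j x a, act Y i j y a)\<rparr>"

text \<open>
  The objects of the derived category obtained from the free module by finitely many shifts and
  mapping cones. A morphism of the derived category is a roof; since the class is closed under
  quasi-isomorphism, it suffices to take cones of actual homomorphisms. Cones and sums are
  transported from the product type to the fixed type along an isomorphism.
\<close>

inductive built_from_free :: "'a dg_algebra \<Rightarrow> ('a, 'a) dg_module \<Rightarrow> bool"
  for A :: "'a dg_algebra"
where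
  free: "built_from_free A (free_module A)"
| shift: "built_from_free A X \<Longrightarrow> built_from_free A (shift n X)"
| cone: "built_from_free A X \<Longrightarrow> built_from_free A Y \<Longrightarrow> dg_hom A X Y f \<Longrightarrow>
         dg_module A Z \<Longrightarrow> dg_isomorphic A Z (mapping_cone X Y f) \<Longrightarrow> built_from_free A Z"
| quasi_iso: "built_from_free A X \<Longrightarrow> quasi_isomorphic A X Y \<Longrightarrow> built_from_free A Y"

definition perfect :: "'a dg_algebra \<Rightarrow> ('a, 'a) dg_module \<Rightarrow> bool" where
  "perfect A M \<longleftrightarrow>
     dg_module A M \<and>
     (\<exists>(N :: ('a, 'a) dg_module) S X. dg_module A N \<and> dg_module A S \<and>
              dg_isomorphic A S (direct_sum M N) \<and> built_from_free A X \<and> quasi_isomorphic A S X)"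


section \<open>Derived morphisms\<close>

text \<open>
  The degree-n elements of the complex of morphisms are the degree-n maps which are linear over
  the algebra, not necessarily compatible with the differentials. They are represented by
  extensional functions, so that equality of morphisms is equality in HOL.
\<close>

definition hom_complex ::
  "'a dg_algebra \<Rightarrow> ('a, 'u) dg_module \<Rightarrow> ('a, 'v) dg_module \<Rightarrow> (int \<Rightarrow> 'u \<Rightarrow> 'v) cochain_complex"
where
  "hom_complex A X Y =
     \<lparr>gr = \<lambda>n. make_space
        {f. (\<forall>i. f i \<in> linear_maps (gr X i) (gr Y (i + n)) \<inter> extensional (carrier (gr X i))) \<and>
            (\<forall>i j. \<forall>x\<in>carrier (gr X i). \<forall>a\<in>carrier (gr A j).
               f (i + j) (act X i j x a) = act Y (i + n) j (f i x) a)}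
        (\<lambda>i. \<lambda>x\<in>carrier (gr X i). \<zero>\<^bsub>gr Y (i + n)\<^esub>)
        (\<lambda>f g i. \<lambda>x\<in>carrier (gr X i). f i x \<oplus>\<^bsub>gr Y (i + n)\<^esub> g i x)
        (\<lambda>c f i. \<lambda>x\<in>carrier (gr X i). c \<odot>\<^bsub>gr Y (i + n)\<^esub> f i x),
      dif = \<lambda>n f i. \<lambda>x\<in>carrier (gr X i).
        dif Y (i + n) (f i x)
          \<ominus>\<^bsub>gr Y (i + n + 1)\<^esub> sign n \<odot>\<^bsub>gr Y (i + n + 1)\<^esub> f (i + 1) (dif X i x)\<rparr>"

definition h_projective :: "'a dg_algebra \<Rightarrow> ('a, 'u) dg_module \<Rightarrow> bool" where
  "h_projective A P \<longleftrightarrow>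
     dg_module A P \<and>
     (\<forall>N :: ('a, 'u) dg_module. dg_module A N \<longrightarrow> acyclic_complex N \<longrightarrow>
        acyclic_complex (hom_complex A P N))"

definition h_projective_resolution ::
  "'a dg_algebra \<Rightarrow> ('a, 'u) dg_module \<Rightarrow> ('a, 'u) dg_module \<Rightarrow> (int \<Rightarrow> 'u \<Rightarrow> 'u) \<Rightarrow> bool"
where
  "h_projective_resolution A M P p \<longleftrightarrow> h_projective A P \<and> quasi_isomorphism A P M p"

text \<open>
  The derived morphism complex from M to M is the complex of morphisms from an h-projective
  resolution of M to M. Up to quasi-isomorphism it does not depend on the choice of the resolution.
\<close>

definition rigid_simple :: "'a dg_algebra \<Rightarrow> ('a, 'a) dg_module \<Rightarrow> bool" where
  "rigid_simple A M \<longleftrightarrow>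
     dg_module A M \<and>
     (\<exists>P p. h_projective_resolution A M P p \<and>
            zero_space (cohomology (hom_complex A P M) 1) \<and>
            linearly_isomorphic (cohomology (hom_complex A P M) 0) complex_line)"


section \<open>Actions of the multiplicative group\<close>

text \<open>
  Since an action preserves the grading, it is a direct sum of finite-dimensional algebraic
  representations if and only if this holds in each degree.
\<close>

locale rational_complex = cochain_complex C
  for C :: "('u, 'z) cochain_complex_scheme" and r :: "complex \<Rightarrow> int \<Rightarrow> 'u \<Rightarrow> 'u" +
  assumes rational: "rational_representation (gr C i) (\<lambda>z. r z i)"
    and dif_equivariant:
      "z \<noteq> 0 \<Longrightarrow> x \<in> carrier (gr C i) \<Longrightarrow> r z (i + 1) (dif C i x) = dif C i (r z i x)"

locale equivariant_dg_algebra = dg_algebra A + rational_complex A r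
  for A :: "'a dg_algebra" and r :: "complex \<Rightarrow> int \<Rightarrow> 'a \<Rightarrow> 'a" +
  assumes mul_equivariant:
      "z \<noteq> 0 \<Longrightarrow> a \<in> carrier (gr A i) \<Longrightarrow> b \<in> carrier (gr A j) \<Longrightarrow>
       r z (i + j) (mul A i j a b) = mul A i j (r z i a) (r z j b)"
    and unt_invariant: "z \<noteq> 0 \<Longrightarrow> r z 0 (unt A) = unt A"

locale equivariant_dg_module =
  equivariant_dg_algebra A r + dg_module A N + N: rational_complex N t
  for A :: "'a dg_algebra" and r :: "complex \<Rightarrow> int \<Rightarrow> 'a \<Rightarrow> 'a"
    and N :: "('a, 'u) dg_module" and t :: "complex \<Rightarrow> int \<Rightarrow> 'u \<Rightarrow> 'u" +
  assumes act_equivariant: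
      "z \<noteq> 0 \<Longrightarrow> x \<in> carrier (gr N i) \<Longrightarrow> a \<in> carrier (gr A j) \<Longrightarrow>
       t z (i + j) (act N i j x a) = act N i j (t z i x) (r z j a)"

end

theory Submission
  imports Defs "HOL-Library.Function_Algebras" "HOL-Library.Product_Plus"
begin

text \<open>
  The infinitesimal action on \<open>A\<close> is a derivation \<open>E\<close> of degree \<open>0\<close>, which multiplies elements of weight
  \<open>n\<close> by \<open>n\<close>. The obstruction to a connection on \<open>M\<close> along \<open>E\<close>, that is a chain map \<open>D\<close> with
  \<open>D (x a) = (D x) a + x (E a)\<close>, is the class of the Atiyah extension of \<open>M\<close> by itself, an element of the
  first cohomology of the derived endomorphisms of \<open>M\<close>. For a rigid module it vanishes. In terms of
  modules, an h-projective resolution \<open>P\<close> of \<open>M\<close> has a quasi-isomorphism \<open>q\<close> to \<open>M\<close> and a connection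
  \<open>D\<close> from \<open>P\<close> to \<open>M\<close> with \<open>D (x a) = (D x) a + (q x) (E a)\<close> (lemma \<open>atiyah_lift\<close>).

  A connection is only an action of the Lie algebra, and its exponential \<open>exp (s D)\<close> need neither exist
  nor be rational. Therefore \<open>M\<close> is replaced by a space of functions \<open>s \<mapsto> exp (s D) x\<close>: the solutions,
  in a derived sense, of the equation \<open>y' = D y\<close> among the exponential polynomials
  \<open>\<Sum> x * s ^ k * exp (l * s)\<close> with coefficients in the module. They form a dg module if an element \<open>a\<close> of
  weight \<open>n\<close> acts by multiplication with \<open>a * exp (n * s)\<close>. Evaluation at \<open>s = 0\<close> is a
  quasi-isomorphism (theorem \<open>value0_bijective\<close>): a perfect module over a proper algebra has
  finite-dimensional cohomology in each degree (lemma \<open>perfect_finite_cohomology\<close>), on which \<open>D\<close> acts as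
  a matrix, and linear differential equations with constant coefficients have exponential polynomials
  as their solutions.

  On the module of solutions the multiplicative group acts through the exponents \<open>l\<close>. Multiplication by
  an element of weight \<open>n\<close> changes \<open>l\<close> to \<open>l + n\<close>, and all other operations preserve the part of exponent
  \<open>l\<close>. Hence any function of the exponents with integer values which is compatible with integer translations,
  such as the integral part of \<open>Re l\<close>, is a grading by weights compatible with all operations, and it
  defines a rational action (lemma \<open>equivariant_model\<close>).

  Connections and solutions are constructed for modules whose homogeneous parts are subspaces of
  types with a vector space structure; every module is isomorphic to such a module by a choice of bases.
  The module of solutions is finally carried over to the type of \<open>M\<close>, which is
  infinite and at least as large as the complex numbers because \<open>M\<close> has a nonzero vector.
\<close>

section \<open>Complex vector spaces and linear maps\<close>

lemma complex_field_simps [simp]: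
  "carrier complex_field = UNIV"
  "add complex_field = (+)"
  "monoid.mult complex_field = (*)"
  "\<one>\<^bsub>complex_field\<^esub> = 1"
  "\<zero>\<^bsub>complex_field\<^esub> = 0"
  by (auto simp: ring_of_type_algebra_def)

lemma make_space_simps [simp]:
  "carrier (make_space S z p s) = S"
  "add (make_space S z p s) = p"
  "\<zero>\<^bsub>make_space S z p s\<^esub> = z"
  "module.smult (make_space S z p s) = s"
  by (auto simp: make_space_def)

lemma complex_vector_spaceI:
  fixes V (structure)
  assumes "\<zero> \<in> carrier V"
    and "\<And>x y. x \<in> carrier V \<Longrightarrow> y \<in> carrier V \<Longrightarrow> x \<oplus> y \<in> carrier V"
    and "\<And>c x. x \<in> carrier V \<Longrightarrow> c \<odot> x \<in> carrier V"
    and "\<And>x y z. x \<in> carrier V \<Longrightarrow> y \<in> carrier V \<Longrightarrow> z \<in> carrier V \<Longrightarrow> (x \<oplus> y) \<oplus> z = x \<oplus> (y \<oplus> z)"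
    and "\<And>x y. x \<in> carrier V \<Longrightarrow> y \<in> carrier V \<Longrightarrow> x \<oplus> y = y \<oplus> x"
    and "\<And>x. x \<in> carrier V \<Longrightarrow> \<zero> \<oplus> x = x"
    and "\<And>x. x \<in> carrier V \<Longrightarrow> (- 1) \<odot> x \<oplus> x = \<zero>"
    and "\<And>c d x. x \<in> carrier V \<Longrightarrow> (c + d) \<odot> x = c \<odot> x \<oplus> d \<odot> x"
    and "\<And>c x y. x \<in> carrier V \<Longrightarrow> y \<in> carrier V \<Longrightarrow> c \<odot> (x \<oplus> y) = c \<odot> x \<oplus> c \<odot> y"
    and "\<And>c d x. x \<in> carrier V \<Longrightarrow> (c * d) \<odot> x = c \<odot> (d \<odot> x)"
    and "\<And>x. x \<in> carrier V \<Longrightarrow> 1 \<odot> x = x"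
  shows "complex_vector_space V"
proof (rule moduleI)
  show "cring complex_field" by (rule cring_from_type_algebra)
  show "abelian_group V"
  proof (rule abelian_groupI, goal_cases)
    case (6 x)
    then show ?case using assms(3,7) by blast
  qed (use assms in blast)+
qed (use assms in auto)

lemma vs_facts:
  assumes "complex_vector_space V"
  shows vs_zero: "\<zero>\<^bsub>V\<^esub> \<in> carrier V"
    and vs_add: "\<lbrakk>x \<in> carrier V; y \<in> carrier V\<rbrakk> \<Longrightarrow> x \<oplus>\<^bsub>V\<^esub> y \<in> carrier V"
    and vs_smult: "x \<in> carrier V \<Longrightarrow> c \<odot>\<^bsub>V\<^esub> x \<in> carrier V"
    and vs_assoc: "\<lbrakk>x \<in> carrier V; y \<in> carrier V; z \<in> carrier V\<rbrakk> \<Longrightarrow>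
           (x \<oplus>\<^bsub>V\<^esub> y) \<oplus>\<^bsub>V\<^esub> z = x \<oplus>\<^bsub>V\<^esub> (y \<oplus>\<^bsub>V\<^esub> z)"
    and vs_comm: "\<lbrakk>x \<in> carrier V; y \<in> carrier V\<rbrakk> \<Longrightarrow> x \<oplus>\<^bsub>V\<^esub> y = y \<oplus>\<^bsub>V\<^esub> x"
    and vs_lcomm: "\<lbrakk>x \<in> carrier V; y \<in> carrier V; z \<in> carrier V\<rbrakk> \<Longrightarrow>
           x \<oplus>\<^bsub>V\<^esub> (y \<oplus>\<^bsub>V\<^esub> z) = y \<oplus>\<^bsub>V\<^esub> (x \<oplus>\<^bsub>V\<^esub> z)"
    and vs_lzero: "x \<in> carrier V \<Longrightarrow> \<zero>\<^bsub>V\<^esub> \<oplus>\<^bsub>V\<^esub> x = x"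
    and vs_rzero: "x \<in> carrier V \<Longrightarrow> x \<oplus>\<^bsub>V\<^esub> \<zero>\<^bsub>V\<^esub> = x"
    and vs_distl: "x \<in> carrier V \<Longrightarrow> (c + d) \<odot>\<^bsub>V\<^esub> x = c \<odot>\<^bsub>V\<^esub> x \<oplus>\<^bsub>V\<^esub> d \<odot>\<^bsub>V\<^esub> x"
    and vs_distr: "\<lbrakk>x \<in> carrier V; y \<in> carrier V\<rbrakk> \<Longrightarrow>
           c \<odot>\<^bsub>V\<^esub> (x \<oplus>\<^bsub>V\<^esub> y) = c \<odot>\<^bsub>V\<^esub> x \<oplus>\<^bsub>V\<^esub> c \<odot>\<^bsub>V\<^esub> y"
    and vs_smult_smult: "x \<in> carrier V \<Longrightarrow> c \<odot>\<^bsub>V\<^esub> (d \<odot>\<^bsub>V\<^esub> x) = (c * d) \<odot>\<^bsub>V\<^esub> x"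
    and vs_one: "x \<in> carrier V \<Longrightarrow> 1 \<odot>\<^bsub>V\<^esub> x = x"
    and vs_null: "x \<in> carrier V \<Longrightarrow> 0 \<odot>\<^bsub>V\<^esub> x = \<zero>\<^bsub>V\<^esub>"
    and vs_smult_zero: "c \<odot>\<^bsub>V\<^esub> \<zero>\<^bsub>V\<^esub> = \<zero>\<^bsub>V\<^esub>"
    and vs_neg: "x \<in> carrier V \<Longrightarrow> \<ominus>\<^bsub>V\<^esub> x = (- 1) \<odot>\<^bsub>V\<^esub> x"
    and vs_minus: "\<lbrakk>x \<in> carrier V; y \<in> carrier V\<rbrakk> \<Longrightarrow> x \<ominus>\<^bsub>V\<^esub> y = x \<oplus>\<^bsub>V\<^esub> (- 1) \<odot>\<^bsub>V\<^esub> y"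
    and vs_abelian_group: "abelian_group V"
proof -
  interpret V: module complex_field V by fact
  show "\<zero>\<^bsub>V\<^esub> \<in> carrier V" by simp
  show "\<lbrakk>x \<in> carrier V; y \<in> carrier V\<rbrakk> \<Longrightarrow> x \<oplus>\<^bsub>V\<^esub> y \<in> carrier V" by simp
  show sm: "x \<in> carrier V \<Longrightarrow> c \<odot>\<^bsub>V\<^esub> x \<in> carrier V" for c x by simp
  show "\<lbrakk>x \<in> carrier V; y \<in> carrier V; z \<in> carrier V\<rbrakk> \<Longrightarrow>
           (x \<oplus>\<^bsub>V\<^esub> y) \<oplus>\<^bsub>V\<^esub> z = x \<oplus>\<^bsub>V\<^esub> (y \<oplus>\<^bsub>V\<^esub> z)" by (rule V.M.a_assoc)
  show "\<lbrakk>x \<in> carrier V; y \<in> carrier V\<rbrakk> \<Longrightarrow> x \<oplus>\<^bsub>V\<^esub> y = y \<oplus>\<^bsub>V\<^esub> x" by (rule V.M.a_comm)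
  show "\<lbrakk>x \<in> carrier V; y \<in> carrier V; z \<in> carrier V\<rbrakk> \<Longrightarrow>
           x \<oplus>\<^bsub>V\<^esub> (y \<oplus>\<^bsub>V\<^esub> z) = y \<oplus>\<^bsub>V\<^esub> (x \<oplus>\<^bsub>V\<^esub> z)" by (rule V.M.a_lcomm)
  show "x \<in> carrier V \<Longrightarrow> \<zero>\<^bsub>V\<^esub> \<oplus>\<^bsub>V\<^esub> x = x" by simp
  show "x \<in> carrier V \<Longrightarrow> x \<oplus>\<^bsub>V\<^esub> \<zero>\<^bsub>V\<^esub> = x" by simp
  show dl: "x \<in> carrier V \<Longrightarrow> (c + d) \<odot>\<^bsub>V\<^esub> x = c \<odot>\<^bsub>V\<^esub> x \<oplus>\<^bsub>V\<^esub> d \<odot>\<^bsub>V\<^esub> x" for c d x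
    using V.smult_l_distr[of c d x] by simp
  show "\<lbrakk>x \<in> carrier V; y \<in> carrier V\<rbrakk> \<Longrightarrow>
           c \<odot>\<^bsub>V\<^esub> (x \<oplus>\<^bsub>V\<^esub> y) = c \<odot>\<^bsub>V\<^esub> x \<oplus>\<^bsub>V\<^esub> c \<odot>\<^bsub>V\<^esub> y" using V.smult_r_distr[of c x y] by simp
  show "x \<in> carrier V \<Longrightarrow> c \<odot>\<^bsub>V\<^esub> (d \<odot>\<^bsub>V\<^esub> x) = (c * d) \<odot>\<^bsub>V\<^esub> x"
    using V.smult_assoc1[of c d x] by simp
  show on: "x \<in> carrier V \<Longrightarrow> 1 \<odot>\<^bsub>V\<^esub> x = x" for x using V.smult_one[of x] by simp
  show nl: "x \<in> carrier V \<Longrightarrow> 0 \<odot>\<^bsub>V\<^esub> x = \<zero>\<^bsub>V\<^esub>" for x using V.smult_l_null[of x] by simp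
  show "c \<odot>\<^bsub>V\<^esub> \<zero>\<^bsub>V\<^esub> = \<zero>\<^bsub>V\<^esub>" using V.smult_r_null[of c] by simp
  show ng: "x \<in> carrier V \<Longrightarrow> \<ominus>\<^bsub>V\<^esub> x = (- 1) \<odot>\<^bsub>V\<^esub> x" for x
  proof -
    assume x: "x \<in> carrier V"
    have "(- 1) \<odot>\<^bsub>V\<^esub> x \<oplus>\<^bsub>V\<^esub> x = \<zero>\<^bsub>V\<^esub>"
      using dl[of x "- 1" 1] x on nl by simp
    then show ?thesis using x sm V.M.minus_equality by blast
  qed
  show "\<lbrakk>x \<in> carrier V; y \<in> carrier V\<rbrakk> \<Longrightarrow> x \<ominus>\<^bsub>V\<^esub> y = x \<oplus>\<^bsub>V\<^esub> (- 1) \<odot>\<^bsub>V\<^esub> y"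
    by (simp add: a_minus_def ng)
  show "abelian_group V" by unfold_locales
qed

lemma linear_mapsI:
  assumes "\<And>x. x \<in> carrier V \<Longrightarrow> f x \<in> carrier W"
    and "\<And>x y. x \<in> carrier V \<Longrightarrow> y \<in> carrier V \<Longrightarrow> f (x \<oplus>\<^bsub>V\<^esub> y) = f x \<oplus>\<^bsub>W\<^esub> f y"
    and "\<And>c x. x \<in> carrier V \<Longrightarrow> f (c \<odot>\<^bsub>V\<^esub> x) = c \<odot>\<^bsub>W\<^esub> f x"
  shows "f \<in> linear_maps V W"
  using assms by (auto simp: linear_maps_def)

lemma
  assumes "f \<in> linear_maps V W"
  shows lin_closed: "x \<in> carrier V \<Longrightarrow> f x \<in> carrier W"
    and lin_add: "x \<in> carrier V \<Longrightarrow> y \<in> carrier V \<Longrightarrow> f (x \<oplus>\<^bsub>V\<^esub> y) = f x \<oplus>\<^bsub>W\<^esub> f y"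
    and lin_smult: "x \<in> carrier V \<Longrightarrow> f (c \<odot>\<^bsub>V\<^esub> x) = c \<odot>\<^bsub>W\<^esub> f x"
  using assms by (auto simp: linear_maps_def)

lemma lin_zero:
  assumes "f \<in> linear_maps V W" "complex_vector_space V" "complex_vector_space W"
  shows "f \<zero>\<^bsub>V\<^esub> = \<zero>\<^bsub>W\<^esub>"
proof -
  have "f (0 \<odot>\<^bsub>V\<^esub> \<zero>\<^bsub>V\<^esub>) = 0 \<odot>\<^bsub>W\<^esub> f \<zero>\<^bsub>V\<^esub>"
    using assms by (intro lin_smult[OF assms(1)] vs_zero)
  then show ?thesis
    using assms by (simp add: vs_null vs_zero lin_closed)
qed

lemma lin_comp:
  assumes "f \<in> linear_maps U V" "g \<in> linear_maps V W"
  shows "(\<lambda>x. g (f x)) \<in> linear_maps U W"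
  using assms by (auto simp: linear_maps_def Pi_iff)

lemma lin_inv:
  assumes f: "f \<in> linear_maps V W" and b: "bij_betw f (carrier V) (carrier W)"
    and V: "complex_vector_space V"
  shows "inv_into (carrier V) f \<in> linear_maps W V"
proof -
  let ?g = "inv_into (carrier V) f"
  have g: "?g y \<in> carrier V" "f (?g y) = y" if "y \<in> carrier W" for y
    using b that by (auto simp: bij_betw_def f_inv_into_f inv_into_into)
  have gf: "?g (f x) = x" if "x \<in> carrier V" for x
    using b that by (auto simp: bij_betw_def)
  show ?thesis
  proof (rule linear_mapsI)
    fix x y assume "x \<in> carrier W" "y \<in> carrier W"
    then show "?g (x \<oplus>\<^bsub>W\<^esub> y) = ?g x \<oplus>\<^bsub>V\<^esub> ?g y"
      using gf[of "?g x \<oplus>\<^bsub>V\<^esub> ?g y"] by (simp add: g lin_add[OF f] vs_add[OF V])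
  next
    fix c x assume "x \<in> carrier W"
    then show "?g (c \<odot>\<^bsub>W\<^esub> x) = c \<odot>\<^bsub>V\<^esub> ?g x"
      using gf[of "c \<odot>\<^bsub>V\<^esub> ?g x"] by (simp add: g lin_smult[OF f] vs_smult[OF V])
  qed (use g in auto)
qed

definition pushforward :: "('u \<Rightarrow> 'v) \<Rightarrow> (complex, 'u) module \<Rightarrow> (complex, 'v) module" where
  "pushforward e V = make_space (e ` carrier V) (e \<zero>\<^bsub>V\<^esub>)
     (\<lambda>x y. e (inv_into (carrier V) e x \<oplus>\<^bsub>V\<^esub> inv_into (carrier V) e y))
     (\<lambda>c x. e (c \<odot>\<^bsub>V\<^esub> inv_into (carrier V) e x))"

lemma
  assumes V: "complex_vector_space V" and e: "inj_on e (carrier V)"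
  shows pushforward_space: "complex_vector_space (pushforward e V)"
    and pushforward_linear: "e \<in> linear_maps V (pushforward e V)"
    and pushforward_bij: "bij_betw e (carrier V) (carrier (pushforward e V))"
proof -
  have [simp]: "inv_into (carrier V) e (e x) = x" if "x \<in> carrier V" for x
    using e that by simp
  note [simp] = vs_zero[OF V] vs_add[OF V] vs_smult[OF V]
  show "complex_vector_space (pushforward e V)"
  proof (rule complex_vector_spaceI, unfold pushforward_def make_space_simps, goal_cases)
    case (4 x y z)
    then show ?case by (auto simp: vs_assoc[OF V])
  next
    case (5 x y)
    then show ?case by (auto simp: vs_comm[OF V])
  next
    case (7 x)
    then show ?case
      by (auto simp: abelian_group.l_neg[OF vs_abelian_group[OF V]] abelian_group.a_inv_closed[OF vs_abelian_group[OF V]]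
          simp flip: vs_neg[OF V])
  qed (auto simp: vs_lzero[OF V] vs_distl[OF V] vs_distr[OF V] vs_smult_smult[OF V] vs_one[OF V])
  show "e \<in> linear_maps V (pushforward e V)"
    by (rule linear_mapsI) (auto simp: pushforward_def)
  show "bij_betw e (carrier V) (carrier (pushforward e V))"
    using e by (auto simp: pushforward_def bij_betw_def)
qed

section \<open>Vector spaces inside a type\<close>

text \<open>
  In computations with several module structures it is convenient to have addition and scaling as
  overloaded operations: then the simplification rules for abelian groups apply without membership
  conditions.
\<close>

class complex_vector = ab_group_add +
  fixes scaleC :: "complex \<Rightarrow> 'a \<Rightarrow> 'a"  (infixr \<open>*\<^sub>C\<close> 75)
  assumes scaleC_add_right: "c *\<^sub>C (x + y) = c *\<^sub>C x + c *\<^sub>C y"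
    and scaleC_add_left: "(c + d) *\<^sub>C x = c *\<^sub>C x + d *\<^sub>C x"
    and scaleC_scaleC [simp]: "c *\<^sub>C (d *\<^sub>C x) = (c * d) *\<^sub>C x"
    and scaleC_one [simp]: "1 *\<^sub>C x = x"
begin

lemma scaleC_zero_left [simp]: "0 *\<^sub>C x = 0"
  using scaleC_add_left[of 0 0 x] by simp

lemma scaleC_zero_right [simp]: "c *\<^sub>C 0 = 0"
  using scaleC_add_right[of c 0 0] by simp

lemma scaleC_minus_left: "(- c) *\<^sub>C x = - (c *\<^sub>C x)"
  using scaleC_add_left[of "- c" c x] by (simp add: eq_neg_iff_add_eq_0)

lemma scaleC_minus_one: "(- 1) *\<^sub>C x = - x"
  using scaleC_minus_left[of 1 x] by simp

lemma scaleC_minus_right: "c *\<^sub>C (- x) = - (c *\<^sub>C x)"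
  using scaleC_add_right[of c "- x" x] by (simp add: eq_neg_iff_add_eq_0)

lemma scaleC_diff_right: "c *\<^sub>C (x - y) = c *\<^sub>C x - c *\<^sub>C y"
  using scaleC_add_right[of c x "- y"] by (simp add: scaleC_minus_right)

lemma scaleC_diff_left: "(c - d) *\<^sub>C x = c *\<^sub>C x - d *\<^sub>C x"
  using scaleC_add_left[of c "- d" x] by (simp add: scaleC_minus_left)

lemma scaleC_sum_right: "c *\<^sub>C (\<Sum>i\<in>I. f i) = (\<Sum>i\<in>I. c *\<^sub>C f i)"
  by (induction I rule: infinite_finite_induct) (auto simp: scaleC_add_right)

end

lemmas scaleC_simps = scaleC_add_right scaleC_add_left scaleC_minus_left scaleC_minus_right
  scaleC_diff_right scaleC_diff_left

instantiation complex :: complex_vector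
begin
definition "scaleC_complex c (x :: complex) = c * x"
instance by standard (auto simp: scaleC_complex_def algebra_simps)
end

instantiation "fun" :: (type, complex_vector) complex_vector
begin
definition "scaleC_fun c f = (\<lambda>x. c *\<^sub>C f x)"
instance by standard (auto simp: scaleC_fun_def scaleC_simps fun_eq_iff)
end

lemma scaleC_fun_apply [simp]: "(c *\<^sub>C f) x = c *\<^sub>C f x"
  by (simp add: scaleC_fun_def)

instantiation prod :: (complex_vector, complex_vector) complex_vector
begin
definition "scaleC_prod c p = (c *\<^sub>C fst p, c *\<^sub>C snd p)"
instance by standard (auto simp: scaleC_prod_def scaleC_simps prod_eq_iff)
end

lemma scaleC_Pair [simp]: "c *\<^sub>C (x, y) = (c *\<^sub>C x, c *\<^sub>C y)"
  by (simp add: scaleC_prod_def)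

lemma fst_scaleC [simp]: "fst (c *\<^sub>C p) = c *\<^sub>C fst p"
  and snd_scaleC [simp]: "snd (c *\<^sub>C p) = c *\<^sub>C snd p"
  by (simp_all add: scaleC_prod_def)

definition subspace :: "'v::complex_vector set \<Rightarrow> bool" where
  "subspace S \<longleftrightarrow> 0 \<in> S \<and> (\<forall>x\<in>S. \<forall>y\<in>S. x + y \<in> S) \<and> (\<forall>c. \<forall>x\<in>S. c *\<^sub>C x \<in> S)"

lemma
  assumes "subspace S"
  shows subspace_0: "0 \<in> S"
    and subspace_add: "x \<in> S \<Longrightarrow> y \<in> S \<Longrightarrow> x + y \<in> S"
    and subspace_scale: "x \<in> S \<Longrightarrow> c *\<^sub>C x \<in> S"
    and subspace_neg: "x \<in> S \<Longrightarrow> - x \<in> S"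
    and subspace_diff: "x \<in> S \<Longrightarrow> y \<in> S \<Longrightarrow> x - y \<in> S"
    and subspace_sum: "(\<And>i. i \<in> I \<Longrightarrow> f i \<in> S) \<Longrightarrow> sum f I \<in> S"
proof -
  show 0: "0 \<in> S" and a: "x \<in> S \<Longrightarrow> y \<in> S \<Longrightarrow> x + y \<in> S"
    and s: "x \<in> S \<Longrightarrow> c *\<^sub>C x \<in> S" for x y c
    using assms by (auto simp: subspace_def)
  show n: "x \<in> S \<Longrightarrow> - x \<in> S" for x
    using s[of x "- 1"] by (simp add: scaleC_minus_one)
  show "x \<in> S \<Longrightarrow> y \<in> S \<Longrightarrow> x - y \<in> S"
    using a[of x "- y"] n[of y] by simp
  show "(\<And>i. i \<in> I \<Longrightarrow> f i \<in> S) \<Longrightarrow> sum f I \<in> S"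
    by (induction I rule: infinite_finite_induct) (auto simp: 0 a)
qed

definition space_on :: "'v::complex_vector set \<Rightarrow> (complex, 'v) module" where
  "space_on S = make_space S 0 (+) (*\<^sub>C)"

lemma space_on_simps [simp]:
  "carrier (space_on S) = S"
  "add (space_on S) = (+)"
  "\<zero>\<^bsub>space_on S\<^esub> = 0"
  "module.smult (space_on S) = (*\<^sub>C)"
  by (auto simp: space_on_def)

lemma space_on_space: "subspace S \<Longrightarrow> complex_vector_space (space_on S)"
  by (rule complex_vector_spaceI)
    (auto simp: subspace_0 subspace_add subspace_scale scaleC_simps ac_simps scaleC_minus_one)

section \<open>Cochain complexes and cohomology\<close>

definition linear_subspace :: "(complex, 'u) module \<Rightarrow> 'u set \<Rightarrow> bool" where
  "linear_subspace V S \<longleftrightarrow> S \<subseteq> carrier V \<and> \<zero>\<^bsub>V\<^esub> \<in> S \<and>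
     (\<forall>x\<in>S. \<forall>y\<in>S. x \<oplus>\<^bsub>V\<^esub> y \<in> S) \<and> (\<forall>c. \<forall>x\<in>S. c \<odot>\<^bsub>V\<^esub> x \<in> S)"

lemma
  assumes "linear_subspace V S"
  shows linear_subspace_carrier: "x \<in> S \<Longrightarrow> x \<in> carrier V"
    and linear_subspace_zero: "\<zero>\<^bsub>V\<^esub> \<in> S"
    and linear_subspace_add: "x \<in> S \<Longrightarrow> y \<in> S \<Longrightarrow> x \<oplus>\<^bsub>V\<^esub> y \<in> S"
    and linear_subspace_smult: "x \<in> S \<Longrightarrow> c \<odot>\<^bsub>V\<^esub> x \<in> S"
  using assms by (auto simp: linear_subspace_def)

lemma linear_subspace_image:
  assumes f: "f \<in> linear_maps V W" and "complex_vector_space V" "complex_vector_space W"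
    and S: "linear_subspace V S"
  shows "linear_subspace W (f ` S)"
  unfolding linear_subspace_def
proof (intro conjI allI ballI)
  have c: "x \<in> carrier V" if "x \<in> S" for x using linear_subspace_carrier[OF S that] .
  show "f ` S \<subseteq> carrier W" using c lin_closed[OF f] by auto
  show "\<zero>\<^bsub>W\<^esub> \<in> f ` S"
    using lin_zero[OF assms(1-3)] linear_subspace_zero[OF S] by (metis imageI)
  show "x \<oplus>\<^bsub>W\<^esub> y \<in> f ` S" if "x \<in> f ` S" "y \<in> f ` S" for x y
    using that c linear_subspace_add[OF S] by (auto simp: lin_add[OF f, symmetric])
  show "a \<odot>\<^bsub>W\<^esub> x \<in> f ` S" if "x \<in> f ` S" for x a
    using that c linear_subspace_smult[OF S] by (auto simp: lin_smult[OF f, symmetric])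
qed

lemma linear_subspace_vector_space:
  assumes "complex_vector_space V" "linear_subspace V S"
  shows "complex_vector_space (V\<lparr>carrier := S\<rparr>)"
proof -
  note V = assms(1) and S = assms(2)
  have c: "x \<in> carrier V" if "x \<in> S" for x using linear_subspace_carrier[OF S that] .
  show ?thesis
    by (rule complex_vector_spaceI)
      (auto simp: linear_subspace_zero[OF S] linear_subspace_add[OF S] linear_subspace_smult[OF S]
        c vs_assoc[OF V] vs_lzero[OF V] vs_one[OF V] vs_smult_smult[OF V] vs_distl[OF V]
        vs_distr[OF V] abelian_group.l_neg[OF vs_abelian_group[OF V]] simp flip: vs_neg[OF V]
        intro: vs_comm[OF V])
qed

context cochain_complex
begin

lemma dif_closed: "x \<in> carrier (gr C i) \<Longrightarrow> dif C i x \<in> carrier (gr C (i + 1))"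
  by (rule lin_closed[OF dif_linear])

lemma dif_zero: "dif C i \<zero>\<^bsub>gr C i\<^esub> = \<zero>\<^bsub>gr C (i + 1)\<^esub>"
  by (rule lin_zero[OF dif_linear vector_space vector_space])

lemma cocycles_subspace: "linear_subspace (gr C i) (cocycles C i)"
  by (auto simp: linear_subspace_def cocycles_def vs_zero[OF vector_space] dif_zero
      vs_add[OF vector_space] vs_smult[OF vector_space] lin_add[OF dif_linear]
      lin_smult[OF dif_linear] vs_lzero[OF vector_space] vs_smult_zero[OF vector_space])

lemma coboundaries_subspace: "linear_subspace (gr C i) (coboundaries C i)"
proof -
  have "linear_subspace (gr C (i - 1)) (carrier (gr C (i - 1)))"
    by (auto simp: linear_subspace_def vs_zero[OF vector_space] vs_add[OF vector_space]
        vs_smult[OF vector_space])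
  from linear_subspace_image[OF dif_linear vector_space vector_space this] show ?thesis
    by (simp add: coboundaries_def)
qed

lemma coboundaries_cocycles: "coboundaries C i \<subseteq> cocycles C i"
proof
  fix x assume "x \<in> coboundaries C i"
  then obtain y where y: "y \<in> carrier (gr C (i - 1))" "x = dif C (i - 1) y"
    by (auto simp: coboundaries_def)
  show "x \<in> cocycles C i"
    using y dif_closed[OF y(1)] dif_dif[OF y(1)] by (simp add: cocycles_def add.commute)
qed

lemma coboundariesI: "y \<in> carrier (gr C i) \<Longrightarrow> dif C i y \<in> coboundaries C (i + 1)"
  by (auto simp: coboundaries_def)

end

lemma carrier_cohomology:
  "carrier (cohomology C i) = {coboundaries C i +>\<^bsub>gr C i\<^esub> x |x. x \<in> cocycles C i}"
  by (simp add: cohomology_def quotient_space_def a_r_coset_def')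

lemma zero_cohomology [simp]: "\<zero>\<^bsub>cohomology C i\<^esub> = coboundaries C i"
  by (simp add: cohomology_def quotient_space_def)

lemma zero_space_cohomologyD:
  assumes "zero_space (cohomology C i)" "x \<in> cocycles C i"
    and "\<zero>\<^bsub>gr C i\<^esub> \<in> coboundaries C i" "\<zero>\<^bsub>gr C i\<^esub> \<oplus>\<^bsub>gr C i\<^esub> x = x"
  shows "x \<in> coboundaries C i"
proof -
  have "coboundaries C i +>\<^bsub>gr C i\<^esub> x = coboundaries C i"
    using assms(1,2) by (auto simp: zero_space_def carrier_cohomology)
  moreover have "x \<in> coboundaries C i +>\<^bsub>gr C i\<^esub> x"
    using assms(3,4) by (force simp: a_r_coset_def')
  ultimately show ?thesis by simp
qed

context cochain_complex
begin

lemma coset_eq_iff: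
  assumes "x \<in> carrier (gr C i)" "y \<in> carrier (gr C i)"
  shows "coboundaries C i +>\<^bsub>gr C i\<^esub> x = coboundaries C i +>\<^bsub>gr C i\<^esub> y \<longleftrightarrow>
    (\<exists>b\<in>coboundaries C i. x = b \<oplus>\<^bsub>gr C i\<^esub> y)"  (is "?l \<longleftrightarrow> ?r")
proof
  note V = vector_space[of i] and B = coboundaries_subspace[of i]
  assume ?l
  moreover have "x \<in> coboundaries C i +>\<^bsub>gr C i\<^esub> x"
    using linear_subspace_zero[OF B] assms vs_lzero[OF V] by (force simp: a_r_coset_def')
  ultimately show ?r by (auto simp: a_r_coset_def')
next
  note V = vector_space[of i] and B = coboundaries_subspace[of i]
  assume ?r
  then obtain b where b: "b \<in> coboundaries C i" "x = b \<oplus>\<^bsub>gr C i\<^esub> y" by blast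
  have bc: "b \<in> carrier (gr C i)" by (rule linear_subspace_carrier[OF B b(1)])
  have m: "(- 1) \<odot>\<^bsub>gr C i\<^esub> b \<in> coboundaries C i" by (rule linear_subspace_smult[OF B b(1)])
  show ?l
  proof (intro Set.set_eqI iffI)
    fix w assume "w \<in> coboundaries C i +>\<^bsub>gr C i\<^esub> x"
    then obtain b' where b': "b' \<in> coboundaries C i" "w = b' \<oplus>\<^bsub>gr C i\<^esub> x"
      by (auto simp: a_r_coset_def')
    then have "w = (b' \<oplus>\<^bsub>gr C i\<^esub> b) \<oplus>\<^bsub>gr C i\<^esub> y"
      using b bc assms linear_subspace_carrier[OF B] by (simp add: vs_assoc[OF V])
    with linear_subspace_add[OF B b'(1) b(1)] show "w \<in> coboundaries C i +>\<^bsub>gr C i\<^esub> y"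
      by (auto simp: a_r_coset_def')
  next
    fix w assume "w \<in> coboundaries C i +>\<^bsub>gr C i\<^esub> y"
    then obtain b' where b': "b' \<in> coboundaries C i" "w = b' \<oplus>\<^bsub>gr C i\<^esub> y"
      by (auto simp: a_r_coset_def')
    have "(- 1) \<odot>\<^bsub>gr C i\<^esub> b \<oplus>\<^bsub>gr C i\<^esub> x = y"
      using bc assms abelian_group.l_neg[OF vs_abelian_group[OF V] bc] b(2)
      by (simp add: vs_assoc[OF V, symmetric] vs_smult[OF V] vs_lzero[OF V] vs_neg[OF V])
    then have "w = (b' \<oplus>\<^bsub>gr C i\<^esub> (- 1) \<odot>\<^bsub>gr C i\<^esub> b) \<oplus>\<^bsub>gr C i\<^esub> x"
      using b' bc assms linear_subspace_carrier[OF B] m by (simp add: vs_assoc[OF V])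
    with linear_subspace_add[OF B b'(1) m] show "w \<in> coboundaries C i +>\<^bsub>gr C i\<^esub> x"
      by (auto simp: a_r_coset_def')
  qed
qed

lemma coboundaries_coset_iff:
  assumes "x \<in> carrier (gr C i)"
  shows "coboundaries C i +>\<^bsub>gr C i\<^esub> x = coboundaries C i \<longleftrightarrow> x \<in> coboundaries C i"
proof -
  note V = vector_space[of i] and B = coboundaries_subspace[of i]
  have "coboundaries C i +>\<^bsub>gr C i\<^esub> \<zero>\<^bsub>gr C i\<^esub> = coboundaries C i"
    using linear_subspace_carrier[OF B] vs_rzero[OF V] by (force simp: a_r_coset_def')
  then have "coboundaries C i +>\<^bsub>gr C i\<^esub> x = coboundaries C i \<longleftrightarrow>
      (\<exists>b\<in>coboundaries C i. x = b \<oplus>\<^bsub>gr C i\<^esub> \<zero>\<^bsub>gr C i\<^esub>)"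
    using coset_eq_iff[OF assms vs_zero[OF V]] by simp
  also have "\<dots> \<longleftrightarrow> x \<in> coboundaries C i"
    using linear_subspace_carrier[OF B] vs_rzero[OF V] by (metis)
  finally show ?thesis .
qed

lemma zero_space_cohomology_iff:
  "zero_space (cohomology C i) \<longleftrightarrow> cocycles C i \<subseteq> coboundaries C i"
proof
  note V = vector_space[of i] and B = coboundaries_subspace[of i] and Z = cocycles_subspace[of i]
  show "zero_space (cohomology C i) \<Longrightarrow> cocycles C i \<subseteq> coboundaries C i"
    using zero_space_cohomologyD linear_subspace_zero[OF B] vs_lzero[OF V] linear_subspace_carrier[OF Z]
    by (metis subsetI)
  assume s: "cocycles C i \<subseteq> coboundaries C i"
  have "coboundaries C i +>\<^bsub>gr C i\<^esub> x = coboundaries C i" if "x \<in> cocycles C i" for x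
    using coboundaries_coset_iff[OF linear_subspace_carrier[OF Z that]] s that by blast
  then show "zero_space (cohomology C i)"
    using linear_subspace_zero[OF Z] by (auto simp: zero_space_def carrier_cohomology)
qed

end

text \<open>
  In terms of elements instead of cosets, the maps induced by \<open>f\<close> on cohomology are injective and
  surjective.
\<close>

definition cohomology_bijective ::
  "('u, 'y) cochain_complex_scheme \<Rightarrow> ('v, 'z) cochain_complex_scheme \<Rightarrow> (int \<Rightarrow> 'u \<Rightarrow> 'v) \<Rightarrow> bool"
where
  "cohomology_bijective X Y f \<longleftrightarrow>
     (\<forall>i. \<forall>x\<in>cocycles X i. f i x \<in> coboundaries Y i \<longrightarrow> x \<in> coboundaries X i) \<and>
     (\<forall>i. \<forall>y\<in>cocycles Y i. \<exists>x\<in>cocycles X i. \<exists>b\<in>coboundaries Y i. y = b \<oplus>\<^bsub>gr Y i\<^esub> f i x)"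

lemma cohomology_bijective_iff:
  assumes "cochain_complex X" "cochain_complex Y"
    and f: "\<And>i. f i \<in> linear_maps (gr X i) (gr Y i)"
    and fd: "\<And>i x. x \<in> carrier (gr X i) \<Longrightarrow> f (i + 1) (dif X i x) = dif Y i (f i x)"
  shows "(\<forall>i. bij_betw (cohomology_map Y f i) (carrier (cohomology X i)) (carrier (cohomology Y i)))
    \<longleftrightarrow> cohomology_bijective X Y f"
proof -
  interpret X: cochain_complex X by fact
  interpret Y: cochain_complex Y by fact
  have fZ: "f i x \<in> cocycles Y i" if "x \<in> cocycles X i" for i x
    using that lin_closed[OF f] fd[of x i]
      lin_zero[OF f[of "i + 1"] X.vector_space Y.vector_space] by (auto simp: cocycles_def)
  have fB: "f i x \<in> coboundaries Y i" if "x \<in> coboundaries X i" for i x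
    using that lin_closed[OF f] fd[of _ "i - 1"] by (auto simp: coboundaries_def)
  have Zc: "x \<in> carrier (gr X i)" if "x \<in> cocycles X i" for x i
    using that by (simp add: cocycles_def)
  have map: "cohomology_map Y f i (coboundaries X i +>\<^bsub>gr X i\<^esub> x) = coboundaries Y i +>\<^bsub>gr Y i\<^esub> f i x"
    if x: "x \<in> cocycles X i" for i x
  proof -
    have eq: "f i (b \<oplus>\<^bsub>gr X i\<^esub> x) = f i b \<oplus>\<^bsub>gr Y i\<^esub> f i x" if "b \<in> coboundaries X i" for b
      using lin_add[OF f, of b i x] Zc[OF x] linear_subspace_carrier[OF X.coboundaries_subspace that] by simp
    have 1: "h \<oplus>\<^bsub>gr Y i\<^esub> (f i b \<oplus>\<^bsub>gr Y i\<^esub> f i x) = (h \<oplus>\<^bsub>gr Y i\<^esub> f i b) \<oplus>\<^bsub>gr Y i\<^esub> f i x"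
      and 2: "h \<oplus>\<^bsub>gr Y i\<^esub> f i b \<in> coboundaries Y i"
      if "h \<in> coboundaries Y i" "b \<in> coboundaries X i" for h b
      using that fB fZ[OF x] linear_subspace_carrier[OF Y.coboundaries_subspace]
        linear_subspace_carrier[OF Y.cocycles_subspace] vs_assoc[OF Y.vector_space]
        linear_subspace_add[OF Y.coboundaries_subspace] by metis+
    have 3: "h \<oplus>\<^bsub>gr Y i\<^esub> f i x = h \<oplus>\<^bsub>gr Y i\<^esub> (f i \<zero>\<^bsub>gr X i\<^esub> \<oplus>\<^bsub>gr Y i\<^esub> f i x)" for h
      using lin_zero[OF f[of i] X.vector_space Y.vector_space] vs_lzero[OF Y.vector_space]
        fZ[OF x] linear_subspace_carrier[OF Y.cocycles_subspace] by metis
    have z: "\<zero>\<^bsub>gr X i\<^esub> \<in> coboundaries X i" by (rule linear_subspace_zero[OF X.coboundaries_subspace])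
    have "cohomology_map Y f i (coboundaries X i +>\<^bsub>gr X i\<^esub> x) =
        (\<Union>h\<in>coboundaries Y i. \<Union>b\<in>coboundaries X i. {h \<oplus>\<^bsub>gr Y i\<^esub> f i (b \<oplus>\<^bsub>gr X i\<^esub> x)})"
      by (auto simp: cohomology_map_def set_add_def' a_r_coset_def')
    also have "\<dots> = (\<Union>h\<in>coboundaries Y i. \<Union>b\<in>coboundaries X i. {(h \<oplus>\<^bsub>gr Y i\<^esub> f i b) \<oplus>\<^bsub>gr Y i\<^esub> f i x})"
      by (intro SUP_cong refl) (simp add: eq 1)
    also have "\<dots> = (\<Union>h\<in>coboundaries Y i. {h \<oplus>\<^bsub>gr Y i\<^esub> f i x})"
    proof (intro equalityI subsetI)
      fix w assume "w \<in> (\<Union>h\<in>coboundaries Y i. {h \<oplus>\<^bsub>gr Y i\<^esub> f i x})"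
      then obtain h where h: "h \<in> coboundaries Y i" "w = h \<oplus>\<^bsub>gr Y i\<^esub> f i x" by blast
      have "w = (h \<oplus>\<^bsub>gr Y i\<^esub> f i \<zero>\<^bsub>gr X i\<^esub>) \<oplus>\<^bsub>gr Y i\<^esub> f i x"
        unfolding h(2) 3[of h] by (rule 1[OF h(1) z])
      with h(1) z show "w \<in> (\<Union>h\<in>coboundaries Y i. \<Union>b\<in>coboundaries X i. {(h \<oplus>\<^bsub>gr Y i\<^esub> f i b) \<oplus>\<^bsub>gr Y i\<^esub> f i x})"
        by blast
    qed (use 2 in blast)
    finally show ?thesis by (simp add: a_r_coset_def')
  qed
  have inj: "inj_on (cohomology_map Y f i) (carrier (cohomology X i)) \<longleftrightarrow>
      (\<forall>x\<in>cocycles X i. f i x \<in> coboundaries Y i \<longrightarrow> x \<in> coboundaries X i)" (is "?l \<longleftrightarrow> ?r") for i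
  proof
    assume l: ?l
    show ?r
    proof (intro ballI impI)
      fix x assume x: "x \<in> cocycles X i" "f i x \<in> coboundaries Y i"
      let ?z = "\<zero>\<^bsub>gr X i\<^esub>"
      have z: "?z \<in> cocycles X i" by (rule linear_subspace_zero[OF X.cocycles_subspace])
      have fz: "f i ?z = \<zero>\<^bsub>gr Y i\<^esub>" by (rule lin_zero[OF f X.vector_space Y.vector_space])
      have "coboundaries Y i +>\<^bsub>gr Y i\<^esub> f i x = coboundaries Y i +>\<^bsub>gr Y i\<^esub> f i ?z"
        using x fz Y.coboundaries_coset_iff[of "f i x" i] Y.coboundaries_coset_iff[of "f i ?z" i]
          fZ[OF x(1)] fZ[OF z] linear_subspace_carrier[OF Y.cocycles_subspace]
          linear_subspace_zero[OF Y.coboundaries_subspace[of i]] by metis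
      then have "coboundaries X i +>\<^bsub>gr X i\<^esub> x = coboundaries X i +>\<^bsub>gr X i\<^esub> ?z"
        using inj_onD[OF l, of "coboundaries X i +>\<^bsub>gr X i\<^esub> x" "coboundaries X i +>\<^bsub>gr X i\<^esub> ?z"] map x z
        by (auto simp: carrier_cohomology)
      then show "x \<in> coboundaries X i"
        using x z Zc X.coboundaries_coset_iff linear_subspace_zero[OF X.coboundaries_subspace[of i]] by metis
    qed
  next
    assume r: ?r
    show ?l
    proof (rule inj_onI)
      fix u v assume uv: "u \<in> carrier (cohomology X i)" "v \<in> carrier (cohomology X i)"
        "cohomology_map Y f i u = cohomology_map Y f i v"
      then obtain x y where x: "x \<in> cocycles X i" "u = coboundaries X i +>\<^bsub>gr X i\<^esub> x"
        and y: "y \<in> cocycles X i" "v = coboundaries X i +>\<^bsub>gr X i\<^esub> y"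
        by (auto simp: carrier_cohomology)
      note VX = X.vector_space[of i] and VY = Y.vector_space[of i]
      have fxc: "f i x \<in> carrier (gr Y i)" and fyc: "f i y \<in> carrier (gr Y i)"
        using fZ x y linear_subspace_carrier[OF Y.cocycles_subspace] by blast+
      obtain b where b: "b \<in> coboundaries Y i" "f i x = b \<oplus>\<^bsub>gr Y i\<^esub> f i y"
        using uv(3) map x y Y.coset_eq_iff[OF fxc fyc] by auto
      have bc: "b \<in> carrier (gr Y i)" using b linear_subspace_carrier[OF Y.coboundaries_subspace] by blast
      let ?w = "x \<oplus>\<^bsub>gr X i\<^esub> (- 1) \<odot>\<^bsub>gr X i\<^esub> y"
      have w: "?w \<in> cocycles X i"
        using x y linear_subspace_add[OF X.cocycles_subspace] linear_subspace_smult[OF X.cocycles_subspace]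
        by metis
      have "f i ?w = b \<oplus>\<^bsub>gr Y i\<^esub> (f i y \<oplus>\<^bsub>gr Y i\<^esub> (- 1) \<odot>\<^bsub>gr Y i\<^esub> f i y)"
        using x y Zc b bc fyc
        by (simp add: lin_add[OF f] lin_smult[OF f] vs_smult[OF VX] vs_smult[OF VY] vs_assoc[OF VY])
      also have "\<dots> = b"
        using abelian_group.r_neg[OF vs_abelian_group[OF VY] fyc] bc fyc
        by (simp add: vs_neg[OF VY] vs_rzero[OF VY])
      finally have "?w \<in> coboundaries X i" using r w b by auto
      moreover have "x = ?w \<oplus>\<^bsub>gr X i\<^esub> y"
        using x y Zc abelian_group.l_neg[OF vs_abelian_group[OF VX], of y]
        by (simp add: vs_assoc[OF VX] vs_smult[OF VX] vs_neg[OF VX] vs_rzero[OF VX])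
      ultimately show "u = v" using x y Zc X.coset_eq_iff by metis
    qed
  qed
  have surj: "cohomology_map Y f i ` carrier (cohomology X i) = carrier (cohomology Y i) \<longleftrightarrow>
     (\<forall>y\<in>cocycles Y i. \<exists>x\<in>cocycles X i. \<exists>b\<in>coboundaries Y i. y = b \<oplus>\<^bsub>gr Y i\<^esub> f i x)" (is "?l \<longleftrightarrow> ?r") for i
  proof -
    have e: "cohomology_map Y f i ` carrier (cohomology X i) =
        {coboundaries Y i +>\<^bsub>gr Y i\<^esub> f i x |x. x \<in> cocycles X i}"
      using map by (force simp: carrier_cohomology image_iff)
    have "{coboundaries Y i +>\<^bsub>gr Y i\<^esub> f i x |x. x \<in> cocycles X i} \<subseteq> carrier (cohomology Y i)"
      using fZ unfolding carrier_cohomology by blast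
    then have "?l \<longleftrightarrow> carrier (cohomology Y i) \<subseteq> {coboundaries Y i +>\<^bsub>gr Y i\<^esub> f i x |x. x \<in> cocycles X i}"
      unfolding e by blast
    also have "\<dots> \<longleftrightarrow> (\<forall>y\<in>cocycles Y i. \<exists>x\<in>cocycles X i.
        coboundaries Y i +>\<^bsub>gr Y i\<^esub> y = coboundaries Y i +>\<^bsub>gr Y i\<^esub> f i x)"
      unfolding carrier_cohomology by blast
    also have "\<dots> \<longleftrightarrow> ?r"
    proof (intro ball_cong bex_cong refl)
      fix x y assume "y \<in> cocycles Y i" "x \<in> cocycles X i"
      then show "coboundaries Y i +>\<^bsub>gr Y i\<^esub> y = coboundaries Y i +>\<^bsub>gr Y i\<^esub> f i x \<longleftrightarrow>
          (\<exists>b\<in>coboundaries Y i. y = b \<oplus>\<^bsub>gr Y i\<^esub> f i x)"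
        by (intro Y.coset_eq_iff linear_subspace_carrier[OF Y.cocycles_subspace] fZ)
    qed
    finally show ?thesis .
  qed
  show ?thesis
    unfolding bij_betw_def cohomology_bijective_def inj surj all_conj_distrib ..
qed

section \<open>Transport of modules along linear isomorphisms\<close>

lemma dg_homD:
  assumes "dg_hom A X Y f"
  shows dg_hom_linear: "f i \<in> linear_maps (gr X i) (gr Y i)"
    and dg_hom_closed: "x \<in> carrier (gr X i) \<Longrightarrow> f i x \<in> carrier (gr Y i)"
    and dg_hom_dif: "x \<in> carrier (gr X i) \<Longrightarrow> f (i + 1) (dif X i x) = dif Y i (f i x)"
    and dg_hom_act: "x \<in> carrier (gr X i) \<Longrightarrow> a \<in> carrier (gr A j) \<Longrightarrow>
       f (i + j) (act X i j x a) = act Y i j (f i x) a"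
proof -
  show l: "f i \<in> linear_maps (gr X i) (gr Y i)" for i using assms by (simp add: dg_hom_def)
  show "x \<in> carrier (gr X i) \<Longrightarrow> f i x \<in> carrier (gr Y i)" for x by (rule lin_closed[OF l])
  show "x \<in> carrier (gr X i) \<Longrightarrow> f (i + 1) (dif X i x) = dif Y i (f i x)"
    and "x \<in> carrier (gr X i) \<Longrightarrow> a \<in> carrier (gr A j) \<Longrightarrow>
       f (i + j) (act X i j x a) = act Y i j (f i x) a" using assms by (simp_all add: dg_hom_def)
qed

lemma quasi_isomorphism_iff:
  assumes "dg_module A X" "dg_module A Y"
  shows "quasi_isomorphism A X Y f \<longleftrightarrow> dg_hom A X Y f \<and> cohomology_bijective X Y f"
proof -
  have X: "cochain_complex X" and Y: "cochain_complex Y"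
    using assms by (auto simp: dg_module_def)
  show ?thesis
    unfolding quasi_isomorphism_def
    using cohomology_bijective_iff[OF X Y, of f] dg_hom_linear[of A X Y f] dg_hom_dif[of A X Y f] by blast
qed

definition transport ::
  "(int \<Rightarrow> 'u \<Rightarrow> 'v) \<Rightarrow> (int \<Rightarrow> (complex, 'v) module) \<Rightarrow> ('a, 'u) dg_module \<Rightarrow> ('a, 'v) dg_module"
where
  "transport e G X =
     \<lparr>gr = G,
      dif = \<lambda>i y. e (i + 1) (dif X i (inv_into (carrier (gr X i)) (e i) y)),
      act = \<lambda>i j y a. e (i + j) (act X i j (inv_into (carrier (gr X i)) (e i) y) a)\<rparr>"

lemma transport_simps [simp]:
  "gr (transport e G X) = G"
  "dif (transport e G X) i y = e (i + 1) (dif X i (inv_into (carrier (gr X i)) (e i) y))"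
  "act (transport e G X) i j y a = e (i + j) (act X i j (inv_into (carrier (gr X i)) (e i) y) a)"
  by (simp_all add: transport_def)

lemma
  assumes "dg_module A X"
    and G: "\<And>i. complex_vector_space (G i)"
    and e: "\<And>i. e i \<in> linear_maps (gr X i) (G i)"
    and b: "\<And>i. bij_betw (e i) (carrier (gr X i)) (carrier (G i))"
  shows transport_dg_module: "dg_module A (transport e G X)"
    and transport_dg_hom: "dg_hom A X (transport e G X) e"
    and transport_dg_hom_inv: "dg_hom A (transport e G X) X (\<lambda>i. inv_into (carrier (gr X i)) (e i))"
proof -
  interpret X: dg_module A X by fact
  let ?h = "\<lambda>i. inv_into (carrier (gr X i)) (e i)"
  have hc [simp]: "?h i y \<in> carrier (gr X i)" "e i (?h i y) = y" if "y \<in> carrier (G i)" for i y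
    using b[of i] that by (auto simp: bij_betw_def f_inv_into_f inv_into_into)
  have he [simp]: "?h i (e i x) = x" if "x \<in> carrier (gr X i)" for i x
    using b[of i] that by (auto simp: bij_betw_def)
  have h: "?h i \<in> linear_maps (G i) (gr X i)" for i
    by (rule lin_inv[OF e b X.M.vector_space])
  have ec [simp]: "e i x \<in> carrier (G i)" if "x \<in> carrier (gr X i)" for i x
    by (rule lin_closed[OF e that])
  have ac [simp]: "act X i j x a \<in> carrier (gr X (i + j))" if "x \<in> carrier (gr X i)" "a \<in> carrier (gr A j)" for i j x a
    by (rule lin_closed[OF X.act_linear_left[OF that(2)] that(1)])
  note [simp] = X.M.dif_closed
  have dc: "(\<lambda>y. e (i + 1) (dif X i (?h i y))) \<in> linear_maps (G i) (G (i + 1))" for i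
    by (rule lin_comp[OF lin_comp[OF h X.M.dif_linear] e])
  have al: "(\<lambda>y. e (i + j) (act X i j (?h i y) a)) \<in> linear_maps (G i) (G (i + j))"
    if "a \<in> carrier (gr A j)" for i j a
    using lin_comp[OF lin_comp[OF h X.act_linear_left[OF that]] e] .
  have ar: "(\<lambda>a. e (i + j) (act X i j (?h i y) a)) \<in> linear_maps (gr A j) (G (i + j))"
    if "y \<in> carrier (G i)" for i j y
    using lin_comp[OF X.act_linear_right[OF hc(1)[OF that]] e] .
  show "dg_module A (transport e G X)"
  proof (intro dg_module.intro dg_module_axioms.intro cochain_complex.intro, unfold transport_simps(1))
    show "dg_algebra A" by (rule X.dg_algebra_axioms)
    show "complex_vector_space (G i)" for i by (rule G)
    show "dif (transport e G X) i \<in> linear_maps (G i) (G (i + 1))" for i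
      using dc[of i] by (simp add: transport_def)
    show "dif (transport e G X) (i + 1) (dif (transport e G X) i x) = \<zero>\<^bsub>G (i + 2)\<^esub>"
      if "x \<in> carrier (G i)" for i x
    proof -
      have "dif (transport e G X) (i + 1) (dif (transport e G X) i x) = e (i + 1 + 1) (dif X (i + 1) (dif X i (?h i x)))"
        using that by simp
      also have "\<dots> = e (i + 1 + 1) \<zero>\<^bsub>gr X (i + 2)\<^esub>"
        using that X.M.dif_dif[of "?h i x" i] by simp
      also have "\<dots> = e (i + 2) \<zero>\<^bsub>gr X (i + 2)\<^esub>" by (simp add: ac_simps)
      also have "\<dots> = \<zero>\<^bsub>G (i + 2)\<^esub>" by (rule lin_zero[OF e X.M.vector_space G])
      finally show ?thesis .
    qed
    show "(\<lambda>y. act (transport e G X) i j y a) \<in> linear_maps (G i) (G (i + j))"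
      if "a \<in> carrier (gr A j)" for i j a using al[OF that] by simp
    show "act (transport e G X) i j y \<in> linear_maps (gr A j) (G (i + j))"
      if "y \<in> carrier (G i)" for i j y using ar[OF that] by (simp add: transport_def)
    show "act (transport e G X) (i + j) k (act (transport e G X) i j x a) b =
        act (transport e G X) i (j + k) x (mul A j k a b)"
      if "x \<in> carrier (G i)" "a \<in> carrier (gr A j)" "b \<in> carrier (gr A k)" for x i a j b k
      using that X.act_assoc[of "?h i x" i a j b k] by (simp add: add.assoc)
    show "act (transport e G X) i 0 x (unt A) = x" if "x \<in> carrier (G i)" for x i
      using that X.act_unt[of "?h i x" i] by simp
    show "dif (transport e G X) (i + j) (act (transport e G X) i j x a) =
       act (transport e G X) (i + 1) j (dif (transport e G X) i x) a
       \<oplus>\<^bsub>G (i + j + 1)\<^esub> sign i \<odot>\<^bsub>G (i + j + 1)\<^esub> act (transport e G X) i (j + 1) x (dif A j a)"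
      if "x \<in> carrier (G i)" "a \<in> carrier (gr A j)" for x i a j
    proof -
      have i1: "i + 1 + j = i + j + 1" "i + (j + 1) = i + j + 1" by simp_all
      have c1: "act X (i + 1) j (dif X i (?h i x)) a \<in> carrier (gr X (i + j + 1))"
        using ac[of "dif X i (?h i x)" "i + 1" a j] that by (simp add: i1)
      have c2: "act X i (j + 1) (?h i x) (dif A j a) \<in> carrier (gr X (i + j + 1))"
        using ac[of "?h i x" i "dif A j a" "j + 1"] that X.dif_closed by (simp add: i1)
      show ?thesis
        using that c1 c2 X.act_leibniz[of "?h i x" i a j]
        by (simp add: i1 lin_add[OF e] lin_smult[OF e] vs_smult[OF X.M.vector_space] X.dif_closed)
    qed
  qed
  show "dg_hom A X (transport e G X) e"
    by (auto simp: dg_hom_def e)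
  show "dg_hom A (transport e G X) X ?h"
    by (auto simp: dg_hom_def h)
qed

section \<open>Coordinates\<close>

definition finitely_supported :: "'b set \<Rightarrow> ('b \<Rightarrow> 'v::zero) set" where
  "finitely_supported B = {f. finite {b. f b \<noteq> 0} \<and> (\<forall>b. f b \<noteq> 0 \<longrightarrow> b \<in> B)}"

lemma finitely_supported_subspace: "subspace (finitely_supported B :: ('b \<Rightarrow> 'v::complex_vector) set)"
  unfolding subspace_def
proof (intro conjI ballI allI)
  fix f g :: "'b \<Rightarrow> 'v" assume f: "f \<in> finitely_supported B" and g: "g \<in> finitely_supported B"
  have "{b. (f + g) b \<noteq> 0} \<subseteq> {b. f b \<noteq> 0} \<union> {b. g b \<noteq> 0}" by auto
  moreover have "(f + g) b \<noteq> 0 \<longrightarrow> b \<in> B" for b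
    using f g by (auto simp: finitely_supported_def) (metis add.right_neutral)
  ultimately show "f + g \<in> finitely_supported B"
    using f g unfolding finitely_supported_def by (blast intro: finite_subset)
next
  fix c and f :: "'b \<Rightarrow> 'v" assume f: "f \<in> finitely_supported B"
  have s: "{b. (c *\<^sub>C f) b \<noteq> 0} \<subseteq> {b. f b \<noteq> 0}" by auto
  moreover have "(c *\<^sub>C f) b \<noteq> 0 \<longrightarrow> b \<in> B" for b
    using f s by (auto simp: finitely_supported_def)
  ultimately show "c *\<^sub>C f \<in> finitely_supported B"
    using f unfolding finitely_supported_def by (blast intro: finite_subset)
qed (auto simp: finitely_supported_def)

definition combination :: "(complex, 'u) module \<Rightarrow> ('u \<Rightarrow> complex) \<Rightarrow> 'u" where
  "combination V f = (\<Oplus>\<^bsub>V\<^esub>v\<in>{v. f v \<noteq> 0}. f v \<odot>\<^bsub>V\<^esub> v)"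

lemma
  assumes V: "complex_vector_space V"
  shows combination_superset: "finite T \<Longrightarrow> T \<subseteq> carrier V \<Longrightarrow> (\<And>v. f v \<noteq> 0 \<Longrightarrow> v \<in> T) \<Longrightarrow>
      combination V f = (\<Oplus>\<^bsub>V\<^esub>v\<in>T. f v \<odot>\<^bsub>V\<^esub> v)"
    and combination_linear: "combination V \<in> linear_maps (space_on (finitely_supported (carrier V))) V"
proof -
  interpret V: module complex_field V by (rule V)
  show sup: "combination V f = (\<Oplus>\<^bsub>V\<^esub>v\<in>T. f v \<odot>\<^bsub>V\<^esub> v)"
    if T: "finite T" "T \<subseteq> carrier V" "\<And>v. f v \<noteq> 0 \<Longrightarrow> v \<in> T" for f T
    unfolding combination_def
    by (rule V.M.add.finprod_mono_neutral_cong_left) (use T in \<open>auto simp: vs_null[OF V] vs_smult[OF V]\<close>)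
  show "combination V \<in> linear_maps (space_on (finitely_supported (carrier V))) V"
  proof (rule linear_mapsI, unfold space_on_simps)
    fix f :: "'a \<Rightarrow> complex" assume f: "f \<in> finitely_supported (carrier V)"
    then show "combination V f \<in> carrier V"
      unfolding combination_def by (intro V.M.finsum_closed) (auto simp: finitely_supported_def vs_smult[OF V])
    fix c
    have "combination V (c *\<^sub>C f) = (\<Oplus>\<^bsub>V\<^esub>v\<in>{v. f v \<noteq> 0}. (c *\<^sub>C f) v \<odot>\<^bsub>V\<^esub> v)"
      using f by (intro sup) (auto simp: finitely_supported_def)
    also have "\<dots> = (\<Oplus>\<^bsub>V\<^esub>v\<in>{v. f v \<noteq> 0}. c \<odot>\<^bsub>V\<^esub> (f v \<odot>\<^bsub>V\<^esub> v))"
      using f by (intro V.M.finsum_cong')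
        (auto simp: finitely_supported_def vs_smult[OF V] vs_smult_smult[OF V] scaleC_complex_def)
    also have "\<dots> = c \<odot>\<^bsub>V\<^esub> combination V f"
      unfolding combination_def
      by (rule V.finsum_smult_ldistr[symmetric]) (use f in \<open>auto simp: finitely_supported_def vs_smult[OF V]\<close>)
    finally show "combination V (c *\<^sub>C f) = c \<odot>\<^bsub>V\<^esub> combination V f" .
  next
    fix f g :: "'a \<Rightarrow> complex"
    assume f: "f \<in> finitely_supported (carrier V)" and g: "g \<in> finitely_supported (carrier V)"
    let ?T = "{v. f v \<noteq> 0} \<union> {v. g v \<noteq> 0}"
    have T: "finite ?T" "?T \<subseteq> carrier V" using f g by (auto simp: finitely_supported_def)
    have "combination V (f + g) = (\<Oplus>\<^bsub>V\<^esub>v\<in>?T. (f + g) v \<odot>\<^bsub>V\<^esub> v)"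
      using T by (intro sup) auto
    also have "\<dots> = (\<Oplus>\<^bsub>V\<^esub>v\<in>?T. f v \<odot>\<^bsub>V\<^esub> v \<oplus>\<^bsub>V\<^esub> g v \<odot>\<^bsub>V\<^esub> v)"
      using T by (intro V.M.finsum_cong') (auto simp: vs_distl[OF V] vs_smult[OF V] vs_add[OF V])
    also have "\<dots> = (\<Oplus>\<^bsub>V\<^esub>v\<in>?T. f v \<odot>\<^bsub>V\<^esub> v) \<oplus>\<^bsub>V\<^esub> (\<Oplus>\<^bsub>V\<^esub>v\<in>?T. g v \<odot>\<^bsub>V\<^esub> v)"
      using T by (intro V.M.finsum_addf) (auto simp: vs_smult[OF V])
    also have "\<dots> = combination V f \<oplus>\<^bsub>V\<^esub> combination V g"
      using T by (intro arg_cong2[where f = "add V"] sup[symmetric]) auto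
    finally show "combination V (f + g) = combination V f \<oplus>\<^bsub>V\<^esub> combination V g" .
  qed
qed

lemma linear_on_finitely_supported_subset:
  assumes "f \<in> linear_maps (space_on (finitely_supported C)) V" "B \<subseteq> C"
  shows "f \<in> linear_maps (space_on (finitely_supported B)) V"
proof -
  have "g \<in> finitely_supported C" if "g \<in> finitely_supported B" for g :: "'a \<Rightarrow> 'b"
    using that assms(2) by (auto simp: finitely_supported_def)
  then show ?thesis
    using assms(1) by (simp add: linear_maps_def Pi_iff)
qed

text \<open>
  A maximal linearly independent set is a basis. Bases are only used for turning a vector space on an
  arbitrary carrier into a space of functions.
\<close>

theorem coordinates_exist:
  fixes V :: "(complex, 'u) module"
  assumes V: "complex_vector_space V"
  obtains B :: "'u set" and \<phi> :: "'u \<Rightarrow> 'u \<Rightarrow> complex"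
  where "\<phi> \<in> linear_maps V (space_on (finitely_supported B))"
    and "bij_betw \<phi> (carrier V) (finitely_supported B)"
proof -
  define \<A> where "\<A> = {B. B \<subseteq> carrier V \<and>
      (\<forall>f \<in> finitely_supported B. combination V f = \<zero>\<^bsub>V\<^esub> \<longrightarrow> f = 0)}"
  have "\<exists>M\<in>\<A>. \<forall>X\<in>\<A>. M \<subseteq> X \<longrightarrow> X = M"
  proof (rule subset_Zorn')
    fix \<C> assume ch: "subset.chain \<A> \<C>"
    then have sub: "\<C> \<subseteq> \<A>" by (auto simp: subset.chain_def)
    show "\<Union>\<C> \<in> \<A>"
    proof -
      have "f = 0" if f: "f \<in> finitely_supported (\<Union>\<C>)" "combination V f = \<zero>\<^bsub>V\<^esub>" for f
      proof (cases "\<C> = {}")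
        case True
        then show ?thesis using f by (auto simp: finitely_supported_def fun_eq_iff)
      next
        case False
        have "finite {b. f b \<noteq> 0}" "{b. f b \<noteq> 0} \<subseteq> \<Union>\<C>" using f by (auto simp: finitely_supported_def)
        then obtain B where B: "B \<in> \<C>" "{b. f b \<noteq> 0} \<subseteq> B"
          using finite_subset_Union_chain[OF _ _ False ch] by blast
        then have "f \<in> finitely_supported B" using f by (auto simp: finitely_supported_def)
        then show ?thesis using f B sub by (auto simp: \<A>_def)
      qed
      then show ?thesis using sub by (auto simp: \<A>_def)
    qed
  qed
  then obtain M where M: "M \<in> \<A>" and max: "\<And>X. X \<in> \<A> \<Longrightarrow> M \<subseteq> X \<Longrightarrow> X = M" by blast
  have Mc: "M \<subseteq> carrier V" and Mi: "\<And>f. f \<in> finitely_supported M \<Longrightarrow> combination V f = \<zero>\<^bsub>V\<^esub> \<Longrightarrow> f = 0"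
    using M by (auto simp: \<A>_def)
  let ?F = "space_on (finitely_supported M :: ('u \<Rightarrow> complex) set)"
  note F = space_on_space[OF finitely_supported_subspace]
  have lin: "combination V \<in> linear_maps ?F V"
    by (rule linear_on_finitely_supported_subset[OF combination_linear[OF V] Mc])
  note sM = finitely_supported_subspace[where 'v = complex, of M]
  have inj: "inj_on (combination V) (finitely_supported M)"
  proof (rule inj_onI)
    fix f g assume f: "f \<in> finitely_supported M" and g: "g \<in> finitely_supported M"
      and eq: "combination V f = combination V g"
    have c: "combination V f \<in> carrier V" using lin_closed[OF lin] f by simp
    have "combination V (f + (- 1) *\<^sub>C g) = combination V f \<oplus>\<^bsub>V\<^esub> (- 1) \<odot>\<^bsub>V\<^esub> combination V g"
      using lin_add[OF lin, of f "(- 1) *\<^sub>C g"] lin_smult[OF lin, of g "- 1"] f g subspace_scale[OF sM] by simp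
    also have "\<dots> = \<zero>\<^bsub>V\<^esub>"
      using c eq abelian_group.r_neg[OF vs_abelian_group[OF V]] vs_neg[OF V] by metis
    finally have "f + (- 1) *\<^sub>C g = 0" using f g Mi subspace_add[OF sM] subspace_scale[OF sM] by blast
    then show "f = g" by (simp add: scaleC_minus_one)
  qed
  have surj: "x \<in> combination V ` finitely_supported M" if x: "x \<in> carrier V" for x
  proof (rule ccontr)
    assume nx: "x \<notin> combination V ` finitely_supported M"
    let ?C = "\<lambda>y. if y = x then 1 else (0::complex)"
    have cx: "combination V ?C = x"
    proof -
      interpret V: module complex_field V by (rule V)
      have "combination V ?C = (\<Oplus>\<^bsub>V\<^esub>v\<in>{x}. ?C v \<odot>\<^bsub>V\<^esub> v)"
        using x by (intro combination_superset[OF V]) (auto split: if_splits)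
      also have "\<dots> = x" using x by (simp add: vs_one[OF V])
      finally show ?thesis .
    qed
    have "insert x M \<in> \<A>"
    proof -
      have "f = 0" if f: "f \<in> finitely_supported (insert x M)" and f0: "combination V f = \<zero>\<^bsub>V\<^esub>" for f
      proof (cases "f x = 0")
        case True
        then have "f \<in> finitely_supported M" using f by (auto simp: finitely_supported_def)
        then show ?thesis using f0 Mi by blast
      next
        case False
        let ?g = "f(x := 0)"
        have g: "?g \<in> finitely_supported M"
          using f by (auto simp: finitely_supported_def elim: rev_finite_subset)
        have "?C = (1 / f x) *\<^sub>C f + (- 1 / f x) *\<^sub>C ?g"
          using False by (auto simp: fun_eq_iff scaleC_complex_def)
        moreover have l: "combination V \<in> linear_maps (space_on (finitely_supported (insert x M))) V"
          by (rule linear_on_finitely_supported_subset[OF combination_linear[OF V]]) (use Mc x in auto)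
        moreover have "?g \<in> finitely_supported (insert x M)" using g by (auto simp: finitely_supported_def)
        moreover from this have "combination V ((1 / f x) *\<^sub>C f + (- 1 / f x) *\<^sub>C ?g) =
            combination V ((1 / f x) *\<^sub>C f) \<oplus>\<^bsub>V\<^esub> combination V ((- 1 / f x) *\<^sub>C ?g)"
          by (intro lin_add[OF l, unfolded space_on_simps] subspace_scale[OF finitely_supported_subspace] f)
        moreover have "combination V ((1 / f x) *\<^sub>C f) = (1 / f x) \<odot>\<^bsub>V\<^esub> combination V f"
          using lin_smult[OF l, of f "1 / f x"] f by (simp only: space_on_simps)
        ultimately have "x = (1 / f x) \<odot>\<^bsub>V\<^esub> combination V f \<oplus>\<^bsub>V\<^esub> combination V ((- 1 / f x) *\<^sub>C ?g)"
          using cx by metis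
        then have "x = combination V ((- 1 / f x) *\<^sub>C ?g)"
          using f0 lin_closed[OF lin] subspace_scale[OF sM g]
          by (simp add: vs_smult_zero[OF V] vs_lzero[OF V])
        then show ?thesis using nx subspace_scale[OF sM g] by blast
      qed
      then show ?thesis using x Mc by (auto simp: \<A>_def)
    qed
    then have "x \<in> M" using max by blast
    then have "?C \<in> finitely_supported M" by (auto simp: finitely_supported_def)
    then show False using nx cx by (metis imageI)
  qed
  have b: "bij_betw (combination V) (carrier ?F) (carrier V)"
    using inj surj lin_closed[OF lin] by (auto simp: bij_betw_def)
  show thesis
    using that[of "inv_into (carrier ?F) (combination V)" M] lin_inv[OF lin b F] bij_betw_inv_into[OF b] by simp
qed

section \<open>Subspaces of finite codimension\<close>

text \<open>
  \<open>fin_codim V B Z\<close> says that \<open>Z\<close> is spanned by \<open>B\<close> and finitely many vectors. Adding the vectors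
  one at a time gives an induction that replaces all arguments with bases and dimensions.
\<close>

inductive fin_codim :: "(complex, 'u) module \<Rightarrow> 'u set \<Rightarrow> 'u set \<Rightarrow> bool"
  for V :: "(complex, 'u) module" and B :: "'u set"
where
  base: "fin_codim V B B"
| line: "fin_codim V B Z \<Longrightarrow> v \<in> carrier V \<Longrightarrow> fin_codim V B {z \<oplus>\<^bsub>V\<^esub> c \<odot>\<^bsub>V\<^esub> v | z c. z \<in> Z}"

lemma fin_codim_trans: "fin_codim V B C \<Longrightarrow> fin_codim V C Z \<Longrightarrow> fin_codim V B Z"
proof (rotate_tac, induction rule: fin_codim.induct)
  case (line Z v)
  then show ?case by (intro fin_codim.line) auto
qed auto

lemma linear_subspace_add_line:
  assumes V: "complex_vector_space V" and Z: "linear_subspace V Z" and v: "v \<in> carrier V"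
  shows "linear_subspace V {z \<oplus>\<^bsub>V\<^esub> c \<odot>\<^bsub>V\<^esub> v | z c. z \<in> Z}" (is "linear_subspace V ?W")
    and "Z \<subseteq> {z \<oplus>\<^bsub>V\<^esub> c \<odot>\<^bsub>V\<^esub> v | z c. z \<in> Z}"
proof -
  have zc: "z \<in> carrier V" if "z \<in> Z" for z by (rule linear_subspace_carrier[OF Z that])
  show sub: "Z \<subseteq> ?W"
  proof
    fix z assume z: "z \<in> Z"
    have "z = z \<oplus>\<^bsub>V\<^esub> 0 \<odot>\<^bsub>V\<^esub> v" using zc[OF z] v by (simp add: vs_null[OF V] vs_rzero[OF V])
    then show "z \<in> ?W" using z by blast
  qed
  have "x \<oplus>\<^bsub>V\<^esub> y \<in> ?W" if xy: "x \<in> ?W" "y \<in> ?W" for x y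
  proof -
    obtain z c z' c' where "z \<in> Z" "z' \<in> Z" "x = z \<oplus>\<^bsub>V\<^esub> c \<odot>\<^bsub>V\<^esub> v" "y = z' \<oplus>\<^bsub>V\<^esub> c' \<odot>\<^bsub>V\<^esub> v"
      using xy by blast
    moreover from this have "x \<oplus>\<^bsub>V\<^esub> y = (z \<oplus>\<^bsub>V\<^esub> z') \<oplus>\<^bsub>V\<^esub> (c + c') \<odot>\<^bsub>V\<^esub> v"
      using v zc by (simp add: vs_distl[OF V] vs_assoc[OF V] vs_lcomm[OF V] vs_add[OF V] vs_smult[OF V])
    ultimately show ?thesis using linear_subspace_add[OF Z] by blast
  qed
  moreover have "d \<odot>\<^bsub>V\<^esub> x \<in> ?W" if x: "x \<in> ?W" for x d
  proof -
    obtain z c where "z \<in> Z" "x = z \<oplus>\<^bsub>V\<^esub> c \<odot>\<^bsub>V\<^esub> v" using x by blast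
    moreover from this have "d \<odot>\<^bsub>V\<^esub> x = d \<odot>\<^bsub>V\<^esub> z \<oplus>\<^bsub>V\<^esub> (d * c) \<odot>\<^bsub>V\<^esub> v"
      using v zc by (simp add: vs_distr[OF V] vs_smult_smult[OF V] vs_smult[OF V])
    ultimately show ?thesis using linear_subspace_smult[OF Z] by blast
  qed
  ultimately show "linear_subspace V ?W"
    using sub linear_subspace_zero[OF Z] zc v vs_add[OF V] vs_smult[OF V]
    unfolding linear_subspace_def by blast
qed

lemma fin_codim_subspace:
  assumes V: "complex_vector_space V" and "fin_codim V B Z" and B: "linear_subspace V B"
  shows "linear_subspace V Z \<and> B \<subseteq> Z"
  using assms(2)
proof induction
  case (line Z v)
  then show ?case using linear_subspace_add_line[OF V, of Z v] by blast
qed (use B in auto)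

text \<open>
  When a line is added to \<open>Z\<close>, the preimage either does not change, or it grows by the line through any of
  its new elements \<open>w\<close>.
\<close>

lemma fin_codim_preimage:
  assumes V: "complex_vector_space V" and W: "complex_vector_space W"
    and f: "f \<in> linear_maps (V\<lparr>carrier := U\<rparr>) W" and U: "linear_subspace V U"
    and B: "linear_subspace W B" and Z: "fin_codim W B Z"
  shows "fin_codim V {u \<in> U. f u \<in> B} {u \<in> U. f u \<in> Z}"
  using Z
proof induction
  case base
  show ?case by (rule fin_codim.base)
next
  case (line Z v)
  note Z = fin_codim_subspace[OF W line.hyps(1) B, THEN conjunct1] and v = line.hyps(2)
  let ?Z = "{z \<oplus>\<^bsub>W\<^esub> c \<odot>\<^bsub>W\<^esub> v | z c. z \<in> Z}"
  have f': "f x \<in> carrier W" "f (x \<oplus>\<^bsub>V\<^esub> y) = f x \<oplus>\<^bsub>W\<^esub> f y" "f (c \<odot>\<^bsub>V\<^esub> x) = c \<odot>\<^bsub>W\<^esub> f x"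
    if "x \<in> U" "y \<in> U" for x y c
    using lin_closed[OF f, of x] lin_add[OF f, of x y] lin_smult[OF f, of x c] that by auto
  have Zc: "z \<in> carrier W" if "z \<in> Z" for z by (rule linear_subspace_carrier[OF Z that])
  have Uc: "z \<in> carrier V" if "z \<in> U" for z by (rule linear_subspace_carrier[OF U that])
  have sub: "Z \<subseteq> ?Z" by (rule linear_subspace_add_line(2)[OF W Z v])
  show ?case
  proof (cases "{u \<in> U. f u \<in> ?Z} = {u \<in> U. f u \<in> Z}")
    case True
    then show ?thesis using line.IH by simp
  next
    case False
    then obtain w z0 c0 where w: "w \<in> U" "f w = z0 \<oplus>\<^bsub>W\<^esub> c0 \<odot>\<^bsub>W\<^esub> v" "f w \<notin> Z" and z0: "z0 \<in> Z"
      using sub by blast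
    have c0: "c0 \<noteq> 0"
      using w z0 Zc v by (auto simp: vs_null[OF W] vs_rzero[OF W])
    have "{u \<in> U. f u \<in> ?Z} = {u \<oplus>\<^bsub>V\<^esub> c \<odot>\<^bsub>V\<^esub> w | u c. u \<in> {u \<in> U. f u \<in> Z}}"
    proof (intro equalityI subsetI)
      fix u assume "u \<in> {u \<in> U. f u \<in> ?Z}"
      then obtain z c where u: "u \<in> U" "f u = z \<oplus>\<^bsub>W\<^esub> c \<odot>\<^bsub>W\<^esub> v" "z \<in> Z" by blast
      let ?u = "u \<oplus>\<^bsub>V\<^esub> (- (c / c0)) \<odot>\<^bsub>V\<^esub> w"
      have uU: "?u \<in> U" using u w linear_subspace_add[OF U] linear_subspace_smult[OF U] by blast
      have "f ?u = (z \<oplus>\<^bsub>W\<^esub> c \<odot>\<^bsub>W\<^esub> v) \<oplus>\<^bsub>W\<^esub> (- (c / c0)) \<odot>\<^bsub>W\<^esub> (z0 \<oplus>\<^bsub>W\<^esub> c0 \<odot>\<^bsub>W\<^esub> v)"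
        using u w linear_subspace_smult[OF U] by (simp add: f')
      also have "\<dots> = (z \<oplus>\<^bsub>W\<^esub> (- (c / c0)) \<odot>\<^bsub>W\<^esub> z0) \<oplus>\<^bsub>W\<^esub> (c \<odot>\<^bsub>W\<^esub> v \<oplus>\<^bsub>W\<^esub> (- c) \<odot>\<^bsub>W\<^esub> v)"
        using u(3) z0 v Zc c0
        by (simp add: vs_distr[OF W] vs_smult_smult[OF W] vs_smult[OF W] vs_add[OF W] vs_assoc[OF W] vs_lcomm[OF W])
      also have "\<dots> = z \<oplus>\<^bsub>W\<^esub> (- (c / c0)) \<odot>\<^bsub>W\<^esub> z0"
        using u(3) z0 v Zc vs_distl[OF W v, of c "- c", symmetric]
        by (simp add: vs_null[OF W] vs_rzero[OF W] vs_smult[OF W] vs_add[OF W])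
      also have "\<dots> \<in> Z" using u(3) z0 linear_subspace_add[OF Z] linear_subspace_smult[OF Z] by blast
      finally have "?u \<in> {u \<in> U. f u \<in> Z}" using uU by blast
      moreover have "u = ?u \<oplus>\<^bsub>V\<^esub> (c / c0) \<odot>\<^bsub>V\<^esub> w"
        using u(1) w(1) Uc vs_distl[OF V, of w "- (c / c0)" "c / c0", symmetric]
        by (simp add: vs_assoc[OF V] vs_smult[OF V] vs_null[OF V] vs_rzero[OF V])
      ultimately show "u \<in> {u \<oplus>\<^bsub>V\<^esub> c \<odot>\<^bsub>V\<^esub> w | u c. u \<in> {u \<in> U. f u \<in> Z}}" by blast
    next
      fix x assume "x \<in> {u \<oplus>\<^bsub>V\<^esub> c \<odot>\<^bsub>V\<^esub> w | u c. u \<in> {u \<in> U. f u \<in> Z}}"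
      then obtain u c where x: "x = u \<oplus>\<^bsub>V\<^esub> c \<odot>\<^bsub>V\<^esub> w" "u \<in> U" "f u \<in> Z" by blast
      have "c \<odot>\<^bsub>V\<^esub> w \<in> U" using w linear_subspace_smult[OF U] by blast
      then have "x \<in> U" "f x = f u \<oplus>\<^bsub>W\<^esub> c \<odot>\<^bsub>W\<^esub> (z0 \<oplus>\<^bsub>W\<^esub> c0 \<odot>\<^bsub>W\<^esub> v)"
        using x w linear_subspace_add[OF U] by (auto simp: f')
      moreover have "f u \<oplus>\<^bsub>W\<^esub> c \<odot>\<^bsub>W\<^esub> (z0 \<oplus>\<^bsub>W\<^esub> c0 \<odot>\<^bsub>W\<^esub> v) = (f u \<oplus>\<^bsub>W\<^esub> c \<odot>\<^bsub>W\<^esub> z0) \<oplus>\<^bsub>W\<^esub> (c * c0) \<odot>\<^bsub>W\<^esub> v"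
        using x(3) z0 v Zc by (simp add: vs_distr[OF W] vs_smult_smult[OF W] vs_smult[OF W] vs_assoc[OF W])
      moreover have "f u \<oplus>\<^bsub>W\<^esub> c \<odot>\<^bsub>W\<^esub> z0 \<in> Z"
        using x(3) z0 linear_subspace_add[OF Z] linear_subspace_smult[OF Z] by blast
      ultimately show "x \<in> {u \<in> U. f u \<in> ?Z}" by auto
    qed
    then show ?thesis using fin_codim.line[OF line.IH, of w] Uc w by simp
  qed
qed

lemma fin_codim_image:
  assumes V: "complex_vector_space V" and W: "complex_vector_space W"
    and f: "f \<in> linear_maps V W"
    and B: "linear_subspace V B" and B': "linear_subspace W B'" and Z: "fin_codim V B Z"
  shows "fin_codim W {b' \<oplus>\<^bsub>W\<^esub> f b | b' b. b' \<in> B' \<and> b \<in> B} {b' \<oplus>\<^bsub>W\<^esub> f z | b' z. b' \<in> B' \<and> z \<in> Z}"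
  using Z
proof induction
  case base
  show ?case by (rule fin_codim.base)
next
  case (line Z v)
  note Z = fin_codim_subspace[OF V line.hyps(1) B, THEN conjunct1]
  have eq: "b' \<oplus>\<^bsub>W\<^esub> f (z \<oplus>\<^bsub>V\<^esub> c \<odot>\<^bsub>V\<^esub> v) = (b' \<oplus>\<^bsub>W\<^esub> f z) \<oplus>\<^bsub>W\<^esub> c \<odot>\<^bsub>W\<^esub> f v" if "b' \<in> B'" "z \<in> Z" for b' z c
    using that line.hyps(2) linear_subspace_carrier[OF Z] linear_subspace_carrier[OF B']
    by (simp add: lin_add[OF f] lin_smult[OF f] lin_closed[OF f] vs_assoc[OF W] vs_smult[OF W] vs_smult[OF V])
  have "{b' \<oplus>\<^bsub>W\<^esub> f z | b' z. b' \<in> B' \<and> z \<in> {z \<oplus>\<^bsub>V\<^esub> c \<odot>\<^bsub>V\<^esub> v | z c. z \<in> Z}} =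
      {y \<oplus>\<^bsub>W\<^esub> c \<odot>\<^bsub>W\<^esub> f v | y c. y \<in> {b' \<oplus>\<^bsub>W\<^esub> f z | b' z. b' \<in> B' \<and> z \<in> Z}}"
  proof (intro equalityI subsetI)
    fix w assume "w \<in> {b' \<oplus>\<^bsub>W\<^esub> f z | b' z. b' \<in> B' \<and> z \<in> {z \<oplus>\<^bsub>V\<^esub> c \<odot>\<^bsub>V\<^esub> v | z c. z \<in> Z}}"
    then obtain b' z c where "b' \<in> B'" "z \<in> Z" "w = b' \<oplus>\<^bsub>W\<^esub> f (z \<oplus>\<^bsub>V\<^esub> c \<odot>\<^bsub>V\<^esub> v)" by blast
    then show "w \<in> {y \<oplus>\<^bsub>W\<^esub> c \<odot>\<^bsub>W\<^esub> f v | y c. y \<in> {b' \<oplus>\<^bsub>W\<^esub> f z | b' z. b' \<in> B' \<and> z \<in> Z}}"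
      using eq by blast
  next
    fix w assume "w \<in> {y \<oplus>\<^bsub>W\<^esub> c \<odot>\<^bsub>W\<^esub> f v | y c. y \<in> {b' \<oplus>\<^bsub>W\<^esub> f z | b' z. b' \<in> B' \<and> z \<in> Z}}"
    then obtain b' z c where "b' \<in> B'" "z \<in> Z" "w = (b' \<oplus>\<^bsub>W\<^esub> f z) \<oplus>\<^bsub>W\<^esub> c \<odot>\<^bsub>W\<^esub> f v" by blast
    then show "w \<in> {b' \<oplus>\<^bsub>W\<^esub> f z | b' z. b' \<in> B' \<and> z \<in> {z \<oplus>\<^bsub>V\<^esub> c \<odot>\<^bsub>V\<^esub> v | z c. z \<in> Z}}"
      using eq[symmetric] by blast
  qed
  with fin_codim.line[OF line.IH lin_closed[OF f line.hyps(2)]] show ?case by simp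
qed

text \<open>
  Representatives of the finitely many classes that span the cohomology are added to the coboundaries one
  at a time.
\<close>

lemma (in cochain_complex) finite_dimensional_cohomology:
  assumes "finite_dimensional (cohomology C i)"
  shows "fin_codim (gr C i) (coboundaries C i) (cocycles C i)"
proof -
  let ?V = "gr C i" let ?B = "coboundaries C i" let ?Z = "cocycles C i" let ?Q = "cohomology C i"
  let ?VZ = "(gr C i)\<lparr>carrier := ?Z\<rparr>"
  note V = vector_space[of i] and B = coboundaries_subspace[of i] and Z = cocycles_subspace[of i]
  have VZ: "complex_vector_space ?VZ" by (rule linear_subspace_vector_space[OF V Z])
  interpret VZ: module complex_field ?VZ by (rule VZ)
  have "abelian_subgroup ?B ?VZ"
  proof (rule abelian_subgroupI3)
    show "abelian_group ?VZ" by (rule vs_abelian_group[OF VZ])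
    show "additive_subgroup ?B ?VZ"
    proof (rule additive_subgroup.intro, rule group.subgroupI[OF VZ.M.a_group])
      show "?B \<subseteq> carrier (add_monoid ?VZ)" using coboundaries_cocycles by simp
      show "?B \<noteq> {}" using linear_subspace_zero[OF B] by blast
      show "inv\<^bsub>add_monoid ?VZ\<^esub> x \<in> ?B" if x: "x \<in> ?B" for x
      proof -
        have "\<ominus>\<^bsub>?VZ\<^esub> x = (- 1) \<odot>\<^bsub>?VZ\<^esub> x" using x coboundaries_cocycles by (intro vs_neg[OF VZ]) auto
        then show ?thesis using linear_subspace_smult[OF B x] by (simp add: a_inv_def)
      qed
      show "x \<otimes>\<^bsub>add_monoid ?VZ\<^esub> y \<in> ?B" if "x \<in> ?B" "y \<in> ?B" for x y
        using linear_subspace_add[OF B that] by simp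
    qed
  qed
  then interpret F: comm_group "?VZ A_Mod ?B" by (rule abelian_subgroup.a_factorgroup_is_comm_group)
  have eqs: "carrier (?VZ A_Mod ?B) = carrier ?Q" "monoid.mult (?VZ A_Mod ?B) = add ?Q"
    "\<one>\<^bsub>?VZ A_Mod ?B\<^esub> = \<zero>\<^bsub>?Q\<^esub>"
    by (auto simp: cohomology_def quotient_space_def A_FactGroup_def' A_RCOSETS_def' make_space_def)
  interpret Q: abelian_monoid ?Q
  proof (rule abelian_monoidI)
    show "x \<oplus>\<^bsub>?Q\<^esub> y \<in> carrier ?Q" if "x \<in> carrier ?Q" "y \<in> carrier ?Q" for x y
      using F.m_closed[of x y] that unfolding eqs by blast
    show "\<zero>\<^bsub>?Q\<^esub> \<in> carrier ?Q" using F.one_closed unfolding eqs .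
    show "(x \<oplus>\<^bsub>?Q\<^esub> y) \<oplus>\<^bsub>?Q\<^esub> z = x \<oplus>\<^bsub>?Q\<^esub> (y \<oplus>\<^bsub>?Q\<^esub> z)"
      if "x \<in> carrier ?Q" "y \<in> carrier ?Q" "z \<in> carrier ?Q" for x y z
      using F.m_assoc[of x y z] that unfolding eqs by blast
    show "\<zero>\<^bsub>?Q\<^esub> \<oplus>\<^bsub>?Q\<^esub> x = x" if "x \<in> carrier ?Q" for x
      using F.l_one[of x] that unfolding eqs by blast
    show "x \<oplus>\<^bsub>?Q\<^esub> y = y \<oplus>\<^bsub>?Q\<^esub> x" if "x \<in> carrier ?Q" "y \<in> carrier ?Q" for x y
      using F.m_comm[of x y] that unfolding eqs by blast
  qed
  obtain S where S: "finite S" "S \<subseteq> carrier ?Q"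
    and sp: "\<forall>v\<in>carrier ?Q. \<exists>c. v = (\<Oplus>\<^bsub>?Q\<^esub>s\<in>S. c s \<odot>\<^bsub>?Q\<^esub> s)"
    using assms[unfolded finite_dimensional_def] by (elim exE conjE) (rule that)
  have Qa: "X \<oplus>\<^bsub>?Q\<^esub> Y = {x \<oplus>\<^bsub>?V\<^esub> y | x y. x \<in> X \<and> y \<in> Y}" for X Y
    by (auto simp: cohomology_def quotient_space_def set_add_def')
  have Qs: "c \<odot>\<^bsub>?Q\<^esub> X = {b \<oplus>\<^bsub>?V\<^esub> c \<odot>\<^bsub>?V\<^esub> x | b x. b \<in> ?B \<and> x \<in> X}" for c X
    by (auto simp: cohomology_def quotient_space_def set_add_def')
  have Zc: "x \<in> carrier ?V" if "x \<in> ?Z" for x by (rule linear_subspace_carrier[OF Z that])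
  have self: "x \<in> ?B +>\<^bsub>?V\<^esub> x" if "x \<in> ?Z" for x
  proof -
    have "x = \<zero>\<^bsub>?V\<^esub> \<oplus>\<^bsub>?V\<^esub> x" using Zc[OF that] by (simp add: vs_lzero[OF V])
    then show ?thesis using linear_subspace_zero[OF B] by (auto simp: a_r_coset_def')
  qed
  have sm: "c \<odot>\<^bsub>?Q\<^esub> s \<in> carrier ?Q" if s: "s \<in> carrier ?Q" for c s
  proof -
    obtain x where x: "x \<in> ?Z" "s = ?B +>\<^bsub>?V\<^esub> x" using s by (auto simp: carrier_cohomology)
    have "c \<odot>\<^bsub>?Q\<^esub> s = ?B +>\<^bsub>?V\<^esub> c \<odot>\<^bsub>?V\<^esub> x"
    proof (intro equalityI subsetI)
      fix w assume "w \<in> c \<odot>\<^bsub>?Q\<^esub> s"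
      then obtain b b' where b: "b \<in> ?B" "b' \<in> ?B" "w = b \<oplus>\<^bsub>?V\<^esub> c \<odot>\<^bsub>?V\<^esub> (b' \<oplus>\<^bsub>?V\<^esub> x)"
        unfolding Qs x(2) by (auto simp: a_r_coset_def')
      then have "w = (b \<oplus>\<^bsub>?V\<^esub> c \<odot>\<^bsub>?V\<^esub> b') \<oplus>\<^bsub>?V\<^esub> c \<odot>\<^bsub>?V\<^esub> x"
        using Zc[OF x(1)] linear_subspace_carrier[OF B]
        by (simp add: vs_distr[OF V] vs_assoc[OF V] vs_smult[OF V])
      moreover have "b \<oplus>\<^bsub>?V\<^esub> c \<odot>\<^bsub>?V\<^esub> b' \<in> ?B"
        by (intro linear_subspace_add[OF B] linear_subspace_smult[OF B] b)
      ultimately show "w \<in> ?B +>\<^bsub>?V\<^esub> c \<odot>\<^bsub>?V\<^esub> x"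
        by (auto simp: a_r_coset_def')
    next
      fix w assume "w \<in> ?B +>\<^bsub>?V\<^esub> c \<odot>\<^bsub>?V\<^esub> x"
      then obtain b where b: "b \<in> ?B" "w = b \<oplus>\<^bsub>?V\<^esub> c \<odot>\<^bsub>?V\<^esub> x" by (auto simp: a_r_coset_def')
      have "x \<in> s" using x self by simp
      with b show "w \<in> c \<odot>\<^bsub>?Q\<^esub> s" unfolding Qs by auto
    qed
    then show ?thesis using x linear_subspace_smult[OF Z] by (auto simp: carrier_cohomology)
  qed
  have "\<exists>W. fin_codim ?V ?B W \<and> (\<forall>c. (\<Oplus>\<^bsub>?Q\<^esub>s\<in>S. c s \<odot>\<^bsub>?Q\<^esub> s) \<subseteq> W)"
    using S
  proof (induction S rule: finite_induct)
    case empty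
    show ?case using fin_codim.base[of ?V ?B] by (intro exI[of _ ?B]) simp
  next
    case (insert s S)
    then obtain W where W: "fin_codim ?V ?B W" "\<And>c. (\<Oplus>\<^bsub>?Q\<^esub>s\<in>S. c s \<odot>\<^bsub>?Q\<^esub> s) \<subseteq> W" by blast
    note Ws = fin_codim_subspace[OF V W(1) B]
    obtain x where x: "x \<in> ?Z" "s = ?B +>\<^bsub>?V\<^esub> x" using insert.prems by (auto simp: carrier_cohomology)
    let ?W = "{z \<oplus>\<^bsub>?V\<^esub> c \<odot>\<^bsub>?V\<^esub> x | z c. z \<in> W}"
    have "(\<Oplus>\<^bsub>?Q\<^esub>s\<in>insert s S. c s \<odot>\<^bsub>?Q\<^esub> s) \<subseteq> ?W" for c
    proof
      fix w assume "w \<in> (\<Oplus>\<^bsub>?Q\<^esub>s\<in>insert s S. c s \<odot>\<^bsub>?Q\<^esub> s)"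
      then have "w \<in> c s \<odot>\<^bsub>?Q\<^esub> s \<oplus>\<^bsub>?Q\<^esub> (\<Oplus>\<^bsub>?Q\<^esub>s\<in>S. c s \<odot>\<^bsub>?Q\<^esub> s)"
        using insert by (subst (asm) Q.finsum_insert) (auto simp: sm subset_iff)
      then obtain p y where p: "p \<in> c s \<odot>\<^bsub>?Q\<^esub> s" "w = p \<oplus>\<^bsub>?V\<^esub> y" and yW: "y \<in> W"
        using W(2)[of c] unfolding Qa by auto
      then obtain b q where q: "b \<in> ?B" "q \<in> s" "p = b \<oplus>\<^bsub>?V\<^esub> c s \<odot>\<^bsub>?V\<^esub> q" unfolding Qs by auto
      then obtain b' where "b' \<in> ?B" "q = b' \<oplus>\<^bsub>?V\<^esub> x" unfolding x(2) a_r_coset_def' by auto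
      with p q yW have y: "b \<in> ?B" "b' \<in> ?B" "y \<in> W" "w = (b \<oplus>\<^bsub>?V\<^esub> c s \<odot>\<^bsub>?V\<^esub> (b' \<oplus>\<^bsub>?V\<^esub> x)) \<oplus>\<^bsub>?V\<^esub> y"
        by auto
      have yc: "y \<in> carrier ?V" by (rule linear_subspace_carrier[OF Ws[THEN conjunct1] y(3)])
      have bc: "b \<in> carrier ?V" "b' \<in> carrier ?V" by (auto intro: linear_subspace_carrier[OF B] y)
      have "w = (b \<oplus>\<^bsub>?V\<^esub> (c s \<odot>\<^bsub>?V\<^esub> b' \<oplus>\<^bsub>?V\<^esub> y)) \<oplus>\<^bsub>?V\<^esub> c s \<odot>\<^bsub>?V\<^esub> x"
        unfolding y(4) using bc yc Zc[OF x(1)]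
        by (simp add: vs_distr[OF V] vs_assoc[OF V] vs_smult[OF V] vs_add[OF V] vs_comm[OF V] vs_lcomm[OF V])
      moreover have "b \<oplus>\<^bsub>?V\<^esub> (c s \<odot>\<^bsub>?V\<^esub> b' \<oplus>\<^bsub>?V\<^esub> y) \<in> W"
        using y Ws linear_subspace_smult[OF B, of b' "c s"]
        by (intro linear_subspace_add[OF Ws[THEN conjunct1]]) auto
      ultimately show "w \<in> ?W" by blast
    qed
    then show ?case using fin_codim.line[OF W(1) Zc[OF x(1)]] by blast
  qed
  then obtain W where W: "fin_codim ?V ?B W" "\<And>c. (\<Oplus>\<^bsub>?Q\<^esub>s\<in>S. c s \<odot>\<^bsub>?Q\<^esub> s) \<subseteq> W" by blast
  have ZW: "?Z \<subseteq> W"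
  proof
    fix x assume x: "x \<in> ?Z"
    have "x \<in> ?B +>\<^bsub>?V\<^esub> x" by (rule self[OF x])
    moreover have "?B +>\<^bsub>?V\<^esub> x \<in> carrier ?Q" using x by (auto simp: carrier_cohomology)
    moreover from this obtain c where "?B +>\<^bsub>?V\<^esub> x = (\<Oplus>\<^bsub>?Q\<^esub>s\<in>S. c s \<odot>\<^bsub>?Q\<^esub> s)"
      using bspec[OF sp] by blast
    ultimately show "x \<in> W" using W(2)[of c] by auto
  qed
  have "(\<lambda>x. x) \<in> linear_maps ?VZ ?V" by (rule linear_mapsI) (auto simp: Zc)
  from fin_codim_preimage[OF V V this Z B W(1)] show ?thesis
    using ZW coboundaries_cocycles by (simp add: Collect_conj_eq Int_absorb1 Int_absorb2 inf.absorb1 inf.absorb2)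
qed

section \<open>Linear recurrences in finite-dimensional quotients\<close>

text \<open>
  If \<open>x n = (T ^^ n) v\<close> for a linear operator \<open>T\<close>, then this is the polynomial \<open>p\<close> in \<open>T\<close>, applied to \<open>v\<close>.
\<close>

definition poly_combination :: "complex poly \<Rightarrow> (nat \<Rightarrow> 'v::complex_vector) \<Rightarrow> 'v" where
  "poly_combination p x = (\<Sum>n\<le>degree p. coeff p n *\<^sub>C x n)"

lemma poly_combination_eq:
  assumes "degree p \<le> N"
  shows "poly_combination p x = (\<Sum>n\<le>N. coeff p n *\<^sub>C x n)"
  unfolding poly_combination_def
  by (rule sum.mono_neutral_left) (use assms in \<open>auto simp: coeff_eq_0\<close>)

lemma poly_combination_add: "poly_combination (p + q) x = poly_combination p x + poly_combination q x"
proof -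
  let ?N = "max (degree p) (degree q)"
  have "degree (p + q) \<le> ?N" by (rule degree_add_le_max)
  then show ?thesis
    by (simp add: poly_combination_eq[of _ ?N] scaleC_add_left sum.distrib)
qed

lemma poly_combination_smult: "poly_combination (Polynomial.smult c p) x = c *\<^sub>C poly_combination p x"
  using degree_smult_le[of c p]
  by (simp add: poly_combination_eq[of _ "degree p"] scaleC_sum_right)

lemma poly_combination_0 [simp]: "poly_combination 0 x = 0"
  by (simp add: poly_combination_def)

lemma poly_combination_pCons: "poly_combination (pCons a p) x = a *\<^sub>C x 0 + poly_combination p (\<lambda>n. x (Suc n))"
proof -
  have "degree (pCons a p) \<le> Suc (degree p)" by (rule degree_pCons_le)
  then show ?thesis
    by (simp add: poly_combination_eq[of _ "Suc (degree p)"] sum.atMost_Suc_shift poly_combination_def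
        del: sum.atMost_Suc)
qed

text \<open>
  This is the existence of a minimal polynomial. If \<open>p \<mapsto> poly_combination p x\<close> were injective modulo \<open>B\<close>,
  then the zero space would have finite codimension in the space of all polynomials; but adding
  finitely many lines to it yields only polynomials of bounded degree.
\<close>

lemma fin_codim_recurrence:
  fixes x :: "nat \<Rightarrow> 'v::complex_vector"
  assumes S: "subspace S" and B: "linear_subspace (space_on S) B" and fc: "fin_codim (space_on S) B Z"
    and x: "\<And>n. x n \<in> Z"
  obtains p where "p \<noteq> 0" "poly_combination p x \<in> B"
proof -
  let ?P = "make_space (UNIV :: complex poly set) 0 (+) Polynomial.smult"
  have P: "complex_vector_space ?P"
    by (rule complex_vector_spaceI) (auto simp: smult_add_left smult_add_right)
  note W = space_on_space[OF S]
  note Z = fin_codim_subspace[OF W fc B, THEN conjunct1]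
  have cl: "poly_combination p x \<in> Z" for p
    unfolding poly_combination_def
    by (rule subspace_sum[of Z])
      (use Z linear_subspace_smult[OF Z] x in \<open>auto simp: linear_subspace_def subspace_def\<close>)
  have f: "(\<lambda>p. poly_combination p x) \<in> linear_maps (?P\<lparr>carrier := UNIV\<rparr>) (space_on S)"
    by (rule linear_mapsI)
      (use cl linear_subspace_carrier[OF Z] in \<open>auto simp: poly_combination_add poly_combination_smult\<close>)
  have U: "linear_subspace ?P UNIV" by (auto simp: linear_subspace_def)
  have fin: "fin_codim ?P {p. poly_combination p x \<in> B} UNIV"
    using fin_codim_preimage[OF P W f U B fc] cl by simp
  have "\<exists>p. p \<noteq> 0 \<and> poly_combination p x \<in> B"
  proof (rule ccontr)
    assume "\<not> ?thesis"
    then have "{p. poly_combination p x \<in> B} = {0}"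
      using linear_subspace_zero[OF B] by auto
    with fin have "fin_codim ?P {0} UNIV" by simp
    moreover have "\<exists>N. \<forall>p\<in>Z. degree p \<le> N" if "fin_codim ?P {0} Z" for Z
      using that
    proof induction
      case (line Z v)
      then obtain N where N: "\<And>p. p \<in> Z \<Longrightarrow> degree p \<le> N" by blast
      have "degree (z + Polynomial.smult c v) \<le> max N (degree v)" if "z \<in> Z" for z c
        using N[OF that] degree_smult_le[of c v] by (intro degree_add_le) auto
      then show ?case by (auto intro!: exI[of _ "max N (degree v)"])
    qed auto
    ultimately obtain N where "\<And>p :: complex poly. degree p \<le> N" by blast
    from this[of "monom 1 (Suc N)"] show False by (simp add: degree_monom_eq)
  qed
  with that show thesis by blast
qed

section \<open>Perfect modules have finite-dimensional cohomology\<close>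

text \<open>
  Finiteness of the cohomology in each degree, without quotients; in this form it is inherited along
  shifts, cones and quasi-isomorphisms by the rules for \<open>fin_codim\<close>.
\<close>

definition finite_cohomology :: "('u, 'z) cochain_complex_scheme \<Rightarrow> bool" where
  "finite_cohomology X \<longleftrightarrow> (\<forall>i. fin_codim (gr X i) (coboundaries X i) (cocycles X i))"

text \<open>
  The middle term of an exact sequence of cohomology spaces \<open>ZY / BY \<rightarrow> Z / B \<rightarrow> ZX / BX\<close> is finite-dimensional
  if the outer terms are. The kernel of the second map divides the inclusion of \<open>B\<close> in \<open>Z\<close> into two steps.
\<close>

lemma fin_codim_exact:
  assumes VY: "complex_vector_space VY" and V: "complex_vector_space V" and VX: "complex_vector_space VX"
    and j: "j \<in> linear_maps VY V" and p: "p \<in> linear_maps V VX"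
    and BY: "linear_subspace VY BY" and BX: "linear_subspace VX BX"
    and B: "linear_subspace V B" and Z: "linear_subspace V Z" and BZ: "B \<subseteq> Z"
    and fY: "fin_codim VY BY ZY" and fX: "fin_codim VX BX ZX"
    and jB: "\<And>y. y \<in> BY \<Longrightarrow> j y \<in> B" and jZ: "\<And>y. y \<in> ZY \<Longrightarrow> j y \<in> Z"
    and pB: "\<And>x. x \<in> B \<Longrightarrow> p x \<in> BX" and pZ: "\<And>x. x \<in> Z \<Longrightarrow> p x \<in> ZX"
    and pj: "\<And>y. y \<in> ZY \<Longrightarrow> p (j y) \<in> BX"
    and ex: "\<And>x. x \<in> Z \<Longrightarrow> p x \<in> BX \<Longrightarrow> \<exists>b\<in>B. \<exists>y\<in>ZY. x = b \<oplus>\<^bsub>V\<^esub> j y"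
  shows "fin_codim V B Z"
proof -
  let ?K = "{u \<in> Z. p u \<in> BX}"
  have pr: "p \<in> linear_maps (V\<lparr>carrier := Z\<rparr>) VX"
    using p linear_subspace_carrier[OF Z] by (auto simp: linear_maps_def)
  have "{u \<in> Z. p u \<in> ZX} = Z" using pZ by blast
  with fin_codim_preimage[OF V VX pr Z BX fX] have KZ: "fin_codim V ?K Z" by simp
  have BYZY: "y \<in> ZY" if "y \<in> BY" for y using fin_codim_subspace[OF VY fY BY] that by blast
  have zY: "\<zero>\<^bsub>VY\<^esub> \<in> BY" by (rule linear_subspace_zero[OF BY])
  have j0: "j \<zero>\<^bsub>VY\<^esub> = \<zero>\<^bsub>V\<^esub>" by (rule lin_zero[OF j VY V])
  have 1: "{b \<oplus>\<^bsub>V\<^esub> j y | b y. b \<in> B \<and> y \<in> BY} = B"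
  proof (intro equalityI subsetI)
    fix x assume x: "x \<in> B"
    have "x = x \<oplus>\<^bsub>V\<^esub> j \<zero>\<^bsub>VY\<^esub>" using linear_subspace_carrier[OF B x] by (simp add: j0 vs_rzero[OF V])
    then show "x \<in> {b \<oplus>\<^bsub>V\<^esub> j y | b y. b \<in> B \<and> y \<in> BY}" using x zY by blast
  qed (use jB linear_subspace_add[OF B] in blast)
  have 2: "{b \<oplus>\<^bsub>V\<^esub> j y | b y. b \<in> B \<and> y \<in> ZY} = ?K"
  proof (intro equalityI subsetI)
    fix x assume "x \<in> {b \<oplus>\<^bsub>V\<^esub> j y | b y. b \<in> B \<and> y \<in> ZY}"
    then obtain b y where x: "x = b \<oplus>\<^bsub>V\<^esub> j y" "b \<in> B" "y \<in> ZY" by blast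
    have "b \<in> Z" "j y \<in> Z" using x BZ jZ by auto
    moreover have "p x = p b \<oplus>\<^bsub>VX\<^esub> p (j y)"
      unfolding x(1) using calculation linear_subspace_carrier[OF Z] by (intro lin_add[OF p]) auto
    ultimately show "x \<in> ?K" using x pB pj linear_subspace_add[OF Z] linear_subspace_add[OF BX] by simp
  qed (use ex in blast)
  have "fin_codim V B ?K" using fin_codim_image[OF VY V j BY B fY] unfolding 1 2 .
  then show ?thesis using KZ by (rule fin_codim_trans)
qed

lemma finite_cohomology_injective:
  assumes "cochain_complex X" "cochain_complex Y"
    and f: "\<And>i. f i \<in> linear_maps (gr X i) (gr Y i)"
    and fd: "\<And>i x. x \<in> carrier (gr X i) \<Longrightarrow> f (i + 1) (dif X i x) = dif Y i (f i x)"
    and inj: "\<And>i x. x \<in> cocycles X i \<Longrightarrow> f i x \<in> coboundaries Y i \<Longrightarrow> x \<in> coboundaries X i"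
    and Y: "finite_cohomology Y"
  shows "finite_cohomology X"
  unfolding finite_cohomology_def
proof
  interpret X: cochain_complex X by fact
  interpret Y: cochain_complex Y by fact
  fix i
  have fZ: "f i x \<in> cocycles Y i" if "x \<in> cocycles X i" for x
    using that lin_closed[OF f] fd[of x i]
      lin_zero[OF f[of "i + 1"] X.vector_space Y.vector_space] by (auto simp: cocycles_def)
  have fB: "f i x \<in> coboundaries Y i" if "x \<in> coboundaries X i" for x
    using that lin_closed[OF f] fd[of _ "i - 1"] by (auto simp: coboundaries_def)
  have r: "f i \<in> linear_maps (gr X i\<lparr>carrier := cocycles X i\<rparr>) (gr Y i)"
    using f[of i] linear_subspace_carrier[OF X.cocycles_subspace] by (auto simp: linear_maps_def)
  have "{u \<in> cocycles X i. f i u \<in> coboundaries Y i} = coboundaries X i"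
    "{u \<in> cocycles X i. f i u \<in> cocycles Y i} = cocycles X i"
    using inj fB fZ X.coboundaries_cocycles by blast+
  with fin_codim_preimage[OF X.vector_space Y.vector_space r X.cocycles_subspace Y.coboundaries_subspace,
      of "cocycles Y i"] Y
  show "fin_codim (gr X i) (coboundaries X i) (cocycles X i)" by (simp add: finite_cohomology_def)
qed

lemma finite_cohomology_surjective:
  assumes "cochain_complex X" "cochain_complex Y"
    and f: "\<And>i. f i \<in> linear_maps (gr X i) (gr Y i)"
    and fd: "\<And>i x. x \<in> carrier (gr X i) \<Longrightarrow> f (i + 1) (dif X i x) = dif Y i (f i x)"
    and surj: "\<And>i y. y \<in> cocycles Y i \<Longrightarrow> \<exists>x\<in>cocycles X i. \<exists>b\<in>coboundaries Y i. y = b \<oplus>\<^bsub>gr Y i\<^esub> f i x"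
    and X: "finite_cohomology X"
  shows "finite_cohomology Y"
  unfolding finite_cohomology_def
proof
  interpret X: cochain_complex X by fact
  interpret Y: cochain_complex Y by fact
  fix i
  have fZ: "f i x \<in> cocycles Y i" if "x \<in> cocycles X i" for x
    using that lin_closed[OF f] fd[of x i]
      lin_zero[OF f[of "i + 1"] X.vector_space Y.vector_space] by (auto simp: cocycles_def)
  have fB: "f i x \<in> coboundaries Y i" if "x \<in> coboundaries X i" for x
    using that lin_closed[OF f] fd[of _ "i - 1"] by (auto simp: coboundaries_def)
  note BY = Y.coboundaries_subspace[of i]
  have 1: "{b \<oplus>\<^bsub>gr Y i\<^esub> f i y | b y. b \<in> coboundaries Y i \<and> y \<in> coboundaries X i} = coboundaries Y i"
  proof (intro equalityI subsetI)
    fix x assume x: "x \<in> coboundaries Y i"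
    have "x = x \<oplus>\<^bsub>gr Y i\<^esub> f i \<zero>\<^bsub>gr X i\<^esub>"
      using linear_subspace_carrier[OF BY x] lin_zero[OF f X.vector_space Y.vector_space]
      by (simp add: vs_rzero[OF Y.vector_space])
    then show "x \<in> {b \<oplus>\<^bsub>gr Y i\<^esub> f i y | b y. b \<in> coboundaries Y i \<and> y \<in> coboundaries X i}"
      using x linear_subspace_zero[OF X.coboundaries_subspace] by blast
  qed (use fB linear_subspace_add[OF BY] in blast)
  have 2: "{b \<oplus>\<^bsub>gr Y i\<^esub> f i y | b y. b \<in> coboundaries Y i \<and> y \<in> cocycles X i} = cocycles Y i"
  proof (intro equalityI subsetI)
    fix x assume "x \<in> {b \<oplus>\<^bsub>gr Y i\<^esub> f i y | b y. b \<in> coboundaries Y i \<and> y \<in> cocycles X i}"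
    then obtain b y where "x = b \<oplus>\<^bsub>gr Y i\<^esub> f i y" "b \<in> cocycles Y i" "f i y \<in> cocycles Y i"
      using fZ Y.coboundaries_cocycles by blast
    then show "x \<in> cocycles Y i" using linear_subspace_add[OF Y.cocycles_subspace] by blast
  qed (use surj in blast)
  show "fin_codim (gr Y i) (coboundaries Y i) (cocycles Y i)"
    using fin_codim_image[OF X.vector_space Y.vector_space f X.coboundaries_subspace BY,
        of "cocycles X i"] X
    unfolding 1 2 by (simp add: finite_cohomology_def)
qed

lemma dg_module_cochain: "dg_module A X \<Longrightarrow> cochain_complex X"
  by (simp add: dg_module_def)

lemma quasi_isomorphism_finite:
  assumes "dg_module A X" "dg_module A Y" "quasi_isomorphism A X Y f"
  shows "finite_cohomology X \<longleftrightarrow> finite_cohomology Y"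
proof -
  have f: "dg_hom A X Y f" and b: "cohomology_bijective X Y f"
    using assms quasi_isomorphism_iff by blast+
  note X = dg_module_cochain[OF assms(1)] and Y = dg_module_cochain[OF assms(2)]
  show ?thesis
    using finite_cohomology_injective[OF X Y dg_hom_linear[OF f] dg_hom_dif[OF f]]
      finite_cohomology_surjective[OF X Y dg_hom_linear[OF f] dg_hom_dif[OF f]] b
    unfolding cohomology_bijective_def by blast
qed

lemma quasi_isomorphic_finite:
  assumes "quasi_isomorphic A X Y"
  shows "finite_cohomology X \<longleftrightarrow> finite_cohomology Y"
    and "cochain_complex X \<longleftrightarrow> cochain_complex Y"
proof -
  have "(finite_cohomology X \<longleftrightarrow> finite_cohomology Y) \<and> (cochain_complex X \<longleftrightarrow> cochain_complex Y)"
    using assms unfolding quasi_isomorphic_def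
  proof (induction rule: equivclp_induct)
    case (step Y Z)
    then show ?case using quasi_isomorphism_finite dg_module_cochain by blast
  qed simp
  then show "finite_cohomology X \<longleftrightarrow> finite_cohomology Y" "cochain_complex X \<longleftrightarrow> cochain_complex Y"
    by auto
qed

lemma product_space_simps [simp]:
  "carrier (product_space V W) = carrier V \<times> carrier W"
  "(x, y) \<oplus>\<^bsub>product_space V W\<^esub> (x', y') = (x \<oplus>\<^bsub>V\<^esub> x', y \<oplus>\<^bsub>W\<^esub> y')"
  "\<zero>\<^bsub>product_space V W\<^esub> = (\<zero>\<^bsub>V\<^esub>, \<zero>\<^bsub>W\<^esub>)"
  "c \<odot>\<^bsub>product_space V W\<^esub> (x, y) = (c \<odot>\<^bsub>V\<^esub> x, c \<odot>\<^bsub>W\<^esub> y)"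
  by (simp_all add: product_space_def)

lemma product_space_fst: "fst \<in> linear_maps (product_space V W) V"
  and product_space_snd: "snd \<in> linear_maps (product_space V W) W"
  by (auto intro!: linear_mapsI)

lemma product_space_inl:
  "complex_vector_space W \<Longrightarrow> (\<lambda>x. (x, \<zero>\<^bsub>W\<^esub>)) \<in> linear_maps V (product_space V W)"
  by (rule linear_mapsI) (auto simp: vs_zero vs_lzero vs_smult_zero)

lemma product_space_inr:
  "complex_vector_space V \<Longrightarrow> (\<lambda>x. (\<zero>\<^bsub>V\<^esub>, x)) \<in> linear_maps W (product_space V W)"
  by (rule linear_mapsI) (auto simp: vs_zero vs_lzero vs_smult_zero)

text \<open>
  The long exact sequence of a cone. The complex \<open>Z\<close> is only isomorphic to the cone, since the class of
  modules built from the free module consists of modules on a fixed type.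
\<close>

lemma finite_cohomology_cone:
  assumes "cochain_complex X" "cochain_complex Y" "cochain_complex Z"
    and f: "\<And>i. f i \<in> linear_maps (gr X i) (gr Y i)"
    and fd: "\<And>i x. x \<in> carrier (gr X i) \<Longrightarrow> f (i + 1) (dif X i x) = dif Y i (f i x)"
    and e: "\<And>i. e i \<in> linear_maps (gr Z i) (product_space (gr X (i + 1)) (gr Y i))"
    and eb: "\<And>i. bij_betw (e i) (carrier (gr Z i)) (carrier (gr X (i + 1)) \<times> carrier (gr Y i))"
    and ed: "\<And>i z. z \<in> carrier (gr Z i) \<Longrightarrow> e (i + 1) (dif Z i z) = dif (mapping_cone X Y f) i (e i z)"
    and X: "finite_cohomology X" and Y: "finite_cohomology Y"
  shows "finite_cohomology Z"
  unfolding finite_cohomology_def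
proof
  interpret X: cochain_complex X by fact
  interpret Y: cochain_complex Y by fact
  interpret Z: cochain_complex Z by fact
  fix i
  let ?h = "\<lambda>i. inv_into (carrier (gr Z i)) (e i)"
  have h: "?h i \<in> linear_maps (product_space (gr X (i + 1)) (gr Y i)) (gr Z i)" for i
    by (rule lin_inv[OF e _ Z.vector_space]) (simp add: eb)
  have hc [simp]: "?h i w \<in> carrier (gr Z i)" "e i (?h i w) = w"
    if "w \<in> carrier (gr X (i + 1)) \<times> carrier (gr Y i)" for i w
    using that bij_betw_inv_into_right[OF eb] bij_betw_apply[OF bij_betw_inv_into[OF eb]] by auto
  have einj: "z = z'" if "e i z = e i z'" "z \<in> carrier (gr Z i)" "z' \<in> carrier (gr Z i)" for i z z'
    using that bij_betw_imp_inj_on[OF eb] by (auto dest: inj_onD)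
  define j where "j = (\<lambda>y. ?h i (\<zero>\<^bsub>gr X (i + 1)\<^esub>, y))"
  define p where "p = (\<lambda>z. fst (e i z))"
  note Xz [simp] = vs_zero[OF X.vector_space] and Yz [simp] = vs_zero[OF Y.vector_space]
  have j: "j \<in> linear_maps (gr Y i) (gr Z i)"
    unfolding j_def by (rule lin_comp[OF product_space_inr[OF X.vector_space] h])
  have p: "p \<in> linear_maps (gr Z i) (gr X (i + 1))"
    unfolding p_def by (rule lin_comp[OF e product_space_fst])
  have ec: "e i z \<in> carrier (gr X (i + 1)) \<times> carrier (gr Y i)" if "z \<in> carrier (gr Z i)" for i z
    using lin_closed[OF e that] by simp
  have xneg: "\<ominus>\<^bsub>gr X k\<^esub> x \<in> carrier (gr X k)" if "x \<in> carrier (gr X k)" for k x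
    using that by (simp add: vs_neg[OF X.vector_space] vs_smult[OF X.vector_space])
  have ej: "e i (j y) = (\<zero>\<^bsub>gr X (i + 1)\<^esub>, y)" if "y \<in> carrier (gr Y i)" for y
    using that by (simp add: j_def)
  have negz: "\<ominus>\<^bsub>gr X k\<^esub> \<zero>\<^bsub>gr X k\<^esub> = \<zero>\<^bsub>gr X k\<^esub>" for k
    by (simp add: vs_neg[OF X.vector_space] vs_smult_zero[OF X.vector_space])
  have f0: "f k \<zero>\<^bsub>gr X k\<^esub> = \<zero>\<^bsub>gr Y k\<^esub>" for k by (rule lin_zero[OF f X.vector_space Y.vector_space])
  have i2: "i + 1 + 1 = i + 2" by simp
  have edh: "dif Z k (?h k (\<zero>\<^bsub>gr X (k + 1)\<^esub>, y)) = ?h (k + 1) (\<zero>\<^bsub>gr X (k + 2)\<^esub>, dif Y k y)"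
    if y: "y \<in> carrier (gr Y k)" for k y
  proof (rule einj[where i = "k + 1"])
    have k2: "k + 1 + 1 = k + 2" by simp
    have "(\<zero>\<^bsub>gr X (k + 2)\<^esub>, dif Y k y) \<in> carrier (gr X (k + 1 + 1)) \<times> carrier (gr Y (k + 1))"
      using Y.dif_closed[OF y] by (simp add: k2)
    moreover have "dif X (k + 1) \<zero>\<^bsub>gr X (k + 1)\<^esub> = \<zero>\<^bsub>gr X (k + 2)\<^esub>" using X.dif_zero[of "k + 1"] by (simp add: k2)
    ultimately show "e (k + 1) (dif Z k (?h k (\<zero>\<^bsub>gr X (k + 1)\<^esub>, y))) = e (k + 1) (?h (k + 1) (\<zero>\<^bsub>gr X (k + 2)\<^esub>, dif Y k y))"
      using y Y.dif_closed[OF y] by (simp add: ed mapping_cone_def negz f0 vs_lzero[OF Y.vector_space])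
    show "dif Z k (?h k (\<zero>\<^bsub>gr X (k + 1)\<^esub>, y)) \<in> carrier (gr Z (k + 1))" using y by (intro Z.dif_closed) simp
    show "?h (k + 1) (\<zero>\<^bsub>gr X (k + 2)\<^esub>, dif Y k y) \<in> carrier (gr Z (k + 1))"
      using Y.dif_closed[OF y] by (simp add: k2)
  qed
  show "fin_codim (gr Z i) (coboundaries Z i) (cocycles Z i)"
  proof (rule fin_codim_exact[OF Y.vector_space Z.vector_space X.vector_space j p Y.coboundaries_subspace
        X.coboundaries_subspace Z.coboundaries_subspace Z.cocycles_subspace Z.coboundaries_cocycles])
    show "fin_codim (gr Y i) (coboundaries Y i) (cocycles Y i)"
      "fin_codim (gr X (i + 1)) (coboundaries X (i + 1)) (cocycles X (i + 1))"
      using X Y by (simp_all add: finite_cohomology_def)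
    show "j y \<in> coboundaries Z i" if "y \<in> coboundaries Y i" for y
    proof -
      obtain y0 where y0: "y0 \<in> carrier (gr Y (i - 1))" "y = dif Y (i - 1) y0"
        using \<open>y \<in> coboundaries Y i\<close> by (auto simp: coboundaries_def)
      have "j y = dif Z (i - 1) (?h (i - 1) (\<zero>\<^bsub>gr X (i - 1 + 1)\<^esub>, y0))"
        using edh[OF y0(1)] y0 by (simp add: j_def add.commute[of 1])
      moreover have "?h (i - 1) (\<zero>\<^bsub>gr X (i - 1 + 1)\<^esub>, y0) \<in> carrier (gr Z (i - 1))"
        using y0 hc(1)[of "(\<zero>\<^bsub>gr X (i - 1 + 1)\<^esub>, y0)" "i - 1"] by simp
      ultimately show ?thesis by (auto simp: coboundaries_def)
    qed
    show "j y \<in> cocycles Z i" if "y \<in> cocycles Y i" for y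
    proof -
      have y: "y \<in> carrier (gr Y i)" "dif Y i y = \<zero>\<^bsub>gr Y (i + 1)\<^esub>" using that by (auto simp: cocycles_def)
      have "?h (i + 1) (\<zero>\<^bsub>gr X (i + 2)\<^esub>, \<zero>\<^bsub>gr Y (i + 1)\<^esub>) = \<zero>\<^bsub>gr Z (i + 1)\<^esub>"
        using lin_zero[OF e[of "i + 1"] Z.vector_space] hc[of "(\<zero>\<^bsub>gr X (i + 2)\<^esub>, \<zero>\<^bsub>gr Y (i + 1)\<^esub>)" "i + 1"]
          vs_zero[OF Z.vector_space] lin_smult[OF e[of "i + 1"], of "\<zero>\<^bsub>gr Z (i + 1)\<^esub>" 0]
          ec[OF vs_zero[OF Z.vector_space], of "i + 1"]
        by (intro einj[where i = "i + 1"])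
          (auto simp: i2 vs_null[OF Z.vector_space] vs_null[OF X.vector_space] vs_null[OF Y.vector_space]
            mem_Times_iff prod_eq_iff product_space_def split: prod.splits)
      then show ?thesis using edh[OF y(1)] y lin_closed[OF j] by (simp add: cocycles_def j_def)
    qed
    have pd: "p (dif Z (i - 1) z) = \<ominus>\<^bsub>gr X (i + 1)\<^esub> dif X i (fst (e (i - 1) z))"
      if z: "z \<in> carrier (gr Z (i - 1))" for z
      using ed[OF z] ec[OF z] by (auto simp: p_def mapping_cone_def add.commute[of 1] split: prod.splits)
    show "p x \<in> coboundaries X (i + 1)" if "x \<in> coboundaries Z i" for x
    proof -
      obtain z where z: "z \<in> carrier (gr Z (i - 1))" "x = dif Z (i - 1) z"
        using \<open>x \<in> coboundaries Z i\<close> by (auto simp: coboundaries_def)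
      have "fst (e (i - 1) z) \<in> carrier (gr X i)" using ec[OF z(1)] by (auto simp: mem_Times_iff)
      from X.coboundariesI[OF this] X.dif_closed[OF this]
      show ?thesis
        using pd[OF z(1)] z linear_subspace_smult[OF X.coboundaries_subspace]
        by (simp add: vs_neg[OF X.vector_space])
    qed
    have cocyc: "dif X (i + 1) (fst (e i x)) = \<zero>\<^bsub>gr X (i + 2)\<^esub>
        \<and> f (i + 1) (fst (e i x)) \<oplus>\<^bsub>gr Y (i + 1)\<^esub> dif Y i (snd (e i x)) = \<zero>\<^bsub>gr Y (i + 1)\<^esub>"
      if x: "x \<in> cocycles Z i" for x
    proof -
      have xc: "x \<in> carrier (gr Z i)" "dif Z i x = \<zero>\<^bsub>gr Z (i + 1)\<^esub>" using x by (auto simp: cocycles_def)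
      have e0: "e (i + 1) \<zero>\<^bsub>gr Z (i + 1)\<^esub> = (\<zero>\<^bsub>gr X (i + 2)\<^esub>, \<zero>\<^bsub>gr Y (i + 1)\<^esub>)"
        using vs_zero[OF Z.vector_space] lin_smult[OF e[of "i + 1"], of "\<zero>\<^bsub>gr Z (i + 1)\<^esub>" 0]
          ec[OF vs_zero[OF Z.vector_space], of "i + 1"]
        by (auto simp: i2 vs_null[OF Z.vector_space] vs_null[OF X.vector_space] vs_null[OF Y.vector_space]
            mem_Times_iff prod_eq_iff product_space_def split: prod.splits)
      have x1: "fst (e i x) \<in> carrier (gr X (i + 1))" using ec[OF xc(1)] by (auto simp: mem_Times_iff)
      have dc: "dif X (i + 1) (fst (e i x)) \<in> carrier (gr X (i + 2))" using X.dif_closed[OF x1] by (simp add: i2)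
      have "\<ominus>\<^bsub>gr X (i + 2)\<^esub> dif X (i + 1) (fst (e i x)) = \<zero>\<^bsub>gr X (i + 2)\<^esub>"
        and 2: "f (i + 1) (fst (e i x)) \<oplus>\<^bsub>gr Y (i + 1)\<^esub> dif Y i (snd (e i x)) = \<zero>\<^bsub>gr Y (i + 1)\<^esub>"
        using ed[OF xc(1)] unfolding xc(2) e0 by (auto simp: mapping_cone_def split: prod.splits)
      then have "dif X (i + 1) (fst (e i x)) = \<zero>\<^bsub>gr X (i + 2)\<^esub>"
        using dc vs_smult_smult[OF X.vector_space dc, of "- 1" "- 1"]
        by (simp add: vs_neg[OF X.vector_space] vs_one[OF X.vector_space] vs_smult_zero[OF X.vector_space])
      with 2 show ?thesis by blast
    qed
    show "p x \<in> cocycles X (i + 1)" if x: "x \<in> cocycles Z i" for x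
      using cocyc[OF x] lin_closed[OF p linear_subspace_carrier[OF Z.cocycles_subspace x]]
      by (simp add: cocycles_def p_def i2)
    show "p (j y) \<in> coboundaries X (i + 1)" if "y \<in> cocycles Y i" for y
      using ej[OF linear_subspace_carrier[OF Y.cocycles_subspace that]]
        linear_subspace_zero[OF X.coboundaries_subspace] by (simp add: p_def)
    fix x assume x: "x \<in> cocycles Z i" and px: "p x \<in> coboundaries X (i + 1)"
    note V = X.vector_space and W = Y.vector_space
    have xc: "x \<in> carrier (gr Z i)" by (rule linear_subspace_carrier[OF Z.cocycles_subspace x])
    obtain x0 where x0: "x0 \<in> carrier (gr X i)" "p x = dif X i x0" using px by (auto simp: coboundaries_def)
    define y where "y = snd (e i x)"
    have y: "y \<in> carrier (gr Y i)" using ec[OF xc] by (auto simp: y_def mem_Times_iff)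
    have fx0: "f i x0 \<in> carrier (gr Y i)" by (rule lin_closed[OF f x0(1)])
    define y' where "y' = y \<oplus>\<^bsub>gr Y i\<^esub> f i x0"
    have y'c: "y' \<in> carrier (gr Y i)" unfolding y'_def by (rule vs_add[OF W y fx0])
    define b where "b = dif Z (i - 1) (?h (i - 1) (\<ominus>\<^bsub>gr X i\<^esub> x0, \<zero>\<^bsub>gr Y (i - 1)\<^esub>))"
    have w: "(\<ominus>\<^bsub>gr X i\<^esub> x0, \<zero>\<^bsub>gr Y (i - 1)\<^esub>) \<in> carrier (gr X (i - 1 + 1)) \<times> carrier (gr Y (i - 1))"
      using xneg[OF x0(1)] by simp
    have bB: "b \<in> coboundaries Z i" using hc(1)[OF w] by (auto simp: b_def coboundaries_def)
    have dx0: "dif X i (\<ominus>\<^bsub>gr X i\<^esub> x0) = \<ominus>\<^bsub>gr X (i + 1)\<^esub> dif X i x0"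
      using x0 X.dif_closed[OF x0(1)] by (simp add: vs_neg[OF V] lin_smult[OF X.dif_linear])
    have nn: "\<ominus>\<^bsub>gr X (i + 1)\<^esub> (\<ominus>\<^bsub>gr X (i + 1)\<^esub> dif X i x0) = dif X i x0"
      by (rule abelian_group.minus_minus[OF vs_abelian_group[OF V] X.dif_closed[OF x0(1)]])
    have fn: "f i (\<ominus>\<^bsub>gr X i\<^esub> x0) = \<ominus>\<^bsub>gr Y i\<^esub> f i x0"
      using x0 fx0 by (simp add: vs_neg[OF V] vs_neg[OF W] lin_smult[OF f])
    have nfc: "\<ominus>\<^bsub>gr Y i\<^esub> f i x0 \<in> carrier (gr Y i)"
      using fx0 by (simp add: vs_neg[OF W] vs_smult[OF W])
    have eb': "e i b = (dif X i x0, \<ominus>\<^bsub>gr Y i\<^esub> f i x0)"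
      using ed[OF hc(1)[OF w]] hc(2)[OF w] Y.dif_zero[of "i - 1"] nfc
      by (simp add: b_def mapping_cone_def dx0 nn fn vs_rzero[OF W] add.commute[of 1])
    have bc: "b \<in> carrier (gr Z i)" by (rule linear_subspace_carrier[OF Z.coboundaries_subspace bB])
    have jy': "j y' \<in> carrier (gr Z i)" by (rule lin_closed[OF j y'c])
    have "\<ominus>\<^bsub>gr Y i\<^esub> f i x0 \<oplus>\<^bsub>gr Y i\<^esub> y' = y"
      unfolding y'_def using y fx0 nfc
      by (simp add: vs_comm[OF W, of y] vs_assoc[OF W, symmetric] abelian_group.l_neg[OF vs_abelian_group[OF W]]
          vs_lzero[OF W])
    then have xeq: "x = b \<oplus>\<^bsub>gr Z i\<^esub> j y'"
      using lin_add[OF e bc jy'] eb' ej[OF y'c] x0 X.dif_closed[OF x0(1)]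
      by (intro einj[OF _ xc vs_add[OF Z.vector_space bc jy']])
        (simp add: prod_eq_iff p_def y_def vs_rzero[OF V])
    have "dif Y i y' = dif Y i y \<oplus>\<^bsub>gr Y (i + 1)\<^esub> f (i + 1) (dif X i x0)"
      unfolding y'_def using lin_add[OF Y.dif_linear y fx0] fd[OF x0(1)] by simp
    also have "\<dots> = \<zero>\<^bsub>gr Y (i + 1)\<^esub>"
      using cocyc[OF x] x0(2) Y.dif_closed[OF y] lin_closed[OF f X.dif_closed[OF x0(1)]]
      by (simp add: p_def y_def vs_comm[OF W])
    finally have "y' \<in> cocycles Y i" using y'c by (simp add: cocycles_def)
    then show "\<exists>b\<in>coboundaries Z i. \<exists>y\<in>cocycles Y i. x = b \<oplus>\<^bsub>gr Z i\<^esub> j y" using bB xeq by blast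
  qed
qed

lemma shift_finite:
  assumes "cochain_complex X" "finite_cohomology X"
  shows "cochain_complex (shift n X)" "finite_cohomology (shift n X)"
proof -
  interpret X: cochain_complex X by fact
  note V = X.vector_space
  have s0: "sign n \<noteq> 0" by simp
  have ac: "i + 1 + n = i + n + 1" "i + 2 + n = i + n + 2" "i - 1 + n = i + n - 1" for i by simp_all
  have scale: "c \<odot>\<^bsub>gr X k\<^esub> x = \<zero>\<^bsub>gr X k\<^esub> \<longleftrightarrow> x = \<zero>\<^bsub>gr X k\<^esub>" if "c \<noteq> 0" "x \<in> carrier (gr X k)" for c x k
  proof
    assume "c \<odot>\<^bsub>gr X k\<^esub> x = \<zero>\<^bsub>gr X k\<^esub>"
    then have "(1 / c) \<odot>\<^bsub>gr X k\<^esub> (c \<odot>\<^bsub>gr X k\<^esub> x) = \<zero>\<^bsub>gr X k\<^esub>" by (simp add: vs_smult_zero[OF V])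
    then show "x = \<zero>\<^bsub>gr X k\<^esub>" using that by (simp add: vs_smult_smult[OF V] vs_one[OF V])
  qed (simp add: vs_smult_zero[OF V])
  show "cochain_complex (shift n X)"
  proof (rule cochain_complex.intro)
    show "complex_vector_space (gr (shift n X) i)" for i by (simp add: shift_def V)
    show "dif (shift n X) i \<in> linear_maps (gr (shift n X) i) (gr (shift n X) (i + 1))" for i
      unfolding shift_def using X.dif_closed[of _ "i + n"]
      by (intro linear_mapsI)
        (auto simp: ac vs_smult[OF V] lin_add[OF X.dif_linear] lin_smult[OF X.dif_linear] vs_distr[OF V]
          vs_smult_smult[OF V] mult.commute)
    show "dif (shift n X) (i + 1) (dif (shift n X) i x) = \<zero>\<^bsub>gr (shift n X) (i + 2)\<^esub>"
      if "x \<in> carrier (gr (shift n X) i)" for i x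
      using that X.dif_closed[of x "i + n"] X.dif_dif[of x "i + n"]
      by (simp add: shift_def ac lin_smult[OF X.dif_linear] vs_smult_zero[OF V] add.commute[of 2])
  qed
  have "cocycles (shift n X) i = cocycles X (i + n)" for i
    using X.dif_closed[of _ "i + n"] by (auto simp: cocycles_def shift_def ac scale vs_smult_zero[OF V])
  moreover have "coboundaries (shift n X) i = coboundaries X (i + n)" for i
  proof -
    have "coboundaries (shift n X) i = (\<lambda>x. sign n \<odot>\<^bsub>gr X (i + n)\<^esub> dif X (i + n - 1) x) ` carrier (gr X (i + n - 1))"
      by (simp add: coboundaries_def shift_def ac)
    also have "\<dots> = coboundaries X (i + n)"
    proof (intro equalityI subsetI)
      fix x assume "x \<in> (\<lambda>x. sign n \<odot>\<^bsub>gr X (i + n)\<^esub> dif X (i + n - 1) x) ` carrier (gr X (i + n - 1))"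
      then show "x \<in> coboundaries X (i + n)"
        using linear_subspace_smult[OF X.coboundaries_subspace[of "i + n"]] by (auto simp: coboundaries_def)
    next
      fix x assume "x \<in> coboundaries X (i + n)"
      then obtain y where y: "y \<in> carrier (gr X (i + n - 1))" "x = dif X (i + n - 1) y"
        by (auto simp: coboundaries_def)
      then have "x = sign n \<odot>\<^bsub>gr X (i + n)\<^esub> dif X (i + n - 1) ((1 / sign n) \<odot>\<^bsub>gr X (i + n - 1)\<^esub> y)"
        using X.dif_closed[OF y(1)] s0
        by (simp add: lin_smult[OF X.dif_linear] vs_smult_smult[OF V] vs_one[OF V])
      then show "x \<in> (\<lambda>x. sign n \<odot>\<^bsub>gr X (i + n)\<^esub> dif X (i + n - 1) x) ` carrier (gr X (i + n - 1))"
        using vs_smult[OF V y(1)] by blast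
    qed
    finally show ?thesis .
  qed
  moreover have "gr (shift n X) i = gr X (i + n)" for i by (simp add: shift_def)
  ultimately show "finite_cohomology (shift n X)" using assms(2) by (simp add: finite_cohomology_def)
qed

lemma built_from_free_finite:
  assumes A: "dg_algebra A" "proper A" and "built_from_free A X"
  shows "cochain_complex X \<and> finite_cohomology X"
  using assms(3)
proof induction
  case free
  interpret A: dg_algebra A by fact
  have "cochain_complex (free_module A)"
    using A.vector_space A.dif_linear A.dif_dif by (simp add: cochain_complex_def free_module_def)
  moreover have "finite_cohomology (free_module A)"
    using A.finite_dimensional_cohomology A(2)
    by (simp add: finite_cohomology_def proper_def finite_total_cohomology_def free_module_def
        cocycles_def coboundaries_def)
  ultimately show ?case ..
next
  case (shift X n)
  then show ?case using shift_finite by blast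
next
  case (cone X Y f Z)
  then obtain e where e: "dg_hom A Z (mapping_cone X Y f) e"
    and b: "\<And>i. bij_betw (e i) (carrier (gr Z i)) (carrier (gr (mapping_cone X Y f) i))"
    by (auto simp: dg_isomorphic_def)
  have g: "gr (mapping_cone X Y f) i = product_space (gr X (i + 1)) (gr Y i)" for i
    by (simp add: mapping_cone_def)
  have X: "cochain_complex X" "finite_cohomology X" and Y: "cochain_complex Y" "finite_cohomology Y"
    using cone.IH by auto
  note Z = dg_module_cochain[OF cone.hyps(4)]
  have "finite_cohomology Z"
    by (rule finite_cohomology_cone[OF X(1) Y(1) Z dg_hom_linear[OF cone.hyps(3)] dg_hom_dif[OF cone.hyps(3)]
          dg_hom_linear[OF e, unfolded g] b[unfolded g product_space_simps(1)] dg_hom_dif[OF e] X(2) Y(2)])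
  with Z show ?case ..
next
  case (quasi_iso X Y)
  then show ?case using quasi_isomorphic_finite by blast
qed

text \<open>
  The cohomology of a direct summand embeds into the cohomology of the sum.
\<close>

lemma perfect_finite_cohomology:
  assumes A: "dg_algebra A" "proper A" and "perfect A M"
  shows "finite_cohomology M"
proof -
  obtain N S X where M: "dg_module A M" and N: "dg_module A (N :: ('a, 'a) dg_module)" and S: "dg_module A S"
    and iso: "dg_isomorphic A S (direct_sum M N)" and X: "built_from_free A X" and SX: "quasi_isomorphic A S X"
    using assms(3) unfolding perfect_def by blast
  interpret M: cochain_complex M by (rule dg_module_cochain[OF M])
  interpret N: cochain_complex N by (rule dg_module_cochain[OF N])
  interpret S: cochain_complex S by (rule dg_module_cochain[OF S])
  have fS: "finite_cohomology S"
    using quasi_isomorphic_finite(1)[OF SX] built_from_free_finite[OF A X] by blast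
  have g: "gr (direct_sum M N) i = product_space (gr M i) (gr N i)" for i
    by (simp add: direct_sum_def)
  obtain e where e: "dg_hom A S (direct_sum M N) e"
    and b: "\<And>i. bij_betw (e i) (carrier (gr S i)) (carrier (gr M i) \<times> carrier (gr N i))"
    using iso by (auto simp: dg_isomorphic_def g)
  note el = dg_hom_linear[OF e, unfolded g] and ed = dg_hom_dif[OF e]
  let ?h = "\<lambda>i. inv_into (carrier (gr S i)) (e i)"
  have h: "?h i \<in> linear_maps (product_space (gr M i) (gr N i)) (gr S i)" for i
    by (rule lin_inv[OF el _ S.vector_space]) (simp add: b)
  have hc [simp]: "?h i w \<in> carrier (gr S i)" "e i (?h i w) = w"
    if "w \<in> carrier (gr M i) \<times> carrier (gr N i)" for i w
    using that bij_betw_inv_into_right[OF b] bij_betw_apply[OF bij_betw_inv_into[OF b]] by auto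
  have einj: "z = z'" if "e i z = e i z'" "z \<in> carrier (gr S i)" "z' \<in> carrier (gr S i)" for i z z'
    using that bij_betw_imp_inj_on[OF b] by (auto dest: inj_onD)
  define f where "f = (\<lambda>i x. ?h i (x, \<zero>\<^bsub>gr N i\<^esub>))"
  note [simp] = vs_zero[OF N.vector_space]
  have ef: "e i (f i x) = (x, \<zero>\<^bsub>gr N i\<^esub>)" "f i x \<in> carrier (gr S i)" if "x \<in> carrier (gr M i)" for i x
    using that by (auto simp: f_def)
  show ?thesis
  proof (rule finite_cohomology_injective[OF dg_module_cochain[OF M] dg_module_cochain[OF S], of f])
    show "f i \<in> linear_maps (gr M i) (gr S i)" for i
      unfolding f_def by (rule lin_comp[OF product_space_inl[OF N.vector_space] h])
    show "f (i + 1) (dif M i x) = dif S i (f i x)" if x: "x \<in> carrier (gr M i)" for i x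
      by (rule einj[where i = "i + 1"])
        (use x in \<open>auto simp: ef ed M.dif_closed S.dif_closed direct_sum_def N.dif_zero\<close>)
    show "x \<in> coboundaries M i" if x: "x \<in> cocycles M i" "f i x \<in> coboundaries S i" for i x
    proof -
      obtain s where s: "s \<in> carrier (gr S (i - 1))" "f i x = dif S (i - 1) s"
        using x by (auto simp: coboundaries_def)
      have "e (i - 1) s \<in> carrier (gr M (i - 1)) \<times> carrier (gr N (i - 1))" using lin_closed[OF el s(1)] by simp
      then obtain m n where mn: "e (i - 1) s = (m, n)" "m \<in> carrier (gr M (i - 1))" by auto
      have "e i (f i x) = dif (direct_sum M N) (i - 1) (m, n)"
        using ed[OF s(1)] s(2) mn by simp
      then have "x = dif M (i - 1) m"
        using ef[of x i] x by (simp add: direct_sum_def cocycles_def)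
      then show ?thesis using mn by (auto simp: coboundaries_def)
    qed
    show "finite_cohomology S" by fact
  qed
qed

section \<open>Weights of rational representations\<close>

lemma laurent_coefficients_zero:
  fixes c :: "int \<Rightarrow> complex"
  assumes F: "finite F" and z: "\<And>z. z \<noteq> 0 \<Longrightarrow> (\<Sum>n\<in>F. c n * z powi n) = 0" and n: "n \<in> F"
  shows "c n = 0"
proof -
  obtain m :: nat where m: "\<And>k. k \<in> F \<Longrightarrow> - int m \<le> k"
  proof
    fix k assume "k \<in> F"
    then have "\<bar>k\<bar> \<le> Max (abs ` F)" using F by simp
    then show "- int (nat (Max (abs ` F))) \<le> k" by linarith
  qed
  define p where "p = (\<Sum>k\<in>F. monom (c k) (nat (k + int m)))"
  have "poly p z = 0" if "z \<noteq> 0" for z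
  proof -
    have "c k * z ^ nat (k + int m) = z ^ m * (c k * z powi k)" if "k \<in> F" for k
    proof -
      have "z ^ nat (k + int m) = z powi (k + int m)" using m[OF that] by (simp add: power_int_def)
      also have "\<dots> = z powi k * z ^ m" using \<open>z \<noteq> 0\<close> by (simp add: power_int_add)
      finally show ?thesis by simp
    qed
    then have "poly p z = z ^ m * (\<Sum>k\<in>F. c k * z powi k)"
      unfolding p_def poly_sum poly_monom sum_distrib_left by (intro sum.cong refl)
    then show ?thesis using z[OF that] by simp
  qed
  then have "- {0} \<subseteq> {z. poly p z = 0}" by auto
  moreover have "infinite (- {0 :: complex})"
    by (simp add: Compl_eq_Diff_UNIV infinite_UNIV_char_0)
  ultimately have "infinite {z. poly p z = 0}" using finite_subset by blast
  then have "p = 0" using poly_roots_finite by blast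
  then have "0 = coeff p (nat (n + int m))" by simp
  also have "\<dots> = (\<Sum>k\<in>F. if k = n then c k else 0)"
    unfolding p_def coeff_sum coeff_monom
  proof (intro sum.cong refl)
    fix k assume "k \<in> F"
    then show "(if nat (k + int m) = nat (n + int m) then c k else 0) = (if k = n then c k else 0)"
      using m[of k] m[OF n] by auto
  qed
  also have "\<dots> = c n" using F n by simp
  finally show ?thesis by simp
qed

lemma regular_function_laurent:
  assumes "regular_function g"
  obtains c :: "int \<Rightarrow> complex" where "finite {n. c n \<noteq> 0}"
    and "\<And>z F. z \<noteq> 0 \<Longrightarrow> finite F \<Longrightarrow> {n. c n \<noteq> 0} \<subseteq> F \<Longrightarrow> g z = (\<Sum>n\<in>F. c n * z powi n)"
proof -
  obtain p m where p: "\<And>z. z \<noteq> 0 \<Longrightarrow> g z = poly p z / z ^ m"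
    using assms unfolding regular_function_def by blast
  define c where "c n = (if n < - int m then 0 else coeff p (nat (n + int m)))" for n :: int
  let ?F = "(\<lambda>k. int k - int m) ` {..degree p}"
  have supp: "{n. c n \<noteq> 0} \<subseteq> ?F"
  proof
    fix n assume "n \<in> {n. c n \<noteq> 0}"
    then have "\<not> n < - int m" "coeff p (nat (n + int m)) \<noteq> 0" by (auto simp: c_def split: if_splits)
    then have "n = int (nat (n + int m)) - int m" "nat (n + int m) \<le> degree p" by (auto simp: le_degree)
    then show "n \<in> ?F" by blast
  qed
  show thesis
  proof
    show "finite {n. c n \<noteq> 0}" by (rule finite_subset[OF supp]) simp
    fix z :: complex and F assume z: "z \<noteq> 0" and F: "finite F" "{n. c n \<noteq> 0} \<subseteq> F"
    have "g z = (\<Sum>k\<le>degree p. coeff p k * z ^ k / z ^ m)"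
      by (simp add: p[OF z] poly_altdef sum_divide_distrib)
    also have "\<dots> = (\<Sum>k\<le>degree p. c (int k - int m) * z powi (int k - int m))"
      using z by (intro sum.cong) (auto simp: c_def power_int_diff)
    also have "\<dots> = (\<Sum>n\<in>?F. c n * z powi n)"
      by (subst sum.reindex) (auto simp: inj_on_def)
    also have "\<dots> = (\<Sum>n\<in>F. c n * z powi n)"
      by (rule sum.mono_neutral_cong) (use F supp in auto)
    finally show "g z = (\<Sum>n\<in>F. c n * z powi n)" .
  qed
qed

lemma lin_finsum:
  assumes f: "f \<in> linear_maps V (space_on S)" and V: "complex_vector_space V" and S: "subspace S"
    and "finite I" "\<And>i. i \<in> I \<Longrightarrow> g i \<in> carrier V"
  shows "f (\<Oplus>\<^bsub>V\<^esub>i\<in>I. g i) = (\<Sum>i\<in>I. f (g i))"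
proof -
  interpret V: module complex_field V by (rule V)
  show ?thesis
    using assms(4,5)
  proof (induction I rule: finite_induct)
    case empty
    then show ?case using lin_zero[OF f V space_on_space[OF S]] by simp
  next
    case (insert i I)
    then have "(\<Oplus>\<^bsub>V\<^esub>i\<in>insert i I. g i) = g i \<oplus>\<^bsub>V\<^esub> (\<Oplus>\<^bsub>V\<^esub>i\<in>I. g i)"
      by (intro V.M.finsum_insert) auto
    moreover have "(\<Oplus>\<^bsub>V\<^esub>i\<in>I. g i) \<in> carrier V" using insert by (intro V.M.finsum_closed) auto
    ultimately show ?case using insert lin_add[OF f, of "g i" "(\<Oplus>\<^bsub>V\<^esub>i\<in>I. g i)"] by simp
  qed
qed

lemma lin_sum:
  assumes f: "f \<in> linear_maps (space_on S) (space_on T)" and S: "subspace S" and T: "subspace T"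
    and "\<And>i. i \<in> I \<Longrightarrow> g i \<in> S"
  shows "f (\<Sum>i\<in>I. c i *\<^sub>C g i) = (\<Sum>i\<in>I. c i *\<^sub>C f (g i))"
proof (cases "finite I")
  case True
  then show ?thesis
    using assms(4)
  proof (induction I rule: finite_induct)
    case empty
    then show ?case using lin_zero[OF f space_on_space[OF S] space_on_space[OF T]] by simp
  next
    case (insert i I)
    have "f (c i *\<^sub>C g i + (\<Sum>i\<in>I. c i *\<^sub>C g i)) = f (c i *\<^sub>C g i) + f (\<Sum>i\<in>I. c i *\<^sub>C g i)"
      using lin_add[OF f, of "c i *\<^sub>C g i" "\<Sum>i\<in>I. c i *\<^sub>C g i"] insert.prems
      by (simp add: subspace_scale[OF S] subspace_sum[OF S])
    then show ?case using insert lin_smult[OF f, of "g i" "c i"] by simp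
  qed
next
  case False
  then show ?thesis using lin_zero[OF f space_on_space[OF S] space_on_space[OF T]] by simp
qed

definition weight_vector :: "(complex, 'u) module \<Rightarrow> (complex \<Rightarrow> 'u \<Rightarrow> 'u) \<Rightarrow> int \<Rightarrow> 'u \<Rightarrow> bool" where
  "weight_vector V r n x \<longleftrightarrow> x \<in> carrier V \<and> (\<forall>z. z \<noteq> 0 \<longrightarrow> r z x = z powi n \<odot>\<^bsub>V\<^esub> x)"

inductive weight_span :: "(complex, 'u) module \<Rightarrow> (complex \<Rightarrow> 'u \<Rightarrow> 'u) \<Rightarrow> 'u \<Rightarrow> bool"
  for V :: "(complex, 'u) module" and r :: "complex \<Rightarrow> 'u \<Rightarrow> 'u"
where
  weight: "weight_vector V r n x \<Longrightarrow> weight_span V r x"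
| add: "weight_span V r x \<Longrightarrow> weight_span V r y \<Longrightarrow> weight_span V r (x \<oplus>\<^bsub>V\<^esub> y)"

lemma weight_vector_zero:
  assumes "complex_vector_space V" "representation V r"
  shows "weight_vector V r n \<zero>\<^bsub>V\<^esub>"
  using assms lin_zero[of "r _" V V]
  by (auto simp: weight_vector_def vs_zero vs_smult_zero representation_def)

lemma weight_span_finsum:
  assumes V: "complex_vector_space V" and r: "representation V r"
    and "finite I" "\<And>i. i \<in> I \<Longrightarrow> weight_span V r (g i) \<and> g i \<in> carrier V"
  shows "weight_span V r (\<Oplus>\<^bsub>V\<^esub>i\<in>I. g i)"
proof -
  interpret V: module complex_field V by (rule V)
  show ?thesis
    using assms(3,4)
  proof (induction I rule: finite_induct)
    case empty
    then show ?case using weight_span.weight[OF weight_vector_zero[OF V r]] by simp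
  next
    case (insert i I)
    then have "(\<Oplus>\<^bsub>V\<^esub>i\<in>insert i I. g i) = g i \<oplus>\<^bsub>V\<^esub> (\<Oplus>\<^bsub>V\<^esub>i\<in>I. g i)"
      by (intro V.M.finsum_insert) auto
    then show ?case using insert by (auto intro: weight_span.add)
  qed
qed

text \<open>
  Expand the matrix coefficients of \<open>r z x\<close> in powers of \<open>z\<close>. Comparing coefficients in
  \<open>r y (r z x) = r (y * z) x\<close> shows that the coefficient of \<open>z powi n\<close> is a vector of weight \<open>n\<close>;
  at \<open>z = 1\<close> these vectors add up to \<open>x\<close>.
\<close>

lemma algebraic_weight_span:
  assumes V: "complex_vector_space V" and r: "algebraic_representation V r" and x: "x \<in> carrier V"
  shows "weight_span V r x"
proof -
  have rep: "representation V r" and fin: "finite_dimensional V"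
    and reg: "\<And>f x. f \<in> linear_maps V complex_line \<Longrightarrow> x \<in> carrier V \<Longrightarrow> regular_function (\<lambda>z. f (r z x))"
    using r by (auto simp: algebraic_representation_def)
  have rl: "r z \<in> linear_maps V V" if "z \<noteq> 0" for z using rep that by (auto simp: representation_def)
  have rm: "r (z * w) x = r z (r w x)" if "z \<noteq> 0" "w \<noteq> 0" "x \<in> carrier V" for z w x
    using rep that by (auto simp: representation_def)
  have r1: "r 1 x = x" using rep x by (auto simp: representation_def)
  obtain B :: "'a set" and \<phi> :: "'a \<Rightarrow> 'a \<Rightarrow> complex"
    where \<phi>: "\<phi> \<in> linear_maps V (space_on (finitely_supported B))"
    and b: "bij_betw \<phi> (carrier V) (finitely_supported B)"
    by (rule coordinates_exist[OF V])
  let ?S = "finitely_supported B :: ('a \<Rightarrow> complex) set" let ?h = "inv_into (carrier V) \<phi>"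
  note S = finitely_supported_subspace[where 'v = complex, of B]
  have h: "?h \<in> linear_maps (space_on ?S) V" by (rule lin_inv[OF \<phi> _ V]) (simp add: b)
  have h\<phi>: "?h (\<phi> v) = v" if "v \<in> carrier V" for v using b that by (auto simp: bij_betw_def)
  have \<phi>h: "\<phi> (?h f) = f" "?h f \<in> carrier V" if "f \<in> ?S" for f
    using bij_betw_inv_into_right[OF b that] bij_betw_apply[OF bij_betw_inv_into[OF b] that] by auto
  have \<phi>c: "\<phi> v \<in> ?S" if "v \<in> carrier V" for v using lin_closed[OF \<phi> that] by simp
  obtain T where T: "finite T" "T \<subseteq> carrier V"
    and sp: "\<forall>v\<in>carrier V. \<exists>c. v = (\<Oplus>\<^bsub>V\<^esub>s\<in>T. c s \<odot>\<^bsub>V\<^esub> s)"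
    using fin[unfolded finite_dimensional_def] by (elim exE conjE) (rule that)
  define F0 where "F0 = (\<Union>s\<in>T. {b. \<phi> s b \<noteq> 0})"
  have F0: "finite F0" "F0 \<subseteq> B"
    using T \<phi>c by (auto simp: F0_def finitely_supported_def)
  have supp: "b \<in> F0" if v: "v \<in> carrier V" and nz: "\<phi> v b \<noteq> 0" for v b
  proof (rule ccontr)
    assume nb: "b \<notin> F0"
    obtain c where c: "v = (\<Oplus>\<^bsub>V\<^esub>s\<in>T. c s \<odot>\<^bsub>V\<^esub> s)" using bspec[OF sp v] by blast
    have "\<phi> v = (\<Sum>s\<in>T. \<phi> (c s \<odot>\<^bsub>V\<^esub> s))"
      unfolding c by (rule lin_finsum[OF \<phi> V S T(1)]) (use T vs_smult[OF V] in auto)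
    also have "\<dots> = (\<Sum>s\<in>T. c s *\<^sub>C \<phi> s)"
      using T lin_smult[OF \<phi>] by (intro sum.cong) auto
    finally have e: "\<phi> v = (\<Sum>s\<in>T. c s *\<^sub>C \<phi> s)" .
    have "(\<Sum>s\<in>T. c s *\<^sub>C \<phi> s) b = (\<Sum>s\<in>T. c s *\<^sub>C \<phi> s b)"
      by (induction T rule: infinite_finite_induct) auto
    also have "\<dots> = 0" using nb by (intro sum.neutral) (auto simp: F0_def)
    finally show False using nz e by simp
  qed
  have "\<exists>c. finite {n. c n \<noteq> 0} \<and> (\<forall>z F. z \<noteq> 0 \<longrightarrow> finite F \<longrightarrow> {n. c n \<noteq> 0} \<subseteq> F \<longrightarrow>
      \<phi> (r z x) b = (\<Sum>n\<in>F. c n * z powi n))" for b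
  proof -
    have "(\<lambda>v. \<phi> v b) \<in> linear_maps V complex_line"
      by (rule linear_mapsI) (auto simp: complex_line_def lin_add[OF \<phi>] lin_smult[OF \<phi>] scaleC_complex_def)
    from regular_function_laurent[OF reg[OF this x]] show ?thesis by metis
  qed
  then obtain c where c: "\<And>b. finite {n. c b n \<noteq> 0}"
    "\<And>b z F. z \<noteq> 0 \<Longrightarrow> finite F \<Longrightarrow> {n. c b n \<noteq> 0} \<subseteq> F \<Longrightarrow> \<phi> (r z x) b = (\<Sum>n\<in>F. c b n * z powi n)"
    by metis
  define F where "F = (\<Union>b\<in>F0. {n. c b n \<noteq> 0})"
  have F: "finite F" using F0 c by (auto simp: F_def)
  define \<beta> where "\<beta> n b = (if b \<in> F0 then c b n else 0)" for n b
  have \<beta>: "\<beta> n \<in> ?S" for n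
    using F0 by (auto simp: \<beta>_def finitely_supported_def split: if_splits elim: rev_finite_subset)
  have sum_apply: "(\<Sum>n\<in>F. d n *\<^sub>C g n) b = (\<Sum>n\<in>F. d n * g n b)" for d :: "int \<Rightarrow> complex" and g :: "int \<Rightarrow> 'a \<Rightarrow> complex" and b
    by (induction F rule: infinite_finite_induct) (auto simp: scaleC_complex_def)
  have expand: "\<phi> (r z x) = (\<Sum>n\<in>F. z powi n *\<^sub>C \<beta> n)" if z: "z \<noteq> 0" for z
  proof
    fix b
    show "\<phi> (r z x) b = (\<Sum>n\<in>F. z powi n *\<^sub>C \<beta> n) b"
    proof (cases "b \<in> F0")
      case True
      then have "{n. c b n \<noteq> 0} \<subseteq> F" by (auto simp: F_def)
      then show ?thesis using c(2)[OF z F, of b] True by (simp add: sum_apply \<beta>_def mult.commute)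
    next
      case False
      then show ?thesis using supp[OF lin_closed[OF rl[OF z] x]] by (auto simp: sum_apply \<beta>_def)
    qed
  qed
  have wt: "weight_vector V r n (?h (\<beta> n))" if n: "n \<in> F" for n
    unfolding weight_vector_def
  proof (intro conjI allI impI)
    show "?h (\<beta> n) \<in> carrier V" by (rule \<phi>h(2)[OF \<beta>])
    fix y :: complex assume y: "y \<noteq> 0"
    let ?R = "\<lambda>f. \<phi> (r y (?h f))"
    have R: "?R \<in> linear_maps (space_on ?S) (space_on ?S)"
      by (rule lin_comp[OF lin_comp[OF h rl[OF y]] \<phi>])
    have "?R (\<beta> n) = y powi n *\<^sub>C \<beta> n"
    proof
      fix b
      have "(\<Sum>n\<in>F. (?R (\<beta> n) b - y powi n * \<beta> n b) * z powi n) = 0" if z: "z \<noteq> 0" for z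
      proof -
        have rz: "r z x \<in> carrier V" by (rule lin_closed[OF rl[OF z] x])
        have "(\<Sum>n\<in>F. z powi n *\<^sub>C ?R (\<beta> n)) = ?R (\<Sum>n\<in>F. z powi n *\<^sub>C \<beta> n)"
          by (rule lin_sum[OF R S S \<beta>, symmetric])
        also have "\<dots> = \<phi> (r y (r z x))" using expand[OF z] h\<phi>[OF rz] by simp
        also have "\<dots> = (\<Sum>n\<in>F. (y * z) powi n *\<^sub>C \<beta> n)"
          using expand[of "y * z"] y z rm[OF y z x] by simp
        finally have "(\<Sum>n\<in>F. z powi n *\<^sub>C ?R (\<beta> n)) b = (\<Sum>n\<in>F. (y * z) powi n *\<^sub>C \<beta> n) b" by simp
        then have "(\<Sum>n\<in>F. z powi n * ?R (\<beta> n) b) = (\<Sum>n\<in>F. (y * z) powi n * \<beta> n b)"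
          unfolding sum_apply .
        then show ?thesis
          by (simp add: algebra_simps sum_subtractf power_int_mult_distrib)
      qed
      from laurent_coefficients_zero[OF F this n] show "?R (\<beta> n) b = (y powi n *\<^sub>C \<beta> n) b"
        by (simp add: scaleC_complex_def)
    qed
    also have "\<dots> = \<phi> (y powi n \<odot>\<^bsub>V\<^esub> ?h (\<beta> n))" using lin_smult[OF \<phi> \<phi>h(2)[OF \<beta>]] \<phi>h(1)[OF \<beta>] by simp
    finally have "?h (\<phi> (r y (?h (\<beta> n)))) = ?h (\<phi> (y powi n \<odot>\<^bsub>V\<^esub> ?h (\<beta> n)))" by simp
    then show "r y (?h (\<beta> n)) = y powi n \<odot>\<^bsub>V\<^esub> ?h (\<beta> n)"
      using h\<phi> lin_closed[OF rl[OF y]] \<phi>h(2)[OF \<beta>] vs_smult[OF V] by simp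
  qed
  have "weight_span V r (\<Oplus>\<^bsub>V\<^esub>n\<in>F. ?h (\<beta> n))"
    by (rule weight_span_finsum[OF V rep F]) (intro conjI weight_span.weight[OF wt] \<phi>h(2)[OF \<beta>])
  moreover have "(\<Oplus>\<^bsub>V\<^esub>n\<in>F. ?h (\<beta> n)) = x"
  proof -
    interpret V: module complex_field V by (rule V)
    have c: "(\<Oplus>\<^bsub>V\<^esub>n\<in>F. ?h (\<beta> n)) \<in> carrier V" using \<phi>h(2)[OF \<beta>] by (intro V.M.finsum_closed) auto
    have "\<phi> (\<Oplus>\<^bsub>V\<^esub>n\<in>F. ?h (\<beta> n)) = (\<Sum>n\<in>F. \<phi> (?h (\<beta> n)))"
      by (rule lin_finsum[OF \<phi> V S F \<phi>h(2)[OF \<beta>]])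
    also have "\<dots> = \<phi> x" using expand[of 1] r1 by (simp add: \<phi>h(1)[OF \<beta>])
    finally show ?thesis using h\<phi> c x by metis
  qed
  ultimately show ?thesis by simp
qed

lemma rational_weight_span:
  assumes V: "complex_vector_space V" and r: "rational_representation V r" and x: "x \<in> carrier V"
  shows "weight_span V r x"
proof -
  obtain \<W> where rep: "representation V r" and W: "internal_direct_sum V \<W>"
    and alg: "\<And>W. W \<in> \<W> \<Longrightarrow> algebraic_representation (V\<lparr>carrier := W\<rparr>) r"
    using r unfolding rational_representation_def by blast
  have sub: "submodule W complex_field V" if "W \<in> \<W>" for W using W that by (auto simp: internal_direct_sum_def)
  have ls: "linear_subspace V W" if "W \<in> \<W>" for W
    using sub[OF that] by (auto simp: linear_subspace_def submodule_def submodule_axioms_def subgroup_def)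
  have wsp: "weight_span V r w" if W: "W \<in> \<W>" and w: "w \<in> W" for W w
  proof -
    have "weight_span (V\<lparr>carrier := W\<rparr>) r w"
      by (rule algebraic_weight_span[OF linear_subspace_vector_space[OF V ls[OF W]] alg[OF W]]) (simp add: w)
    then show ?thesis
    proof induction
      case (weight n x)
      then show ?case
        using linear_subspace_carrier[OF ls[OF W]] by (intro weight_span.weight[of _ _ n]) (simp add: weight_vector_def)
    next
      case (add x y)
      then show ?case using weight_span.add[of V r x y] by simp
    qed
  qed
  obtain f where f: "f \<in> (\<Pi>\<^sub>E W\<in>\<W>. W)" "finite {W\<in>\<W>. f W \<noteq> \<zero>\<^bsub>V\<^esub>}"
    "x = (\<Oplus>\<^bsub>V\<^esub>W\<in>{W\<in>\<W>. f W \<noteq> \<zero>\<^bsub>V\<^esub>}. f W)"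
    using W x unfolding internal_direct_sum_def by blast
  show ?thesis
    unfolding f(3)
    by (rule weight_span_finsum[OF V rep f(2)])
      (use f(1) wsp linear_subspace_carrier[OF ls] in \<open>auto simp: PiE_iff\<close>)
qed

definition weight_projections :: "(complex, 'u) module \<Rightarrow> (complex \<Rightarrow> 'u \<Rightarrow> 'u) \<Rightarrow> (int \<Rightarrow> 'u \<Rightarrow> 'u) \<Rightarrow> bool" where
  "weight_projections V r \<pi> \<longleftrightarrow>
     (\<forall>n. \<pi> n \<in> linear_maps V V) \<and> (\<forall>x\<in>carrier V. finite {n. \<pi> n x \<noteq> \<zero>\<^bsub>V\<^esub>}) \<and>
     (\<forall>n x. weight_vector V r n x \<longrightarrow> \<pi> n x = x \<and> (\<forall>m. m \<noteq> n \<longrightarrow> \<pi> m x = \<zero>\<^bsub>V\<^esub>))"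

text \<open>
  In coordinates, the weight components of \<open>x\<close> are the coefficients of the Laurent polynomial
  \<open>z \<mapsto> r z x\<close>. So they are unique, and therefore they depend linearly on \<open>x\<close>.
\<close>

lemma weight_projections_exist:
  assumes V: "complex_vector_space V" and r: "rational_representation V r"
  shows "\<exists>\<pi>. weight_projections V r \<pi>"
proof -
  have rep: "representation V r" using r by (simp add: rational_representation_def)
  have rl: "r z \<in> linear_maps V V" if "z \<noteq> 0" for z using rep that by (auto simp: representation_def)
  obtain B :: "'a set" and \<phi> :: "'a \<Rightarrow> 'a \<Rightarrow> complex"
    where \<phi>: "\<phi> \<in> linear_maps V (space_on (finitely_supported B))"
    and b: "bij_betw \<phi> (carrier V) (finitely_supported B)"
    by (rule coordinates_exist[OF V])
  have inj: "x = y" if "\<phi> x = \<phi> y" "x \<in> carrier V" "y \<in> carrier V" for x y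
    using b that by (auto simp: bij_betw_def dest: inj_onD)
  have sum_apply: "(\<Sum>n\<in>F. d n *\<^sub>C g n) b = (\<Sum>n\<in>F. d n * g n b)"
    for d :: "int \<Rightarrow> complex" and g :: "int \<Rightarrow> 'a \<Rightarrow> complex" and b F
    by (induction F rule: infinite_finite_induct) (auto simp: scaleC_complex_def)
  have \<phi>0: "\<phi> \<zero>\<^bsub>V\<^esub> = 0"
    using lin_zero[OF \<phi> V space_on_space[OF finitely_supported_subspace]] by simp
  \<comment> \<open>\<open>dec x \<alpha>\<close>: the family \<open>\<alpha>\<close> consists of the weight components of \<open>x\<close>\<close>
  define dec where "dec x \<alpha> \<longleftrightarrow> finite {n. \<alpha> n \<noteq> \<zero>\<^bsub>V\<^esub>} \<and> (\<forall>n. \<alpha> n \<in> carrier V) \<and>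
      (\<forall>z F. z \<noteq> 0 \<longrightarrow> finite F \<longrightarrow> {n. \<alpha> n \<noteq> \<zero>\<^bsub>V\<^esub>} \<subseteq> F \<longrightarrow> \<phi> (r z x) = (\<Sum>n\<in>F. z powi n *\<^sub>C \<phi> (\<alpha> n)))"
    for x \<alpha>
  have decE: "\<phi> (r z x) = (\<Sum>n\<in>F. z powi n *\<^sub>C \<phi> (\<alpha> n))"
    if "dec x \<alpha>" "z \<noteq> 0" "finite F" "{n. \<alpha> n \<noteq> \<zero>\<^bsub>V\<^esub>} \<subseteq> F" for x \<alpha> z F
    using that by (simp add: dec_def)
  have uniq: "\<alpha> = \<beta>" if "dec x \<alpha>" "dec x \<beta>" for x \<alpha> \<beta>
  proof
    fix n
    let ?F = "insert n ({n. \<alpha> n \<noteq> \<zero>\<^bsub>V\<^esub>} \<union> {n. \<beta> n \<noteq> \<zero>\<^bsub>V\<^esub>})"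
    have F: "finite ?F" using that by (auto simp: dec_def)
    have "\<phi> (\<alpha> n) = \<phi> (\<beta> n)"
    proof
      fix b
      have "(\<Sum>n\<in>?F. (\<phi> (\<alpha> n) b - \<phi> (\<beta> n) b) * z powi n) = 0" if z: "z \<noteq> 0" for z
      proof -
        have "(\<Sum>n\<in>?F. z powi n *\<^sub>C \<phi> (\<alpha> n)) = (\<Sum>n\<in>?F. z powi n *\<^sub>C \<phi> (\<beta> n))"
          by (rule trans[OF decE[OF \<open>dec x \<alpha>\<close> z F, symmetric] decE[OF \<open>dec x \<beta>\<close> z F]]) blast+
        then have "(\<Sum>n\<in>?F. z powi n *\<^sub>C \<phi> (\<alpha> n)) b = (\<Sum>n\<in>?F. z powi n *\<^sub>C \<phi> (\<beta> n)) b" by simp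
        then show ?thesis 
          unfolding sum_apply by (simp only: left_diff_distrib sum_subtractf mult.commute[of "z powi _"]) simp
      qed
      from laurent_coefficients_zero[OF F this, of n] show "\<phi> (\<alpha> n) b = \<phi> (\<beta> n) b" by simp
    qed
    then show "\<alpha> n = \<beta> n" using that inj by (auto simp: dec_def)
  qed
  have dec_add: "dec (x \<oplus>\<^bsub>V\<^esub> y) (\<lambda>n. \<alpha> n \<oplus>\<^bsub>V\<^esub> \<beta> n)"
    if "dec x \<alpha>" "dec y \<beta>" "x \<in> carrier V" "y \<in> carrier V" for x y \<alpha> \<beta>
    unfolding dec_def
  proof (intro conjI allI impI)
    have ac: "\<alpha> n \<in> carrier V" "\<beta> n \<in> carrier V" for n using that by (auto simp: dec_def)
    have s: "{n. \<alpha> n \<oplus>\<^bsub>V\<^esub> \<beta> n \<noteq> \<zero>\<^bsub>V\<^esub>} \<subseteq> {n. \<alpha> n \<noteq> \<zero>\<^bsub>V\<^esub>} \<union> {n. \<beta> n \<noteq> \<zero>\<^bsub>V\<^esub>}"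
      by (auto simp: vs_lzero[OF V] vs_zero[OF V])
    have f: "finite ({n. \<alpha> n \<noteq> \<zero>\<^bsub>V\<^esub>} \<union> {n. \<beta> n \<noteq> \<zero>\<^bsub>V\<^esub>})" using that by (auto simp: dec_def)
    show "finite {n. \<alpha> n \<oplus>\<^bsub>V\<^esub> \<beta> n \<noteq> \<zero>\<^bsub>V\<^esub>}" by (rule finite_subset[OF s f])
    show "\<alpha> n \<oplus>\<^bsub>V\<^esub> \<beta> n \<in> carrier V" for n by (rule vs_add[OF V ac])
    fix z :: complex and F assume z: "z \<noteq> 0" and F: "finite F" "{n. \<alpha> n \<oplus>\<^bsub>V\<^esub> \<beta> n \<noteq> \<zero>\<^bsub>V\<^esub>} \<subseteq> F"
    let ?G = "F \<union> ({n. \<alpha> n \<noteq> \<zero>\<^bsub>V\<^esub>} \<union> {n. \<beta> n \<noteq> \<zero>\<^bsub>V\<^esub>})"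
    have G: "finite ?G" "{n. \<alpha> n \<noteq> \<zero>\<^bsub>V\<^esub>} \<subseteq> ?G" "{n. \<beta> n \<noteq> \<zero>\<^bsub>V\<^esub>} \<subseteq> ?G" using F f by auto
    have "\<phi> (r z x) = (\<Sum>n\<in>?G. z powi n *\<^sub>C \<phi> (\<alpha> n))" "\<phi> (r z y) = (\<Sum>n\<in>?G. z powi n *\<^sub>C \<phi> (\<beta> n))"
      by (rule decE[OF that(1) z G(1,2)], rule decE[OF that(2) z G(1,3)])
    then have "\<phi> (r z (x \<oplus>\<^bsub>V\<^esub> y)) = (\<Sum>n\<in>?G. z powi n *\<^sub>C \<phi> (\<alpha> n \<oplus>\<^bsub>V\<^esub> \<beta> n))"
      using that(3,4) ac
      by (simp add: lin_add[OF rl[OF z]] lin_add[OF \<phi>] lin_closed[OF rl[OF z]] scaleC_add_right sum.distrib)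
    also have "\<dots> = (\<Sum>n\<in>F. z powi n *\<^sub>C \<phi> (\<alpha> n \<oplus>\<^bsub>V\<^esub> \<beta> n))"
    proof (rule sum.mono_neutral_right[OF G(1)])
      show "\<forall>n\<in>?G - F. z powi n *\<^sub>C \<phi> (\<alpha> n \<oplus>\<^bsub>V\<^esub> \<beta> n) = 0"
      proof
        fix n assume "n \<in> ?G - F"
        then have "\<alpha> n \<oplus>\<^bsub>V\<^esub> \<beta> n = \<zero>\<^bsub>V\<^esub>" using F(2) by blast
        then show "z powi n *\<^sub>C \<phi> (\<alpha> n \<oplus>\<^bsub>V\<^esub> \<beta> n) = 0" by (simp add: \<phi>0)
      qed
    qed simp
    finally show "\<phi> (r z (x \<oplus>\<^bsub>V\<^esub> y)) = (\<Sum>n\<in>F. z powi n *\<^sub>C \<phi> (\<alpha> n \<oplus>\<^bsub>V\<^esub> \<beta> n))" .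
  qed
  have dec_smult: "dec (c \<odot>\<^bsub>V\<^esub> x) (\<lambda>n. c \<odot>\<^bsub>V\<^esub> \<alpha> n)" if "dec x \<alpha>" "x \<in> carrier V" for x \<alpha> c
    unfolding dec_def
  proof (intro conjI allI impI)
    have ac: "\<alpha> n \<in> carrier V" for n using that by (auto simp: dec_def)
    have s: "{n. c \<odot>\<^bsub>V\<^esub> \<alpha> n \<noteq> \<zero>\<^bsub>V\<^esub>} \<subseteq> {n. \<alpha> n \<noteq> \<zero>\<^bsub>V\<^esub>}" by (auto simp: vs_smult_zero[OF V])
    have f: "finite {n. \<alpha> n \<noteq> \<zero>\<^bsub>V\<^esub>}" using that by (auto simp: dec_def)
    show "finite {n. c \<odot>\<^bsub>V\<^esub> \<alpha> n \<noteq> \<zero>\<^bsub>V\<^esub>}" by (rule finite_subset[OF s f])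
    show "c \<odot>\<^bsub>V\<^esub> \<alpha> n \<in> carrier V" for n by (rule vs_smult[OF V ac])
    fix z :: complex and F assume z: "z \<noteq> 0" and F: "finite F" "{n. c \<odot>\<^bsub>V\<^esub> \<alpha> n \<noteq> \<zero>\<^bsub>V\<^esub>} \<subseteq> F"
    let ?G = "F \<union> {n. \<alpha> n \<noteq> \<zero>\<^bsub>V\<^esub>}"
    have G: "finite ?G" "{n. \<alpha> n \<noteq> \<zero>\<^bsub>V\<^esub>} \<subseteq> ?G" using F f by auto
    have "\<phi> (r z x) = (\<Sum>n\<in>?G. z powi n *\<^sub>C \<phi> (\<alpha> n))" by (rule decE[OF that(1) z G])
    then have "\<phi> (r z (c \<odot>\<^bsub>V\<^esub> x)) = (\<Sum>n\<in>?G. z powi n *\<^sub>C \<phi> (c \<odot>\<^bsub>V\<^esub> \<alpha> n))"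
      using that(2) ac
      by (simp add: lin_smult[OF rl[OF z]] lin_smult[OF \<phi>] lin_closed[OF rl[OF z]] scaleC_sum_right mult.commute)
    also have "\<dots> = (\<Sum>n\<in>F. z powi n *\<^sub>C \<phi> (c \<odot>\<^bsub>V\<^esub> \<alpha> n))"
    proof (rule sum.mono_neutral_right[OF G(1)])
      show "\<forall>n\<in>?G - F. z powi n *\<^sub>C \<phi> (c \<odot>\<^bsub>V\<^esub> \<alpha> n) = 0"
      proof
        fix n assume "n \<in> ?G - F"
        then have "c \<odot>\<^bsub>V\<^esub> \<alpha> n = \<zero>\<^bsub>V\<^esub>" using F(2) by blast
        then show "z powi n *\<^sub>C \<phi> (c \<odot>\<^bsub>V\<^esub> \<alpha> n) = 0" by (simp add: \<phi>0)
      qed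
    qed simp
    finally show "\<phi> (r z (c \<odot>\<^bsub>V\<^esub> x)) = (\<Sum>n\<in>F. z powi n *\<^sub>C \<phi> (c \<odot>\<^bsub>V\<^esub> \<alpha> n))" .
  qed
  have dec_weight: "dec x (\<lambda>m. if m = n then x else \<zero>\<^bsub>V\<^esub>)" if "weight_vector V r n x" for n x
    unfolding dec_def
  proof (intro conjI allI impI)
    show "finite {m. (if m = n then x else \<zero>\<^bsub>V\<^esub>) \<noteq> \<zero>\<^bsub>V\<^esub>}" by (rule finite_subset[of _ "{n}"]) auto
    show "(if m = n then x else \<zero>\<^bsub>V\<^esub>) \<in> carrier V" for m using that vs_zero[OF V] by (simp add: weight_vector_def)
    fix z :: complex and F
    assume z: "z \<noteq> 0" and F: "finite F" "{m. (if m = n then x else \<zero>\<^bsub>V\<^esub>) \<noteq> \<zero>\<^bsub>V\<^esub>} \<subseteq> F"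
    have "(\<Sum>m\<in>F. z powi m *\<^sub>C \<phi> (if m = n then x else \<zero>\<^bsub>V\<^esub>)) = (\<Sum>m\<in>F. if m = n then z powi n *\<^sub>C \<phi> x else 0)"
      by (intro sum.cong) (auto simp: \<phi>0)
    also have "\<dots> = z powi n *\<^sub>C \<phi> x" using F by (auto simp: \<phi>0 split: if_splits)
    also have "\<dots> = \<phi> (r z x)" using that z lin_smult[OF \<phi>, of x] by (simp add: weight_vector_def)
    finally show "\<phi> (r z x) = (\<Sum>m\<in>F. z powi m *\<^sub>C \<phi> (if m = n then x else \<zero>\<^bsub>V\<^esub>))" by simp
  qed
  have carr: "x \<in> carrier V" if "weight_span V r x" for x
    using that by induction (auto simp: weight_vector_def vs_add[OF V])
  have "\<exists>\<alpha>. dec x \<alpha>" if "x \<in> carrier V" for x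
    using rational_weight_span[OF V r that]
  proof induction
    case (weight n x)
    then show ?case using dec_weight by blast
  next
    case (add x y)
    then show ?case using dec_add carr by blast
  qed
  then obtain \<alpha> where \<alpha>: "\<And>x. x \<in> carrier V \<Longrightarrow> dec x (\<alpha> x)" by metis
  have "weight_projections V r (\<lambda>n x. \<alpha> x n)"
    unfolding weight_projections_def
  proof (intro conjI allI ballI impI)
    fix n show "(\<lambda>x. \<alpha> x n) \<in> linear_maps V V"
    proof (rule linear_mapsI)
      show "\<alpha> x n \<in> carrier V" if "x \<in> carrier V" for x using \<alpha>[OF that] by (simp add: dec_def)
      show "\<alpha> (x \<oplus>\<^bsub>V\<^esub> y) n = \<alpha> x n \<oplus>\<^bsub>V\<^esub> \<alpha> y n" if "x \<in> carrier V" "y \<in> carrier V" for x y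
        using uniq[OF \<alpha>[OF vs_add[OF V that]] dec_add[OF \<alpha>[OF that(1)] \<alpha>[OF that(2)] that]] by simp
      show "\<alpha> (c \<odot>\<^bsub>V\<^esub> x) n = c \<odot>\<^bsub>V\<^esub> \<alpha> x n" if "x \<in> carrier V" for x c
        using uniq[OF \<alpha>[OF vs_smult[OF V that]] dec_smult[OF \<alpha>[OF that] that]] by metis
    qed
  next
    fix x assume "x \<in> carrier V"
    then show "finite {n. \<alpha> x n \<noteq> \<zero>\<^bsub>V\<^esub>}" using \<alpha> by (auto simp: dec_def)
  next
    fix n x assume x: "weight_vector V r n x"
    then have "\<alpha> x = (\<lambda>m. if m = n then x else \<zero>\<^bsub>V\<^esub>)"
      by (intro uniq[OF \<alpha> dec_weight]) (auto simp: weight_vector_def)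
    then show "\<alpha> x n = x" "\<And>m. m \<noteq> n \<Longrightarrow> \<alpha> x m = \<zero>\<^bsub>V\<^esub>" by auto
  qed
  then show ?thesis by blast
qed

section \<open>Concrete dg modules\<close>

text \<open>
  In a concrete module the vector space operations of all homogeneous parts are those of the type, and
  constructions are plain computations.
  The indices in the rules below are kept flexible, so that rewriting need not know which of the
  equal expressions for a degree it meets.
\<close>

definition concrete :: "'a dg_algebra \<Rightarrow> ('a, 'v::complex_vector) dg_module \<Rightarrow> (int \<Rightarrow> 'v set) \<Rightarrow> bool" where
  "concrete A X S \<longleftrightarrow> dg_module A X \<and> (\<forall>i. gr X i = space_on (S i) \<and> subspace (S i))"

lemma
  assumes "concrete A X S"
  shows concrete_dg_module: "dg_module A X"
    and concrete_gr: "gr X i = space_on (S i)"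
    and concrete_subspace: "subspace (S i)"
  using assms by (auto simp: concrete_def)

lemma concrete_facts:
  assumes "concrete A X S"
  shows cdif_closed: "x \<in> S i \<Longrightarrow> k = i + 1 \<Longrightarrow> dif X i x \<in> S k"
    and cdif_add: "x \<in> S i \<Longrightarrow> y \<in> S i \<Longrightarrow> dif X i (x + y) = dif X i x + dif X i y"
    and cdif_scale: "x \<in> S i \<Longrightarrow> dif X i (c *\<^sub>C x) = c *\<^sub>C dif X i x"
    and cdif_zero: "dif X i 0 = 0"
    and cdif_dif: "x \<in> S i \<Longrightarrow> k = i + 1 \<Longrightarrow> dif X k (dif X i x) = 0"
    and cact_closed: "x \<in> S i \<Longrightarrow> a \<in> carrier (gr A j) \<Longrightarrow> k = i + j \<Longrightarrow> act X i j x a \<in> S k"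
    and cact_add: "x \<in> S i \<Longrightarrow> y \<in> S i \<Longrightarrow> a \<in> carrier (gr A j) \<Longrightarrow>
        act X i j (x + y) a = act X i j x a + act X i j y a"
    and cact_scale: "x \<in> S i \<Longrightarrow> a \<in> carrier (gr A j) \<Longrightarrow> act X i j (c *\<^sub>C x) a = c *\<^sub>C act X i j x a"
    and cact_zero: "a \<in> carrier (gr A j) \<Longrightarrow> act X i j 0 a = 0"
    and cact_linear: "x \<in> S i \<Longrightarrow> k = i + j \<Longrightarrow> act X i j x \<in> linear_maps (gr A j) (space_on (S k))"
    and cact_assoc: "x \<in> S i \<Longrightarrow> a \<in> carrier (gr A j) \<Longrightarrow> b \<in> carrier (gr A k) \<Longrightarrow> ij = i + j \<Longrightarrow>
        act X ij k (act X i j x a) b = act X i (j + k) x (mul A j k a b)"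
    and cact_unt: "x \<in> S i \<Longrightarrow> act X i 0 x (unt A) = x"
    and cact_leibniz: "x \<in> S i \<Longrightarrow> a \<in> carrier (gr A j) \<Longrightarrow> ij = i + j \<Longrightarrow>
        dif X ij (act X i j x a) = act X (i + 1) j (dif X i x) a + sign i *\<^sub>C act X i (j + 1) x (dif A j a)"
proof -
  interpret X: dg_module A X by (rule concrete_dg_module[OF assms])
  note g = concrete_gr[OF assms] and s = concrete_subspace[OF assms]
  note dl = X.M.dif_linear[unfolded g]
  note al = X.act_linear_left[unfolded g] and ar = X.act_linear_right[unfolded g]
  note sp = space_on_space[OF s]
  show "x \<in> S i \<Longrightarrow> k = i + 1 \<Longrightarrow> dif X i x \<in> S k" for x i k using lin_closed[OF dl, of x i] by simp
  show "x \<in> S i \<Longrightarrow> y \<in> S i \<Longrightarrow> dif X i (x + y) = dif X i x + dif X i y" using lin_add[OF dl, of x i y] by simp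
  show "x \<in> S i \<Longrightarrow> dif X i (c *\<^sub>C x) = c *\<^sub>C dif X i x" using lin_smult[OF dl, of x i c] by simp
  show "dif X i 0 = 0" using lin_zero[OF dl sp sp, of i] by simp
  show "x \<in> S i \<Longrightarrow> k = i + 1 \<Longrightarrow> dif X k (dif X i x) = 0" using X.M.dif_dif[unfolded g, of x i] by simp
  show "x \<in> S i \<Longrightarrow> a \<in> carrier (gr A j) \<Longrightarrow> k = i + j \<Longrightarrow> act X i j x a \<in> S k"
    using lin_closed[OF al, of a j x i] by simp
  show "x \<in> S i \<Longrightarrow> y \<in> S i \<Longrightarrow> a \<in> carrier (gr A j) \<Longrightarrow> act X i j (x + y) a = act X i j x a + act X i j y a"
    using lin_add[OF al, of a j x i y] by simp
  show "x \<in> S i \<Longrightarrow> a \<in> carrier (gr A j) \<Longrightarrow> act X i j (c *\<^sub>C x) a = c *\<^sub>C act X i j x a"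
    using lin_smult[OF al, of a j x i c] by simp
  show "a \<in> carrier (gr A j) \<Longrightarrow> act X i j 0 a = 0" using lin_zero[OF al sp sp, of a j i] by simp
  show "x \<in> S i \<Longrightarrow> k = i + j \<Longrightarrow> act X i j x \<in> linear_maps (gr A j) (space_on (S k))"
    using ar[of x i j] by simp
  show "x \<in> S i \<Longrightarrow> a \<in> carrier (gr A j) \<Longrightarrow> b \<in> carrier (gr A k) \<Longrightarrow> ij = i + j \<Longrightarrow>
        act X ij k (act X i j x a) b = act X i (j + k) x (mul A j k a b)"
    using X.act_assoc[unfolded g, of x i a j b k] by simp
  show "x \<in> S i \<Longrightarrow> act X i 0 x (unt A) = x" using X.act_unt[unfolded g, of x i] by simp
  show "x \<in> S i \<Longrightarrow> a \<in> carrier (gr A j) \<Longrightarrow> ij = i + j \<Longrightarrow>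
        dif X ij (act X i j x a) = act X (i + 1) j (dif X i x) a + sign i *\<^sub>C act X i (j + 1) x (dif A j a)"
    using X.act_leibniz[unfolded g, of x i a j] by simp
qed

lemma concreteI:
  assumes A: "dg_algebra A" and S: "\<And>i. subspace (S i)" and g: "\<And>i. gr X i = space_on (S i)"
    and d: "\<And>i x. x \<in> S i \<Longrightarrow> dif X i x \<in> S (i + 1)"
    and da: "\<And>i x y. x \<in> S i \<Longrightarrow> y \<in> S i \<Longrightarrow> dif X i (x + y) = dif X i x + dif X i y"
    and ds: "\<And>i x c. x \<in> S i \<Longrightarrow> dif X i (c *\<^sub>C x) = c *\<^sub>C dif X i x"
    and dd: "\<And>i x. x \<in> S i \<Longrightarrow> dif X (i + 1) (dif X i x) = 0"
    and aa: "\<And>i j x y a. x \<in> S i \<Longrightarrow> y \<in> S i \<Longrightarrow> a \<in> carrier (gr A j) \<Longrightarrow>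
        act X i j (x + y) a = act X i j x a + act X i j y a"
    and as: "\<And>i j x a c. x \<in> S i \<Longrightarrow> a \<in> carrier (gr A j) \<Longrightarrow> act X i j (c *\<^sub>C x) a = c *\<^sub>C act X i j x a"
    and ar: "\<And>i j x. x \<in> S i \<Longrightarrow> act X i j x \<in> linear_maps (gr A j) (space_on (S (i + j)))"
    and ass: "\<And>i j k x a b. x \<in> S i \<Longrightarrow> a \<in> carrier (gr A j) \<Longrightarrow> b \<in> carrier (gr A k) \<Longrightarrow>
        act X (i + j) k (act X i j x a) b = act X i (j + k) x (mul A j k a b)"
    and un: "\<And>i x. x \<in> S i \<Longrightarrow> act X i 0 x (unt A) = x"
    and le: "\<And>i j x a. x \<in> S i \<Longrightarrow> a \<in> carrier (gr A j) \<Longrightarrow>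
        dif X (i + j) (act X i j x a) = act X (i + 1) j (dif X i x) a + sign i *\<^sub>C act X i (j + 1) x (dif A j a)"
  shows "concrete A X S"
proof -
  have ac: "act X i j x a \<in> S (i + j)" if "x \<in> S i" "a \<in> carrier (gr A j)" for i j x a
    using lin_closed[OF ar[OF that(1)] that(2)] by simp
  have "dg_module A X"
    by (intro dg_module.intro dg_module_axioms.intro cochain_complex.intro A linear_mapsI)
      (auto simp: g d da ds dd aa as ac ass un le space_on_space[OF S] lin_add[OF ar] lin_smult[OF ar]
        lin_closed[OF ar] intro: ar)
  then show ?thesis using S g by (simp add: concrete_def)
qed

lemma concrete_cocycles: "concrete A X S \<Longrightarrow> cocycles X i = {x \<in> S i. dif X i x = 0}"
  by (simp add: cocycles_def concrete_gr)

lemma concrete_coboundaries: "concrete A X S \<Longrightarrow> coboundaries X i = dif X (i - 1) ` S (i - 1)"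
  by (simp add: coboundaries_def concrete_gr)

lemma concrete_coboundaries_subspace:
  assumes "concrete A X S"
  shows "subspace (coboundaries X i)"
proof -
  interpret X: cochain_complex X by (rule dg_module_cochain[OF concrete_dg_module[OF assms]])
  show ?thesis
    using X.coboundaries_subspace[of i] by (auto simp: concrete_gr[OF assms] linear_subspace_def subspace_def)
qed

lemma concrete_coboundariesI: "concrete A X S \<Longrightarrow> x \<in> S (i - 1) \<Longrightarrow> dif X (i - 1) x \<in> coboundaries X i"
  by (simp add: concrete_coboundaries)

lemma concrete_coboundaryE:
  assumes "concrete A X S" "x \<in> coboundaries X i"
  obtains u where "u \<in> S (i - 1)" "x = dif X (i - 1) u"
  using assms by (auto simp: concrete_coboundaries)

lemma subspace_Times: "subspace S \<Longrightarrow> subspace T \<Longrightarrow> subspace (S \<times> T)"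
  by (auto simp: subspace_def zero_prod_def)

lemma cdif_neg: "concrete A X S \<Longrightarrow> x \<in> S i \<Longrightarrow> dif X i (- x) = - dif X i x"
  using cdif_scale[of A X S x i "- 1"] by (simp add: scaleC_minus_one)

lemma cdif_diff: "concrete A X S \<Longrightarrow> x \<in> S i \<Longrightarrow> y \<in> S i \<Longrightarrow> dif X i (x - y) = dif X i x - dif X i y"
  using cdif_add[of A X S x i "- y"] subspace_neg[OF concrete_subspace, of A X S y i] by (simp add: cdif_neg)

lemma cact_neg: "concrete A X S \<Longrightarrow> x \<in> S i \<Longrightarrow> a \<in> carrier (gr A j) \<Longrightarrow> act X i j (- x) a = - act X i j x a"
  using cact_scale[of A X S x i a j "- 1"] by (simp add: scaleC_minus_one)

lemma cact_diff: "concrete A X S \<Longrightarrow> x \<in> S i \<Longrightarrow> y \<in> S i \<Longrightarrow> a \<in> carrier (gr A j) \<Longrightarrow>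
    act X i j (x - y) a = act X i j x a - act X i j y a"
  using cact_add[of A X S x i "- y" a j] subspace_neg[OF concrete_subspace, of A X S y i] by (simp add: cact_neg)

lemma sign_simps: "sign (i + 1) = - sign i" "sign (i - 1) = - sign i"
  by (simp_all add: power_int_add power_int_diff)

section \<open>Exponential polynomials with values in a vector space\<close>

text \<open>
  For a vector space \<open>S\<close>, the elements of \<open>exp_poly S\<close> are the finite sums of \<open>x * e (l, k)\<close>
  with \<open>x\<close> in \<open>S\<close>, where \<open>e (l, k)\<close> stands for the function \<open>s \<mapsto> s ^ k / fact k * exp (l * s)\<close>.
  If a weight vector \<open>a\<close> of weight \<open>n\<close> acts by \<open>x * f(s) \<mapsto> x a * (exp (n * s) * f(s))\<close>, which is what the
  element \<open>exp s\<close> of the multiplicative group would do, then it takes \<open>e (l, k)\<close> to \<open>e (l + n, k)\<close>.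
\<close>

definition exp_poly :: "'v::complex_vector set \<Rightarrow> (complex \<times> nat \<Rightarrow> 'v) set" where
  "exp_poly S = {y. finite {k. y k \<noteq> 0} \<and> (\<forall>k. y k \<in> S)}"

lemma exp_poly_subspace:
  assumes S: "subspace S"
  shows "subspace (exp_poly S)"
  unfolding subspace_def
proof (intro conjI ballI allI)
  show "0 \<in> exp_poly S" by (simp add: exp_poly_def subspace_0[OF S])
  show "x + y \<in> exp_poly S" if "x \<in> exp_poly S" "y \<in> exp_poly S" for x y
  proof -
    have "{k. (x + y) k \<noteq> 0} \<subseteq> {k. x k \<noteq> 0} \<union> {k. y k \<noteq> 0}" by auto
    then show ?thesis using that finite_subset by (fastforce simp: exp_poly_def subspace_add[OF S])
  qed
  show "c *\<^sub>C x \<in> exp_poly S" if "x \<in> exp_poly S" for x c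
  proof -
    have "{k. (c *\<^sub>C x) k \<noteq> 0} \<subseteq> {k. x k \<noteq> 0}" by auto
    then show ?thesis using that finite_subset by (fastforce simp: exp_poly_def subspace_scale[OF S])
  qed
qed

section \<open>Weights in the algebra\<close>

locale weighted_dg_algebra = equivariant_dg_algebra A r
  for A :: "'a dg_algebra" and r :: "complex \<Rightarrow> int \<Rightarrow> 'a \<Rightarrow> 'a" +
  fixes \<pi> :: "int \<Rightarrow> int \<Rightarrow> 'a \<Rightarrow> 'a"
  assumes projections: "weight_projections (gr A j) (\<lambda>z. r z j) (\<pi> j)"
begin

definition wt :: "int \<Rightarrow> int \<Rightarrow> 'a \<Rightarrow> bool" where
  "wt j n a \<longleftrightarrow> weight_vector (gr A j) (\<lambda>z. r z j) n a"

lemma wt_carrier: "wt j n a \<Longrightarrow> a \<in> carrier (gr A j)"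
  by (simp add: wt_def weight_vector_def)

lemma wt_r: "wt j n a \<Longrightarrow> z \<noteq> 0 \<Longrightarrow> r z j a = z powi n \<odot>\<^bsub>gr A j\<^esub> a"
  by (simp add: wt_def weight_vector_def)

lemma \<pi>_linear: "\<pi> j n \<in> linear_maps (gr A j) (gr A j)"
  using projections[of j] by (simp add: weight_projections_def)

lemma \<pi>_finite: "a \<in> carrier (gr A j) \<Longrightarrow> finite {n. \<pi> j n a \<noteq> \<zero>\<^bsub>gr A j\<^esub>}"
  using projections[of j] by (simp add: weight_projections_def)

lemma \<pi>_wt: "wt j n a \<Longrightarrow> \<pi> j m a = (if m = n then a else \<zero>\<^bsub>gr A j\<^esub>)"
  using projections[of j] by (auto simp: weight_projections_def wt_def)

lemma wt_dif: "wt j n a \<Longrightarrow> wt (j + 1) n (dif A j a)"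
  using dif_equivariant[of _ a j] dif_closed
  by (auto simp: wt_def weight_vector_def lin_smult[OF dif_linear])

lemma mul_closed: "a \<in> carrier (gr A i) \<Longrightarrow> b \<in> carrier (gr A j) \<Longrightarrow> mul A i j a b \<in> carrier (gr A (i + j))"
  using lin_closed[OF mul_linear_right] .

lemma wt_mul:
  assumes "wt i n a" "wt j m b"
  shows "wt (i + j) (n + m) (mul A i j a b)"
proof -
  note a = wt_carrier[OF assms(1)] and b = wt_carrier[OF assms(2)]
  have "r z (i + j) (mul A i j a b) = z powi (n + m) \<odot>\<^bsub>gr A (i + j)\<^esub> mul A i j a b" if z: "z \<noteq> 0" for z
    using z a b vs_smult[OF vector_space b] mul_closed[OF a b]
    by (simp add: mul_equivariant wt_r[OF assms(1)] wt_r[OF assms(2)] lin_smult[OF mul_linear_right]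
        lin_smult[OF mul_linear_left] vs_smult_smult[OF vector_space] power_int_add mult.commute)
  then show ?thesis using mul_closed[OF a b] by (simp add: wt_def weight_vector_def)
qed

lemma wt_unt: "wt 0 0 (unt A)"
  using unt_closed unt_invariant by (simp add: wt_def weight_vector_def vs_one[OF vector_space])

lemma weight_induct [consumes 1, case_names weight add]:
  assumes a: "a \<in> carrier (gr A j)"
    and w: "\<And>n a. wt j n a \<Longrightarrow> P a"
    and p: "\<And>a b. a \<in> carrier (gr A j) \<Longrightarrow> b \<in> carrier (gr A j) \<Longrightarrow> P a \<Longrightarrow> P b \<Longrightarrow> P (a \<oplus>\<^bsub>gr A j\<^esub> b)"
  shows "P a"
proof -
  have "weight_span (gr A j) (\<lambda>z. r z j) a"
    by (rule rational_weight_span[OF vector_space rational a])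
  then have "a \<in> carrier (gr A j) \<and> P a"
  proof induction
    case (weight n x)
    then show ?case using w wt_carrier by (simp add: wt_def[symmetric])
  next
    case (add x y)
    then show ?case using p vs_add[OF vector_space] by blast
  qed
  then show ?thesis ..
qed

text \<open>
  An operation on the algebra that is given on the elements of each weight \<open>n\<close> by a linear map \<open>h n\<close> is
  extended to all elements. Both the action on exponential polynomials and the derivation arise in
  this way, so that their properties need to be checked on elements of a single weight only.
\<close>

definition weight_sum :: "int \<Rightarrow> (int \<Rightarrow> 'a \<Rightarrow> 'v::complex_vector) \<Rightarrow> 'a \<Rightarrow> 'v" where
  "weight_sum j h a = (\<Sum>n\<in>{n. \<pi> j n a \<noteq> \<zero>\<^bsub>gr A j\<^esub>}. h n (\<pi> j n a))"

context
  fixes h :: "int \<Rightarrow> 'a \<Rightarrow> 'v::complex_vector" and j and S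
  assumes S: "subspace S" and h: "\<And>n. h n \<in> linear_maps (gr A j) (space_on S)"
begin

lemma weight_sum_superset:
  assumes "finite F" "{n. \<pi> j n a \<noteq> \<zero>\<^bsub>gr A j\<^esub>} \<subseteq> F"
  shows "weight_sum j h a = (\<Sum>n\<in>F. h n (\<pi> j n a))"
  unfolding weight_sum_def
  by (rule sum.mono_neutral_left) (use assms lin_zero[OF h vector_space space_on_space[OF S]] in auto)

lemma weight_sum_linear: "weight_sum j h \<in> linear_maps (gr A j) (space_on S)"
proof (rule linear_mapsI, unfold space_on_simps)
  fix a assume a: "a \<in> carrier (gr A j)"
  show "weight_sum j h a \<in> S"
    unfolding weight_sum_def using lin_closed[OF h] lin_closed[OF \<pi>_linear a]
    by (intro subspace_sum[OF S]) simp
  fix c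
  let ?F = "{n. \<pi> j n a \<noteq> \<zero>\<^bsub>gr A j\<^esub>}"
  have "{n. \<pi> j n (c \<odot>\<^bsub>gr A j\<^esub> a) \<noteq> \<zero>\<^bsub>gr A j\<^esub>} \<subseteq> ?F"
    using a by (auto simp: lin_smult[OF \<pi>_linear] vs_smult_zero[OF vector_space])
  from weight_sum_superset[OF \<pi>_finite[OF a] this]
  show "weight_sum j h (c \<odot>\<^bsub>gr A j\<^esub> a) = c *\<^sub>C weight_sum j h a"
    using a lin_closed[OF \<pi>_linear a]
    by (simp add: weight_sum_def lin_smult[OF \<pi>_linear] lin_smult[OF h] scaleC_sum_right)
next
  fix a b assume a: "a \<in> carrier (gr A j)" and b: "b \<in> carrier (gr A j)"
  let ?F = "{n. \<pi> j n a \<noteq> \<zero>\<^bsub>gr A j\<^esub>} \<union> {n. \<pi> j n b \<noteq> \<zero>\<^bsub>gr A j\<^esub>}"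
  have F: "finite ?F" using \<pi>_finite a b by simp
  have s: "{n. \<pi> j n (a \<oplus>\<^bsub>gr A j\<^esub> b) \<noteq> \<zero>\<^bsub>gr A j\<^esub>} \<subseteq> ?F"
    using a b by (auto simp: lin_add[OF \<pi>_linear] vs_lzero[OF vector_space] vs_zero[OF vector_space])
  have "weight_sum j h a = (\<Sum>n\<in>?F. h n (\<pi> j n a))" "weight_sum j h b = (\<Sum>n\<in>?F. h n (\<pi> j n b))"
    by (rule weight_sum_superset[OF F], blast)+
  then show "weight_sum j h (a \<oplus>\<^bsub>gr A j\<^esub> b) = weight_sum j h a + weight_sum j h b"
    using a b lin_closed[OF \<pi>_linear a] lin_closed[OF \<pi>_linear b]
    by (simp add: weight_sum_superset[OF F s] lin_add[OF \<pi>_linear] lin_add[OF h] sum.distrib)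
qed

lemma weight_sum_wt:
  assumes "wt j n a"
  shows "weight_sum j h a = h n a"
proof -
  have "{m. \<pi> j m a \<noteq> \<zero>\<^bsub>gr A j\<^esub>} \<subseteq> {n}" using \<pi>_wt[OF assms] by auto
  from weight_sum_superset[OF _ this] show ?thesis by (simp add: \<pi>_wt[OF assms])
qed

end

section \<open>The module of exponential polynomials\<close>

definition exp_act :: "('a, 'v::complex_vector) dg_module \<Rightarrow> int \<Rightarrow> int \<Rightarrow> (complex \<times> nat \<Rightarrow> 'v) \<Rightarrow> 'a \<Rightarrow> complex \<times> nat \<Rightarrow> 'v"
where
  "exp_act X i j y a = (\<lambda>(l, k). weight_sum j (\<lambda>n b. act X i j (y (l - of_int n, k)) b) a)"

definition exp_module :: "('a, 'v::complex_vector) dg_module \<Rightarrow> (int \<Rightarrow> 'v set) \<Rightarrow> ('a, complex \<times> nat \<Rightarrow> 'v) dg_module"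
where
  "exp_module X S =
     \<lparr>gr = \<lambda>i. space_on (exp_poly (S i)), dif = \<lambda>i y k. dif X i (y k), act = exp_act X\<rparr>"

lemma exp_module_simps [simp]:
  "gr (exp_module X S) i = space_on (exp_poly (S i))"
  "dif (exp_module X S) i y k = dif X i (y k)"
  "act (exp_module X S) = exp_act X"
  by (simp_all add: exp_module_def)

context
  fixes X :: "('a, 'v::complex_vector) dg_module" and S
  assumes X: "concrete A X S"
begin

lemma exp_act_linear_at:
  assumes "y \<in> exp_poly (S i)"
  shows "(\<lambda>a. exp_act X i j y a p) \<in> linear_maps (gr A j) (space_on (S (i + j)))"
proof -
  obtain l k where p: "p = (l, k)" by (cases p)
  have "(\<lambda>n b. act X i j (y (l - of_int n, k)) b) n \<in> linear_maps (gr A j) (space_on (S (i + j)))" for n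
    using cact_linear[OF X, of "y (l - of_int n, k)" i "i + j" j] assms by (simp add: exp_poly_def)
  from weight_sum_linear[OF concrete_subspace[OF X] this] show ?thesis by (simp add: exp_act_def p)
qed

lemma exp_act_wt:
  assumes "y \<in> exp_poly (S i)" "wt j n a"
  shows "exp_act X i j y a (l, k) = act X i j (y (l - of_int n, k)) a"
proof -
  have "(\<lambda>n b. act X i j (y (l - of_int n, k)) b) n \<in> linear_maps (gr A j) (space_on (S (i + j)))" for n
    using cact_linear[OF X, of "y (l - of_int n, k)" i "i + j" j] assms by (simp add: exp_poly_def)
  from weight_sum_wt[OF concrete_subspace[OF X] this assms(2)] show ?thesis by (simp add: exp_act_def)
qed

lemma exp_act_add_right:
  assumes "y \<in> exp_poly (S i)" "a \<in> carrier (gr A j)" "b \<in> carrier (gr A j)"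
  shows "exp_act X i j y (a \<oplus>\<^bsub>gr A j\<^esub> b) = exp_act X i j y a + exp_act X i j y b"
proof
  show "exp_act X i j y (a \<oplus>\<^bsub>gr A j\<^esub> b) p = (exp_act X i j y a + exp_act X i j y b) p" for p
    using lin_add[OF exp_act_linear_at[OF assms(1)] assms(2,3), of p] by simp
qed

lemma exp_act_closed:
  assumes y: "y \<in> exp_poly (S i)" and a: "a \<in> carrier (gr A j)"
  shows "exp_act X i j y a \<in> exp_poly (S (i + j))"
proof -
  have "finite {p. exp_act X i j y a p \<noteq> 0}"
    using a
  proof (induction rule: weight_induct)
    case (weight n a)
    have "{p. exp_act X i j y a p \<noteq> 0} \<subseteq> (\<lambda>(l, k). (l + of_int n, k)) ` {p. y p \<noteq> 0}"
    proof
      fix p assume p: "p \<in> {p. exp_act X i j y a p \<noteq> 0}"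
      obtain l k where lk: "p = (l, k)" by (cases p)
      have "y (l - of_int n, k) \<noteq> 0"
        using p exp_act_wt[OF y weight] cact_zero[OF X wt_carrier[OF weight]] by (auto simp: lk)
      then show "p \<in> (\<lambda>(l, k). (l + of_int n, k)) ` {p. y p \<noteq> 0}"
        by (intro image_eqI[of _ _ "(l - of_int n, k)"]) (auto simp: lk)
    qed
    moreover have "finite {p. y p \<noteq> 0}" using y by (simp add: exp_poly_def)
    ultimately show ?case using finite_surj by blast
  next
    case (add a b)
    have "{p. (exp_act X i j y a + exp_act X i j y b) p \<noteq> 0} \<subseteq>
        {p. exp_act X i j y a p \<noteq> 0} \<union> {p. exp_act X i j y b p \<noteq> 0}" by auto
    then show ?case using add finite_subset by (fastforce simp: exp_act_add_right[OF y add.hyps])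
  qed
  moreover have "exp_act X i j y a p \<in> S (i + j)" for p
    using lin_closed[OF exp_act_linear_at[OF y] a] by simp
  ultimately show ?thesis by (simp add: exp_poly_def)
qed

lemma exp_act_linear: "y \<in> exp_poly (S i) \<Longrightarrow> exp_act X i j y \<in> linear_maps (gr A j) (space_on (exp_poly (S (i + j))))"
  by (rule linear_mapsI)
    (auto simp: exp_act_closed exp_act_add_right fun_eq_iff lin_smult[OF exp_act_linear_at])

lemma exp_dif_closed: "y \<in> exp_poly (S i) \<Longrightarrow> (\<lambda>k. dif X i (y k)) \<in> exp_poly (S (i + 1))"
proof -
  assume y: "y \<in> exp_poly (S i)"
  have "{k. dif X i (y k) \<noteq> 0} \<subseteq> {k. y k \<noteq> 0}" using cdif_zero[OF X] by auto
  then show ?thesis using y finite_subset by (fastforce simp: exp_poly_def cdif_closed[OF X])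
qed

lemma exp_poly_at: "y \<in> exp_poly (S i) \<Longrightarrow> y p \<in> S i"
  by (cases p) (simp add: exp_poly_def)

lemma exp_act_add_left:
  assumes "x \<in> exp_poly (S i)" "y \<in> exp_poly (S i)" "a \<in> carrier (gr A j)"
  shows "exp_act X i j (x + y) a = exp_act X i j x a + exp_act X i j y a"
  using assms(3)
proof (induction rule: weight_induct)
  note xy = subspace_add[OF exp_poly_subspace[OF concrete_subspace[OF X]] assms(1,2)]
  {
    case (weight n a)
    show ?case
    proof
      fix p :: "complex \<times> nat"
      obtain l k where p: "p = (l, k)" by (cases p)
      show "exp_act X i j (x + y) a p = (exp_act X i j x a + exp_act X i j y a) p"
        by (simp add: p exp_act_wt[OF xy weight] exp_act_wt[OF assms(1) weight] exp_act_wt[OF assms(2) weight]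
            cact_add[OF X exp_poly_at[OF assms(1)] exp_poly_at[OF assms(2)] wt_carrier[OF weight]])
    qed
  next
    case (add a b)
    show ?case
      unfolding exp_act_add_right[OF xy add.hyps] exp_act_add_right[OF assms(1) add.hyps]
        exp_act_add_right[OF assms(2) add.hyps] add.IH by (simp only: add_ac)
  }
qed

lemma exp_act_scale_left:
  assumes "x \<in> exp_poly (S i)" "a \<in> carrier (gr A j)"
  shows "exp_act X i j (c *\<^sub>C x) a = c *\<^sub>C exp_act X i j x a"
  using assms(2)
proof (induction rule: weight_induct)
  note cx = subspace_scale[OF exp_poly_subspace[OF concrete_subspace[OF X]] assms(1)]
  {
    case (weight n a)
    show ?case
    proof
      fix p :: "complex \<times> nat"
      obtain l k where p: "p = (l, k)" by (cases p)
      show "exp_act X i j (c *\<^sub>C x) a p = (c *\<^sub>C exp_act X i j x a) p"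
        by (simp add: p exp_act_wt[OF cx weight] exp_act_wt[OF assms(1) weight]
            cact_scale[OF X exp_poly_at[OF assms(1)] wt_carrier[OF weight]])
    qed
  next
    case (add a b)
    show ?case
      unfolding exp_act_add_right[OF cx add.hyps] exp_act_add_right[OF assms(1) add.hyps] add.IH
      by (simp only: scaleC_add_right)
  }
qed

lemma exp_act_assoc:
  assumes y: "y \<in> exp_poly (S i)" and a: "a \<in> carrier (gr A j)" and b: "b \<in> carrier (gr A k)"
  shows "exp_act X (i + j) k (exp_act X i j y a) b = exp_act X i (j + k) y (mul A j k a b)"
  using a
proof (induction rule: weight_induct)
  case (add a a')
  have "exp_act X (i + j) k (exp_act X i j y (a \<oplus>\<^bsub>gr A j\<^esub> a')) b =
      exp_act X (i + j) k (exp_act X i j y a + exp_act X i j y a') b"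
    by (simp only: exp_act_add_right[OF y add.hyps])
  also have "\<dots> = exp_act X (i + j) k (exp_act X i j y a) b + exp_act X (i + j) k (exp_act X i j y a') b"
    by (rule exp_act_add_left[OF exp_act_closed[OF y add.hyps(1)] exp_act_closed[OF y add.hyps(2)] b])
  also have "\<dots> = exp_act X i (j + k) y (mul A j k (a \<oplus>\<^bsub>gr A j\<^esub> a') b)"
    by (simp only: add.IH lin_add[OF mul_linear_left[OF b] add.hyps]
        exp_act_add_right[OF y mul_closed[OF add.hyps(1) b] mul_closed[OF add.hyps(2) b]])
  finally show ?case .
next
  case (weight n a)
  note a = wt_carrier[OF weight]
  show ?case
    using b
  proof (induction rule: weight_induct)
    case (add b b')
    then show ?case
      using y a by (simp add: exp_act_add_right exp_act_closed lin_add[OF mul_linear_right] mul_closed)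
  next
    case b: (weight m b)
    show ?case
    proof
      fix p :: "complex \<times> nat"
      obtain l q where p: "p = (l, q)" by (cases p)
      have "exp_act X (i + j) k (exp_act X i j y a) b p = act X (i + j) k (act X i j (y (l - of_int m - of_int n, q)) a) b"
        by (simp add: p exp_act_wt[OF exp_act_closed[OF y a] b] exp_act_wt[OF y weight])
      also have "\<dots> = act X i (j + k) (y (l - of_int (n + m), q)) (mul A j k a b)"
        by (simp add: cact_assoc[OF X exp_poly_at[OF y] a wt_carrier[OF b] refl] algebra_simps)
      also have "\<dots> = exp_act X i (j + k) y (mul A j k a b) p"
        by (simp add: p exp_act_wt[OF y wt_mul[OF weight b]])
      finally show "exp_act X (i + j) k (exp_act X i j y a) b p = exp_act X i (j + k) y (mul A j k a b) p" .
    qed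
  qed
qed

lemma exp_act_leibniz:
  assumes y: "y \<in> exp_poly (S i)" and a: "a \<in> carrier (gr A j)"
  shows "(\<lambda>k. dif X (i + j) (exp_act X i j y a k)) =
    exp_act X (i + 1) j (\<lambda>k. dif X i (y k)) a + sign i *\<^sub>C exp_act X i (j + 1) y (dif A j a)"
  using a
proof (induction rule: weight_induct)
  case (weight n a)
  show ?case
  proof
    fix p :: "complex \<times> nat"
    obtain l q where p: "p = (l, q)" by (cases p)
    show "dif X (i + j) (exp_act X i j y a p) =
      (exp_act X (i + 1) j (\<lambda>k. dif X i (y k)) a + sign i *\<^sub>C exp_act X i (j + 1) y (dif A j a)) p"
      using cact_leibniz[OF X exp_poly_at[OF y] wt_carrier[OF weight] refl]
      by (simp add: p exp_act_wt[OF y weight] exp_act_wt[OF y wt_dif[OF weight]]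
          exp_act_wt[OF exp_dif_closed[OF y] weight])
  qed
next
  case (add a b)
  have "(\<lambda>k. dif X (i + j) (exp_act X i j y (a \<oplus>\<^bsub>gr A j\<^esub> b) k)) =
      (\<lambda>k. dif X (i + j) (exp_act X i j y a k)) + (\<lambda>k. dif X (i + j) (exp_act X i j y b k))"
    using add.hyps y exp_poly_at[OF exp_act_closed]
    by (simp add: fun_eq_iff exp_act_add_right cdif_add[OF X] exp_act_closed exp_poly_def)
  then show ?case
    unfolding add.IH exp_act_add_right[OF exp_dif_closed[OF y] add.hyps] lin_add[OF dif_linear add.hyps]
        exp_act_add_right[OF y dif_closed[OF add.hyps(1)] dif_closed[OF add.hyps(2)]] scaleC_add_right
    by (simp only: add_ac)
qed

lemma exp_module_concrete: "concrete A (exp_module X S) (\<lambda>i. exp_poly (S i))"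
proof (rule concreteI)
  show "dg_algebra A" by (rule dg_algebra_axioms)
  show "subspace (exp_poly (S i))" for i by (rule exp_poly_subspace[OF concrete_subspace[OF X]])
  show "gr (exp_module X S) i = space_on (exp_poly (S i))" for i by simp
  have d: "dif (exp_module X S) i y = (\<lambda>k. dif X i (y k))" for i y by (simp add: fun_eq_iff)
  show "dif (exp_module X S) i x \<in> exp_poly (S (i + 1))" if "x \<in> exp_poly (S i)" for i x
    unfolding d by (rule exp_dif_closed[OF that])
  show "dif (exp_module X S) i (x + y) = dif (exp_module X S) i x + dif (exp_module X S) i y"
    if "x \<in> exp_poly (S i)" "y \<in> exp_poly (S i)" for i x y
    using that by (simp add: fun_eq_iff cdif_add[OF X] exp_poly_at)
  show "dif (exp_module X S) i (c *\<^sub>C x) = c *\<^sub>C dif (exp_module X S) i x" if "x \<in> exp_poly (S i)" for i x c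
    using that by (simp add: fun_eq_iff cdif_scale[OF X] exp_poly_at)
  show "dif (exp_module X S) (i + 1) (dif (exp_module X S) i x) = 0" if "x \<in> exp_poly (S i)" for i x
    using that by (simp add: fun_eq_iff cdif_dif[OF X] exp_poly_at)
  show "act (exp_module X S) i 0 x (unt A) = x" if "x \<in> exp_poly (S i)" for i x
    using that by (auto simp: fun_eq_iff exp_act_wt[OF _ wt_unt] cact_unt[OF X] exp_poly_at)
  show "dif (exp_module X S) (i + j) (act (exp_module X S) i j x a) =
      act (exp_module X S) (i + 1) j (dif (exp_module X S) i x) a +
      sign i *\<^sub>C act (exp_module X S) i (j + 1) x (dif A j a)"
    if "x \<in> exp_poly (S i)" "a \<in> carrier (gr A j)" for i j x a
    unfolding d exp_module_simps by (rule exp_act_leibniz[OF that])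
qed (simp_all add: exp_act_add_left exp_act_scale_left exp_act_linear exp_act_assoc)

end

section \<open>The Atiyah extension\<close>

text \<open>
  The derivation of the algebra given by the infinitesimal action multiplies elements of weight
  \<open>n\<close> by \<open>n\<close>. \<open>euler_act X i j x a\<close> is \<open>x\<close> times the derivative of \<open>a\<close>.
\<close>

definition euler_act :: "('a, 'v::complex_vector) dg_module \<Rightarrow> int \<Rightarrow> int \<Rightarrow> 'v \<Rightarrow> 'a \<Rightarrow> 'v" where
  "euler_act X i j x a = weight_sum j (\<lambda>n b. of_int n *\<^sub>C act X i j x b) a"

context
  fixes X :: "('a, 'v::complex_vector) dg_module" and S
  assumes X: "concrete A X S"
begin

lemma
  assumes x: "x \<in> S i"
  shows euler_act_linear: "euler_act X i j x \<in> linear_maps (gr A j) (space_on (S (i + j)))"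
    and euler_act_wt: "wt j n a \<Longrightarrow> euler_act X i j x a = of_int n *\<^sub>C act X i j x a"
proof -
  have "(\<lambda>n b. of_int n *\<^sub>C act X i j x b) n \<in> linear_maps (gr A j) (space_on (S (i + j)))" for n
    using cact_linear[OF X x refl, of j] subspace_scale[OF concrete_subspace[OF X]]
    by (auto simp: linear_maps_def Pi_iff scaleC_simps mult.commute)
  from weight_sum_linear[OF concrete_subspace[OF X] this] weight_sum_wt[OF concrete_subspace[OF X] this]
  show "euler_act X i j x \<in> linear_maps (gr A j) (space_on (S (i + j)))"
    and "wt j n a \<Longrightarrow> euler_act X i j x a = of_int n *\<^sub>C act X i j x a"
    by (simp_all add: euler_act_def[abs_def])
qed

lemma euler_act_add_right:
  "x \<in> S i \<Longrightarrow> a \<in> carrier (gr A j) \<Longrightarrow> b \<in> carrier (gr A j) \<Longrightarrow>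
    euler_act X i j x (a \<oplus>\<^bsub>gr A j\<^esub> b) = euler_act X i j x a + euler_act X i j x b"
  using lin_add[OF euler_act_linear] by simp

lemma euler_act_closed: "x \<in> S i \<Longrightarrow> a \<in> carrier (gr A j) \<Longrightarrow> k = i + j \<Longrightarrow> euler_act X i j x a \<in> S k"
  using lin_closed[OF euler_act_linear] by simp

lemma cact_add_right:
  "x \<in> S i \<Longrightarrow> a \<in> carrier (gr A j) \<Longrightarrow> b \<in> carrier (gr A j) \<Longrightarrow>
    act X i j x (a \<oplus>\<^bsub>gr A j\<^esub> b) = act X i j x a + act X i j x b"
  using lin_add[OF cact_linear[OF X _ refl]] by simp

lemma euler_act_add_left:
  assumes "x \<in> S i" "y \<in> S i" "a \<in> carrier (gr A j)"
  shows "euler_act X i j (x + y) a = euler_act X i j x a + euler_act X i j y a"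
  using assms(3)
proof (induction rule: weight_induct)
  case (weight n a)
  then show ?case
    using assms(1,2) subspace_add[OF concrete_subspace[OF X] assms(1,2)] wt_carrier[OF weight]
    by (simp add: euler_act_wt cact_add[OF X] scaleC_add_right)
next
  case (add a b)
  then show ?case
    using assms(1,2) subspace_add[OF concrete_subspace[OF X] assms(1,2)] by (simp add: euler_act_add_right)
qed

lemma euler_act_scale_left:
  assumes "x \<in> S i" "a \<in> carrier (gr A j)"
  shows "euler_act X i j (c *\<^sub>C x) a = c *\<^sub>C euler_act X i j x a"
  using assms(2)
proof (induction rule: weight_induct)
  case (weight n a)
  then show ?case
    using assms(1) subspace_scale[OF concrete_subspace[OF X] assms(1)] wt_carrier[OF weight]
    by (simp add: euler_act_wt cact_scale[OF X] mult.commute)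
next
  case (add a b)
  then show ?case
    using assms(1) subspace_scale[OF concrete_subspace[OF X] assms(1)]
    by (simp add: euler_act_add_right scaleC_add_right)
qed

lemma euler_act_assoc:
  assumes x: "x \<in> S i" and a: "a \<in> carrier (gr A j)" and b: "b \<in> carrier (gr A k)"
  shows "euler_act X i (j + k) x (mul A j k a b) =
    act X (i + j) k (euler_act X i j x a) b + euler_act X (i + j) k (act X i j x a) b"
  using a
proof (induction rule: weight_induct)
  case (add a a')
  then show ?case
    using x b by (simp add: euler_act_add_right lin_add[OF mul_linear_left] mul_closed cact_add_right
        cact_add[OF X] cact_closed[OF X] euler_act_closed euler_act_add_left)
next
  case (weight n a)
  note a = wt_carrier[OF weight]
  show ?case
    using b
  proof (induction rule: weight_induct)
    case (add b b')
    then show ?case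
      using x a by (simp add: euler_act_add_right lin_add[OF mul_linear_right] mul_closed cact_add_right
          cact_closed[OF X] euler_act_closed)
  next
    case b: (weight m b)
    then show ?case
      using x a wt_carrier[OF b]
      by (simp add: euler_act_wt[OF x weight] euler_act_wt[OF x wt_mul[OF weight b]]
          euler_act_wt[OF cact_closed[OF X x a refl] b] cact_scale[OF X] cact_closed[OF X]
          cact_assoc[OF X] scaleC_add_left)
  qed
qed

lemma euler_act_leibniz:
  assumes x: "x \<in> S i" and a: "a \<in> carrier (gr A j)"
  shows "dif X (i + j) (euler_act X i j x a) =
    euler_act X (i + 1) j (dif X i x) a + sign i *\<^sub>C euler_act X i (j + 1) x (dif A j a)"
  using a
proof (induction rule: weight_induct)
  case (weight n a)
  show ?case
    using cact_leibniz[OF X x wt_carrier[OF weight] refl] wt_carrier[OF weight]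
    by (simp add: euler_act_wt[OF x weight] euler_act_wt[OF x wt_dif[OF weight]] cdif_scale[OF X]
        euler_act_wt[OF cdif_closed[OF X x refl] weight] cact_closed[OF X x] scaleC_add_right mult.commute)
next
  case (add a b)
  then show ?case
    using x by (simp add: euler_act_add_right cdif_add[OF X] euler_act_closed cdif_closed[OF X]
        lin_add[OF dif_linear] dif_closed scaleC_add_right)
qed

lemma euler_act_unt: "x \<in> S i \<Longrightarrow> euler_act X i 0 x (unt A) = 0"
  by (simp add: euler_act_wt[OF _ wt_unt])

end

text \<open>
  The Atiyah extension of \<open>X\<close> by itself is the sum of two copies of \<open>X\<close> with the action
  \<open>(x, y) a = (x a, y a + x (E a))\<close>, where \<open>E\<close> is the derivation; its splittings are the connections on \<open>X\<close>.
  The following module is the total complex of the short exact sequence of this extension, so it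
  is acyclic. The first and the last component are the copies of \<open>X\<close> that occur as the submodule
  and as the quotient in this sequence.
\<close>

definition atiyah_complex ::
  "('a, 'v::complex_vector) dg_module \<Rightarrow> (int \<Rightarrow> 'v set) \<Rightarrow> ('a, 'v \<times> 'v \<times> 'v \<times> 'v) dg_module"
where
  "atiyah_complex X S =
     \<lparr>gr = \<lambda>i. space_on (S (i + 1) \<times> S i \<times> S i \<times> S (i - 1)),
      dif = \<lambda>i (u, x, y, v). (- dif X (i + 1) u, dif X i x, dif X i y + u, x - dif X (i - 1) v),
      act = \<lambda>i j (u, x, y, v) a.
        (act X (i + 1) j u a, act X i j x a, act X i j y a + euler_act X i j x a, act X (i - 1) j v a)\<rparr>"

lemma atiyah_complex_simps [simp]:
  "gr (atiyah_complex X S) i = space_on (S (i + 1) \<times> S i \<times> S i \<times> S (i - 1))"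
  "dif (atiyah_complex X S) i (u, x, y, v) =
     (- dif X (i + 1) u, dif X i x, dif X i y + u, x - dif X (i - 1) v)"
  "act (atiyah_complex X S) i j (u, x, y, v) a =
     (act X (i + 1) j u a, act X i j x a, act X i j y a + euler_act X i j x a, act X (i - 1) j v a)"
  by (simp_all add: atiyah_complex_def)

lemma atiyah_complex_concrete:
  assumes X: "concrete A X S"
  shows "concrete A (atiyah_complex X S) (\<lambda>i. S (i + 1) \<times> S i \<times> S i \<times> S (i - 1))"
proof (rule concreteI)
  note S = concrete_subspace[OF X]
  note [simp] = subspace_add[OF S] subspace_neg[OF S] subspace_diff[OF S] subspace_scale[OF S]
    cdif_closed[OF X] cact_closed[OF X] euler_act_closed[OF X]
  show "dg_algebra A" by (rule dg_algebra_axioms)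
  show "subspace (S (i + 1) \<times> S i \<times> S i \<times> S (i - 1))" for i by (intro subspace_Times S)
  show "gr (atiyah_complex X S) i = space_on (S (i + 1) \<times> S i \<times> S i \<times> S (i - 1))" for i by simp
  show "dif (atiyah_complex X S) i p \<in> S (i + 1 + 1) \<times> S (i + 1) \<times> S (i + 1) \<times> S (i + 1 - 1)"
    if "p \<in> S (i + 1) \<times> S i \<times> S i \<times> S (i - 1)" for i p
    using that by auto
  show "dif (atiyah_complex X S) i (p + p') = dif (atiyah_complex X S) i p + dif (atiyah_complex X S) i p'"
    if "p \<in> S (i + 1) \<times> S i \<times> S i \<times> S (i - 1)" "p' \<in> S (i + 1) \<times> S i \<times> S i \<times> S (i - 1)" for i p p'
    using that by (auto simp: cdif_add[OF X])
  show "dif (atiyah_complex X S) i (c *\<^sub>C p) = c *\<^sub>C dif (atiyah_complex X S) i p"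
    if "p \<in> S (i + 1) \<times> S i \<times> S i \<times> S (i - 1)" for i p c
    using that by (auto simp: cdif_scale[OF X] scaleC_simps)
  show "dif (atiyah_complex X S) (i + 1) (dif (atiyah_complex X S) i p) = 0"
    if "p \<in> S (i + 1) \<times> S i \<times> S i \<times> S (i - 1)" for i p
    using that by (auto simp: cdif_add[OF X] cdif_diff[OF X] cdif_neg[OF X] cdif_dif[OF X] zero_prod_def)
  show "act (atiyah_complex X S) i j (p + p') a = act (atiyah_complex X S) i j p a + act (atiyah_complex X S) i j p' a"
    if "p \<in> S (i + 1) \<times> S i \<times> S i \<times> S (i - 1)" "p' \<in> S (i + 1) \<times> S i \<times> S i \<times> S (i - 1)"
      "a \<in> carrier (gr A j)" for i j p p' a
    using that by (auto simp: cact_add[OF X] euler_act_add_left[OF X])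
  show "act (atiyah_complex X S) i j (c *\<^sub>C p) a = c *\<^sub>C act (atiyah_complex X S) i j p a"
    if "p \<in> S (i + 1) \<times> S i \<times> S i \<times> S (i - 1)" "a \<in> carrier (gr A j)" for i j p a c
    using that by (auto simp: cact_scale[OF X] euler_act_scale_left[OF X] scaleC_simps)
  show "act (atiyah_complex X S) i j p \<in>
      linear_maps (gr A j) (space_on (S (i + j + 1) \<times> S (i + j) \<times> S (i + j) \<times> S (i + j - 1)))"
    if "p \<in> S (i + 1) \<times> S i \<times> S i \<times> S (i - 1)" for i j p
    using that lin_smult[OF cact_linear[OF X _ refl]] lin_smult[OF euler_act_linear[OF X]]
    by (intro linear_mapsI)
      (auto simp: cact_add_right[OF X] euler_act_add_right[OF X] scaleC_simps)
  show "act (atiyah_complex X S) (i + j) k (act (atiyah_complex X S) i j p a) b =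
      act (atiyah_complex X S) i (j + k) p (mul A j k a b)"
    if "p \<in> S (i + 1) \<times> S i \<times> S i \<times> S (i - 1)" "a \<in> carrier (gr A j)" "b \<in> carrier (gr A k)" for i j k p a b
    using that by (auto simp: cact_assoc[OF X] euler_act_assoc[OF X] cact_add[OF X] add.assoc)
  show "act (atiyah_complex X S) i 0 p (unt A) = p" if "p \<in> S (i + 1) \<times> S i \<times> S i \<times> S (i - 1)" for i p
    using that by (auto simp: cact_unt[OF X] euler_act_unt[OF X])
  show "dif (atiyah_complex X S) (i + j) (act (atiyah_complex X S) i j p a) =
      act (atiyah_complex X S) (i + 1) j (dif (atiyah_complex X S) i p) a +
      sign i *\<^sub>C act (atiyah_complex X S) i (j + 1) p (dif A j a)"
    if p: "p \<in> S (i + 1) \<times> S i \<times> S i \<times> S (i - 1)" and a: "a \<in> carrier (gr A j)" for i j p a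
  proof -
    obtain u x y v where p': "p = (u, x, y, v)" and m: "u \<in> S (i + 1)" "x \<in> S i" "y \<in> S i" "v \<in> S (i - 1)"
      using p by auto
    have 1: "dif X (i + j + 1) (act X (i + 1) j u a) =
        act X (i + 1 + 1) j (dif X (i + 1) u) a - sign i *\<^sub>C act X (i + 1) (j + 1) u (dif A j a)"
      by (subst cact_leibniz[OF X m(1) a]) (simp_all add: sign_simps scaleC_minus_left)
    have 2: "dif X (i + j - 1) (act X (i - 1) j v a) =
        act X i j (dif X (i - 1) v) a - sign i *\<^sub>C act X (i - 1) (j + 1) v (dif A j a)"
      by (subst cact_leibniz[OF X m(4) a]) (simp_all add: sign_simps scaleC_minus_left)
    show ?thesis
      using m a
      by (simp add: p' 1 2 cact_leibniz[OF X _ a refl] euler_act_leibniz[OF X _ a] cdif_add[OF X] cact_neg[OF X]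
          cact_add[OF X] cact_diff[OF X] scaleC_simps euler_act_add_left[OF X])
  qed
qed

lemma atiyah_complex_acyclic:
  assumes X: "concrete A X S"
  shows "cocycles (atiyah_complex X S) i \<subseteq> coboundaries (atiyah_complex X S) i"
proof
  fix p assume p: "p \<in> cocycles (atiyah_complex X S) i"
  then obtain u x y v where p': "p = (u, x, y, v)" and m: "u \<in> S (i + 1)" "x \<in> S i" "y \<in> S i" "v \<in> S (i - 1)"
    by (auto simp: cocycles_def)
  have d: "dif X i y + u = 0" "x - dif X (i - 1) v = 0" using p by (auto simp: p' cocycles_def zero_prod_def)
  have "p = dif (atiyah_complex X S) (i - 1) (y, v, 0, 0)"
    using d by (simp add: p' cdif_zero[OF X] eq_neg_iff_add_eq_0 add.commute)
  moreover have "(y, v, 0, 0) \<in> S (i - 1 + 1) \<times> S (i - 1) \<times> S (i - 1) \<times> S (i - 1 - 1)"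
    using m subspace_0[OF concrete_subspace[OF X]] by simp
  ultimately show "p \<in> coboundaries (atiyah_complex X S) i"
    unfolding coboundaries_def by (auto simp del: atiyah_complex_simps(2))
qed

end

section \<open>The homotopy fibre of a homomorphism\<close>

definition homotopy_fibre ::
  "('a, 'v) dg_module \<Rightarrow> (int \<Rightarrow> 'v::complex_vector set) \<Rightarrow> ('a, 'w) dg_module \<Rightarrow> (int \<Rightarrow> 'w::complex_vector set) \<Rightarrow>
    (int \<Rightarrow> 'v \<Rightarrow> 'w) \<Rightarrow> ('a, 'v \<times> 'w) dg_module"
where
  "homotopy_fibre X S Y T f =
     \<lparr>gr = \<lambda>i. space_on (S i \<times> T (i - 1)),
      dif = \<lambda>i (x, y). (dif X i x, f i x - dif Y (i - 1) y),
      act = \<lambda>i j (x, y) a. (act X i j x a, act Y (i - 1) j y a)\<rparr>"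

lemma homotopy_fibre_simps [simp]:
  "gr (homotopy_fibre X S Y T f) i = space_on (S i \<times> T (i - 1))"
  "dif (homotopy_fibre X S Y T f) i (x, y) = (dif X i x, f i x - dif Y (i - 1) y)"
  "act (homotopy_fibre X S Y T f) i j (x, y) a = (act X i j x a, act Y (i - 1) j y a)"
  by (simp_all add: homotopy_fibre_def)

lemma homotopy_fibre_concrete:
  assumes X: "concrete A X S" and Y: "concrete A Y T" and f: "dg_hom A X Y f"
  shows "concrete A (homotopy_fibre X S Y T f) (\<lambda>i. S i \<times> T (i - 1))"
proof (rule concreteI)
  interpret X: dg_module A X by (rule concrete_dg_module[OF X])
  note fl = dg_hom_linear[OF f, unfolded concrete_gr[OF X] concrete_gr[OF Y]]
  note fadd = lin_add[OF fl, unfolded space_on_simps] and fs = lin_smult[OF fl, unfolded space_on_simps]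
    and fc = lin_closed[OF fl, unfolded space_on_simps]
    and fd = dg_hom_dif[OF f, unfolded concrete_gr[OF X] space_on_simps]
    and fa = dg_hom_act[OF f, unfolded concrete_gr[OF X] space_on_simps]
  note S = concrete_subspace[OF X] and T = concrete_subspace[OF Y]
  note [simp] = subspace_add[OF S] subspace_neg[OF S] subspace_diff[OF S] subspace_scale[OF S]
    subspace_add[OF T] subspace_neg[OF T] subspace_diff[OF T] subspace_scale[OF T]
    cdif_closed[OF X] cact_closed[OF X] cdif_closed[OF Y] cact_closed[OF Y] fc
  let ?F = "homotopy_fibre X S Y T f"
  show "dg_algebra A" by (rule X.dg_algebra_axioms)
  show "subspace (S i \<times> T (i - 1))" for i by (intro subspace_Times S T)
  show "gr ?F i = space_on (S i \<times> T (i - 1))" for i by simp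
  show "dif ?F i p \<in> S (i + 1) \<times> T (i + 1 - 1)" if "p \<in> S i \<times> T (i - 1)" for i p
    using that by auto
  show "dif ?F i (p + p') = dif ?F i p + dif ?F i p'"
    if "p \<in> S i \<times> T (i - 1)" "p' \<in> S i \<times> T (i - 1)" for i p p'
    using that by (auto simp: cdif_add[OF X] cdif_add[OF Y] fadd)
  show "dif ?F i (c *\<^sub>C p) = c *\<^sub>C dif ?F i p" if "p \<in> S i \<times> T (i - 1)" for i p c
    using that by (auto simp: cdif_scale[OF X] cdif_scale[OF Y] fs scaleC_simps)
  show "dif ?F (i + 1) (dif ?F i p) = 0" if "p \<in> S i \<times> T (i - 1)" for i p
    using that by (auto simp: cdif_dif[OF X] cdif_dif[OF Y] cdif_diff[OF Y] fd zero_prod_def)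
  show "act ?F i j (p + p') a = act ?F i j p a + act ?F i j p' a"
    if "p \<in> S i \<times> T (i - 1)" "p' \<in> S i \<times> T (i - 1)" "a \<in> carrier (gr A j)" for i j p p' a
    using that by (auto simp: cact_add[OF X] cact_add[OF Y])
  show "act ?F i j (c *\<^sub>C p) a = c *\<^sub>C act ?F i j p a"
    if "p \<in> S i \<times> T (i - 1)" "a \<in> carrier (gr A j)" for i j p a c
    using that by (auto simp: cact_scale[OF X] cact_scale[OF Y])
  show "act ?F i j p \<in> linear_maps (gr A j) (space_on (S (i + j) \<times> T (i + j - 1)))"
    if "p \<in> S i \<times> T (i - 1)" for i j p
    using that lin_smult[OF cact_linear[OF X _ refl]] lin_smult[OF cact_linear[OF Y _ refl]]
      lin_add[OF cact_linear[OF X _ refl]] lin_add[OF cact_linear[OF Y _ refl]]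
    by (intro linear_mapsI) auto
  show "act ?F (i + j) k (act ?F i j p a) b = act ?F i (j + k) p (mul A j k a b)"
    if "p \<in> S i \<times> T (i - 1)" "a \<in> carrier (gr A j)" "b \<in> carrier (gr A k)" for i j k p a b
    using that by (auto simp: cact_assoc[OF X] cact_assoc[OF Y])
  show "act ?F i 0 p (unt A) = p" if "p \<in> S i \<times> T (i - 1)" for i p
    using that by (auto simp: cact_unt[OF X] cact_unt[OF Y])
  show "dif ?F (i + j) (act ?F i j p a) = act ?F (i + 1) j (dif ?F i p) a + sign i *\<^sub>C act ?F i (j + 1) p (dif A j a)"
    if p: "p \<in> S i \<times> T (i - 1)" and a: "a \<in> carrier (gr A j)" for i j p a
  proof -
    obtain x y where p': "p = (x, y)" and m: "x \<in> S i" "y \<in> T (i - 1)" using p by auto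
    have 2: "dif Y (i + j - 1) (act Y (i - 1) j y a) =
        act Y i j (dif Y (i - 1) y) a - sign i *\<^sub>C act Y (i - 1) (j + 1) y (dif A j a)"
      by (subst cact_leibniz[OF Y m(2) a]) (simp_all add: sign_simps scaleC_minus_left)
    show ?thesis
      using m a by (simp add: p' 2 cact_leibniz[OF X _ a refl] cact_diff[OF Y] scaleC_simps fa)
  qed
qed

section \<open>Lifting along h-projective modules\<close>

lemma dg_hom_cocycles:
  assumes "dg_hom A X Y f" "dg_module A X" "dg_module A Y" "x \<in> cocycles X i"
  shows "f i x \<in> cocycles Y i"
proof -
  interpret X: cochain_complex X by (rule dg_module_cochain[OF assms(2)])
  interpret Y: cochain_complex Y by (rule dg_module_cochain[OF assms(3)])
  show ?thesis
    using assms(4) dg_hom_closed[OF assms(1)] dg_hom_dif[OF assms(1), of x i]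
      lin_zero[OF dg_hom_linear[OF assms(1)] X.vector_space Y.vector_space] by (auto simp: cocycles_def)
qed

lemma dg_hom_coboundaries:
  assumes "dg_hom A X Y f" "x \<in> coboundaries X i"
  shows "f i x \<in> coboundaries Y i"
  using assms(2) dg_hom_closed[OF assms(1)] dg_hom_dif[OF assms(1), of _ "i - 1"]
  by (auto simp: coboundaries_def)

lemma dg_hom_comp:
  assumes f: "dg_hom A X Y f" and g: "dg_hom A Y Z g"
  shows "dg_hom A X Z (\<lambda>i x. g i (f i x))"
  unfolding dg_hom_def
proof (intro conjI allI ballI)
  show "(\<lambda>x. g i (f i x)) \<in> linear_maps (gr X i) (gr Z i)" for i
    by (rule lin_comp[OF dg_hom_linear[OF f] dg_hom_linear[OF g]])
qed (simp_all add: dg_hom_dif[OF f] dg_hom_dif[OF g] dg_hom_act[OF f] dg_hom_act[OF g] dg_hom_closed[OF f])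

lemma cohomology_bijective_comp:
  assumes X: "dg_module A X" and Y: "dg_module A Y" and Z: "dg_module A Z"
    and f: "dg_hom A X Y f" "cohomology_bijective X Y f" and g: "dg_hom A Y Z g" "cohomology_bijective Y Z g"
  shows "cohomology_bijective X Z (\<lambda>i x. g i (f i x))"
  unfolding cohomology_bijective_def
proof (intro conjI allI ballI impI)
  fix i x assume "x \<in> cocycles X i" "g i (f i x) \<in> coboundaries Z i"
  then show "x \<in> coboundaries X i"
    using f(2) g(2) dg_hom_cocycles[OF f(1) X Y] unfolding cohomology_bijective_def by blast
next
  interpret Y: cochain_complex Y by (rule dg_module_cochain[OF Y])
  interpret Z: cochain_complex Z by (rule dg_module_cochain[OF Z])
  fix i z assume "z \<in> cocycles Z i"
  then obtain y b where y: "y \<in> cocycles Y i" "b \<in> coboundaries Z i" "z = b \<oplus>\<^bsub>gr Z i\<^esub> g i y"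
    using g(2) unfolding cohomology_bijective_def by blast
  obtain x c where x: "x \<in> cocycles X i" "c \<in> coboundaries Y i" "y = c \<oplus>\<^bsub>gr Y i\<^esub> f i x"
    using f(2) y(1) unfolding cohomology_bijective_def by blast
  have cc: "c \<in> carrier (gr Y i)" by (rule linear_subspace_carrier[OF Y.coboundaries_subspace x(2)])
  have fx: "f i x \<in> carrier (gr Y i)" using dg_hom_cocycles[OF f(1) X Y x(1)] by (simp add: cocycles_def)
  have bc: "b \<in> carrier (gr Z i)" by (rule linear_subspace_carrier[OF Z.coboundaries_subspace y(2)])
  have "z = (b \<oplus>\<^bsub>gr Z i\<^esub> g i c) \<oplus>\<^bsub>gr Z i\<^esub> g i (f i x)"
    using cc fx bc
    by (simp add: y(3) x(3) lin_add[OF dg_hom_linear[OF g(1)]] dg_hom_closed[OF g(1)] vs_assoc[OF Z.vector_space])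
  moreover have "b \<oplus>\<^bsub>gr Z i\<^esub> g i c \<in> coboundaries Z i"
    by (rule linear_subspace_add[OF Z.coboundaries_subspace y(2) dg_hom_coboundaries[OF g(1) x(2)]])
  ultimately show "\<exists>x\<in>cocycles X i. \<exists>b\<in>coboundaries Z i. z = b \<oplus>\<^bsub>gr Z i\<^esub> g i (f i x)"
    using x(1) by blast
qed

lemma cohomology_bijective_inverse:
  assumes X: "dg_module A X" and Y: "dg_module A Y" and f: "dg_hom A X Y f" and g: "dg_hom A Y X g"
    and gf: "\<And>i x. x \<in> carrier (gr X i) \<Longrightarrow> g i (f i x) = x"
    and fg: "\<And>i y. y \<in> carrier (gr Y i) \<Longrightarrow> f i (g i y) = y"
  shows "cohomology_bijective X Y f"
proof -
  interpret Y: cochain_complex Y by (rule dg_module_cochain[OF Y])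
  show ?thesis
    unfolding cohomology_bijective_def
  proof (intro conjI allI ballI impI)
    fix i x assume "x \<in> cocycles X i" "f i x \<in> coboundaries Y i"
    then show "x \<in> coboundaries X i" using dg_hom_coboundaries[OF g] gf by (fastforce simp: cocycles_def)
  next
    fix i y assume y: "y \<in> cocycles Y i"
    then have yc: "y \<in> carrier (gr Y i)" by (simp add: cocycles_def)
    show "\<exists>x\<in>cocycles X i. \<exists>b\<in>coboundaries Y i. y = b \<oplus>\<^bsub>gr Y i\<^esub> f i x"
      using dg_hom_cocycles[OF g Y X y] linear_subspace_zero[OF Y.coboundaries_subspace]
        fg[OF yc] vs_lzero[OF Y.vector_space yc] by metis
  qed
qed

definition degree_map ::
  "'a dg_algebra \<Rightarrow> ('a, 'u) dg_module \<Rightarrow> ('a, 'v) dg_module \<Rightarrow> int \<Rightarrow> (int \<Rightarrow> 'u \<Rightarrow> 'v) \<Rightarrow> bool"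
where
  "degree_map A X Y n f \<longleftrightarrow> (\<forall>i. f i \<in> linear_maps (gr X i) (gr Y (i + n))) \<and>
     (\<forall>i j. \<forall>x\<in>carrier (gr X i). \<forall>a\<in>carrier (gr A j). f (i + j) (act X i j x a) = act Y (i + n) j (f i x) a)"

lemma
  assumes "degree_map A X Y n f"
  shows degree_map_linear: "f i \<in> linear_maps (gr X i) (gr Y (i + n))"
    and degree_map_act: "x \<in> carrier (gr X i) \<Longrightarrow> a \<in> carrier (gr A j) \<Longrightarrow>
      f (i + j) (act X i j x a) = act Y (i + n) j (f i x) a"
  using assms by (auto simp: degree_map_def)

text \<open>
  A closed morphism \<open>f\<close> of degree \<open>1\<close> anticommutes with the differentials, and \<open>f = d g - g d\<close> for some
  \<open>g\<close> of degree \<open>0\<close> if the first cohomology vanishes. The elements of the morphism complex are extensional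
  families, so \<open>f\<close> is first restricted to the carriers.
\<close>

lemma hom_complex_exact:
  assumes "dg_module A X" "dg_module A Y" and z: "zero_space (cohomology (hom_complex A X Y) 1)"
    and f: "degree_map A X Y 1 f"
    and closed: "\<And>i x. x \<in> carrier (gr X i) \<Longrightarrow>
      dif Y (i + 1) (f i x) \<oplus>\<^bsub>gr Y (i + 2)\<^esub> f (i + 1) (dif X i x) = \<zero>\<^bsub>gr Y (i + 2)\<^esub>"
  obtains g where "degree_map A X Y 0 g"
    and "\<And>i x. x \<in> carrier (gr X i) \<Longrightarrow>
      f i x = dif Y i (g i x) \<oplus>\<^bsub>gr Y (i + 1)\<^esub> (- 1) \<odot>\<^bsub>gr Y (i + 1)\<^esub> g (i + 1) (dif X i x)"
proof -
  interpret X: dg_module A X by fact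
  interpret Y: dg_module A Y by fact
  note V = Y.M.vector_space
  let ?H = "hom_complex A X Y"
  have Xact: "act X i j x a \<in> carrier (gr X (i + j))" if "x \<in> carrier (gr X i)" "a \<in> carrier (gr A j)" for i j x a
    using lin_closed[OF X.act_linear_right that(2)] that(1) .
  have Yact0: "act Y i j \<zero>\<^bsub>gr Y i\<^esub> a = \<zero>\<^bsub>gr Y (i + j)\<^esub>" if "a \<in> carrier (gr A j)" for i j a
    using lin_zero[OF Y.act_linear_left[OF that] V V] .
  have i2: "i + 1 + 1 = i + 2" for i :: int by simp
  define F where "F i = restrict (f i) (carrier (gr X i))" for i
  have FH: "F \<in> carrier (gr ?H 1)"
    using degree_map_linear[OF f] degree_map_act[OF f] Xact vs_add[OF X.M.vector_space] vs_smult[OF X.M.vector_space]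
    by (auto simp: hom_complex_def F_def linear_maps_def Pi_iff)
  have fc: "f i x \<in> carrier (gr Y (i + 1))" if "x \<in> carrier (gr X i)" for i x
    using lin_closed[OF degree_map_linear[OF f] that] .
  have dF: "dif ?H 1 F = \<zero>\<^bsub>gr ?H (1 + 1)\<^esub>"
  proof -
    have "dif Y (i + 1) (F i x) \<ominus>\<^bsub>gr Y (i + 1 + 1)\<^esub> sign 1 \<odot>\<^bsub>gr Y (i + 1 + 1)\<^esub> F (i + 1) (dif X i x) = \<zero>\<^bsub>gr Y (i + 2)\<^esub>"
      if x: "x \<in> carrier (gr X i)" for i x
    proof -
      have c: "dif Y (i + 1) (f i x) \<in> carrier (gr Y (i + 2))" "f (i + 1) (dif X i x) \<in> carrier (gr Y (i + 2))"
        using Y.M.dif_closed[OF fc[OF x]] fc[OF X.M.dif_closed[OF x]] by (simp_all add: i2)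
      then show ?thesis
        using x closed[OF x] X.M.dif_closed[OF x]
        by (simp add: F_def i2 vs_minus[OF V] vs_smult[OF V] vs_smult_smult[OF V] vs_one[OF V])
    qed
    then show ?thesis by (auto simp: hom_complex_def fun_eq_iff restrict_def)
  qed
  have z0: "\<zero>\<^bsub>gr ?H 0\<^esub> \<in> carrier (gr ?H 0)"
    using Xact Yact0 vs_zero[OF V] vs_lzero[OF V] vs_smult_zero[OF V] vs_add[OF X.M.vector_space] vs_smult[OF X.M.vector_space]
    by (auto simp: hom_complex_def linear_maps_def Pi_iff)
  have "dif ?H 0 \<zero>\<^bsub>gr ?H 0\<^esub> = \<zero>\<^bsub>gr ?H 1\<^esub>"
    using X.M.dif_closed Y.M.dif_zero vs_zero[OF V] vs_lzero[OF V] vs_smult_zero[OF V]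
    by (auto simp: hom_complex_def fun_eq_iff restrict_def vs_minus[OF V])
  then have zB: "\<zero>\<^bsub>gr ?H 1\<^esub> \<in> coboundaries ?H 1"
    unfolding coboundaries_def using z0 by (intro image_eqI[of _ _ "\<zero>\<^bsub>gr ?H 0\<^esub>"]) simp_all
  have "\<zero>\<^bsub>gr ?H 1\<^esub> \<oplus>\<^bsub>gr ?H 1\<^esub> F = F"
    using fc vs_lzero[OF V] by (auto simp: hom_complex_def F_def fun_eq_iff restrict_def)
  with zero_space_cohomologyD[OF z _ zB] FH dF have "F \<in> coboundaries ?H 1" by (simp add: cocycles_def)
  then obtain g where g: "g \<in> carrier (gr ?H 0)" "F = dif ?H 0 g" by (auto simp: coboundaries_def)
  show thesis
  proof
    show "degree_map A X Y 0 g" using g(1) by (auto simp: hom_complex_def degree_map_def)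
    then have gc: "g i x \<in> carrier (gr Y i)" if "x \<in> carrier (gr X i)" for i x
      using lin_closed[OF degree_map_linear that] by force
    fix i x assume x: "x \<in> carrier (gr X i)"
    have "f i x = F i x" using x by (simp add: F_def)
    also have "\<dots> = dif Y i (g i x) \<oplus>\<^bsub>gr Y (i + 1)\<^esub> (- 1) \<odot>\<^bsub>gr Y (i + 1)\<^esub> g (i + 1) (dif X i x)"
      using x Y.M.dif_closed[OF gc[OF x]] gc[OF X.M.dif_closed[OF x]]
      by (simp add: g(2) hom_complex_def vs_minus[OF V] vs_one[OF V])
    finally show "f i x = dif Y i (g i x) \<oplus>\<^bsub>gr Y (i + 1)\<^esub> (- 1) \<odot>\<^bsub>gr Y (i + 1)\<^esub> g (i + 1) (dif X i x)" .
  qed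
qed

text \<open>
  The test modules of h-projectivity have the same underlying type as \<open>P\<close>; by transport, modules
  that embed into this type can be used as well.
\<close>

lemma h_projective_exact:
  fixes P :: "('a, 'u) dg_module" and Y :: "('a, 'v) dg_module"
  assumes P: "h_projective A P" and Y: "dg_module A Y"
    and acyc: "\<And>i. cocycles Y i \<subseteq> coboundaries Y i"
    and e: "\<And>i. inj_on (e i :: 'v \<Rightarrow> 'u) (carrier (gr Y i))"
    and f: "degree_map A P Y 1 f"
    and closed: "\<And>i x. x \<in> carrier (gr P i) \<Longrightarrow>
      dif Y (i + 1) (f i x) \<oplus>\<^bsub>gr Y (i + 2)\<^esub> f (i + 1) (dif P i x) = \<zero>\<^bsub>gr Y (i + 2)\<^esub>"
  obtains g where "degree_map A P Y 0 g"
    and "\<And>i x. x \<in> carrier (gr P i) \<Longrightarrow>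
      f i x = dif Y i (g i x) \<oplus>\<^bsub>gr Y (i + 1)\<^esub> (- 1) \<odot>\<^bsub>gr Y (i + 1)\<^esub> g (i + 1) (dif P i x)"
proof -
  interpret P: dg_module A P using P by (simp add: h_projective_def)
  interpret Y: dg_module A Y by (rule Y)
  note V = Y.M.vector_space
  define G where "G i = pushforward (e i) (gr Y i)" for i
  define Z where "Z = transport e G Y"
  have G: "complex_vector_space (G i)" "e i \<in> linear_maps (gr Y i) (G i)"
    "bij_betw (e i) (carrier (gr Y i)) (carrier (G i))" for i
    unfolding G_def by (rule pushforward_space[OF V e] pushforward_linear[OF V e] pushforward_bij[OF V e])+
  have Z: "dg_module A Z" unfolding Z_def by (rule transport_dg_module[OF Y G])
  have ez: "dg_hom A Y Z e" unfolding Z_def by (rule transport_dg_hom[OF Y G])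
  define h where "h i = inv_into (carrier (gr Y i)) (e i)" for i
  have hz: "dg_hom A Z Y h" unfolding Z_def h_def by (rule transport_dg_hom_inv[OF Y G])
  have gZ [simp]: "gr Z = G" by (simp add: Z_def)
  have hl: "h i \<in> linear_maps (G i) (gr Y i)" for i using dg_hom_linear[OF hz, of i] by simp
  have he: "h i (e i y) = y" if "y \<in> carrier (gr Y i)" for i y using e that by (simp add: h_def)
  have eh: "e i (h i y) = y" if "y \<in> carrier (G i)" for i y
    using bij_betw_inv_into_right[OF G(3) that] by (simp add: h_def)
  interpret Z: dg_module A Z by (rule Z)
  have "acyclic_complex Z"
    unfolding acyclic_complex_def Z.M.zero_space_cohomology_iff
  proof (intro allI subsetI)
    fix i y assume y: "y \<in> cocycles Z i"
    then have "e i (h i y) \<in> coboundaries Z i"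
      using acyc dg_hom_cocycles[OF hz Z Y] dg_hom_coboundaries[OF ez] by blast
    then show "y \<in> coboundaries Z i" using y eh by (simp add: cocycles_def)
  qed
  then have zs: "zero_space (cohomology (hom_complex A P Z) 1)"
    using P Z by (simp add: h_projective_def acyclic_complex_def)
  have fl: "f i \<in> linear_maps (gr P i) (gr Y (i + 1))" for i by (rule degree_map_linear[OF f])
  have fc: "f i x \<in> carrier (gr Y (i + 1))" if "x \<in> carrier (gr P i)" for i x by (rule lin_closed[OF fl that])
  have "degree_map A P Z 1 (\<lambda>i x. e (i + 1) (f i x))"
    unfolding degree_map_def
  proof (intro conjI allI ballI)
    show "(\<lambda>x. e (i + 1) (f i x)) \<in> linear_maps (gr P i) (gr Z (i + 1))" for i
      using lin_comp[OF fl G(2)] by simp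
    fix i j x a assume x: "x \<in> carrier (gr P i)" and a: "a \<in> carrier (gr A j)"
    show "e (i + j + 1) (f (i + j) (act P i j x a)) = act Z (i + 1) j (e (i + 1) (f i x)) a"
      using dg_hom_act[OF ez fc[OF x] a] degree_map_act[OF f x a] by (simp add: add_ac)
  qed
  moreover have "dif Z (i + 1) (e (i + 1) (f i x)) \<oplus>\<^bsub>gr Z (i + 2)\<^esub> e (i + 1 + 1) (f (i + 1) (dif P i x)) = \<zero>\<^bsub>gr Z (i + 2)\<^esub>"
    if x: "x \<in> carrier (gr P i)" for i x
  proof -
    have i2: "i + 1 + 1 = i + 2" by simp
    have c: "dif Y (i + 1) (f i x) \<in> carrier (gr Y (i + 2))" "f (i + 1) (dif P i x) \<in> carrier (gr Y (i + 2))"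
      using Y.M.dif_closed[OF fc[OF x]] fc[OF P.M.dif_closed[OF x]] by (simp_all add: i2)
    have "e (i + 2) (dif Y (i + 1) (f i x) \<oplus>\<^bsub>gr Y (i + 2)\<^esub> f (i + 1) (dif P i x)) = \<zero>\<^bsub>G (i + 2)\<^esub>"
      unfolding closed[OF x] by (rule lin_zero[OF G(2) V G(1)])
    then show ?thesis
      using dg_hom_dif[OF ez fc[OF x]] lin_add[OF G(2) c] by (simp add: i2)
  qed
  ultimately obtain g where g: "degree_map A P Z 0 g"
    and gf: "\<And>i x. x \<in> carrier (gr P i) \<Longrightarrow> e (i + 1) (f i x) =
      dif Z i (g i x) \<oplus>\<^bsub>gr Z (i + 1)\<^esub> (- 1) \<odot>\<^bsub>gr Z (i + 1)\<^esub> g (i + 1) (dif P i x)"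
    by (rule hom_complex_exact[OF P.dg_module_axioms Z zs]) (assumption, rule that)
  have gl: "g i \<in> linear_maps (gr P i) (gr Z i)" for i using degree_map_linear[OF g, of i] by simp
  have gc: "g i x \<in> carrier (gr Z i)" if "x \<in> carrier (gr P i)" for i x by (rule lin_closed[OF gl that])
  show thesis
  proof
    show "degree_map A P Y 0 (\<lambda>i x. h i (g i x))"
      unfolding degree_map_def
    proof (intro conjI allI ballI)
      show "(\<lambda>x. h i (g i x)) \<in> linear_maps (gr P i) (gr Y (i + 0))" for i
        using lin_comp[OF gl dg_hom_linear[OF hz]] by simp
      fix i j x a assume x: "x \<in> carrier (gr P i)" and a: "a \<in> carrier (gr A j)"
      show "h (i + j) (g (i + j) (act P i j x a)) = act Y (i + 0) j (h i (g i x)) a"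
        using dg_hom_act[OF hz gc[OF x] a] degree_map_act[OF g x a] by simp
    qed
    fix i x assume x: "x \<in> carrier (gr P i)"
    note gx = gc[OF x] and gdx = gc[OF P.M.dif_closed[OF x]]
    have "f i x = h (i + 1) (e (i + 1) (f i x))" using he fc[OF x] by simp
    also have "\<dots> = h (i + 1) (dif Z i (g i x)) \<oplus>\<^bsub>gr Y (i + 1)\<^esub> (- 1) \<odot>\<^bsub>gr Y (i + 1)\<^esub> h (i + 1) (g (i + 1) (dif P i x))"
      unfolding gf[OF x] using gx gdx Z.M.dif_closed[OF gx] vs_smult[OF Z.M.vector_space gdx]
      by (simp add: lin_add[OF hl] lin_smult[OF hl])
    also have "h (i + 1) (dif Z i (g i x)) = dif Y i (h i (g i x))" by (rule dg_hom_dif[OF hz gx])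
    finally show "f i x = dif Y i (h i (g i x)) \<oplus>\<^bsub>gr Y (i + 1)\<^esub> (- 1) \<odot>\<^bsub>gr Y (i + 1)\<^esub> h (i + 1) (g (i + 1) (dif P i x))" .
  qed
qed

section \<open>Concrete models and the size of the type\<close>

lemma concrete_model:
  fixes X :: "('a, 'u) dg_module"
  assumes X: "dg_module A X"
  obtains Y :: "('a, 'u \<Rightarrow> complex) dg_module" and B :: "int \<Rightarrow> 'u set" and \<phi> \<psi>
  where "concrete A Y (\<lambda>i. finitely_supported (B i))" "dg_hom A X Y \<phi>" "dg_hom A Y X \<psi>"
    and "\<And>i x. x \<in> carrier (gr X i) \<Longrightarrow> \<psi> i (\<phi> i x) = x"
    and "\<And>i y. y \<in> finitely_supported (B i) \<Longrightarrow> \<phi> i (\<psi> i y) = y"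
proof -
  interpret X: dg_module A X by (rule X)
  have "\<exists>B \<phi>. \<phi> \<in> linear_maps (gr X i) (space_on (finitely_supported B)) \<and>
      bij_betw \<phi> (carrier (gr X i)) (finitely_supported B :: ('u \<Rightarrow> complex) set)" for i
    by (rule coordinates_exist[OF X.M.vector_space[of i]]) blast
  then obtain B \<phi> where \<phi>: "\<And>i. \<phi> i \<in> linear_maps (gr X i) (space_on (finitely_supported (B i)))"
    and b: "\<And>i. bij_betw (\<phi> i) (carrier (gr X i)) (finitely_supported (B i) :: ('u \<Rightarrow> complex) set)"
    by metis
  let ?G = "\<lambda>i. space_on (finitely_supported (B i)) :: (complex, 'u \<Rightarrow> complex) module"
  have sp: "complex_vector_space (?G i)" for i by (rule space_on_space[OF finitely_supported_subspace])
  have b': "bij_betw (\<phi> i) (carrier (gr X i)) (carrier (?G i))" for i using b by simp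
  show thesis
  proof
    show "concrete A (transport \<phi> ?G X) (\<lambda>i. finitely_supported (B i))"
      using transport_dg_module[OF X sp \<phi> b'] by (simp add: concrete_def finitely_supported_subspace)
    show "dg_hom A X (transport \<phi> ?G X) \<phi>" by (rule transport_dg_hom[OF X sp \<phi> b'])
    show "dg_hom A (transport \<phi> ?G X) X (\<lambda>i. inv_into (carrier (gr X i)) (\<phi> i))"
      by (rule transport_dg_hom_inv[OF X sp \<phi> b'])
  qed (use b in \<open>auto simp: bij_betw_def f_inv_into_f\<close>)
qed

lemma complex_embeds:
  assumes V: "complex_vector_space V" and x: "x \<in> carrier V" "x \<noteq> \<zero>\<^bsub>V\<^esub>"
  shows "inj (\<lambda>c. c \<odot>\<^bsub>V\<^esub> x)"
proof (rule injI)
  fix c d assume eq: "c \<odot>\<^bsub>V\<^esub> x = d \<odot>\<^bsub>V\<^esub> x"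
  show "c = d"
  proof (rule ccontr)
    assume n: "c \<noteq> d"
    have "(c - d) \<odot>\<^bsub>V\<^esub> x = c \<odot>\<^bsub>V\<^esub> x \<oplus>\<^bsub>V\<^esub> (- d) \<odot>\<^bsub>V\<^esub> x" using vs_distl[OF V x(1), of c "- d"] by simp
    also have "\<dots> = d \<odot>\<^bsub>V\<^esub> x \<oplus>\<^bsub>V\<^esub> (- d) \<odot>\<^bsub>V\<^esub> x" using eq by simp
    also have "\<dots> = \<zero>\<^bsub>V\<^esub>" using vs_distl[OF V x(1), of d "- d"] by (simp add: vs_null[OF V x(1)])
    finally have "(1 / (c - d)) \<odot>\<^bsub>V\<^esub> ((c - d) \<odot>\<^bsub>V\<^esub> x) = \<zero>\<^bsub>V\<^esub>" by (simp add: vs_smult_zero[OF V])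
    then show False using x n by (simp add: vs_smult_smult[OF V] vs_one[OF V])
  qed
qed

text \<open>
  If all vectors of \<open>M\<close> were zero, then all morphisms to \<open>M\<close> would be zero. The multiples of a nonzero vector
  are a copy of the complex numbers.
\<close>

lemma simple_complex_embeds:
  fixes M :: "('a, 'u) dg_module"
  assumes M: "dg_module A M" and lin: "linearly_isomorphic (cohomology (hom_complex A P M) 0) complex_line"
  shows "\<exists>\<kappa> :: complex \<Rightarrow> 'u. inj \<kappa>"
proof -
  interpret M: dg_module A M by (rule M)
  have "\<exists>i x. x \<in> carrier (gr M i) \<and> x \<noteq> \<zero>\<^bsub>gr M i\<^esub>"
  proof (rule ccontr)
    assume "\<not> ?thesis"
    then have zero: "x = \<zero>\<^bsub>gr M i\<^esub>" if "x \<in> carrier (gr M i)" for i x using that by blast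
    have "f = g" if "f \<in> carrier (gr (hom_complex A P M) 0)" "g \<in> carrier (gr (hom_complex A P M) 0)" for f g
    proof (intro ext)
      fix i x
      have fg: "f i \<in> extensional (carrier (gr P i))" "g i \<in> extensional (carrier (gr P i))"
        "f i \<in> linear_maps (gr P i) (gr M (i + 0))" "g i \<in> linear_maps (gr P i) (gr M (i + 0))"
        using that by (auto simp: hom_complex_def)
      show "f i x = g i x"
      proof (cases "x \<in> carrier (gr P i)")
        case True
        then show ?thesis using zero[OF lin_closed[OF fg(3) True]] zero[OF lin_closed[OF fg(4) True]] by simp
      next
        case False
        then show ?thesis using fg(1,2) by (simp add: extensional_def)
      qed
    qed
    then have eq: "X = Y" if "X \<in> carrier (cohomology (hom_complex A P M) 0)" "Y \<in> carrier (cohomology (hom_complex A P M) 0)" for X Y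
      using that by (auto simp: carrier_cohomology cocycles_def)
    obtain \<theta> where "bij_betw \<theta> (carrier (cohomology (hom_complex A P M) 0)) (UNIV :: complex set)"
      using lin by (auto simp: linearly_isomorphic_def complex_line_def)
    then have im: "\<theta> ` carrier (cohomology (hom_complex A P M) 0) = UNIV" by (simp add: bij_betw_def)
    have "0 \<in> \<theta> ` carrier (cohomology (hom_complex A P M) 0)" "1 \<in> \<theta> ` carrier (cohomology (hom_complex A P M) 0)"
      unfolding im by simp_all
    then obtain X Y where "X \<in> carrier (cohomology (hom_complex A P M) 0)" "\<theta> X = 0"
      "Y \<in> carrier (cohomology (hom_complex A P M) 0)" "\<theta> Y = 1" by (elim imageE) auto
    moreover from this have "X = Y" by (intro eq)
    ultimately show False by simp
  qed
  then obtain i x where "x \<in> carrier (gr M i)" "x \<noteq> \<zero>\<^bsub>gr M i\<^esub>" by blast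
  then show ?thesis using complex_embeds[OF M.M.vector_space] by blast
qed

lemma pairing_exists:
  assumes "inj (\<kappa> :: complex \<Rightarrow> 'u)"
  shows "\<exists>p :: 'u \<times> 'u \<Rightarrow> 'u. inj p"
proof -
  have "infinite (UNIV :: 'u set)"
    using assms infinite_UNIV_char_0[where 'a = complex] finite_subset[of "range \<kappa>" UNIV]
    by (metis finite_imageD top_greatest)
  then have "(card_of ((UNIV :: 'u set) \<times> (UNIV :: 'u set)), card_of (UNIV :: 'u set)) \<in> ordIso" by (rule card_of_Times_same_infinite)
  then obtain p :: "'u \<times> 'u \<Rightarrow> 'u" where "bij_betw p (UNIV \<times> UNIV) UNIV"
    unfolding card_of_ordIso[symmetric] by blast
  then show ?thesis by (auto simp: bij_betw_def)
qed

section \<open>Rigid modules admit connections\<close>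

text \<open>
  A pair \<open>(q, D)\<close> as below is a map to the Atiyah extension of \<open>Y\<close> that lifts \<open>q\<close>: a connection
  along the homomorphism \<open>q\<close>.
\<close>

context weighted_dg_algebra
begin

definition connection_along ::
  "('a, 'v) dg_module \<Rightarrow> ('a, 'w::complex_vector) dg_module \<Rightarrow> (int \<Rightarrow> 'v \<Rightarrow> 'w) \<Rightarrow> (int \<Rightarrow> 'v \<Rightarrow> 'w) \<Rightarrow> bool"
where
  "connection_along X Y q D \<longleftrightarrow>
     (\<forall>i. D i \<in> linear_maps (gr X i) (gr Y i)) \<and>
     (\<forall>i. \<forall>x\<in>carrier (gr X i). D (i + 1) (dif X i x) = dif Y i (D i x)) \<and>
     (\<forall>i j. \<forall>x\<in>carrier (gr X i). \<forall>a\<in>carrier (gr A j).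
        D (i + j) (act X i j x a) = act Y i j (D i x) a + euler_act Y i j (q i x) a)"

text \<open>
  The homomorphism \<open>p\<close>, placed in the last component, is a closed morphism of degree \<open>1\<close> to the acyclic
  module \<open>atiyah_complex Y S\<close>, hence a boundary of some \<open>k = (u, q, D, h)\<close>. The components of this equation say
  that \<open>q\<close> is homotopic to \<open>p\<close> by \<open>h\<close>, that \<open>u\<close> is closed, and that \<open>D\<close> obeys the Leibniz rule but
  is a chain map only up to \<open>u\<close>. So \<open>u\<close> represents the obstruction. By rigidity it is the boundary of some
  \<open>v\<close>, and \<open>D + v\<close> is a connection.
\<close>

lemma atiyah_lift:
  fixes P :: "('a, 'u) dg_module" and Y :: "('a, 'v::complex_vector) dg_module"
  assumes P: "h_projective A P" and Y: "concrete A Y S" and p: "dg_hom A P Y p"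
    and e: "\<And>i. inj_on (e i :: 'v \<times> 'v \<times> 'v \<times> 'v \<Rightarrow> 'u) (S (i + 1) \<times> S i \<times> S i \<times> S (i - 1))"
    and rigid: "\<And>u. degree_map A P Y 1 u \<Longrightarrow>
      (\<And>i x. x \<in> carrier (gr P i) \<Longrightarrow> dif Y (i + 1) (u i x) + u (i + 1) (dif P i x) = 0) \<Longrightarrow>
      \<exists>v. degree_map A P Y 0 v \<and> (\<forall>i. \<forall>x\<in>carrier (gr P i). u i x = dif Y i (v i x) - v (i + 1) (dif P i x))"
  obtains q D h where "dg_hom A P Y q" "connection_along P Y q D"
    and "\<And>i x. x \<in> carrier (gr P i) \<Longrightarrow> h i x \<in> S (i - 1)" "\<And>i. h i \<zero>\<^bsub>gr P i\<^esub> = 0"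
    and "\<And>i x. x \<in> carrier (gr P i) \<Longrightarrow> p i x = q i x - dif Y (i - 1) (h i x) - h (i + 1) (dif P i x)"
proof -
  interpret P: dg_module A P using P by (simp add: h_projective_def)
  note S = concrete_subspace[OF Y] and g = concrete_gr[OF Y]
  let ?T = "atiyah_complex Y S"
  let ?S = "\<lambda>i. S (i + 1) \<times> S i \<times> S i \<times> S (i - 1)"
  note T = atiyah_complex_concrete[OF Y]
  note pl = dg_hom_linear[OF p, unfolded g] and pc = dg_hom_closed[OF p, unfolded g space_on_simps]
  have eu0: "euler_act Y i j 0 a = 0" if "a \<in> carrier (gr A j)" for i j a
    using euler_act_scale_left[OF Y subspace_0[OF S] that, of i 0] by simp
  define f where "f i x = (0 :: 'v, 0 :: 'v, 0 :: 'v, p i x)" for i x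
  have einj: "inj_on (e i) (carrier (gr ?T i))" for i using e by simp
  have "degree_map A P ?T 1 f"
    unfolding degree_map_def
  proof (intro conjI allI ballI)
    show "f i \<in> linear_maps (gr P i) (gr ?T (i + 1))" for i
      using pc lin_add[OF pl, of _ i] lin_smult[OF pl, of _ i]
      by (intro linear_mapsI) (auto simp: f_def subspace_0[OF S])
    show "f (i + j) (act P i j x a) = act ?T (i + 1) j (f i x) a"
      if "x \<in> carrier (gr P i)" "a \<in> carrier (gr A j)" for i j x a
      using that dg_hom_act[OF p that] by (simp add: f_def cact_zero[OF Y] eu0)
  qed
  moreover have "dif ?T (i + 1) (f i x) \<oplus>\<^bsub>gr ?T (i + 2)\<^esub> f (i + 1) (dif P i x) = \<zero>\<^bsub>gr ?T (i + 2)\<^esub>"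
    if x: "x \<in> carrier (gr P i)" for i x
    using dg_hom_dif[OF p x] by (simp add: f_def cdif_zero[OF Y] zero_prod_def)
  ultimately obtain k where k: "degree_map A P ?T 0 k"
    and fk': "\<And>i x. x \<in> carrier (gr P i) \<Longrightarrow> f i x = dif ?T i (k i x) \<oplus>\<^bsub>gr ?T (i + 1)\<^esub>
      (- 1) \<odot>\<^bsub>gr ?T (i + 1)\<^esub> k (i + 1) (dif P i x)"
    by (rule h_projective_exact[OF P concrete_dg_module[OF T] atiyah_complex_acyclic[OF Y] einj]) (assumption, rule that)
  have fk: "f i x = dif ?T i (k i x) + (- 1) *\<^sub>C k (i + 1) (dif P i x)" if "x \<in> carrier (gr P i)" for i x
    using fk'[OF that] by simp
  define u q D h where "u = (\<lambda>i x. fst (k i x))" and "q = (\<lambda>i x. fst (snd (k i x)))"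
    and "D = (\<lambda>i x. fst (snd (snd (k i x))))" and "h = (\<lambda>i x. snd (snd (snd (k i x))))"
  have kk: "k i x = (u i x, q i x, D i x, h i x)" for i x by (simp add: u_def q_def D_def h_def)
  have kl: "k i \<in> linear_maps (gr P i) (space_on (?S i))" for i using degree_map_linear[OF k, of i] by simp
  have kc: "u i x \<in> S (i + 1)" "q i x \<in> S i" "D i x \<in> S i" "h i x \<in> S (i - 1)" if "x \<in> carrier (gr P i)" for i x
    using lin_closed[OF kl that] by (simp_all add: kk)
  have ka: "k i (x \<oplus>\<^bsub>gr P i\<^esub> y) = k i x + k i y" if "x \<in> carrier (gr P i)" "y \<in> carrier (gr P i)" for i x y
    using lin_add[OF kl that] by simp
  have ks: "k i (c \<odot>\<^bsub>gr P i\<^esub> x) = c *\<^sub>C k i x" if "x \<in> carrier (gr P i)" for i x c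
    using lin_smult[OF kl that] by simp
  have kact: "k (i + j) (act P i j x a) = act ?T i j (k i x) a"
    if "x \<in> carrier (gr P i)" "a \<in> carrier (gr A j)" for i j x a
    using degree_map_act[OF k that] by simp
  have h0: "h i \<zero>\<^bsub>gr P i\<^esub> = 0" for i
  proof -
    have "k i \<zero>\<^bsub>gr P i\<^esub> = k i \<zero>\<^bsub>gr P i\<^esub> + k i \<zero>\<^bsub>gr P i\<^esub>"
      using ka[OF vs_zero[OF P.M.vector_space] vs_zero[OF P.M.vector_space], of i]
      unfolding vs_lzero[OF P.M.vector_space vs_zero[OF P.M.vector_space]] .
    then show ?thesis by (simp add: h_def)
  qed
  have ulin: "degree_map A P Y 1 u"
    unfolding degree_map_def
  proof (intro conjI allI ballI)
    show "u i \<in> linear_maps (gr P i) (gr Y (i + 1))" for i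
      using ka[of _ i] ks[of _ i] kc(1) by (intro linear_mapsI) (auto simp: g kk)
    show "u (i + j) (act P i j x a) = act Y (i + 1) j (u i x) a"
      if "x \<in> carrier (gr P i)" "a \<in> carrier (gr A j)" for i j x a
      using kact[OF that] by (simp add: kk)
  qed
  have eqs: "dif Y (i + 1) (u i x) + u (i + 1) (dif P i x) = 0" "dif Y i (q i x) = q (i + 1) (dif P i x)"
    "dif Y i (D i x) + u i x = D (i + 1) (dif P i x)" "p i x = q i x - dif Y (i - 1) (h i x) - h (i + 1) (dif P i x)"
    if x: "x \<in> carrier (gr P i)" for i x
    using fk[OF x] by (simp_all add: kk f_def scaleC_minus_one eq_neg_iff_add_eq_0)
      (metis add.inverse_inverse add_eq_0_iff diff_0_right diff_conv_add_uminus)+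
  obtain v where v: "degree_map A P Y 0 v"
    and uv: "\<And>i x. x \<in> carrier (gr P i) \<Longrightarrow> u i x = dif Y i (v i x) - v (i + 1) (dif P i x)"
    using rigid[OF ulin eqs(1)] by blast
  have vl: "v i \<in> linear_maps (gr P i) (space_on (S i))" for i using degree_map_linear[OF v, of i] by (simp add: g)
  have vc: "v i x \<in> S i" if "x \<in> carrier (gr P i)" for i x using lin_closed[OF vl that] by simp
  show thesis
  proof
    show "dg_hom A P Y q"
      unfolding dg_hom_def
    proof (intro conjI allI ballI)
      show "q i \<in> linear_maps (gr P i) (gr Y i)" for i
        using ka[of _ i] ks[of _ i] kc(2) by (intro linear_mapsI) (auto simp: g kk)
      show "q (i + 1) (dif P i x) = dif Y i (q i x)" if "x \<in> carrier (gr P i)" for i x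
        using eqs(2)[OF that] by simp
      show "q (i + j) (act P i j x a) = act Y i j (q i x) a"
        if "x \<in> carrier (gr P i)" "a \<in> carrier (gr A j)" for i j x a
        using kact[OF that] by (simp add: kk)
    qed
    show "connection_along P Y q (\<lambda>i x. D i x + v i x)"
      unfolding connection_along_def
    proof (intro conjI allI ballI)
      show "(\<lambda>x. D i x + v i x) \<in> linear_maps (gr P i) (gr Y i)" for i
        using ka[of _ i] ks[of _ i] kc(3) vc lin_add[OF vl, of _ i] lin_smult[OF vl, of _ i] subspace_add[OF S]
        by (intro linear_mapsI) (auto simp: g kk scaleC_add_right)
      show "D (i + 1) (dif P i x) + v (i + 1) (dif P i x) = dif Y i (D i x + v i x)"
        if x: "x \<in> carrier (gr P i)" for i x
        using eqs(3)[OF x] uv[OF x] cdif_add[OF Y kc(3)[OF x] vc[OF x]] by (simp add: algebra_simps)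
      show "D (i + j) (act P i j x a) + v (i + j) (act P i j x a) =
          act Y i j (D i x + v i x) a + euler_act Y i j (q i x) a"
        if xa: "x \<in> carrier (gr P i)" "a \<in> carrier (gr A j)" for i j x a
        using kact[OF xa] degree_map_act[OF v xa] cact_add[OF Y kc(3)[OF xa(1)] vc[OF xa(1)] xa(2)]
        by (simp add: kk)
    qed
  qed (use kc(4) h0 eqs(4) in auto)
qed

end

section \<open>Calculus of exponential polynomials\<close>

text \<open>
  In terms of functions, \<open>tderiv\<close> is differentiation and \<open>value0\<close> is evaluation at \<open>0\<close>.
\<close>

definition tderiv :: "(complex \<times> nat \<Rightarrow> 'v::complex_vector) \<Rightarrow> complex \<times> nat \<Rightarrow> 'v" where
  "tderiv y = (\<lambda>(l, k). l *\<^sub>C y (l, k) + y (l, Suc k))"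

definition value0 :: "(complex \<times> nat \<Rightarrow> 'v::complex_vector) \<Rightarrow> 'v" where
  "value0 y = (\<Sum>l\<in>{l. y (l, 0) \<noteq> 0}. y (l, 0))"

definition single :: "'k \<Rightarrow> 'v::zero \<Rightarrow> 'k \<Rightarrow> 'v" where
  "single p x = (\<lambda>q. if q = p then x else 0)"

lemma single_apply: "single p x q = (if q = p then x else 0)"
  by (simp add: single_def)

lemma exp_polyI: "finite {k. y k \<noteq> 0} \<Longrightarrow> (\<And>k. y k \<in> S) \<Longrightarrow> y \<in> exp_poly S"
  by (simp add: exp_poly_def)

lemma exp_poly_finite: "y \<in> exp_poly S \<Longrightarrow> finite {k. y k \<noteq> 0}"
  by (simp add: exp_poly_def)

lemma exp_poly_mem: "y \<in> exp_poly S \<Longrightarrow> y p \<in> S"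
  by (cases p) (simp add: exp_poly_def)

lemma single_exp_poly: "subspace S \<Longrightarrow> x \<in> S \<Longrightarrow> single p x \<in> exp_poly S"
  by (rule exp_polyI) (auto simp: single_def subspace_0 intro: finite_subset[of _ "{p}"])

lemma exp_poly_induct [consumes 2, case_names zero single add]:
  fixes y :: "complex \<times> nat \<Rightarrow> 'v::complex_vector"
  assumes S: "subspace S" and y: "y \<in> exp_poly S"
    and zero: "P 0" and single: "\<And>p x. x \<in> S \<Longrightarrow> P (single p x)"
    and add: "\<And>y z. y \<in> exp_poly S \<Longrightarrow> z \<in> exp_poly S \<Longrightarrow> P y \<Longrightarrow> P z \<Longrightarrow> P (y + z)"
  shows "P y"
proof -
  have "\<forall>y. y \<in> exp_poly S \<longrightarrow> {k. y k \<noteq> 0} \<subseteq> F \<longrightarrow> P y" if "finite F" for F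
    using that
  proof induction
    case empty
    show ?case
    proof (intro allI impI)
      fix y :: "complex \<times> nat \<Rightarrow> 'v" assume "{k. y k \<noteq> 0} \<subseteq> {}"
      then have "y = 0" by (auto simp: fun_eq_iff)
      then show "P y" using zero by simp
    qed
  next
    case (insert p F)
    show ?case
    proof (intro allI impI)
      fix y :: "complex \<times> nat \<Rightarrow> 'v" assume y: "y \<in> exp_poly S" and s: "{k. y k \<noteq> 0} \<subseteq> insert p F"
      let ?z = "y(p := 0)"
      have z: "?z \<in> exp_poly S"
      proof (rule exp_polyI)
        have "{k. ?z k \<noteq> 0} \<subseteq> {k. y k \<noteq> 0}" by auto
        then show "finite {k. ?z k \<noteq> 0}" using exp_poly_finite[OF y] finite_subset by blast
      qed (simp add: exp_poly_mem[OF y] subspace_0[OF S])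
      have "{k. ?z k \<noteq> 0} \<subseteq> F" using s by auto
      then have "P ?z" using insert.IH z by blast
      moreover have "y = ?z + single p (y p)" by (auto simp: fun_eq_iff single_def)
      ultimately show "P y"
        using add[OF z single_exp_poly[OF S]] single exp_poly_mem[OF y] by metis
    qed
  qed
  from this[OF exp_poly_finite[OF y]] y show ?thesis by blast
qed

lemma value0_superset: "finite F \<Longrightarrow> {l. y (l, 0) \<noteq> 0} \<subseteq> F \<Longrightarrow> value0 y = (\<Sum>l\<in>F. y (l, 0))"
  unfolding value0_def by (rule sum.mono_neutral_left) auto

lemma exp_poly_finite0: "y \<in> exp_poly S \<Longrightarrow> finite {l. y (l, 0) \<noteq> 0}"
  by (rule finite_subset[of _ "fst ` {p. y p \<noteq> 0}"]) (force simp: exp_poly_finite)+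

lemma value0_mem: "subspace S \<Longrightarrow> y \<in> exp_poly S \<Longrightarrow> value0 y \<in> S"
  unfolding value0_def by (rule subspace_sum) (auto simp: exp_poly_mem)

lemma value0_add:
  assumes "y \<in> exp_poly S" "z \<in> exp_poly S"
  shows "value0 (y + z) = value0 y + value0 z"
proof -
  let ?F = "{l. y (l, 0) \<noteq> 0} \<union> {l. z (l, 0) \<noteq> 0}"
  have F: "finite ?F" using assms exp_poly_finite0 by blast
  show ?thesis
    by (subst (1 2 3) value0_superset[OF F]) (auto simp: sum.distrib)
qed

lemma value0_zero [simp]: "value0 0 = 0"
  by (simp add: value0_def)

lemma value0_scale:
  assumes "y \<in> exp_poly S"
  shows "value0 (c *\<^sub>C y) = c *\<^sub>C value0 y"
proof -
  have F: "finite {l. y (l, 0) \<noteq> 0}" using assms exp_poly_finite0 by blast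
  have "value0 (c *\<^sub>C y) = (\<Sum>l\<in>{l. y (l, 0) \<noteq> 0}. (c *\<^sub>C y) (l, 0))"
    by (rule value0_superset[OF F]) auto
  then show ?thesis by (simp add: scaleC_sum_right value0_def)
qed

lemma value0_single: "value0 (single (l, k) x) = (if k = 0 then x else 0)"
proof -
  have "value0 (single (l, k) x) = (\<Sum>l'\<in>{l}. single (l, k) x (l', 0))"
    by (rule value0_superset) (auto simp: single_def split: if_splits)
  then show ?thesis by (simp add: single_def)
qed

lemma tderiv_add: "tderiv (y + z) = tderiv y + tderiv z"
  by (auto simp: tderiv_def fun_eq_iff scaleC_add_right)

lemma tderiv_scale: "tderiv (c *\<^sub>C y) = c *\<^sub>C tderiv y"
  by (auto simp: tderiv_def fun_eq_iff scaleC_add_right mult.commute)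

lemma tderiv_zero [simp]: "tderiv 0 = 0"
  by (auto simp: tderiv_def fun_eq_iff)

lemma tderiv_exp_poly:
  assumes S: "subspace S" and y: "y \<in> exp_poly S"
  shows "tderiv y \<in> exp_poly S"
proof (rule exp_polyI)
  have "{p. tderiv y p \<noteq> 0} \<subseteq> {p. y p \<noteq> 0} \<union> (\<lambda>(l, k). (l, k - 1)) ` {p. y p \<noteq> 0}"
  proof
    fix p assume p: "p \<in> {p. tderiv y p \<noteq> 0}"
    obtain l k where lk: "p = (l, k)" by (cases p)
    have "y (l, k) \<noteq> 0 \<or> y (l, Suc k) \<noteq> 0" using p by (auto simp: lk tderiv_def)
    then show "p \<in> {p. y p \<noteq> 0} \<union> (\<lambda>(l, k). (l, k - 1)) ` {p. y p \<noteq> 0}"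
      by (force simp: lk image_iff)
  qed
  then show "finite {p. tderiv y p \<noteq> 0}" using exp_poly_finite[OF y] finite_subset by blast
  show "tderiv y p \<in> S" for p
    by (cases p) (simp add: tderiv_def subspace_add[OF S] subspace_scale[OF S] exp_poly_mem[OF y])
qed

definition tshift :: "complex \<Rightarrow> (complex \<times> nat \<Rightarrow> 'v::complex_vector) \<Rightarrow> complex \<times> nat \<Rightarrow> 'v" where
  "tshift \<mu> y = tderiv y - \<mu> *\<^sub>C y"

lemma tshift_apply: "tshift \<mu> y (l, k) = (l - \<mu>) *\<^sub>C y (l, k) + y (l, Suc k)"
  by (simp add: tshift_def tderiv_def scaleC_simps)

lemma tshift_exp_poly: "subspace S \<Longrightarrow> y \<in> exp_poly S \<Longrightarrow> tshift \<mu> y \<in> exp_poly S"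
  unfolding tshift_def
  by (intro subspace_diff[OF exp_poly_subspace] subspace_scale[OF exp_poly_subspace] tderiv_exp_poly)

lemma tshift_add: "tshift \<mu> (y + z) = tshift \<mu> y + tshift \<mu> z"
  by (simp add: tshift_def tderiv_add scaleC_add_right)

lemma tshift_scale: "tshift \<mu> (c *\<^sub>C y) = c *\<^sub>C tshift \<mu> y"
  by (simp add: tshift_def tderiv_scale scaleC_diff_right mult.commute)

lemma tshift_diff: "tshift \<mu> (y - z) = tshift \<mu> y - tshift \<mu> z"
  using tshift_add[of \<mu> y "(- 1) *\<^sub>C z"] tshift_scale[of \<mu> "- 1" z] by (simp add: scaleC_minus_one)

lemma tshift_zero [simp]: "tshift \<mu> 0 = 0"
  by (simp add: tshift_def)

text \<open>
  The initial value problem \<open>y' - \<mu> y = z\<close>, \<open>y 0 = x\<close> has exactly one solution among the exponential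
  polynomials. All that is needed about them follows from this.
\<close>

lemma initial_value_unique:
  assumes y: "y \<in> exp_poly S" and eq: "tshift \<mu> y = 0" and v: "value0 y = 0"
  shows "y = 0"
proof -
  have rec: "(l - \<mu>) *\<^sub>C y (l, k) + y (l, Suc k) = 0" for l k
    using fun_cong[OF eq, of "(l, k)"] by (simp add: tshift_apply)
  have off: "y (l, k) = 0" if l: "l \<noteq> \<mu>" for l k
  proof -
    have "finite (snd ` {p. y p \<noteq> 0})" using exp_poly_finite[OF y] by simp
    then obtain n where "\<forall>m\<in>snd ` {p. y p \<noteq> 0}. m < n" unfolding finite_nat_set_iff_bounded ..
    then have n: "m < n" if "m \<in> snd ` {p. y p \<noteq> 0}" for m using that by blast
    have big: "y (l, m) = 0" if "n \<le> m" for m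
      using n[of m] that by (force simp: image_iff)
    have "y (l, n - j) = 0" for j
    proof (induction j)
      case (Suc j)
      show ?case
      proof (cases "j < n")
        case True
        then have "Suc (n - Suc j) = n - j" by simp
        then have "(l - \<mu>) *\<^sub>C y (l, n - Suc j) = 0" using rec[of l "n - Suc j"] Suc by simp
        then have "(1 / (l - \<mu>)) *\<^sub>C ((l - \<mu>) *\<^sub>C y (l, n - Suc j)) = 0" by simp
        then show ?thesis using l by simp
      qed (use Suc in simp)
    qed (simp add: big)
    from this[of "n - k"] big[of k] show ?thesis by (cases "n \<le> k") simp_all
  qed
  have suc: "y (\<mu>, Suc k) = 0" for k using rec[of \<mu> k] by simp
  have "{l. y (l, 0) \<noteq> 0} \<subseteq> {\<mu>}" using off by auto
  then have "value0 y = y (\<mu>, 0)" using value0_superset[of "{\<mu>}" y] by simp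
  then have "y (\<mu>, 0) = 0" using v by simp
  then have "y (l, k) = 0" for l k using off suc by (cases k; cases "l = \<mu>") auto
  then show ?thesis by (auto simp: fun_eq_iff)
qed

lemma initial_value_exists:
  assumes S: "subspace S" and z: "z \<in> exp_poly S" and x: "x \<in> S"
  shows "\<exists>y\<in>exp_poly S. tshift \<mu> y = z \<and> value0 y = x"
proof -
  note E = exp_poly_subspace[OF S]
  have shift_single0: "tshift \<mu> (single (l, 0) x) = single (l, 0) ((l - \<mu>) *\<^sub>C x)" for l and x :: 'a
    by (auto simp: fun_eq_iff tshift_apply single_def)
  have shift_single: "tshift \<mu> (single (l, Suc k) x) = single (l, Suc k) ((l - \<mu>) *\<^sub>C x) + single (l, k) x"
    for l k and x :: 'a
    by (auto simp: fun_eq_iff tshift_apply single_def)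
  have "\<exists>y\<in>exp_poly S. tshift \<mu> y = z"
    using S z
  proof (induction rule: exp_poly_induct)
    case zero
    show ?case using subspace_0[OF E] by force
  next
    case (add y z)
    then obtain u v where "u \<in> exp_poly S" "v \<in> exp_poly S" "tshift \<mu> u = y" "tshift \<mu> v = z" by blast
    then show ?case using subspace_add[OF E] tshift_add[of \<mu> u v] by blast
  next
    case (single p x)
    obtain l k where p: "p = (l, k)" by (cases p)
    show ?case
    proof (cases "l = \<mu>")
      case True
      have "tshift \<mu> (single (\<mu>, Suc k) x) = single p x"
        by (auto simp: fun_eq_iff tshift_apply single_def p True)
      then show ?thesis using single_exp_poly[OF S single] by blast
    next
      case False
      have "\<forall>x\<in>S. \<exists>y\<in>exp_poly S. tshift \<mu> y = single (l, k) x"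
      proof (induction k)
        case 0
        show ?case
        proof
          fix x assume x: "x \<in> S"
          have "tshift \<mu> (single (l, 0) ((1 / (l - \<mu>)) *\<^sub>C x)) = single (l, 0) x"
            using False by (simp add: shift_single0)
          then show "\<exists>y\<in>exp_poly S. tshift \<mu> y = single (l, 0) x"
            using single_exp_poly[OF S subspace_scale[OF S x]] by blast
        qed
      next
        case (Suc k)
        show ?case
        proof
          fix x assume x: "x \<in> S"
          let ?x = "(1 / (l - \<mu>)) *\<^sub>C x"
          have x': "?x \<in> S" by (rule subspace_scale[OF S x])
          obtain y where y: "y \<in> exp_poly S" "tshift \<mu> y = single (l, k) ?x" using Suc x' by blast
          have "tshift \<mu> (single (l, Suc k) ?x - y) = single (l, Suc k) x"
            using False by (simp add: tshift_diff shift_single y)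
          then show "\<exists>y\<in>exp_poly S. tshift \<mu> y = single (l, Suc k) x"
            using subspace_diff[OF E single_exp_poly[OF S x'] y(1)] by blast
        qed
      qed
      then show ?thesis using single p by simp
    qed
  qed
  then obtain y where y: "y \<in> exp_poly S" "tshift \<mu> y = z" by blast
  let ?c = "single (\<mu>, 0) (x - value0 y)"
  have c: "?c \<in> exp_poly S" by (intro single_exp_poly S subspace_diff[OF S] x value0_mem[OF S] y)
  have "single (\<mu>, 0 :: nat) (0 :: 'a) = 0" by (simp add: single_def fun_eq_iff)
  then have "tshift \<mu> ?c = 0" by (simp add: shift_single0)
  then have "tshift \<mu> (y + ?c) = z" using y by (simp add: tshift_add)
  moreover have "value0 (y + ?c) = x" using value0_add[OF y(1) c] by (simp add: value0_single)
  ultimately show ?thesis using subspace_add[OF E y(1) c] by blast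
qed

text \<open>
  A linear map acts on exponential polynomials through their coefficients, and this commutes with the
  operations of calculus.
\<close>

context
  fixes f :: "'v::complex_vector \<Rightarrow> 'w::complex_vector" and S T
  assumes f: "f \<in> linear_maps (space_on S) (space_on T)" and S: "subspace S" and T: "subspace T"
begin

lemma lin_map_facts:
  shows lm_closed: "x \<in> S \<Longrightarrow> f x \<in> T" and lm_add: "x \<in> S \<Longrightarrow> y \<in> S \<Longrightarrow> f (x + y) = f x + f y"
    and lm_scale: "x \<in> S \<Longrightarrow> f (c *\<^sub>C x) = c *\<^sub>C f x" and lm_zero: "f 0 = 0"
    and lm_diff: "x \<in> S \<Longrightarrow> y \<in> S \<Longrightarrow> f (x - y) = f x - f y"
proof -
  show c: "x \<in> S \<Longrightarrow> f x \<in> T" for x using lin_closed[OF f] by simp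
  show a: "x \<in> S \<Longrightarrow> y \<in> S \<Longrightarrow> f (x + y) = f x + f y" for x y using lin_add[OF f] by simp
  show s: "x \<in> S \<Longrightarrow> f (c *\<^sub>C x) = c *\<^sub>C f x" for c x using lin_smult[OF f] by simp
  show "f 0 = 0" using lin_zero[OF f space_on_space[OF S] space_on_space[OF T]] by simp
  show "x \<in> S \<Longrightarrow> y \<in> S \<Longrightarrow> f (x - y) = f x - f y"
    using a[of x "(- 1) *\<^sub>C y"] s[of y "- 1"] subspace_scale[OF S, of y "- 1"] by (simp add: scaleC_minus_one)
qed

lemma coeff_exp_poly:
  assumes "y \<in> exp_poly S"
  shows "(\<lambda>p. f (y p)) \<in> exp_poly T"
proof (rule exp_polyI)
  have "{p. f (y p) \<noteq> 0} \<subseteq> {p. y p \<noteq> 0}" using lm_zero by auto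
  then show "finite {p. f (y p) \<noteq> 0}" using exp_poly_finite[OF assms] finite_subset by blast
qed (simp add: lm_closed exp_poly_mem[OF assms])

lemma coeff_tderiv: "y \<in> exp_poly S \<Longrightarrow> tderiv (\<lambda>p. f (y p)) = (\<lambda>p. f (tderiv y p))"
  by (auto simp: fun_eq_iff tderiv_def lm_add lm_scale exp_poly_mem subspace_scale[OF S])

lemma coeff_tshift: "y \<in> exp_poly S \<Longrightarrow> tshift \<mu> (\<lambda>p. f (y p)) = (\<lambda>p. f (tshift \<mu> y p))"
  by (auto simp: fun_eq_iff tshift_apply lm_add lm_scale exp_poly_mem subspace_scale[OF S])

lemma coeff_value0:
  assumes y: "y \<in> exp_poly S"
  shows "value0 (\<lambda>p. f (y p)) = f (value0 y)"
proof -
  have "value0 (\<lambda>p. f (y p)) = (\<Sum>l\<in>{l. y (l, 0) \<noteq> 0}. f (y (l, 0)))"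
    by (rule value0_superset[OF exp_poly_finite0[OF y]]) (auto simp: lm_zero)
  also have "\<dots> = f (value0 y)"
    using lin_sum[OF f S T, of "{l. y (l, 0) \<noteq> 0}" "\<lambda>l. y (l, 0)" "\<lambda>_. 1"] y
    by (simp add: value0_def exp_poly_mem)
  finally show ?thesis .
qed

end

section \<open>The module of solutions\<close>

text \<open>
  Let \<open>D\<close> be a connection along \<open>q\<close>, and let \<open>connection_op\<close> be the operator that takes \<open>y\<close> to the
  derivative of \<open>q y\<close> minus \<open>D y\<close>. If \<open>q\<close> were the identity, the kernel of
  \<open>connection_op\<close> would consist of the solutions \<open>exp (s * D) x\<close> of the differential equation
  \<open>y' = D y\<close>, and evaluation at \<open>0\<close> would identify it with the part of the module on which \<open>D\<close> is
  locally finite. The homotopy fibre of \<open>connection_op\<close> is the derived version of this kernel.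
\<close>

context weighted_dg_algebra
begin

context
  fixes P :: "('a, 'v::complex_vector) dg_module" and SP
    and M :: "('a, 'w::complex_vector) dg_module" and SM
    and q D :: "int \<Rightarrow> 'v \<Rightarrow> 'w"
  assumes P: "concrete A P SP" and M: "concrete A M SM"
    and q: "dg_hom A P M q" and D: "connection_along P M q D"
begin

definition connection_op :: "int \<Rightarrow> (complex \<times> nat \<Rightarrow> 'v) \<Rightarrow> complex \<times> nat \<Rightarrow> 'w" where
  "connection_op i y = tderiv (\<lambda>p. q i (y p)) - (\<lambda>p. D i (y p))"

lemma SP: "subspace (SP i)" and SM: "subspace (SM i)"
  by (rule concrete_subspace[OF P], rule concrete_subspace[OF M])

lemma ql: "q i \<in> linear_maps (space_on (SP i)) (space_on (SM i))"
  using dg_hom_linear[OF q] by (simp add: concrete_gr[OF P] concrete_gr[OF M])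

lemma Dl: "D i \<in> linear_maps (space_on (SP i)) (space_on (SM i))"
  using D by (simp add: connection_along_def concrete_gr[OF P] concrete_gr[OF M])

lemma dPl: "dif P i \<in> linear_maps (space_on (SP i)) (space_on (SP (i + 1)))"
  and dMl: "dif M i \<in> linear_maps (space_on (SM i)) (space_on (SM (i + 1)))"
  by (auto intro!: linear_mapsI simp: cdif_closed[OF P] cdif_add[OF P] cdif_scale[OF P]
      cdif_closed[OF M] cdif_add[OF M] cdif_scale[OF M])

lemma qd: "x \<in> SP i \<Longrightarrow> q (i + 1) (dif P i x) = dif M i (q i x)"
  using dg_hom_dif[OF q, of x i] by (simp add: concrete_gr[OF P])

lemma Dd: "x \<in> SP i \<Longrightarrow> D (i + 1) (dif P i x) = dif M i (D i x)"
  using D by (simp add: connection_along_def concrete_gr[OF P])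

lemma Dact: "x \<in> SP i \<Longrightarrow> a \<in> carrier (gr A j) \<Longrightarrow>
    D (i + j) (act P i j x a) = act M i j (D i x) a + euler_act M i j (q i x) a"
  using D by (simp add: connection_along_def concrete_gr[OF P])

lemma qact: "x \<in> SP i \<Longrightarrow> a \<in> carrier (gr A j) \<Longrightarrow> q (i + j) (act P i j x a) = act M i j (q i x) a"
  using dg_hom_act[OF q, of x i a j] by (simp add: concrete_gr[OF P])

lemmas q_facts = lin_map_facts[OF ql SP SM] and D_facts = lin_map_facts[OF Dl SP SM]
  and dP_facts = lin_map_facts[OF dPl SP SP] and dM_facts = lin_map_facts[OF dMl SM SM]

lemma connection_op_apply:
  "connection_op i y (l, k) = l *\<^sub>C q i (y (l, k)) + q i (y (l, Suc k)) - D i (y (l, k))"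
  by (simp add: connection_op_def tderiv_def)

lemma connection_op_linear:
  "connection_op i \<in> linear_maps (space_on (exp_poly (SP i))) (space_on (exp_poly (SM i)))"
proof (rule linear_mapsI, unfold space_on_simps)
  fix y assume y: "y \<in> exp_poly (SP i)"
  show "connection_op i y \<in> exp_poly (SM i)"
    unfolding connection_op_def
    by (intro subspace_diff[OF exp_poly_subspace[OF SM]] tderiv_exp_poly[OF SM]
        coeff_exp_poly[OF ql SP SM y] coeff_exp_poly[OF Dl SP SM y])
  show "connection_op i (c *\<^sub>C y) = c *\<^sub>C connection_op i y" for c
    by (auto simp: fun_eq_iff connection_op_apply q_facts D_facts exp_poly_mem[OF y] scaleC_simps mult.commute)
next
  fix y z assume y: "y \<in> exp_poly (SP i)" and z: "z \<in> exp_poly (SP i)"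
  show "connection_op i (y + z) = connection_op i y + connection_op i z"
    by (auto simp: fun_eq_iff connection_op_apply q_facts D_facts exp_poly_mem[OF y] exp_poly_mem[OF z]
        scaleC_simps algebra_simps)
qed

lemmas op_facts = lin_map_facts[OF connection_op_linear exp_poly_subspace[OF SP] exp_poly_subspace[OF SM]]

lemma connection_op_tshift:
  assumes y: "y \<in> exp_poly (SP i)"
  shows "connection_op i (tshift \<mu> y) = tshift \<mu> (connection_op i y)"
  by (auto simp: fun_eq_iff tshift_apply connection_op_apply q_facts D_facts exp_poly_mem[OF y]
      subspace_scale[OF SP] subspace_add[OF SP] scaleC_simps algebra_simps)

text \<open>
  Since \<open>a\<close> of weight \<open>n\<close> acts through \<open>a * exp (n * s)\<close>, the derivative of \<open>(q y) a\<close> contains the term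
  \<open>n * (q y) a\<close>. This is also the term by which \<open>D\<close> fails to be linear over the algebra, so both
  cancel.
\<close>

lemma connection_op_hom: "dg_hom A (exp_module P SP) (exp_module M SM) connection_op"
  unfolding dg_hom_def
proof (intro conjI allI ballI)
  show "connection_op i \<in> linear_maps (gr (exp_module P SP) i) (gr (exp_module M SM) i)" for i
    using connection_op_linear by simp
  fix i y assume "y \<in> carrier (gr (exp_module P SP) i)"
  then have y: "y \<in> exp_poly (SP i)" by simp
  show "connection_op (i + 1) (dif (exp_module P SP) i y) = dif (exp_module M SM) i (connection_op i y)"
    by (auto simp: fun_eq_iff connection_op_apply qd Dd exp_poly_mem[OF y] q_facts D_facts
        dM_facts subspace_add[OF SM] subspace_scale[OF SM])
  fix j a assume a: "a \<in> carrier (gr A j)"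
  have "connection_op (i + j) (exp_act P i j y a) = exp_act M i j (connection_op i y) a"
    using a
  proof (induction rule: weight_induct)
    case (weight n a)
    note a = wt_carrier[OF weight]
    show ?case
    proof
      fix p :: "complex \<times> nat"
      obtain l k where p: "p = (l, k)" by (cases p)
      let ?x = "y (l - of_int n, k)" and ?x' = "y (l - of_int n, Suc k)"
      have "connection_op (i + j) (exp_act P i j y a) p =
          l *\<^sub>C act M i j (q i ?x) a + act M i j (q i ?x') a - (act M i j (D i ?x) a + of_int n *\<^sub>C act M i j (q i ?x) a)"
        by (simp add: p connection_op_apply exp_act_wt[OF P y weight] qact[OF exp_poly_mem[OF y] a]
            Dact[OF exp_poly_mem[OF y] a] euler_act_wt[OF M q_facts(1)[OF exp_poly_mem[OF y]] weight])
      also have "\<dots> = act M i j ((l - of_int n) *\<^sub>C q i ?x + q i ?x' - D i ?x) a"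
        by (simp add: cact_diff[OF M] cact_add[OF M] cact_scale[OF M] q_facts D_facts exp_poly_mem[OF y] a
            subspace_add[OF SM] subspace_scale[OF SM] scaleC_diff_left algebra_simps)
      also have "\<dots> = exp_act M i j (connection_op i y) a p"
        by (simp add: p exp_act_wt[OF M op_facts(1)[OF y] weight] connection_op_apply)
      finally show "connection_op (i + j) (exp_act P i j y a) p = exp_act M i j (connection_op i y) a p" .
    qed
  next
    case (add a b)
    show ?case
      unfolding exp_act_add_right[OF P y add.hyps] exp_act_add_right[OF M op_facts(1)[OF y] add.hyps]
        op_facts(2)[OF exp_act_closed[OF P y add.hyps(1)] exp_act_closed[OF P y add.hyps(2)]] add.IH ..
  qed
  then show "connection_op (i + j) (act (exp_module P SP) i j y a) = act (exp_module M SM) i j (connection_op i y) a"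
    by simp
qed

definition solution_module :: "('a, (complex \<times> nat \<Rightarrow> 'v) \<times> (complex \<times> nat \<Rightarrow> 'w)) dg_module" where
  "solution_module = homotopy_fibre (exp_module P SP) (\<lambda>i. exp_poly (SP i)) (exp_module M SM)
     (\<lambda>i. exp_poly (SM i)) connection_op"

lemma solution_module_concrete:
  "concrete A solution_module (\<lambda>i. exp_poly (SP i) \<times> exp_poly (SM (i - 1)))"
  unfolding solution_module_def
  by (rule homotopy_fibre_concrete[OF exp_module_concrete[OF P] exp_module_concrete[OF M] connection_op_hom])

lemma solution_module_simps:
  "dif solution_module i (y, y') = (\<lambda>p. dif P i (y p), connection_op i y - (\<lambda>p. dif M (i - 1) (y' p)))"
  "act solution_module i j (y, y') a = (exp_act P i j y a, exp_act M (i - 1) j y' a)"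
  by (simp_all add: solution_module_def fun_eq_iff)

text \<open>
  At \<open>s = 0\<close> the factors \<open>exp (n * s)\<close> in the action are equal to \<open>1\<close>.
\<close>

lemma value0_hom: "dg_hom A solution_module P (\<lambda>i w. value0 (fst w))"
  unfolding dg_hom_def
proof (intro conjI allI ballI)
  show "(\<lambda>w. value0 (fst w)) \<in> linear_maps (gr solution_module i) (gr P i)" for i
    unfolding concrete_gr[OF solution_module_concrete] concrete_gr[OF P]
    by (rule linear_mapsI) (auto simp: value0_mem[OF SP] value0_add value0_scale)
  fix i w assume "w \<in> carrier (gr solution_module i)"
  then obtain y y' where w: "w = (y, y')" and y: "y \<in> exp_poly (SP i)"
    by (auto simp: concrete_gr[OF solution_module_concrete])
  show "value0 (fst (dif solution_module i w)) = dif P i (value0 (fst w))"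
    by (simp add: w solution_module_simps coeff_value0[OF dPl SP SP y])
  fix j a assume a: "a \<in> carrier (gr A j)"
  have "value0 (exp_act P i j y a) = act P i j (value0 y) a"
    using a
  proof (induction rule: weight_induct)
    case (weight n a)
    note a = wt_carrier[OF weight]
    show ?case
      using SP y
    proof (induction rule: exp_poly_induct)
      case zero
      have "exp_act P i j 0 a = 0"
      proof
        show "exp_act P i j 0 a p = 0 p" for p
          by (cases p) (simp add: exp_act_wt[OF P subspace_0[OF exp_poly_subspace[OF SP]] weight] cact_zero[OF P a])
      qed
      then show ?case by (simp only: value0_zero cact_zero[OF P a])
    next
      case (single p x)
      obtain l k where p: "p = (l, k)" by (cases p)
      have "exp_act P i j (single p x) a = single (l + of_int n, k) (act P i j x a)"
      proof
        show "exp_act P i j (single p x) a r = single (l + of_int n, k) (act P i j x a) r" for r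
          by (cases r)
            (auto simp: exp_act_wt[OF P single_exp_poly[OF SP single] weight] single_apply p cact_zero[OF P a])
      qed
      then show ?case by (simp add: p value0_single cact_zero[OF P a])
    next
      case (add y z)
      then show ?case
        by (simp only: exp_act_add_left[OF P add.hyps a] value0_add[OF add.hyps]
            value0_add[OF exp_act_closed[OF P add.hyps(1) a] exp_act_closed[OF P add.hyps(2) a]]
            cact_add[OF P value0_mem[OF SP add.hyps(1)] value0_mem[OF SP add.hyps(2)] a])
    qed
  next
    case (add a b)
    have "value0 (exp_act P i j y (a \<oplus>\<^bsub>gr A j\<^esub> b)) = value0 (exp_act P i j y a + exp_act P i j y b)"
      by (simp only: exp_act_add_right[OF P y add.hyps])
    also have "\<dots> = act P i j (value0 y) (a \<oplus>\<^bsub>gr A j\<^esub> b)"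
      by (simp only: value0_add[OF exp_act_closed[OF P y add.hyps(1)] exp_act_closed[OF P y add.hyps(2)]]
          add.IH cact_add_right[OF P value0_mem[OF SP y] add.hyps])
    finally show ?case .
  qed
  then show "value0 (fst (act solution_module i j w a)) = act P i j (value0 (fst w)) a"
    by (simp add: w solution_module_simps)
qed

text \<open>
  If \<open>q\<close> is a quasi-isomorphism and the cohomology of \<open>P\<close> is finite-dimensional in each degree, then
  \<open>D\<close> is an operator on a finite-dimensional space, up to the identification by \<open>q\<close>, and each
  class is killed by a product of factors \<open>D - \<mu>\<close>. The predicate below expresses this for the class of
  the cocycle \<open>x\<close>: the class of \<open>x'\<close> is the image of the class of \<open>x\<close> under \<open>D - \<mu>\<close>.
\<close>

inductive locally_finite :: "int \<Rightarrow> 'v \<Rightarrow> bool" for i where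
  exact: "x \<in> coboundaries P i \<Longrightarrow> locally_finite i x"
| factor: "x \<in> cocycles P i \<Longrightarrow> locally_finite i x' \<Longrightarrow>
    q i x' - (D i x - \<mu> *\<^sub>C q i x) \<in> coboundaries M i \<Longrightarrow> locally_finite i x"

lemma cobP: "subspace (coboundaries P i)" and cobM: "subspace (coboundaries M i)"
  by (rule concrete_coboundaries_subspace[OF P], rule concrete_coboundaries_subspace[OF M])

lemma ZP: "x \<in> cocycles P i \<longleftrightarrow> x \<in> SP i \<and> dif P i x = 0" and ZM: "m \<in> cocycles M i \<longleftrightarrow> m \<in> SM i \<and> dif M i m = 0"
  by (simp_all add: concrete_cocycles[OF P] concrete_cocycles[OF M])

lemma ZP_subspace: "subspace (cocycles P i)" and ZM_subspace: "subspace (cocycles M i)"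
  by (auto simp: subspace_def ZP ZM dP_facts dM_facts subspace_0[OF SP] subspace_0[OF SM] subspace_add[OF SP]
      subspace_add[OF SM] subspace_scale[OF SP] subspace_scale[OF SM])

lemma BP_ZP: "x \<in> coboundaries P i \<Longrightarrow> x \<in> cocycles P i"
proof -
  interpret X: cochain_complex P by (rule dg_module_cochain[OF concrete_dg_module[OF P]])
  show "x \<in> coboundaries P i \<Longrightarrow> x \<in> cocycles P i" using X.coboundaries_cocycles by blast
qed

lemma q_cob: "x \<in> coboundaries P i \<Longrightarrow> q i x \<in> coboundaries M i"
  by (rule dg_hom_coboundaries[OF q])

lemma D_cob: "x \<in> coboundaries P i \<Longrightarrow> D i x \<in> coboundaries M i"
  by (erule concrete_coboundaryE[OF P])
    (use Dd[of _ "i - 1"] concrete_coboundariesI[OF M] D_facts(1) in fastforce)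

lemma D_cocycle: "x \<in> cocycles P i \<Longrightarrow> D i x \<in> cocycles M i"
  using Dd[of x i] D_facts(1,4) by (simp add: ZP ZM)

context
  assumes qbij: "cohomology_bijective P M q" and fin: "finite_cohomology P"
begin

lemma q_inj: "x \<in> cocycles P i \<Longrightarrow> q i x \<in> coboundaries M i \<Longrightarrow> x \<in> coboundaries P i"
  using qbij by (auto simp: cohomology_bijective_def)

lemma q_surj: "m \<in> cocycles M i \<Longrightarrow> \<exists>x\<in>cocycles P i. q i x - m \<in> coboundaries M i"
proof -
  assume "m \<in> cocycles M i"
  then have "\<exists>x\<in>cocycles P i. \<exists>b\<in>coboundaries M i. m = b + q i x"
    using qbij by (simp add: cohomology_bijective_def concrete_gr[OF M])
  then obtain x b where x: "x \<in> cocycles P i" and b: "b \<in> coboundaries M i" "m = b + q i x" by blast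
  then have "q i x - m \<in> coboundaries M i" using subspace_neg[OF cobM b(1)] by simp
  with x show ?thesis by blast
qed

text \<open>
  Choose cocycles \<open>xs n\<close> which represent the iterates of \<open>D\<close> on the class of \<open>x\<close>. Some nonzero polynomial \<open>p\<close>
  of \<open>D\<close> kills the class of \<open>x\<close>, and \<open>p\<close> is a product of linear factors.
\<close>

lemma cocycle_locally_finite:
  assumes x: "x \<in> cocycles P i"
  shows "locally_finite i x"
proof -
  have "\<forall>x\<in>cocycles P i. \<exists>x'\<in>cocycles P i. q i x' - D i x \<in> coboundaries M i"
    using q_surj D_cocycle by blast
  then obtain N where N: "\<And>x. x \<in> cocycles P i \<Longrightarrow> N x \<in> cocycles P i"
    "\<And>x. x \<in> cocycles P i \<Longrightarrow> q i (N x) - D i x \<in> coboundaries M i" by metis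
  define xs where "xs n = (N ^^ n) x" for n
  have xs: "xs n \<in> cocycles P i" for n by (induction n) (auto simp: xs_def x N(1))
  have rel: "q i (xs (Suc n)) - D i (xs n) \<in> coboundaries M i" for n using N(2)[OF xs[of n]] by (simp add: xs_def)
  let ?g = "\<lambda>p. poly_combination p xs"
  have g: "?g p \<in> cocycles P i" for p
    unfolding poly_combination_def by (intro subspace_sum[OF ZP_subspace] subspace_scale[OF ZP_subspace] xs)
  have gX: "q i (?g (pCons 0 p)) - D i (?g p) \<in> coboundaries M i" for p
  proof -
    have xP: "xs n \<in> SP i" for n using xs ZP by blast
    have gs: "?g (pCons 0 p) = (\<Sum>n\<le>degree p. coeff p n *\<^sub>C xs (Suc n))"
      by (subst poly_combination_pCons) (simp only: poly_combination_def scaleC_zero_left add_0)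
    have "q i (?g (pCons 0 p)) - D i (?g p) = (\<Sum>n\<le>degree p. coeff p n *\<^sub>C (q i (xs (Suc n)) - D i (xs n)))"
      using lin_sum[OF ql SP SM, of "{..degree p}" "\<lambda>n. xs (Suc n)" i "coeff p"]
        lin_sum[OF Dl SP SM, of "{..degree p}" xs i "coeff p"] xP
      unfolding gs by (simp add: poly_combination_def sum_subtractf scaleC_diff_right)
    also have "\<dots> \<in> coboundaries M i"
      by (intro subspace_sum[OF cobM] subspace_scale[OF cobM] rel)
    finally show ?thesis .
  qed
  have B: "linear_subspace (space_on (SP i)) (coboundaries P i)"
    using cobP BP_ZP ZP by (auto simp: linear_subspace_def subspace_def)
  have "fin_codim (space_on (SP i)) (coboundaries P i) (cocycles P i)"
    using fin by (simp add: finite_cohomology_def concrete_gr[OF P])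
  then obtain p where p: "p \<noteq> 0" "?g p \<in> coboundaries P i"
    by (rule fin_codim_recurrence[OF SP B _ xs])
  have main: "\<forall>p f. degree p = n \<longrightarrow> p \<noteq> 0 \<longrightarrow> ?g (p * f) \<in> coboundaries P i \<longrightarrow> locally_finite i (?g f)" for n
  proof (induction n)
    case 0
    show ?case
    proof (intro allI impI)
      fix p f assume p: "degree p = 0" "p \<noteq> 0" "?g (p * f) \<in> coboundaries P i"
      then obtain c where c: "p = [:c:]" "c \<noteq> 0" by (metis degree_eq_zeroE pCons_0_0)
      have "?g f = (1 / c) *\<^sub>C ?g (p * f)" using c by (simp add: poly_combination_smult)
      then show "locally_finite i (?g f)" using subspace_scale[OF cobP p(3)] locally_finite.exact by metis
    qed
  next
    case (Suc n)
    show ?case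
    proof (intro allI impI)
      fix p f assume p: "degree p = Suc n" "p \<noteq> 0" "?g (p * f) \<in> coboundaries P i"
      then have "\<not> constant (poly p)" by (simp add: constant_degree)
      then obtain \<mu> where "poly p \<mu> = 0" using fundamental_theorem_of_algebra by blast
      then obtain p' where p': "p = [:- \<mu>, 1:] * p'" using poly_eq_0_iff_dvd by (metis dvdE)
      have "p' \<noteq> 0" using p(2) unfolding p' by auto
      moreover from this have "degree p = degree [:- \<mu>, 1:] + degree p'"
        unfolding p' by (intro degree_mult_eq) auto
      then have "degree p' = n" using p(1) by simp
      moreover have "p' * ([:- \<mu>, 1:] * f) = p * f" unfolding p' by (simp only: ac_simps)
      ultimately have "locally_finite i (?g ([:- \<mu>, 1:] * f))" using Suc p(3) by metis
      moreover have "[:- \<mu>, 1:] * f = pCons 0 f + Polynomial.smult (- \<mu>) f" by simp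
      then have "?g ([:- \<mu>, 1:] * f) = ?g (pCons 0 f) + (- \<mu>) *\<^sub>C ?g f"
        by (simp only: poly_combination_add poly_combination_smult)
      then have "q i (?g ([:- \<mu>, 1:] * f)) - (D i (?g f) - \<mu> *\<^sub>C q i (?g f)) = q i (?g (pCons 0 f)) - D i (?g f)"
        using g ZP by (simp add: q_facts subspace_scale[OF SP] scaleC_minus_left)
      ultimately show "locally_finite i (?g f)" using locally_finite.factor[OF g] gX by metis
    qed
  qed
  have "locally_finite i (?g 1)" using main p by (metis mult.right_neutral)
  moreover have "?g 1 = x" by (simp add: poly_combination_def xs_def)
  ultimately show ?thesis by simp
qed

text \<open>
  Let \<open>y2\<close> be a solution whose initial value \<open>x2\<close> represents \<open>D - \<mu>\<close> applied to \<open>x\<close>, and let \<open>y\<close> be the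
  solution of the initial value problem \<open>tshift \<mu> y = y2\<close>, \<open>value0 y = x\<close>. Then \<open>tshift \<mu>\<close> makes
  \<open>connection_op i y\<close> exact, because it commutes with \<open>connection_op\<close>, and the value of
  \<open>connection_op i y\<close> at \<open>0\<close> is exact by the choice of \<open>x\<close>. So \<open>connection_op i y\<close> is exact itself, since
  initial value problems can be solved for primitives.
\<close>

lemma solution_exists:
  assumes "locally_finite i x"
  shows "\<exists>y\<in>exp_poly (SP i). \<exists>y'\<in>exp_poly (SM (i - 1)). (\<lambda>p. dif P i (y p)) = 0 \<and>
    connection_op i y = (\<lambda>p. dif M (i - 1) (y' p)) \<and> value0 y - x \<in> coboundaries P i"
  using assms
proof induction
  case (exact x)
  have "(\<lambda>p. dif P i ((0 :: complex \<times> nat \<Rightarrow> 'v) p)) = 0" "(\<lambda>p. dif M (i - 1) ((0 :: complex \<times> nat \<Rightarrow> 'w) p)) = 0"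
    by (auto simp: fun_eq_iff dP_facts(4) dM_facts(4))
  moreover have "value0 0 - x \<in> coboundaries P i" using subspace_neg[OF cobP exact] by simp
  ultimately show ?case
    using subspace_0[OF exp_poly_subspace[OF SP]] subspace_0[OF exp_poly_subspace[OF SM]]
    by (intro bexI[of _ "0 :: complex \<times> nat \<Rightarrow> 'v"] bexI[of _ "0 :: complex \<times> nat \<Rightarrow> 'w"] conjI) (simp_all only: op_facts(4))
next
  case (factor x x2 \<mu>)
  then obtain y2 y2' where y2: "y2 \<in> exp_poly (SP i)" "y2' \<in> exp_poly (SM (i - 1))" "(\<lambda>p. dif P i (y2 p)) = 0"
    "connection_op i y2 = (\<lambda>p. dif M (i - 1) (y2' p))" "value0 y2 - x2 \<in> coboundaries P i" by blast
  have x: "x \<in> SP i" "dif P i x = 0" using factor.hyps ZP by auto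
  obtain y where y: "y \<in> exp_poly (SP i)" "tshift \<mu> y = y2" "value0 y = x"
    using initial_value_exists[OF SP y2(1) x(1), of \<mu>] by blast
  have dy: "(\<lambda>p. dif P i (y p)) = 0"
  proof (rule initial_value_unique[OF coeff_exp_poly[OF dPl SP SP y(1)]])
    show "tshift \<mu> (\<lambda>p. dif P i (y p)) = 0"
      using coeff_tshift[OF dPl SP SP y(1)] y2(3) by (simp add: y(2))
    show "value0 (\<lambda>p. dif P i (y p)) = 0" using coeff_value0[OF dPl SP SP y(1)] x by (simp add: y(3))
  qed
  have qy: "(\<lambda>p. q i (y p)) \<in> exp_poly (SM i)" and Dy: "(\<lambda>p. D i (y p)) \<in> exp_poly (SM i)"
    by (rule coeff_exp_poly[OF ql SP SM y(1)], rule coeff_exp_poly[OF Dl SP SM y(1)])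
  have vc: "value0 y2 \<in> SP i" by (rule value0_mem[OF SP y2(1)])
  have x2c: "x2 \<in> SP i"
  proof -
    have "value0 y2 - x2 \<in> SP i" using BP_ZP[OF y2(5)] by (simp only: ZP)
    then have "value0 y2 - (value0 y2 - x2) \<in> SP i" by (rule subspace_diff[OF SP vc])
    then show ?thesis by simp
  qed
  have ty: "tderiv y = y2 + \<mu> *\<^sub>C y" using y(2) by (simp add: tshift_def algebra_simps)
  have "value0 (connection_op i y) = value0 (tderiv (\<lambda>p. q i (y p)) + (- 1) *\<^sub>C (\<lambda>p. D i (y p)))"
    by (simp add: connection_op_def scaleC_minus_one)
  also have "\<dots> = value0 (tderiv (\<lambda>p. q i (y p))) + (- 1) *\<^sub>C value0 (\<lambda>p. D i (y p))"
    using value0_add[OF tderiv_exp_poly[OF SM qy] subspace_scale[OF exp_poly_subspace[OF SM] Dy]]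
    by (simp only: value0_scale[OF Dy])
  also have "\<dots> = q i (value0 (tderiv y)) - D i x"
    using coeff_value0[OF Dl SP SM y(1)] coeff_value0[OF ql SP SM tderiv_exp_poly[OF SP y(1)]]
    by (simp add: coeff_tderiv[OF ql SP SM y(1)] y(3) scaleC_minus_one)
  also have "value0 (tderiv y) = value0 y2 + \<mu> *\<^sub>C x"
    unfolding ty using value0_add[OF y2(1) subspace_scale[OF exp_poly_subspace[OF SP] y(1)]]
    by (simp only: value0_scale[OF y(1)] y(3))
  also have "q i (value0 y2 + \<mu> *\<^sub>C x) - D i x = q i (value0 y2 - x2) + (q i x2 - (D i x - \<mu> *\<^sub>C q i x))"
    by (simp add: q_facts vc x2c x subspace_scale[OF SP] algebra_simps)
  also have "\<dots> \<in> coboundaries M i"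
    by (rule subspace_add[OF cobM q_cob[OF y2(5)] factor.hyps(3)])
  finally obtain m where m: "m \<in> SM (i - 1)" "value0 (connection_op i y) = dif M (i - 1) m"
    by (rule concrete_coboundaryE[OF M])
  obtain y' where y': "y' \<in> exp_poly (SM (i - 1))" "tshift \<mu> y' = y2'" "value0 y' = m"
    using initial_value_exists[OF SM y2(2) m(1), of \<mu>] by blast
  have dy'c: "(\<lambda>p. dif M (i - 1) (y' p)) \<in> exp_poly (SM i)"
    using coeff_exp_poly[OF dMl SM SM y'(1)] by simp
  let ?w = "connection_op i y - (\<lambda>p. dif M (i - 1) (y' p))"
  have wc: "?w \<in> exp_poly (SM i)" by (intro subspace_diff[OF exp_poly_subspace[OF SM]] op_facts(1) y(1) dy'c)
  have "?w = 0"
  proof (rule initial_value_unique[OF wc])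
    have "tshift \<mu> (connection_op i y) = connection_op i (tshift \<mu> y)"
      by (rule connection_op_tshift[OF y(1), symmetric])
    then show "tshift \<mu> ?w = 0"
      using coeff_tshift[OF dMl SM SM y'(1), of \<mu>] y2(4) by (simp add: tshift_diff y(2) y'(2))
    have "value0 ?w = value0 (connection_op i y + (- 1) *\<^sub>C (\<lambda>p. dif M (i - 1) (y' p)))"
      by (simp add: scaleC_minus_one)
    also have "\<dots> = value0 (connection_op i y) + (- 1) *\<^sub>C value0 (\<lambda>p. dif M (i - 1) (y' p))"
      using value0_add[OF op_facts(1)[OF y(1)] subspace_scale[OF exp_poly_subspace[OF SM] dy'c]]
      by (simp only: value0_scale[OF dy'c])
    also have "\<dots> = 0" using coeff_value0[OF dMl SM SM y'(1)] m(2) y'(3) by (simp add: scaleC_minus_one)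
    finally show "value0 ?w = 0" .
  qed
  then show ?case using y dy y'(1) subspace_0[OF cobP] by (intro bexI[of _ y] bexI[of _ y']) auto
qed

text \<open>
  By linearity and surjectivity of \<open>q\<close> on cohomology it suffices to reach \<open>v * q x\<close> for a scalar exponential
  polynomial \<open>v\<close> and a cocycle \<open>x\<close>. Write \<open>v\<close> as \<open>tshift \<mu> v1\<close>. Then \<open>connection_op\<close> takes \<open>v1 * x\<close> to
  \<open>v * q x - v1 * (D - \<mu> q) x\<close>, and the last term is reached by induction on \<open>locally_finite\<close>.
\<close>

lemma connection_op_surjective:
  assumes y: "y \<in> exp_poly (cocycles M i)"
  shows "\<exists>z\<in>exp_poly (SP i). \<exists>z'\<in>exp_poly (SM (i - 1)). (\<lambda>p. dif P i (z p)) = 0 \<and>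
    connection_op i z - (\<lambda>p. dif M (i - 1) (z' p)) = y"
proof -
  note EP = exp_poly_subspace[OF SP] and EM = exp_poly_subspace[OF SM]
  define R where "R y \<longleftrightarrow> (\<exists>z\<in>exp_poly (SP i). \<exists>z'\<in>exp_poly (SM (i - 1)). (\<lambda>p. dif P i (z p)) = 0 \<and>
    connection_op i z - (\<lambda>p. dif M (i - 1) (z' p)) = y)" for y
  have R_add: "R (y + z)" if "R y" "R z" for y z
  proof -
    obtain a a' where a: "a \<in> exp_poly (SP i)" "a' \<in> exp_poly (SM (i - 1))" "(\<lambda>p. dif P i (a p)) = 0"
        "connection_op i a - (\<lambda>p. dif M (i - 1) (a' p)) = y"
      using \<open>R y\<close>[unfolded R_def] by (elim bexE conjE) (rule that)
    obtain b b' where b: "b \<in> exp_poly (SP i)" "b' \<in> exp_poly (SM (i - 1))" "(\<lambda>p. dif P i (b p)) = 0"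
        "connection_op i b - (\<lambda>p. dif M (i - 1) (b' p)) = z"
      using \<open>R z\<close>[unfolded R_def] by (elim bexE conjE) (rule that)
    have "(\<lambda>p. dif P i ((a + b) p)) = (\<lambda>p. dif P i (a p)) + (\<lambda>p. dif P i (b p))"
      "(\<lambda>p. dif M (i - 1) ((a' + b') p)) = (\<lambda>p. dif M (i - 1) (a' p)) + (\<lambda>p. dif M (i - 1) (b' p))"
      by (auto simp: fun_eq_iff dP_facts dM_facts exp_poly_mem[OF a(1)] exp_poly_mem[OF b(1)]
          exp_poly_mem[OF a(2)] exp_poly_mem[OF b(2)])
    then have "(\<lambda>p. dif P i ((a + b) p)) = 0" "connection_op i (a + b) - (\<lambda>p. dif M (i - 1) ((a' + b') p)) = y + z"
      using a b by (simp_all add: op_facts(2)) (simp add: algebra_simps flip: a(4) b(4))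
    then show ?thesis
      unfolding R_def using subspace_add[OF EP a(1) b(1)] subspace_add[OF EM a(2) b(2)] by blast
  qed
  have R_exact: "R (\<lambda>p. dif M (i - 1) (m p))" if m: "m \<in> exp_poly (SM (i - 1))" for m
  proof -
    have "(\<lambda>p. dif P i ((0 :: complex \<times> nat \<Rightarrow> 'v) p)) = 0" by (auto simp: fun_eq_iff dP_facts(4))
    moreover have "connection_op i 0 - (\<lambda>p. dif M (i - 1) ((- m) p)) = (\<lambda>p. dif M (i - 1) (m p))"
      using cdif_neg[OF M exp_poly_mem[OF m]] by (auto simp: fun_eq_iff op_facts(4))
    ultimately show ?thesis
      unfolding R_def using subspace_0[OF EP] subspace_neg[OF EM m] by blast
  qed
  have tensor: "(\<lambda>p. v p *\<^sub>C x) \<in> exp_poly S" if "v \<in> exp_poly UNIV" "x \<in> S" "subspace S"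
    for v :: "complex \<times> nat \<Rightarrow> complex" and x :: "'b::complex_vector" and S
    using that by (intro exp_polyI) (auto intro: finite_subset[OF _ exp_poly_finite[OF that(1)]] simp: subspace_scale)
  have CU: "subspace (UNIV :: complex set)" by (simp add: subspace_def)
  have R_tensor: "\<forall>v\<in>exp_poly UNIV. R (\<lambda>p. v p *\<^sub>C q i x)" if "locally_finite i x" for x
    using that
  proof induction
    case (exact x)
    then obtain u where u: "u \<in> SP (i - 1)" "x = dif P (i - 1) u" by (rule concrete_coboundaryE[OF P])
    show ?case
    proof
      fix v :: "complex \<times> nat \<Rightarrow> complex" assume v: "v \<in> exp_poly UNIV"
      have "(\<lambda>p. dif M (i - 1) (v p *\<^sub>C q (i - 1) u)) = (\<lambda>p. v p *\<^sub>C q i x)"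
        using qd[OF u(1)] q_facts(1)[OF u(1)] by (simp add: u(2) dM_facts(3))
      with R_exact[OF tensor[OF v q_facts(1)[OF u(1)] SM]] show "R (\<lambda>p. v p *\<^sub>C q i x)" by simp
    qed
  next
    case (factor x x2 \<mu>)
    have x: "x \<in> SP i" "dif P i x = 0" using factor.hyps ZP by auto
    obtain m where m: "m \<in> SM (i - 1)" "q i x2 - (D i x - \<mu> *\<^sub>C q i x) = dif M (i - 1) m"
      using factor.hyps(3) by (rule concrete_coboundaryE[OF M])
    show ?case
    proof
      fix v :: "complex \<times> nat \<Rightarrow> complex" assume v: "v \<in> exp_poly UNIV"
      obtain v1 where v1: "v1 \<in> exp_poly UNIV" "tshift \<mu> v1 = v"
        using initial_value_exists[OF CU v UNIV_I, of \<mu>] by blast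
      have v_eq: "v (l, k) = (l - \<mu>) * v1 (l, k) + v1 (l, Suc k)" for l k
        using tshift_apply[of \<mu> v1 l k] v1(2) by (simp add: scaleC_complex_def)
      have D_eq: "D i x = q i x2 + \<mu> *\<^sub>C q i x - dif M (i - 1) m" using m(2) by (simp add: algebra_simps)
      let ?y = "\<lambda>p. v1 p *\<^sub>C x"
      have y: "?y \<in> exp_poly (SP i)" by (rule tensor[OF v1(1) x(1) SP])
      have m': "(\<lambda>p. v1 p *\<^sub>C m) \<in> exp_poly (SM (i - 1))" by (rule tensor[OF v1(1) m(1) SM])
      have "R (connection_op i ?y - (\<lambda>p. dif M (i - 1) (v1 p *\<^sub>C m)))"
        unfolding R_def using y m' x by (intro bexI[of _ ?y] bexI[of _ "\<lambda>p. v1 p *\<^sub>C m"]) (auto simp: dP_facts fun_eq_iff)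
      moreover have "R (\<lambda>p. v1 p *\<^sub>C q i x2)" using factor.IH v1(1) by blast
      ultimately have "R ((connection_op i ?y - (\<lambda>p. dif M (i - 1) (v1 p *\<^sub>C m))) + (\<lambda>p. v1 p *\<^sub>C q i x2))"
        by (rule R_add)
      moreover have "(connection_op i ?y - (\<lambda>p. dif M (i - 1) (v1 p *\<^sub>C m))) + (\<lambda>p. v1 p *\<^sub>C q i x2) = (\<lambda>p. v p *\<^sub>C q i x)"
        using x(1) m(1)
        by (auto simp: fun_eq_iff connection_op_apply q_facts(3) D_facts(3) dM_facts(3) v_eq D_eq scaleC_simps algebra_simps)
      ultimately show "R (\<lambda>p. v p *\<^sub>C q i x)" by simp
    qed
  qed
  have "R y"
    using ZM_subspace y
  proof (induction rule: exp_poly_induct)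
    case zero
    have "(\<lambda>p. dif M (i - 1) ((0 :: complex \<times> nat \<Rightarrow> 'w) p)) = 0" by (auto simp: fun_eq_iff dM_facts(4))
    then show ?case using R_exact[OF subspace_0[OF EM]] by (simp only:)
  next
    case (single p m)
    then obtain x where x: "x \<in> cocycles P i" "q i x - m \<in> coboundaries M i" using q_surj by blast
    then obtain u where u: "u \<in> SM (i - 1)" "q i x - m = dif M (i - 1) u" using concrete_coboundaryE[OF M] by metis
    have "R (\<lambda>r. single p 1 r *\<^sub>C q i x)"
      using R_tensor[OF cocycle_locally_finite[OF x(1)]] single_exp_poly[OF CU UNIV_I] by blast
    moreover have "R (\<lambda>r. dif M (i - 1) (single p (- u) r))"
      by (rule R_exact[OF single_exp_poly[OF SM subspace_neg[OF SM u(1)]]])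
    ultimately have "R ((\<lambda>r. single p 1 r *\<^sub>C q i x) + (\<lambda>r. dif M (i - 1) (single p (- u) r)))" by (rule R_add)
    moreover have "(\<lambda>r. single p 1 r *\<^sub>C q i x) + (\<lambda>r. dif M (i - 1) (single p (- u) r)) = single p m"
      using u cdif_neg[OF M u(1)] by (auto simp: fun_eq_iff single_def dM_facts(4) algebra_simps)
    ultimately show ?case by simp
  qed (rule R_add)
  then show ?thesis unfolding R_def .
qed

text \<open>
  The number of pairs \<open>(l, k)\<close> such that \<open>y\<close> has a nonzero coefficient at \<open>(l, k')\<close> for some \<open>k' \<ge> k\<close>
  drops when \<open>y\<close> is replaced by \<open>tshift l y\<close> for an exponent \<open>l\<close> of \<open>y\<close>. The hypotheses pass to
  \<open>tshift l y\<close>, the exactness of its value at \<open>0\<close> being the injectivity of \<open>q\<close> on cohomology. If \<open>v2\<close> is a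
  primitive of \<open>tshift l y\<close> and \<open>u\<close> a primitive of \<open>value0 y\<close>, then the solution \<open>v\<close> of \<open>tshift l v = v2\<close>,
  \<open>value0 v = u\<close> is a primitive of \<open>y\<close>, by uniqueness for the initial value problem.
\<close>

lemma solution_with_exact_value:
  assumes "y \<in> exp_poly (SP i)" "y' \<in> exp_poly (SM (i - 1))" "(\<lambda>p. dif P i (y p)) = 0"
    "connection_op i y = (\<lambda>p. dif M (i - 1) (y' p))" "value0 y \<in> coboundaries P i"
  shows "\<exists>v\<in>exp_poly (SP (i - 1)). (\<lambda>p. dif P (i - 1) (v p)) = y"
  using assms
proof (induction "card {(l, k). \<exists>k'\<ge>k. y (l, k') \<noteq> 0}" arbitrary: y y' rule: less_induct)
  case less
  note y = less.prems(1) and y' = less.prems(2) and dy = less.prems(3) and op = less.prems(4) and v0 = less.prems(5)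
  show ?case
  proof (cases "y = 0")
    case True
    then show ?thesis
      using subspace_0[OF exp_poly_subspace[OF SP]] by (intro bexI[of _ 0]) (auto simp: fun_eq_iff dP_facts(4))
  next
    case False
    then obtain \<mu> k0 where nz: "y (\<mu>, k0) \<noteq> 0" by (auto simp: fun_eq_iff)
    let ?H = "\<lambda>y :: complex \<times> nat \<Rightarrow> 'v. {(l, k). \<exists>k'\<ge>k. y (l, k') \<noteq> 0}"
    have "?H y \<subseteq> (\<Union>(l, k)\<in>{p. y p \<noteq> 0}. {l} \<times> {..k})" by auto
    then have Hfin: "finite (?H y)" using exp_poly_finite[OF y] by (elim finite_subset) auto
    let ?y2 = "tshift \<mu> y"
    have "?H ?y2 \<subset> ?H y"
    proof
      show "?H ?y2 \<subseteq> ?H y"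
      proof
        fix p assume "p \<in> ?H ?y2"
        then obtain l k k' where p: "p = (l, k)" "k \<le> k'" "?y2 (l, k') \<noteq> 0" by auto
        then have "y (l, k') \<noteq> 0 \<or> y (l, Suc k') \<noteq> 0" by (auto simp: tshift_apply)
        then show "p \<in> ?H y" using p by (auto intro: le_SucI)
      qed
      have "finite {k. y (\<mu>, k) \<noteq> 0}"
        by (rule finite_subset[of _ "snd ` {p. y p \<noteq> 0}"]) (force simp: exp_poly_finite[OF y])+
      then have max: "k \<le> Max {k. y (\<mu>, k) \<noteq> 0}" if "y (\<mu>, k) \<noteq> 0" for k using that by simp
      let ?k = "Max {k. y (\<mu>, k) \<noteq> 0}"
      have "y (\<mu>, ?k) \<noteq> 0" using Max_in[OF \<open>finite {k. y (\<mu>, k) \<noteq> 0}\<close>] nz by blast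
      then have "(\<mu>, ?k) \<in> ?H y" by auto
      moreover have "(\<mu>, ?k) \<notin> ?H ?y2"
        using max by (auto simp: tshift_apply) (metis Suc_n_not_le_n le_trans)
      ultimately show "?H ?y2 \<noteq> ?H y" by blast
    qed
    then have card: "card (?H ?y2) < card (?H y)" by (rule psubset_card_mono[OF Hfin])
    have y2: "?y2 \<in> exp_poly (SP i)" by (rule tshift_exp_poly[OF SP y])
    have dy2: "(\<lambda>p. dif P i (?y2 p)) = 0" using coeff_tshift[OF dPl SP SP y, of \<mu>] dy by simp
    have op2: "connection_op i ?y2 = (\<lambda>p. dif M (i - 1) (tshift \<mu> y' p))"
    proof -
      have "connection_op i ?y2 = tshift \<mu> (connection_op i y)"
        by (rule connection_op_tshift[OF y])
      then show ?thesis using op coeff_tshift[OF dMl SM SM y', of \<mu>] by simp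
    qed
    have qy: "(\<lambda>p. q i (y p)) \<in> exp_poly (SM i)" and Dy: "(\<lambda>p. D i (y p)) \<in> exp_poly (SM i)"
      by (rule coeff_exp_poly[OF ql SP SM y], rule coeff_exp_poly[OF Dl SP SM y])
    have opc: "connection_op i y \<in> exp_poly (SM i)" by (rule op_facts(1)[OF y])
    have "tderiv (\<lambda>p. q i (y p)) = connection_op i y + (\<lambda>p. D i (y p))" by (simp add: connection_op_def)
    then have "q i (value0 (tderiv y)) = value0 (connection_op i y + (\<lambda>p. D i (y p)))"
      using coeff_value0[OF ql SP SM tderiv_exp_poly[OF SP y]] coeff_tderiv[OF ql SP SM y] by simp
    also have "\<dots> = value0 (connection_op i y) + D i (value0 y)"
      using value0_add[OF opc Dy] coeff_value0[OF Dl SP SM y] by simp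
    also have "\<dots> = dif M (i - 1) (value0 y') + D i (value0 y)"
      using coeff_value0[OF dMl SM SM y'] by (simp add: op)
    also have "\<dots> \<in> coboundaries M i"
      by (intro subspace_add[OF cobM] concrete_coboundariesI[OF M] value0_mem[OF SM y'] D_cob v0)
    finally have "q i (value0 (tderiv y)) \<in> coboundaries M i" .
    moreover have "tderiv y = ?y2 + \<mu> *\<^sub>C y" by (simp add: tshift_def)
    then have "value0 (tderiv y) = value0 ?y2 + \<mu> *\<^sub>C value0 y"
      using value0_add[OF y2 subspace_scale[OF exp_poly_subspace[OF SP] y]] by (simp only: value0_scale[OF y])
    ultimately have "q i (value0 ?y2) + \<mu> *\<^sub>C q i (value0 y) \<in> coboundaries M i"
      by (simp add: q_facts value0_mem[OF SP y] value0_mem[OF SP y2] subspace_scale[OF SP])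
    from subspace_diff[OF cobM this subspace_scale[OF cobM q_cob[OF v0], of \<mu>]]
    have "q i (value0 ?y2) \<in> coboundaries M i" by simp
    moreover have "value0 ?y2 \<in> cocycles P i"
      using coeff_value0[OF dPl SP SP y2] dy2 value0_mem[OF SP y2] by (simp add: ZP)
    ultimately have "value0 ?y2 \<in> coboundaries P i" using q_inj by blast
    from less.hyps[OF card y2 tshift_exp_poly[OF SM y'] dy2 op2 this]
    obtain v2 where v2: "v2 \<in> exp_poly (SP (i - 1))" "(\<lambda>p. dif P (i - 1) (v2 p)) = ?y2" by blast
    obtain u where u: "u \<in> SP (i - 1)" "value0 y = dif P (i - 1) u" by (rule concrete_coboundaryE[OF P v0])
    obtain v where v: "v \<in> exp_poly (SP (i - 1))" "tshift \<mu> v = v2" "value0 v = u"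
      using initial_value_exists[OF SP v2(1) u(1), of \<mu>] by blast
    have dv: "(\<lambda>p. dif P (i - 1) (v p)) \<in> exp_poly (SP i)" using coeff_exp_poly[OF dPl SP SP v(1)] by simp
    have "(\<lambda>p. dif P (i - 1) (v p)) - y = 0"
    proof (rule initial_value_unique[OF subspace_diff[OF exp_poly_subspace[OF SP] dv y]])
      show "tshift \<mu> ((\<lambda>p. dif P (i - 1) (v p)) - y) = 0"
        using coeff_tshift[OF dPl SP SP v(1), of \<mu>] v2(2) by (simp add: tshift_diff v(2))
      have "value0 ((\<lambda>p. dif P (i - 1) (v p)) - y) = value0 ((\<lambda>p. dif P (i - 1) (v p)) + (- 1) *\<^sub>C y)"
        by (simp add: scaleC_minus_one)
      also have "\<dots> = value0 (\<lambda>p. dif P (i - 1) (v p)) + (- 1) *\<^sub>C value0 y"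
        using value0_add[OF dv subspace_scale[OF exp_poly_subspace[OF SP] y]] by (simp only: value0_scale[OF y])
      also have "\<dots> = 0" using coeff_value0[OF dPl SP SP v(1)] u(2) by (simp add: v(3) scaleC_minus_one)
      finally show "value0 ((\<lambda>p. dif P (i - 1) (v p)) - y) = 0" .
    qed
    then show ?thesis using v(1) by (intro bexI[of _ v]) auto
  qed
qed

text \<open>
  Surjectivity is \<open>solution_exists\<close>. For injectivity, let \<open>(y, y')\<close> be a cocycle whose value at \<open>0\<close> is exact.
  By \<open>solution_with_exact_value\<close>, \<open>y\<close> is exact, and it becomes zero after subtracting a coboundary; then \<open>y'\<close> has coefficients in the cocycles, and it is
  reached by \<open>connection_op_surjective\<close>.
\<close>

theorem value0_bijective: "cohomology_bijective solution_module P (\<lambda>i w. value0 (fst w))"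
  unfolding cohomology_bijective_def
proof (intro conjI allI ballI impI)
  fix i w assume wz: "w \<in> cocycles solution_module i" and w0: "value0 (fst w) \<in> coboundaries P i"
  obtain y y' where w: "w = (y, y')" and y: "y \<in> exp_poly (SP i)" and y': "y' \<in> exp_poly (SM (i - 1))"
    using wz by (auto simp: concrete_cocycles[OF solution_module_concrete])
  have dy: "(\<lambda>p. dif P i (y p)) = 0" and op: "connection_op i y = (\<lambda>p. dif M (i - 1) (y' p))"
    using wz by (auto simp: w concrete_cocycles[OF solution_module_concrete] solution_module_simps zero_prod_def)
  obtain v where v: "v \<in> exp_poly (SP (i - 1))" "(\<lambda>p. dif P (i - 1) (v p)) = y"
    using solution_with_exact_value[OF y y' dy op] w0 by (auto simp: w)
  let ?z = "y' - connection_op (i - 1) v"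
  have opv: "connection_op (i - 1) v \<in> exp_poly (SM (i - 1))" by (rule op_facts(1)[OF v(1)])
  have zc: "?z \<in> exp_poly (SM (i - 1))" by (rule subspace_diff[OF exp_poly_subspace[OF SM] y' opv])
  have dz: "dif M (i - 1) (?z p) = 0" for p
  proof -
    have "connection_op i y p = dif M (i - 1) (connection_op (i - 1) v p)"
    proof -
      have "connection_op (i - 1 + 1) (\<lambda>k. dif P (i - 1) (v k)) = (\<lambda>k. dif M (i - 1) (connection_op (i - 1) v k))"
        using dg_hom_dif[OF connection_op_hom, of v "i - 1"] v(1) by (simp add: exp_module_def)
      from fun_cong[OF this[unfolded v(2)], of p] show ?thesis by simp
    qed
    then show ?thesis
      using fun_cong[OF op, of p] by (simp add: cdif_diff[OF M exp_poly_mem[OF y'] exp_poly_mem[OF opv]])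
  qed
  have "?z \<in> exp_poly (cocycles M (i - 1))"
    using zc dz exp_poly_mem[OF zc] exp_poly_finite[OF zc] by (intro exp_polyI) (auto simp: ZM)
  then obtain u u' where u: "u \<in> exp_poly (SP (i - 1))" "u' \<in> exp_poly (SM (i - 1 - 1))"
    "(\<lambda>p. dif P (i - 1) (u p)) = 0" "connection_op (i - 1) u - (\<lambda>p. dif M (i - 1 - 1) (u' p)) = ?z"
    using connection_op_surjective by blast
  have "dif solution_module (i - 1) (v + u, u') = w"
  proof -
    have "(\<lambda>p. dif P (i - 1) ((v + u) p)) = (\<lambda>p. dif P (i - 1) (v p)) + (\<lambda>p. dif P (i - 1) (u p))"
      by (auto simp: fun_eq_iff dP_facts exp_poly_mem[OF v(1)] exp_poly_mem[OF u(1)])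
    then have 1: "(\<lambda>p. dif P (i - 1) ((v + u) p)) = y" by (simp only: v(2) u(3) add_0_right)
    have "connection_op (i - 1) (v + u) - (\<lambda>p. dif M (i - 1 - 1) (u' p)) =
        connection_op (i - 1) v + (connection_op (i - 1) u - (\<lambda>p. dif M (i - 1 - 1) (u' p)))"
      by (simp only: op_facts(2)[OF v(1) u(1)] add_diff_eq)
    also have "\<dots> = y'" unfolding u(4) by simp
    finally show ?thesis using 1 by (simp only: w solution_module_simps)
  qed
  moreover have "(v + u, u') \<in> exp_poly (SP (i - 1)) \<times> exp_poly (SM (i - 1 - 1))"
    using subspace_add[OF exp_poly_subspace[OF SP] v(1) u(1)] u(2) by simp
  ultimately show "w \<in> coboundaries solution_module i"
    unfolding concrete_coboundaries[OF solution_module_concrete] by (metis imageI)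
next
  fix i x assume x: "x \<in> cocycles P i"
  obtain y y' where y: "y \<in> exp_poly (SP i)" "y' \<in> exp_poly (SM (i - 1))" "(\<lambda>p. dif P i (y p)) = 0"
    "connection_op i y = (\<lambda>p. dif M (i - 1) (y' p))" "value0 y - x \<in> coboundaries P i"
    using solution_exists[OF cocycle_locally_finite[OF x]] by blast
  have "(y, y') \<in> cocycles solution_module i"
    using y by (simp add: concrete_cocycles[OF solution_module_concrete] solution_module_simps zero_prod_def)
  moreover have "x - value0 y \<in> coboundaries P i" using subspace_neg[OF cobP y(5)] by simp
  moreover have "x = (x - value0 y) \<oplus>\<^bsub>gr P i\<^esub> value0 (fst (y, y'))" by (simp add: concrete_gr[OF P])
  ultimately show "\<exists>w\<in>cocycles solution_module i. \<exists>b\<in>coboundaries P i. x = b \<oplus>\<^bsub>gr P i\<^esub> value0 (fst w)"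
    by blast
qed

end

end

end

section \<open>Diagonal actions are rational\<close>

lemma regular_function_powi: "regular_function (\<lambda>z. z powi n * c)"
proof (cases "0 \<le> n")
  case True
  have "z powi n * c = poly (monom c (nat n)) z / z ^ 0" for z
    using True by (simp add: poly_monom power_int_def)
  then show ?thesis unfolding regular_function_def by blast
next
  case False
  have "z powi n * c = poly [:c:] z / z ^ nat (- n)" for z
    using False by (simp add: power_int_def field_simps)
  then show ?thesis unfolding regular_function_def by blast
qed

text \<open>
  The lines spanned by the basis vectors are one-dimensional algebraic representations. The
  direct sum is indexed by the set of these lines, so they must be distinct as sets.
\<close>

lemma diagonal_rational:
  fixes V :: "(complex, 'u) module" and \<Phi> :: "'u \<Rightarrow> 'b \<Rightarrow> complex"
  assumes V: "complex_vector_space V" and \<Phi>: "\<Phi> \<in> linear_maps V (space_on (finitely_supported Y))"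
    and bij: "bij_betw \<Phi> (carrier V) (finitely_supported Y)"
    and rc: "\<And>z x. z \<noteq> 0 \<Longrightarrow> x \<in> carrier V \<Longrightarrow> r z x \<in> carrier V"
    and r\<Phi>: "\<And>z x. z \<noteq> 0 \<Longrightarrow> x \<in> carrier V \<Longrightarrow> \<Phi> (r z x) = (\<lambda>b. z powi \<omega> b * \<Phi> x b)"
  shows "rational_representation V r"
proof -
  interpret V: module complex_field V by (rule V)
  note fs = finitely_supported_subspace[where 'v = complex, of Y]
  have inj: "x = y" if "\<Phi> x = \<Phi> y" "x \<in> carrier V" "y \<in> carrier V" for x y
    using bij that by (auto simp: bij_betw_def dest: inj_onD)
  have add: "\<Phi> (x \<oplus>\<^bsub>V\<^esub> y) = \<Phi> x + \<Phi> y" if "x \<in> carrier V" "y \<in> carrier V" for x y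
    using lin_add[OF \<Phi> that] by simp
  have smult: "\<Phi> (c \<odot>\<^bsub>V\<^esub> x) = c *\<^sub>C \<Phi> x" if "x \<in> carrier V" for c x
    using lin_smult[OF \<Phi> that] by simp
  have zero: "\<Phi> \<zero>\<^bsub>V\<^esub> = 0" using lin_zero[OF \<Phi> V space_on_space[OF fs]] by simp
  have \<Phi>Y: "\<Phi> x b = 0" if "x \<in> carrier V" "b \<notin> Y" for x b
    using lin_closed[OF \<Phi> that(1)] that(2) by (auto simp: finitely_supported_def)
  have \<Phi>fin: "finite {b. \<Phi> x b \<noteq> 0}" if "x \<in> carrier V" for x
    using lin_closed[OF \<Phi> that] by (auto simp: finitely_supported_def)
  have rl: "r z \<in> linear_maps V V" if z: "z \<noteq> 0" for z
  proof (rule linear_mapsI)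
    show "r z (x \<oplus>\<^bsub>V\<^esub> y) = r z x \<oplus>\<^bsub>V\<^esub> r z y" if "x \<in> carrier V" "y \<in> carrier V" for x y
      using that by (intro inj) (auto simp: rc[OF z] r\<Phi>[OF z] add vs_add[OF V] fun_eq_iff algebra_simps)
    show "r z (c \<odot>\<^bsub>V\<^esub> x) = c \<odot>\<^bsub>V\<^esub> r z x" if "x \<in> carrier V" for c x
      using that by (intro inj) (auto simp: rc[OF z] r\<Phi>[OF z] smult vs_smult[OF V] fun_eq_iff scaleC_complex_def)
  qed (rule rc[OF z])
  have r1: "r 1 x = x" if "x \<in> carrier V" for x
    using that by (intro inj) (auto simp: rc r\<Phi>)
  have rm: "r (z * w) x = r z (r w x)" if "z \<noteq> 0" "w \<noteq> 0" "x \<in> carrier V" for z w x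
    using that by (intro inj) (auto simp: rc r\<Phi> power_int_mult_distrib fun_eq_iff)
  define v where "v b = inv_into (carrier V) \<Phi> (single b 1)" for b
  have sg: "single b (1 :: complex) \<in> finitely_supported Y" if "b \<in> Y" for b
    using that by (auto simp: finitely_supported_def single_def)
  have v: "v b \<in> carrier V" "\<Phi> (v b) = single b 1" if "b \<in> Y" for b
    using bij_betw_inv_into_right[OF bij sg[OF that]] bij_betw_apply[OF bij_betw_inv_into[OF bij] sg[OF that]]
    by (auto simp: v_def)
  have \<Phi>cv: "\<Phi> (c \<odot>\<^bsub>V\<^esub> v b) = single b c" if "b \<in> Y" for c b
    using v[OF that] by (auto simp: smult single_def fun_eq_iff scaleC_complex_def)
  define L where "L b = {c \<odot>\<^bsub>V\<^esub> v b | c. True}" for b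
  have ls: "linear_subspace V (L b)" if b: "b \<in> Y" for b
  proof -
    have "c \<odot>\<^bsub>V\<^esub> v b \<oplus>\<^bsub>V\<^esub> d \<odot>\<^bsub>V\<^esub> v b = (c + d) \<odot>\<^bsub>V\<^esub> v b" "d \<odot>\<^bsub>V\<^esub> (c \<odot>\<^bsub>V\<^esub> v b) = (d * c) \<odot>\<^bsub>V\<^esub> v b"
      "\<zero>\<^bsub>V\<^esub> = 0 \<odot>\<^bsub>V\<^esub> v b" for c d
      using v(1)[OF b] by (simp_all add: vs_distl[OF V] vs_smult_smult[OF V] vs_null[OF V])
    then show ?thesis using v(1)[OF b] vs_smult[OF V] by (fastforce simp: linear_subspace_def L_def)
  qed
  have Linj: "b = b'" if "L b = L b'" "b \<in> Y" "b' \<in> Y" for b b'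
  proof -
    have "v b \<in> L b" using vs_one[OF V v(1)[OF that(2)]] by (auto simp: L_def intro: exI[of _ 1])
    then have "v b \<in> L b'" by (simp only: that(1))
    then obtain c where "v b = c \<odot>\<^bsub>V\<^esub> v b'" unfolding L_def by blast
    then have "single b (1 :: complex) = single b' c" using v(2)[OF that(2)] \<Phi>cv[OF that(3)] by simp
    then show ?thesis by (auto simp: single_def fun_eq_iff split: if_splits)
  qed
  have rL: "r z x = z powi \<omega> b \<odot>\<^bsub>V\<^esub> x" if "z \<noteq> 0" "b \<in> Y" "x \<in> L b" for z b x
  proof -
    obtain c where x: "x = c \<odot>\<^bsub>V\<^esub> v b" using \<open>x \<in> L b\<close> by (auto simp: L_def)
    have xc: "x \<in> carrier V" by (rule linear_subspace_carrier[OF ls[OF that(2)] that(3)])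
    have "\<Phi> x = single b c" using \<Phi>cv[OF that(2)] x by simp
    then show ?thesis
      using xc that(1) by (intro inj) (auto simp: rc r\<Phi> smult vs_smult[OF V] single_def fun_eq_iff scaleC_complex_def)
  qed
  \<comment> \<open>a family of vectors in the lines sums up to \<open>x\<close> if and only if its members are the coordinates of \<open>x\<close>\<close>
  have key: "x = (\<Oplus>\<^bsub>V\<^esub>W\<in>{W\<in>L ` Y. f W \<noteq> \<zero>\<^bsub>V\<^esub>}. f W) \<longleftrightarrow> (\<forall>b\<in>Y. f (L b) = \<Phi> x b \<odot>\<^bsub>V\<^esub> v b)"
    if x: "x \<in> carrier V" and f: "\<And>W. W \<in> L ` Y \<Longrightarrow> f W \<in> W" and fin: "finite {W\<in>L ` Y. f W \<noteq> \<zero>\<^bsub>V\<^esub>}" for x f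
  proof -
    let ?K = "{W\<in>L ` Y. f W \<noteq> \<zero>\<^bsub>V\<^esub>}"
    have fc: "f W \<in> carrier V" if W: "W \<in> L ` Y" for W
    proof -
      obtain b where b: "b \<in> Y" "W = L b" using W by blast
      show ?thesis using linear_subspace_carrier[OF ls[OF b(1)]] f[OF W] by (simp add: b(2))
    qed
    have "\<exists>c. f (L b) = c \<odot>\<^bsub>V\<^esub> v b" if "b \<in> Y" for b
      using f[OF imageI[OF that]] unfolding L_def by blast
    then have "\<forall>b\<in>Y. \<exists>c. f (L b) = c \<odot>\<^bsub>V\<^esub> v b" by blast
    then obtain c where c: "\<And>b. b \<in> Y \<Longrightarrow> f (L b) = c b \<odot>\<^bsub>V\<^esub> v b" by metis
    have \<Phi>f: "\<Phi> (f (L b)) = single b (c b)" if "b \<in> Y" for b using c[OF that] \<Phi>cv[OF that] by simp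
    let ?s = "\<Oplus>\<^bsub>V\<^esub>W\<in>?K. f W"
    have sc: "?s \<in> carrier V" using fc by (intro V.M.finsum_closed) auto
    have "\<Phi> ?s = (\<Sum>W\<in>?K. \<Phi> (f W))" by (rule lin_finsum[OF \<Phi> V fs fin]) (use fc in auto)
    moreover have "(\<Sum>W\<in>K. \<Phi> (f W)) b = (\<Sum>W\<in>K. \<Phi> (f W) b)" for b K
      by (induction K rule: infinite_finite_induct) auto
    ultimately have s: "\<Phi> ?s b = (\<Sum>W\<in>?K. \<Phi> (f W) b)" for b by simp
    have sb: "\<Phi> ?s b = c b" if b: "b \<in> Y" for b
    proof -
      have "(\<Sum>W\<in>?K. \<Phi> (f W) b) = (\<Sum>W\<in>?K. if W = L b then c b else 0)"
      proof (intro sum.cong refl)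
        fix W assume "W \<in> ?K"
        then obtain b' where b': "b' \<in> Y" "W = L b'" by auto
        show "\<Phi> (f W) b = (if W = L b then c b else 0)"
          using \<Phi>f[OF b'(1)] Linj[OF _ b'(1) b] b' by (auto simp: single_def)
      qed
      also have "\<dots> = (if L b \<in> ?K then c b else 0)" using fin by simp
      also have "\<dots> = c b"
      proof (cases "L b \<in> ?K")
        case False
        then have "f (L b) = \<zero>\<^bsub>V\<^esub>" using b by blast
        then have "single b (c b) = 0" using \<Phi>f[OF b] zero by simp
        then have "single b (c b) b = 0" by simp
        then have "c b = 0" by (simp add: single_def)
        then show ?thesis by simp
      qed simp
      finally show ?thesis using s by simp
    qed
    show ?thesis
    proof
      assume "x = ?s"
      then show "\<forall>b\<in>Y. f (L b) = \<Phi> x b \<odot>\<^bsub>V\<^esub> v b" using sb c by simp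
    next
      assume a: "\<forall>b\<in>Y. f (L b) = \<Phi> x b \<odot>\<^bsub>V\<^esub> v b"
      have "\<Phi> x b = c b" if b: "b \<in> Y" for b
      proof -
        have "\<Phi> x b \<odot>\<^bsub>V\<^esub> v b = c b \<odot>\<^bsub>V\<^esub> v b" using a b c[OF b] by simp
        then have "single b (\<Phi> x b) = single b (c b)" unfolding \<Phi>cv[OF b, symmetric] by simp
        then have "single b (\<Phi> x b) b = single b (c b) b" by simp
        then show ?thesis by (simp add: single_def)
      qed
      then have "\<Phi> x b = \<Phi> ?s b" for b using sb \<Phi>Y x sc by (cases "b \<in> Y") simp_all
      then show "x = ?s" using x sc by (intro inj) auto
    qed
  qed
  have "internal_direct_sum V (L ` Y)"
    unfolding internal_direct_sum_def
  proof (intro conjI ballI)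
    fix W assume "W \<in> L ` Y"
    then obtain b where b: "b \<in> Y" "W = L b" by blast
    show "submodule W complex_field V"
    proof (rule V.submoduleI)
      show "\<ominus>\<^bsub>V\<^esub> a \<in> W" if "a \<in> W" for a
        using linear_subspace_smult[OF ls[OF b(1)], of a "- 1"] linear_subspace_carrier[OF ls[OF b(1)], of a] that
        by (simp add: b(2) vs_neg[OF V])
    qed (use ls[OF b(1)] in \<open>auto simp: linear_subspace_def b(2)\<close>)
  next
    fix x assume x: "x \<in> carrier V"
    define f where "f = (\<lambda>W\<in>L ` Y. \<Phi> x (inv_into Y L W) \<odot>\<^bsub>V\<^esub> v (inv_into Y L W))"
    have Li: "inv_into Y L (L b) = b" if "b \<in> Y" for b
      using that Linj by (intro inv_into_f_f inj_onI) auto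
    have fL: "f (L b) = \<Phi> x b \<odot>\<^bsub>V\<^esub> v b" if "b \<in> Y" for b using that Li[OF that] by (simp add: f_def)
    have "f (L b) \<in> L b" if "b \<in> Y" for b
    proof -
      have "\<Phi> x b \<odot>\<^bsub>V\<^esub> v b \<in> L b" unfolding L_def by blast
      then show ?thesis by (simp only: fL[OF that])
    qed
    then have fmem: "f W \<in> W" if "W \<in> L ` Y" for W using that by blast
    have ffin: "finite {W\<in>L ` Y. f W \<noteq> \<zero>\<^bsub>V\<^esub>}"
    proof (rule finite_subset)
      show "{W\<in>L ` Y. f W \<noteq> \<zero>\<^bsub>V\<^esub>} \<subseteq> L ` {b. \<Phi> x b \<noteq> 0}"
        using fL v(1) by (auto simp: vs_null[OF V])
    qed (use \<Phi>fin[OF x] in simp)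
    show "\<exists>!f. f \<in> (\<Pi>\<^sub>E W\<in>L ` Y. W) \<and> finite {W\<in>L ` Y. f W \<noteq> \<zero>\<^bsub>V\<^esub>} \<and>
        x = (\<Oplus>\<^bsub>V\<^esub>W\<in>{W\<in>L ` Y. f W \<noteq> \<zero>\<^bsub>V\<^esub>}. f W)"
    proof (rule ex1I[of _ f])
      have "f \<in> (\<Pi>\<^sub>E W\<in>L ` Y. W)" using fmem by (auto simp: PiE_iff f_def)
      moreover have "x = (\<Oplus>\<^bsub>V\<^esub>W\<in>{W\<in>L ` Y. f W \<noteq> \<zero>\<^bsub>V\<^esub>}. f W)" using key[OF x fmem ffin] fL by simp
      ultimately show "f \<in> (\<Pi>\<^sub>E W\<in>L ` Y. W) \<and> finite {W\<in>L ` Y. f W \<noteq> \<zero>\<^bsub>V\<^esub>} \<and>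
        x = (\<Oplus>\<^bsub>V\<^esub>W\<in>{W\<in>L ` Y. f W \<noteq> \<zero>\<^bsub>V\<^esub>}. f W)" using ffin by blast
    next
      fix g assume g: "g \<in> (\<Pi>\<^sub>E W\<in>L ` Y. W) \<and> finite {W\<in>L ` Y. g W \<noteq> \<zero>\<^bsub>V\<^esub>} \<and>
        x = (\<Oplus>\<^bsub>V\<^esub>W\<in>{W\<in>L ` Y. g W \<noteq> \<zero>\<^bsub>V\<^esub>}. g W)"
      then have gm: "g W \<in> W" if "W \<in> L ` Y" for W using that by (auto simp: PiE_iff)
      have "\<forall>b\<in>Y. g (L b) = \<Phi> x b \<odot>\<^bsub>V\<^esub> v b" using key[OF x gm] g by blast
      then have "g W = f W" if "W \<in> L ` Y" for W using that fL by auto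
      moreover have "f W = g W" if "W \<notin> L ` Y" for W
        using that g by (simp add: f_def PiE_def extensional_def)
      ultimately show "g = f" by (metis ext)
    qed
  qed
  moreover have "algebraic_representation (V\<lparr>carrier := W\<rparr>) r" if "W \<in> L ` Y" for W
  proof -
    obtain b where b: "b \<in> Y" "W = L b" using \<open>W \<in> L ` Y\<close> by blast
    note VL = linear_subspace_vector_space[OF V ls[OF b(1)]]
    interpret VL: module complex_field "V\<lparr>carrier := L b\<rparr>" by (rule VL)
    have Lc: "x \<in> carrier V" if "x \<in> L b" for x by (rule linear_subspace_carrier[OF ls[OF b(1)] that])
    have rLc: "r z x \<in> L b" if "z \<noteq> 0" "x \<in> L b" for z x
      using rL[OF that(1) b(1) that(2)] linear_subspace_smult[OF ls[OF b(1)] that(2)] by simp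
    have "representation (V\<lparr>carrier := L b\<rparr>) r"
      unfolding representation_def
    proof (intro conjI allI impI ballI)
      show "r z \<in> linear_maps (V\<lparr>carrier := L b\<rparr>) (V\<lparr>carrier := L b\<rparr>)" if "z \<noteq> 0" for z
        using rl[OF that] rLc[OF that] Lc by (auto simp: linear_maps_def)
    qed (use r1 rm Lc in auto)
    moreover have "finite_dimensional (V\<lparr>carrier := L b\<rparr>)"
      unfolding finite_dimensional_def
    proof (intro exI[of _ "{v b}"] conjI ballI)
      have vL: "v b \<in> L b" using vs_one[OF V v(1)[OF b(1)]] by (auto simp: L_def intro: exI[of _ 1])
      then show "{v b} \<subseteq> carrier (V\<lparr>carrier := L b\<rparr>)" by simp
      fix x assume "x \<in> carrier (V\<lparr>carrier := L b\<rparr>)"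
      then obtain c where "x = c \<odot>\<^bsub>V\<^esub> v b" by (auto simp: L_def)
      moreover have "c \<odot>\<^bsub>V\<^esub> v b \<in> L b" by (auto simp: L_def)
      ultimately have "x = (\<Oplus>\<^bsub>V\<lparr>carrier := L b\<rparr>\<^esub>s\<in>{v b}. c \<odot>\<^bsub>V\<lparr>carrier := L b\<rparr>\<^esub> s)"
        using VL.M.finsum_insert[of "{}" "v b" "\<lambda>s. c \<odot>\<^bsub>V\<^esub> s"] VL.M.r_zero[of "c \<odot>\<^bsub>V\<^esub> v b"] by simp
      then show "\<exists>c. x = (\<Oplus>\<^bsub>V\<lparr>carrier := L b\<rparr>\<^esub>s\<in>{v b}. c s \<odot>\<^bsub>V\<lparr>carrier := L b\<rparr>\<^esub> s)"
        by (intro exI[of _ "\<lambda>_. c"])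
    qed simp
    moreover have "regular_function (\<lambda>z. \<theta> (r z x))"
      if \<theta>: "\<theta> \<in> linear_maps (V\<lparr>carrier := L b\<rparr>) complex_line" and x: "x \<in> L b" for \<theta> x
    proof -
      have e: "\<theta> (r z x) = z powi \<omega> b * \<theta> x" if "z \<noteq> 0" for z
        using rL[OF that b(1) x] lin_smult[OF \<theta>, of x "z powi \<omega> b"] x by (simp add: complex_line_def)
      obtain p m where "\<forall>z. z \<noteq> 0 \<longrightarrow> z powi \<omega> b * \<theta> x = poly p z / z ^ m"
        using regular_function_powi[of "\<omega> b" "\<theta> x"] unfolding regular_function_def by blast
      then show ?thesis unfolding regular_function_def using e by (intro exI[of _ p] exI[of _ m]) simp
    qed
    ultimately show ?thesis unfolding algebraic_representation_def b(2) by simp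
  qed
  moreover have "representation V r" unfolding representation_def using rl r1 rm by blast
  ultimately show ?thesis unfolding rational_representation_def by blast
qed

section \<open>Embedding exponential polynomials into the given type\<close>

text \<open>
  List the elements of a finite set, combine the list by repeated pairing, and record its length.
\<close>

lemma finite_sets_embed:
  assumes \<kappa>: "inj (\<kappa> :: complex \<Rightarrow> 'u)" and p: "inj (p :: 'u \<times> 'u \<Rightarrow> 'u)"
  shows "\<exists>c :: 'u set \<Rightarrow> 'u. inj_on c {F. finite F}"
proof -
  define enc where "enc xs = foldr (\<lambda>x y. p (x, y)) xs (\<kappa> 0)" for xs
  have enc: "xs = ys" if "length xs = length ys" "enc xs = enc ys" for xs ys
    using that
  proof (induction xs ys rule: list_induct2)
    case (Cons x xs y ys)
    have "p (x, enc xs) = p (y, enc ys)" using Cons.prems by (simp add: enc_def)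
    then have "x = y" "enc xs = enc ys" using injD[OF p] by blast+
    then show ?case using Cons.IH by simp
  qed simp
  define l where "l F = (SOME xs. set xs = F)" for F :: "'u set"
  have l: "set (l F) = F" if "finite F" for F
    unfolding l_def using finite_list[OF that] by (rule someI_ex)
  have "inj_on (\<lambda>F. p (\<kappa> (of_nat (length (l F))), enc (l F))) {F. finite F}"
  proof (rule inj_onI)
    fix F G assume F: "F \<in> {F. finite F}" and G: "G \<in> {F. finite F}"
      and eq: "p (\<kappa> (of_nat (length (l F))), enc (l F)) = p (\<kappa> (of_nat (length (l G))), enc (l G))"
    have "\<kappa> (of_nat (length (l F))) = \<kappa> (of_nat (length (l G)))" and e: "enc (l F) = enc (l G)"
      using injD[OF p eq] by auto
    then have "length (l F) = length (l G)" using injD[OF \<kappa>] by fastforce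
    then have "l F = l G" using e by (rule enc)
    then show "F = G" using l F G by (metis mem_Collect_eq)
  qed
  then show ?thesis by blast
qed

text \<open>
  A finitely supported function is determined by its graph over the support, which is a finite set.
\<close>

lemma exp_poly_embeds:
  assumes \<kappa>: "inj (\<kappa> :: complex \<Rightarrow> 'u)" and p: "inj (p :: 'u \<times> 'u \<Rightarrow> 'u)"
    and j: "inj_on (j :: 'v::complex_vector \<Rightarrow> 'u) S"
  shows "\<exists>e :: (complex \<times> nat \<Rightarrow> 'v) \<Rightarrow> 'u. inj_on e (exp_poly S)"
proof -
  obtain c :: "'u set \<Rightarrow> 'u" where c: "inj_on c {F. finite F}" using finite_sets_embed[OF \<kappa> p] by blast
  define tr where "tr q x = p (\<kappa> (fst q), p (\<kappa> (of_nat (snd q)), x))" for q :: "complex \<times> nat" and x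
  have tr: "q = q' \<and> x = x'" if eq: "tr q x = tr q' x'" for q q' x x'
  proof -
    have 1: "\<kappa> (fst q) = \<kappa> (fst q')" and 2: "p (\<kappa> (of_nat (snd q)), x) = p (\<kappa> (of_nat (snd q')), x')"
      using injD[OF p eq[unfolded tr_def]] by auto
    have 3: "\<kappa> (of_nat (snd q)) = \<kappa> (of_nat (snd q'))" and x: "x = x'" using injD[OF p 2] by auto
    have "fst q = fst q'" by (rule injD[OF \<kappa> 1])
    moreover have "(of_nat (snd q) :: complex) = of_nat (snd q')" by (rule injD[OF \<kappa> 3])
    ultimately show ?thesis using x by (simp add: prod_eq_iff)
  qed
  define G where "G y = (\<lambda>q. tr q (j (y q))) ` {q. y q \<noteq> 0}" for y
  have Gfin: "finite (G y)" if "y \<in> exp_poly S" for y using exp_poly_finite[OF that] by (simp add: G_def)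
  have sub: "y q = y' q" if y: "y \<in> exp_poly S" "y' \<in> exp_poly S" and G: "G y = G y'" and nz: "y q \<noteq> 0" for y y' q
  proof -
    have "tr q (j (y q)) \<in> G y'" using nz G[symmetric] by (auto simp: G_def)
    then obtain q' where "tr q (j (y q)) = tr q' (j (y' q'))" by (auto simp: G_def)
    from tr[OF this] have "q = q'" "j (y q) = j (y' q')" by auto
    then show ?thesis using inj_onD[OF j] exp_poly_mem[OF y(1)] exp_poly_mem[OF y(2)] by metis
  qed
  have "inj_on (\<lambda>y. c (G y)) (exp_poly S)"
  proof (rule inj_onI)
    fix y y' assume y: "y \<in> exp_poly S" "y' \<in> exp_poly S" and eq: "c (G y) = c (G y')"
    have G: "G y = G y'" using inj_onD[OF c eq] Gfin y by simp
    show "y = y'"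
    proof
      show "y q = y' q" for q
      proof (cases "y q = 0 \<and> y' q = 0")
        case False
        then show ?thesis using sub[OF y G, of q] sub[OF y(2,1) G[symmetric], of q] by fastforce
      qed simp
    qed
  qed
  then show ?thesis by blast
qed

section \<open>The equivariant structure\<close>

text \<open>
  The exponents of one coset of the integers would be made into weights by subtracting a fixed
  number. Taking integral parts does this for all cosets at once.
\<close>

definition exponent_weight :: "complex \<Rightarrow> int" where
  "exponent_weight l = \<lfloor>Re l\<rfloor>"

lemma exponent_weight_add: "exponent_weight (l - of_int n) = exponent_weight l - n"
  by (simp add: exponent_weight_def)

definition rotate_exponents :: "complex \<Rightarrow> (complex \<times> nat \<Rightarrow> 'v::complex_vector) \<Rightarrow> complex \<times> nat \<Rightarrow> 'v" where
  "rotate_exponents z y = (\<lambda>(l, k). z powi exponent_weight l *\<^sub>C y (l, k))"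

lemma rotate_apply: "rotate_exponents z y (l, k) = z powi exponent_weight l *\<^sub>C y (l, k)"
  by (simp add: rotate_exponents_def)

lemma rotate_exp_poly:
  assumes S: "subspace S" and y: "y \<in> exp_poly S"
  shows "rotate_exponents z y \<in> exp_poly S"
proof (rule exp_polyI)
  have "{q. rotate_exponents z y q \<noteq> 0} \<subseteq> {q. y q \<noteq> 0}" by (auto simp: rotate_exponents_def)
  then show "finite {q. rotate_exponents z y q \<noteq> 0}" using exp_poly_finite[OF y] finite_subset by blast
  show "rotate_exponents z y q \<in> S" for q
    by (cases q) (simp add: rotate_apply subspace_scale[OF S] exp_poly_mem[OF y])
qed

lemma rotate_coeff:
  assumes f: "f \<in> linear_maps (space_on S) (space_on T)" and y: "y \<in> exp_poly S"
  shows "(\<lambda>q. f (rotate_exponents z y q)) = rotate_exponents z (\<lambda>q. f (y q))"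
  using lin_smult[OF f] exp_poly_mem[OF y] by (auto simp: fun_eq_iff rotate_exponents_def)

lemma rotate_diff: "rotate_exponents z (y - y') = rotate_exponents z y - rotate_exponents z y'"
  by (auto simp: fun_eq_iff rotate_exponents_def scaleC_simps)

context weighted_dg_algebra
begin

lemma r_closed: "z \<noteq> 0 \<Longrightarrow> a \<in> carrier (gr A j) \<Longrightarrow> r z j a \<in> carrier (gr A j)"
  and r_add: "z \<noteq> 0 \<Longrightarrow> a \<in> carrier (gr A j) \<Longrightarrow> b \<in> carrier (gr A j) \<Longrightarrow>
    r z j (a \<oplus>\<^bsub>gr A j\<^esub> b) = r z j a \<oplus>\<^bsub>gr A j\<^esub> r z j b"
proof -
  have l: "r z j \<in> linear_maps (gr A j) (gr A j)" if "z \<noteq> 0" for z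
    using rational[of j] that by (simp add: rational_representation_def representation_def)
  show "z \<noteq> 0 \<Longrightarrow> a \<in> carrier (gr A j) \<Longrightarrow> r z j a \<in> carrier (gr A j)" using lin_closed[OF l] .
  show "z \<noteq> 0 \<Longrightarrow> a \<in> carrier (gr A j) \<Longrightarrow> b \<in> carrier (gr A j) \<Longrightarrow>
    r z j (a \<oplus>\<^bsub>gr A j\<^esub> b) = r z j a \<oplus>\<^bsub>gr A j\<^esub> r z j b" using lin_add[OF l] .
qed

text \<open>
  An element of weight \<open>n\<close> translates exponents by \<open>n\<close>, hence their weights by \<open>n\<close>.
\<close>

lemma exp_act_rotate:
  assumes X: "concrete A X S" and y: "y \<in> exp_poly (S i)" and z: "z \<noteq> 0" and a: "a \<in> carrier (gr A j)"
  shows "exp_act X i j (rotate_exponents z y) (r z j a) = rotate_exponents z (exp_act X i j y a)"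
  using a
proof (induction rule: weight_induct)
  case (weight n a)
  note a = wt_carrier[OF weight]
  have ry: "rotate_exponents z y \<in> exp_poly (S i)" by (rule rotate_exp_poly[OF concrete_subspace[OF X] y])
  show ?case
  proof
    fix q :: "complex \<times> nat"
    obtain l k where q: "q = (l, k)" by (cases q)
    have "wt j n (r z j a)"
    proof -
      have "r w j (z powi n \<odot>\<^bsub>gr A j\<^esub> a) = w powi n \<odot>\<^bsub>gr A j\<^esub> (z powi n \<odot>\<^bsub>gr A j\<^esub> a)" if "w \<noteq> 0" for w
      proof -
        have "r w j \<in> linear_maps (gr A j) (gr A j)"
          using rational[of j] that by (simp add: rational_representation_def representation_def)
        from lin_smult[OF this a] show ?thesis
          using a that by (simp add: wt_r[OF weight that] vs_smult_smult[OF vector_space] mult.commute)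
      qed
      then show ?thesis using vs_smult[OF vector_space a] wt_r[OF weight z] by (simp add: wt_def weight_vector_def)
    qed
    then have "exp_act X i j (rotate_exponents z y) (r z j a) q =
        act X i j (z powi (exponent_weight l - n) *\<^sub>C y (l - of_int n, k)) (z powi n \<odot>\<^bsub>gr A j\<^esub> a)"
      by (simp add: q exp_act_wt[OF X ry] rotate_apply exponent_weight_add wt_r[OF weight z])
    also have "\<dots> = (z powi (exponent_weight l - n) * z powi n) *\<^sub>C act X i j (y (l - of_int n, k)) a"
      using lin_smult[OF cact_linear[OF X exp_poly_mem[OF y] refl] a] vs_smult[OF vector_space a]
      by (simp add: cact_scale[OF X exp_poly_mem[OF y]])
    also have "z powi (exponent_weight l - n) * z powi n = z powi exponent_weight l"
      using z by (simp add: power_int_diff)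
    also have "z powi exponent_weight l *\<^sub>C act X i j (y (l - of_int n, k)) a = rotate_exponents z (exp_act X i j y a) q"
      by (simp add: q rotate_apply exp_act_wt[OF X y weight])
    finally show "exp_act X i j (rotate_exponents z y) (r z j a) q = rotate_exponents z (exp_act X i j y a) q" .
  qed
next
  case (add a b)
  have ry: "rotate_exponents z y \<in> exp_poly (S i)" by (rule rotate_exp_poly[OF concrete_subspace[OF X] y])
  have rot: "rotate_exponents z (u + v) = rotate_exponents z u + rotate_exponents z v" for u v :: "complex \<times> nat \<Rightarrow> 'b"
    by (auto simp: fun_eq_iff rotate_exponents_def scaleC_simps)
  show ?case
    unfolding r_add[OF z add.hyps] exp_act_add_right[OF X ry r_closed[OF z add.hyps(1)] r_closed[OF z add.hyps(2)]]
      exp_act_add_right[OF X y add.hyps] add.IH rot ..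
qed

text \<open>
  Differentiation and linear maps on coefficients do not mix exponents.
\<close>

lemma connection_op_rotate:
  assumes P: "concrete A P SP" and M: "concrete A M SM" and q: "dg_hom A P M q" and D: "connection_along P M q D"
    and y: "y \<in> exp_poly (SP i)"
  shows "connection_op q D i (rotate_exponents z y) = rotate_exponents z (connection_op q D i y)"
proof
  fix p :: "complex \<times> nat"
  obtain l k where p: "p = (l, k)" by (cases p)
  note ql = ql[OF P M q D] and Dl = Dl[OF P M q D]
  have s: "q i (c *\<^sub>C x) = c *\<^sub>C q i x" "D i (c *\<^sub>C x) = c *\<^sub>C D i x" if "x \<in> SP i" for c x
    using lin_smult[OF ql, of x i c] lin_smult[OF Dl, of x i c] that by simp_all
  show "connection_op q D i (rotate_exponents z y) p = rotate_exponents z (connection_op q D i y) p"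
    by (simp add: p connection_op_apply[OF P M q D] rotate_apply s exp_poly_mem[OF y] scaleC_simps mult.commute)
qed

end

text \<open>Coordinates of the solution module in which the action is diagonal.\<close>

definition flatten :: "(complex \<times> nat \<Rightarrow> 'b \<Rightarrow> complex) \<times> (complex \<times> nat \<Rightarrow> 'c \<Rightarrow> complex) \<Rightarrow>
    (complex \<times> nat) \<times> 'b + (complex \<times> nat) \<times> 'c \<Rightarrow> complex" where
  "flatten w s = (case s of Inl (p, b) \<Rightarrow> fst w p b | Inr (p, b) \<Rightarrow> snd w p b)"

lemma flatten_coordinates:
  defines "S \<equiv> \<lambda>B C. exp_poly (finitely_supported B) \<times> exp_poly (finitely_supported C)"
  shows "flatten \<in> linear_maps (space_on (S B C)) (space_on (finitely_supported (Inl ` (UNIV \<times> B) \<union> Inr ` (UNIV \<times> C))))"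
    and "bij_betw flatten (S B C) (finitely_supported (Inl ` (UNIV \<times> B) \<union> Inr ` (UNIV \<times> C)))"
proof -
  let ?Y = "Inl ` (UNIV \<times> B) \<union> Inr ` (UNIV \<times> C) :: ((complex \<times> nat) \<times> 'a + (complex \<times> nat) \<times> 'b) set"
  have fin: "finite {(p, b). y p b \<noteq> 0}" "\<And>p b. y p b \<noteq> 0 \<Longrightarrow> b \<in> B"
    if y: "y \<in> exp_poly (finitely_supported B)" for y :: "complex \<times> nat \<Rightarrow> 'd \<Rightarrow> complex" and B
  proof -
    have "{(p, b). y p b \<noteq> 0} \<subseteq> Sigma {p. y p \<noteq> 0} (\<lambda>p. {b. y p b \<noteq> 0})" by (auto simp: fun_eq_iff)
    moreover have "finite (Sigma {p. y p \<noteq> 0} (\<lambda>p. {b. y p b \<noteq> 0}))"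
      using exp_poly_finite[OF y] exp_poly_mem[OF y] by (intro finite_SigmaI) (auto simp: finitely_supported_def)
    ultimately show "finite {(p, b). y p b \<noteq> 0}" by (rule finite_subset)
    show "b \<in> B" if "y p b \<noteq> 0" for p b using exp_poly_mem[OF y, of p] that by (auto simp: finitely_supported_def)
  qed
  have closed: "flatten w \<in> finitely_supported ?Y" if w: "w \<in> S B C" for w
  proof -
    have w1: "fst w \<in> exp_poly (finitely_supported B)" and w2: "snd w \<in> exp_poly (finitely_supported C)"
      using w by (auto simp: S_def)
    have "{s. flatten w s \<noteq> 0} \<subseteq> Inl ` {(p, b). fst w p b \<noteq> 0} \<union> Inr ` {(p, b). snd w p b \<noteq> 0}"
    proof
      fix s assume "s \<in> {s. flatten w s \<noteq> 0}"
      then show "s \<in> Inl ` {(p, b). fst w p b \<noteq> 0} \<union> Inr ` {(p, b). snd w p b \<noteq> 0}"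
        by (cases s) (force simp: flatten_def)+
    qed
    then have "finite {s. flatten w s \<noteq> 0}" using fin(1)[OF w1] fin(1)[OF w2] finite_subset by blast
    moreover have "s \<in> ?Y" if "flatten w s \<noteq> 0" for s
      using that fin(2)[OF w1] fin(2)[OF w2] by (cases s) (force simp: flatten_def)+
    ultimately show ?thesis by (simp add: finitely_supported_def)
  qed
  show "flatten \<in> linear_maps (space_on (S B C)) (space_on (finitely_supported ?Y))"
    by (rule linear_mapsI) (auto simp: closed fun_eq_iff flatten_def split: sum.splits)
  show "bij_betw flatten (S B C) (finitely_supported ?Y)"
    unfolding bij_betw_def
  proof (intro conjI equalityI subsetI)
    show "inj_on flatten (S B C)"
    proof (rule inj_onI)
      fix w w' :: "(complex \<times> nat \<Rightarrow> 'a \<Rightarrow> complex) \<times> (complex \<times> nat \<Rightarrow> 'b \<Rightarrow> complex)"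
      assume eq: "flatten w = flatten w'"
      have "fst w p b = fst w' p b" for p b using fun_cong[OF eq, of "Inl (p, b)"] by (simp add: flatten_def)
      moreover have "snd w p b = snd w' p b" for p b using fun_cong[OF eq, of "Inr (p, b)"] by (simp add: flatten_def)
      ultimately show "w = w'" by (intro prod_eqI ext)
    qed
    show "g \<in> finitely_supported ?Y" if "g \<in> flatten ` S B C" for g using that closed by blast
    fix g :: "(complex \<times> nat) \<times> 'a + (complex \<times> nat) \<times> 'b \<Rightarrow> complex"
    assume g: "g \<in> finitely_supported ?Y"
    have gf: "finite {s. g s \<noteq> 0}" and gY: "\<And>s. g s \<noteq> 0 \<Longrightarrow> s \<in> ?Y" using g by (auto simp: finitely_supported_def)
    define y where "y p b = g (Inl (p, b))" for p b
    define y' where "y' p b = g (Inr (p, b))" for p b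
    have "y \<in> exp_poly (finitely_supported B)"
    proof (rule exp_polyI)
      have "{p. y p \<noteq> 0} \<subseteq> (\<lambda>s. case s of Inl (p, b) \<Rightarrow> p | Inr (p, b) \<Rightarrow> p) ` {s. g s \<noteq> 0}"
      proof
        fix p assume "p \<in> {p. y p \<noteq> 0}"
        then obtain b where "g (Inl (p, b)) \<noteq> 0" by (auto simp: fun_eq_iff y_def)
        then show "p \<in> (\<lambda>s. case s of Inl (p, b) \<Rightarrow> p | Inr (p, b) \<Rightarrow> p) ` {s. g s \<noteq> 0}"
          by (intro image_eqI[of _ _ "Inl (p, b)"]) auto
      qed
      then show "finite {p. y p \<noteq> 0}" using gf finite_surj by blast
      fix p
      have "finite {b. y p b \<noteq> 0}"
        by (rule finite_surj[OF gf, of _ "\<lambda>s. case s of Inl (p, b) \<Rightarrow> b | Inr _ \<Rightarrow> undefined"])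
          (force simp: y_def image_iff)
      moreover have "b \<in> B" if "y p b \<noteq> 0" for b using gY[of "Inl (p, b)"] that by (auto simp: y_def)
      ultimately show "y p \<in> finitely_supported B" by (simp add: finitely_supported_def)
    qed
    moreover have "y' \<in> exp_poly (finitely_supported C)"
    proof (rule exp_polyI)
      have "{p. y' p \<noteq> 0} \<subseteq> (\<lambda>s. case s of Inl (p, b) \<Rightarrow> p | Inr (p, b) \<Rightarrow> p) ` {s. g s \<noteq> 0}"
      proof
        fix p assume "p \<in> {p. y' p \<noteq> 0}"
        then obtain b where "g (Inr (p, b)) \<noteq> 0" by (auto simp: fun_eq_iff y'_def)
        then show "p \<in> (\<lambda>s. case s of Inl (p, b) \<Rightarrow> p | Inr (p, b) \<Rightarrow> p) ` {s. g s \<noteq> 0}"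
          by (intro image_eqI[of _ _ "Inr (p, b)"]) auto
      qed
      then show "finite {p. y' p \<noteq> 0}" using gf finite_surj by blast
      fix p
      have "finite {b. y' p b \<noteq> 0}"
        by (rule finite_surj[OF gf, of _ "\<lambda>s. case s of Inr (p, b) \<Rightarrow> b | Inl _ \<Rightarrow> undefined"])
          (force simp: y'_def image_iff)
      moreover have "b \<in> C" if "y' p b \<noteq> 0" for b using gY[of "Inr (p, b)"] that by (auto simp: y'_def)
      ultimately show "y' p \<in> finitely_supported C" by (simp add: finitely_supported_def)
    qed
    moreover have "g = flatten (y, y')"
      by (auto simp: fun_eq_iff flatten_def y_def y'_def split: sum.splits)
    ultimately show "g \<in> flatten ` S B C" by (auto simp: S_def)
  qed
qed

section \<open>Equivariant models\<close>

context weighted_dg_algebra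
begin

text \<open>
  \<open>N\<close> is a copy of the module of solutions in the given type. The action \<open>\<rho>\<close> on solutions, which is
  diagonal in the coordinates \<open>flatten\<close>, is carried over to \<open>N\<close>.
\<close>

lemma equivariant_model:
  fixes P :: "('a, 'b \<Rightarrow> complex) dg_module" and M :: "('a, 'c \<Rightarrow> complex) dg_module"
    and e :: "int \<Rightarrow> (complex \<times> nat \<Rightarrow> 'b \<Rightarrow> complex) \<times> (complex \<times> nat \<Rightarrow> 'c \<Rightarrow> complex) \<Rightarrow> 'u"
  assumes P: "concrete A P (\<lambda>i. finitely_supported (BP i))" and M: "concrete A M (\<lambda>i. finitely_supported (BM i))"
    and q: "dg_hom A P M q" and D: "connection_along P M q D"
    and qbij: "cohomology_bijective P M q" and fin: "finite_cohomology P"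
    and e: "\<And>i. inj_on (e i) (exp_poly (finitely_supported (BP i)) \<times> exp_poly (finitely_supported (BM (i - 1))))"
  shows "\<exists>(N :: ('a, 'u) dg_module) t f. equivariant_dg_module A r N t \<and> dg_hom A N P f \<and> cohomology_bijective N P f"
proof -
  define SP where "SP i = (finitely_supported (BP i) :: ('b \<Rightarrow> complex) set)" for i
  define SM where "SM i = (finitely_supported (BM i) :: ('c \<Rightarrow> complex) set)" for i
  have P': "concrete A P SP" and M': "concrete A M SM" using P M by (simp_all add: SP_def[abs_def] SM_def[abs_def])
  define C where "C = solution_module P SP M SM q D"
  define S where "S i = exp_poly (SP i) \<times> exp_poly (SM (i - 1))" for i
  have C: "concrete A C S" unfolding C_def S_def by (rule solution_module_concrete[OF P' M' q D])
  have dC: "dif C i (y, y') = (\<lambda>p. dif P i (y p), connection_op q D i y - (\<lambda>p. dif M (i - 1) (y' p)))"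
    and aC: "act C i j (y, y') a = (exp_act P i j y a, exp_act M (i - 1) j y' a)" for i j y y' a
    unfolding C_def by (rule solution_module_simps[OF P' M' q D])+
  have v0: "dg_hom A C P (\<lambda>i w. value0 (fst w))" unfolding C_def by (rule value0_hom[OF P' M' q D])
  have vb: "cohomology_bijective C P (\<lambda>i w. value0 (fst w))"
    unfolding C_def by (rule value0_bijective[OF P' M' q D qbij fin])
  note Cm = concrete_dg_module[OF C] and gC = concrete_gr[OF C] and sC = concrete_subspace[OF C]
  have eS: "inj_on (e i) (S i)" for i using e by (simp add: S_def SP_def SM_def)
  define G where "G i = pushforward (e i) (gr C i)" for i
  have VC: "complex_vector_space (gr C i)" for i unfolding gC by (rule space_on_space[OF sC])
  have ei: "inj_on (e i) (carrier (gr C i))" for i using eS by (simp add: gC)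
  have G: "complex_vector_space (G i)" "e i \<in> linear_maps (gr C i) (G i)"
    "bij_betw (e i) (carrier (gr C i)) (carrier (G i))" for i
    unfolding G_def by (rule pushforward_space[OF VC ei] pushforward_linear[OF VC ei] pushforward_bij[OF VC ei])+
  define N where "N = transport e G C"
  define h where "h i = inv_into (carrier (gr C i)) (e i)" for i
  have Nm: "dg_module A N" unfolding N_def by (rule transport_dg_module[OF Cm G])
  have eN: "dg_hom A C N e" unfolding N_def by (rule transport_dg_hom[OF Cm G])
  have hN: "dg_hom A N C h" unfolding N_def h_def by (rule transport_dg_hom_inv[OF Cm G])
  have gN [simp]: "gr N i = G i" for i by (simp add: N_def)
  have he: "h i (e i w) = w" if "w \<in> S i" for i w using eS that by (simp add: h_def gC)
  have eh: "e i (h i x) = x" if "x \<in> carrier (G i)" for i x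
    using bij_betw_inv_into_right[OF G(3) that] by (simp add: h_def)
  have hS: "h i x \<in> S i" if "x \<in> carrier (G i)" for i x
    using dg_hom_closed[OF hN, of x i] that by (simp add: gC)
  have eG: "e i w \<in> carrier (G i)" if "w \<in> S i" for i w using lin_closed[OF G(2), of w i] that by (simp add: gC)
  have hbij: "cohomology_bijective N C h"
    by (rule cohomology_bijective_inverse[OF Nm Cm hN eN]) (use eh he in \<open>auto simp: gC\<close>)
  define \<rho> where "\<rho> z w = (rotate_exponents z (fst w), rotate_exponents z (snd w))"
    for z and w :: "(complex \<times> nat \<Rightarrow> 'b \<Rightarrow> complex) \<times> (complex \<times> nat \<Rightarrow> 'c \<Rightarrow> complex)"
  have sP: "subspace (SP i)" and sM: "subspace (SM i)" for i
    by (rule concrete_subspace[OF P'], rule concrete_subspace[OF M'])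
  have \<rho>S: "\<rho> z w \<in> S i" if "w \<in> S i" for z w i
    using that by (auto simp: S_def \<rho>_def intro: rotate_exp_poly[OF sP] rotate_exp_poly[OF sM])
  have \<rho>d: "\<rho> z (dif C i w) = dif C i (\<rho> z w)" if w: "w \<in> S i" for z w i
  proof -
    obtain y y' where yy: "w = (y, y')" "y \<in> exp_poly (SP i)" "y' \<in> exp_poly (SM (i - 1))" using w by (auto simp: S_def)
    have "dif P i \<in> linear_maps (space_on (SP i)) (space_on (SP (i + 1)))"
      "dif M (i - 1) \<in> linear_maps (space_on (SM (i - 1))) (space_on (SM (i - 1 + 1)))"
      by (rule dPl[OF P' M' q D], rule dMl[OF P' M' q D])
    then show ?thesis
      by (simp only: yy(1) \<rho>_def dC fst_conv snd_conv rotate_diff rotate_coeff[OF _ yy(2)] rotate_coeff[OF _ yy(3)]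
          connection_op_rotate[OF P' M' q D yy(2)])
  qed
  have \<rho>a: "\<rho> z (act C i j w a) = act C i j (\<rho> z w) (r z j a)"
    if w: "w \<in> S i" and z: "z \<noteq> 0" and a: "a \<in> carrier (gr A j)" for z w i j a
  proof -
    obtain y y' where yy: "w = (y, y')" "y \<in> exp_poly (SP i)" "y' \<in> exp_poly (SM (i - 1))" using w by (auto simp: S_def)
    show ?thesis
      by (simp only: yy(1) \<rho>_def aC fst_conv snd_conv exp_act_rotate[OF P' yy(2) z a] exp_act_rotate[OF M' yy(3) z a])
  qed
  define t where "t z i x = e i (\<rho> z (h i x))" for z i x
  have ht: "h i (t z i x) = \<rho> z (h i x)" if "x \<in> carrier (G i)" for z i x
    unfolding t_def by (rule he[OF \<rho>S[OF hS[OF that]]])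
  have tc: "t z i x \<in> carrier (G i)" if "x \<in> carrier (G i)" for z i x
    unfolding t_def by (rule eG[OF \<rho>S[OF hS[OF that]]])
  have hinj: "x = y" if "h i x = h i y" "x \<in> carrier (G i)" "y \<in> carrier (G i)" for i x y
    using that eh by metis
  interpret N: dg_module A N by (rule Nm)
  have dN: "dif N i x \<in> carrier (G (i + 1))" "h (i + 1) (dif N i x) = dif C i (h i x)" if "x \<in> carrier (G i)" for i x
    using N.M.dif_closed[of x i] dg_hom_dif[OF hN, of x i] that by simp_all
  have aN: "act N i j x a \<in> carrier (G (i + j))" "h (i + j) (act N i j x a) = act C i j (h i x) a"
    if "x \<in> carrier (G i)" "a \<in> carrier (gr A j)" for i j x a
    using lin_closed[OF N.act_linear_left[OF that(2)], of x i] dg_hom_act[OF hN, of x i a j] that by simp_all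
  have rat: "rational_representation (gr N i) (\<lambda>z. t z i)" for i
  proof -
    let ?Y = "Inl ` (UNIV \<times> BP i) \<union> Inr ` (UNIV \<times> BM (i - 1)) :: ((complex \<times> nat) \<times> 'b + (complex \<times> nat) \<times> 'c) set"
    define \<omega> :: "(complex \<times> nat) \<times> 'b + (complex \<times> nat) \<times> 'c \<Rightarrow> int" where
      "\<omega> s = (case s of Inl (p, b) \<Rightarrow> exponent_weight (fst p) | Inr (p, b) \<Rightarrow> exponent_weight (fst p))" for s
    have hl: "h i \<in> linear_maps (gr N i) (space_on (S i))" using dg_hom_linear[OF hN, of i] by (simp add: gC)
    have hb: "bij_betw (h i) (carrier (gr N i)) (S i)"
      using bij_betw_inv_into[OF G(3)[of i]] by (simp add: h_def gC)
    note fl = flatten_coordinates[of "BP i" "BM (i - 1)", folded SP_def SM_def, folded S_def]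
    show ?thesis
    proof (rule diagonal_rational[where Y = ?Y and \<omega> = \<omega> and \<Phi> = "\<lambda>x. flatten (h i x)"])
      show "complex_vector_space (gr N i)" by (simp add: G(1))
      show "(\<lambda>x. flatten (h i x)) \<in> linear_maps (gr N i) (space_on (finitely_supported ?Y))"
        by (rule lin_comp[OF hl fl(1)])
      show "bij_betw (\<lambda>x. flatten (h i x)) (carrier (gr N i)) (finitely_supported ?Y)"
        using bij_betw_trans[OF hb fl(2)] by (simp add: comp_def)
      show "t z i x \<in> carrier (gr N i)" if "x \<in> carrier (gr N i)" for z x using tc that by simp
      show "flatten (h i (t z i x)) = (\<lambda>b. z powi \<omega> b * flatten (h i x) b)" if "x \<in> carrier (gr N i)" for z x
        using ht[of x i z] that
        by (auto simp: fun_eq_iff flatten_def \<omega>_def \<rho>_def rotate_exponents_def scaleC_complex_def split: sum.splits prod.splits)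
    qed
  qed
  have "equivariant_dg_module A r N t"
  proof (intro equivariant_dg_module.intro rational_complex.intro rational_complex_axioms.intro
      equivariant_dg_module_axioms.intro)
    show "equivariant_dg_algebra A r" by (rule equivariant_dg_algebra_axioms)
    show "dg_module A N" by (rule Nm)
    show "cochain_complex N" by (rule dg_module_cochain[OF Nm])
    show "rational_representation (gr N i) (\<lambda>z. t z i)" for i by (rule rat)
    show "t z (i + 1) (dif N i x) = dif N i (t z i x)" if "z \<noteq> 0" "x \<in> carrier (gr N i)" for z i x
    proof -
      have x: "x \<in> carrier (G i)" using that by simp
      have "h (i + 1) (t z (i + 1) (dif N i x)) = h (i + 1) (dif N i (t z i x))"
        using dN[OF x] dN[OF tc[OF x]] ht[OF x] ht[OF dN(1)[OF x]] \<rho>d[OF hS[OF x]] by simp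
      then show ?thesis by (rule hinj[OF _ tc[OF dN(1)[OF x]] dN(1)[OF tc[OF x]]])
    qed
    show "t z (i + j) (act N i j x a) = act N i j (t z i x) (r z j a)"
      if "z \<noteq> 0" "x \<in> carrier (gr N i)" "a \<in> carrier (gr A j)" for z i x a j
    proof -
      have x: "x \<in> carrier (G i)" using that by simp
      note ra = r_closed[OF that(1,3)]
      have "h (i + j) (t z (i + j) (act N i j x a)) = h (i + j) (act N i j (t z i x) (r z j a))"
        using aN[OF x that(3)] aN[OF tc[OF x] ra] ht[OF x] ht[OF aN(1)[OF x that(3)]] \<rho>a[OF hS[OF x] that(1,3)] by simp
      then show ?thesis by (rule hinj[OF _ tc[OF aN(1)[OF x that(3)]] aN(1)[OF tc[OF x] ra]])
    qed
  qed
  moreover have "dg_hom A N P (\<lambda>i x. value0 (fst (h i x)))" by (rule dg_hom_comp[OF hN v0])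
  moreover have "cohomology_bijective N P (\<lambda>i x. value0 (fst (h i x)))"
    by (rule cohomology_bijective_comp[OF Nm Cm concrete_dg_module[OF P'] hN hbij v0 vb])
  ultimately show ?thesis by blast
qed

end

theorem theorem1p10:
  fixes A :: "'u dg_algebra"
    and r :: "complex \<Rightarrow> int \<Rightarrow> 'u \<Rightarrow> 'u"
    and M :: "('u, 'u) dg_module"
  assumes "dg_algebra A"
    and "proper A"
    and "equivariant_dg_algebra A r"
    and "dg_module A M"
    and "perfect A M"
    and "rigid_simple A M"
  shows "\<exists>(N :: ('u, 'u) dg_module) t. equivariant_dg_module A r N t \<and> quasi_isomorphic A M N"
proof -
  interpret E: equivariant_dg_algebra A r by fact
  have "\<exists>\<pi>. weight_projections (gr A j) (\<lambda>z. r z j) \<pi>" for j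
    by (rule weight_projections_exist[OF E.vector_space E.rational])
  then obtain \<pi> where \<pi>: "\<And>j. weight_projections (gr A j) (\<lambda>z. r z j) (\<pi> j)" by metis
  interpret W: weighted_dg_algebra A r \<pi> by unfold_locales (rule \<pi>)
  have M: "dg_module A M" by fact
  obtain P :: "('u, 'u) dg_module" and p where P: "h_projective A P" and p: "quasi_isomorphism A P M p"
    and rig: "zero_space (cohomology (hom_complex A P M) 1)"
    and simp: "linearly_isomorphic (cohomology (hom_complex A P M) 0) complex_line"
    using assms(6) unfolding rigid_simple_def h_projective_resolution_def by blast
  have Pm: "dg_module A P" using P by (simp add: h_projective_def)
  interpret P: dg_module A P by (rule Pm)
  have ph: "dg_hom A P M p" and pb: "cohomology_bijective P M p"
    using p quasi_isomorphism_iff[OF Pm M] by blast+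
  obtain \<kappa> :: "complex \<Rightarrow> 'u" where \<kappa>: "inj \<kappa>" using simple_complex_embeds[OF M simp] by blast
  obtain pr :: "'u \<times> 'u \<Rightarrow> 'u" where pr: "inj pr" using pairing_exists[OF \<kappa>] by blast
  \<comment> \<open>coordinates for the resolution and for the module\<close>
  obtain P' :: "('u, 'u \<Rightarrow> complex) dg_module" and BP :: "int \<Rightarrow> 'u set" and \<phi>P \<psi>P
    where P': "concrete A P' (\<lambda>i. finitely_supported (BP i))"
      and \<phi>P: "dg_hom A P P' \<phi>P" and \<psi>P: "dg_hom A P' P \<psi>P"
      and \<psi>\<phi>P: "\<And>i x. x \<in> carrier (gr P i) \<Longrightarrow> \<psi>P i (\<phi>P i x) = x"
      and \<phi>\<psi>P: "\<And>i y. y \<in> finitely_supported (BP i) \<Longrightarrow> \<phi>P i (\<psi>P i y) = y"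
    by (rule concrete_model[OF Pm]) (rule that)
  obtain M' :: "('u, 'u \<Rightarrow> complex) dg_module" and BM :: "int \<Rightarrow> 'u set" and \<phi>M \<psi>M
    where M': "concrete A M' (\<lambda>i. finitely_supported (BM i))"
      and \<phi>M: "dg_hom A M M' \<phi>M" and \<psi>M: "dg_hom A M' M \<psi>M"
      and \<psi>\<phi>M: "\<And>i x. x \<in> carrier (gr M i) \<Longrightarrow> \<psi>M i (\<phi>M i x) = x"
      and \<phi>\<psi>M: "\<And>i y. y \<in> finitely_supported (BM i) \<Longrightarrow> \<phi>M i (\<psi>M i y) = y"
    by (rule concrete_model[OF M]) (rule that)
  note Pm' = concrete_dg_module[OF P'] and Mm' = concrete_dg_module[OF M']
  note gP = concrete_gr[OF P'] and gM = concrete_gr[OF M']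
  let ?SP = "\<lambda>i. finitely_supported (BP i) :: ('u \<Rightarrow> complex) set"
  let ?SM = "\<lambda>i. finitely_supported (BM i) :: ('u \<Rightarrow> complex) set"
  have \<psi>Minj: "inj_on (\<psi>M i) (?SM i)" and \<psi>Pinj: "inj_on (\<psi>P i) (?SP i)" for i
    by (rule inj_on_inverseI, erule \<phi>\<psi>M, rule inj_on_inverseI, erule \<phi>\<psi>P)
  have p': "dg_hom A P M' (\<lambda>i x. \<phi>M i (p i x))" by (rule dg_hom_comp[OF ph \<phi>M])
  have \<phi>Mb: "cohomology_bijective M M' \<phi>M"
    by (rule cohomology_bijective_inverse[OF M Mm' \<phi>M \<psi>M]) (simp_all add: gM \<phi>\<psi>M \<psi>\<phi>M)
  have pb': "cohomology_bijective P M' (\<lambda>i x. \<phi>M i (p i x))"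
    by (rule cohomology_bijective_comp[OF Pm M Mm' ph pb \<phi>M \<phi>Mb])
  \<comment> \<open>the Atiyah complex has four components in \<open>M\<close>; pairing embeds it into the type of \<open>P\<close>, so that it
    is a legitimate test module for h-projectivity\<close>
  define e4 where "e4 i = (\<lambda>(u, x, y, v). pr (\<psi>M (i + 1) u, pr (\<psi>M i x, pr (\<psi>M i y, \<psi>M (i - 1) v))))" for i
  have e4: "inj_on (e4 i) (?SM (i + 1) \<times> ?SM i \<times> ?SM i \<times> ?SM (i - 1))" for i
  proof (rule inj_onI)
    fix s s' assume s: "s \<in> ?SM (i + 1) \<times> ?SM i \<times> ?SM i \<times> ?SM (i - 1)"
      and s': "s' \<in> ?SM (i + 1) \<times> ?SM i \<times> ?SM i \<times> ?SM (i - 1)" and eq: "e4 i s = e4 i s'"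
    obtain u x y v u' x' y' v' where ss: "s = (u, x, y, v)" "s' = (u', x', y', v')" by (cases s, cases s') auto
    have "\<psi>M (i + 1) u = \<psi>M (i + 1) u'" "\<psi>M i x = \<psi>M i x'" "\<psi>M i y = \<psi>M i y'" "\<psi>M (i - 1) v = \<psi>M (i - 1) v'"
      using eq unfolding e4_def ss by (auto dest!: injD[OF pr])
    then show "s = s'" using s s' \<psi>Minj by (auto simp: ss dest: inj_onD)
  qed
  \<comment> \<open>rigidity, carried over to the coordinates of \<open>M\<close>\<close>
  have rigid: "\<exists>v. degree_map A P M' 0 v \<and> (\<forall>i. \<forall>x\<in>carrier (gr P i). u i x = dif M' i (v i x) - v (i + 1) (dif P i x))"
    if u: "degree_map A P M' 1 u"
      and cl: "\<And>i x. x \<in> carrier (gr P i) \<Longrightarrow> dif M' (i + 1) (u i x) + u (i + 1) (dif P i x) = 0" for u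
  proof -
    interpret Mi: dg_module A M by (rule M)
    have ul: "u i \<in> linear_maps (gr P i) (gr M' (i + 1))" for i by (rule degree_map_linear[OF u])
    have uc: "u i x \<in> carrier (gr M' (i + 1))" if "x \<in> carrier (gr P i)" for i x by (rule lin_closed[OF ul that])
    have "degree_map A P M 1 (\<lambda>i x. \<psi>M (i + 1) (u i x))"
      unfolding degree_map_def
    proof (intro conjI allI ballI)
      show "(\<lambda>x. \<psi>M (i + 1) (u i x)) \<in> linear_maps (gr P i) (gr M (i + 1))" for i
        by (rule lin_comp[OF ul dg_hom_linear[OF \<psi>M]])
      show "\<psi>M (i + j + 1) (u (i + j) (act P i j x a)) = act M (i + 1) j (\<psi>M (i + 1) (u i x)) a"
        if "x \<in> carrier (gr P i)" "a \<in> carrier (gr A j)" for i j x a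
        using dg_hom_act[OF \<psi>M uc[OF that(1)] that(2)] degree_map_act[OF u that] by (simp add: add_ac)
    qed
    moreover have "dif M (i + 1) (\<psi>M (i + 1) (u i x)) \<oplus>\<^bsub>gr M (i + 2)\<^esub> \<psi>M (i + 1 + 1) (u (i + 1) (dif P i x)) = \<zero>\<^bsub>gr M (i + 2)\<^esub>"
      if x: "x \<in> carrier (gr P i)" for i x
    proof -
      have i2: "i + 1 + 1 = i + 2" by simp
      interpret Mj: dg_module A M' by (rule Mm')
      have c: "dif M' (i + 1) (u i x) \<in> carrier (gr M' (i + 2))" "u (i + 1) (dif P i x) \<in> carrier (gr M' (i + 2))"
        using Mj.M.dif_closed[OF uc[OF x]] uc[OF P.M.dif_closed[OF x]] by (simp_all add: i2)
      have "\<psi>M (i + 2) (dif M' (i + 1) (u i x) \<oplus>\<^bsub>gr M' (i + 2)\<^esub> u (i + 1) (dif P i x)) = \<psi>M (i + 2) \<zero>\<^bsub>gr M' (i + 2)\<^esub>"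
        using cl[OF x] by (simp add: gM)
      then show ?thesis
        using dg_hom_dif[OF \<psi>M uc[OF x]] lin_add[OF dg_hom_linear[OF \<psi>M] c]
          lin_zero[OF dg_hom_linear[OF \<psi>M] Mj.M.vector_space Mi.M.vector_space] by (simp add: i2)
    qed
    ultimately obtain g where g: "degree_map A P M 0 g"
      and ug: "\<And>i x. x \<in> carrier (gr P i) \<Longrightarrow> \<psi>M (i + 1) (u i x) =
        dif M i (g i x) \<oplus>\<^bsub>gr M (i + 1)\<^esub> (- 1) \<odot>\<^bsub>gr M (i + 1)\<^esub> g (i + 1) (dif P i x)"
      by (rule hom_complex_exact[OF Pm M rig]) (assumption, rule that)
    have gl: "g i \<in> linear_maps (gr P i) (gr M i)" for i using degree_map_linear[OF g, of i] by simp
    have gc: "g i x \<in> carrier (gr M i)" if "x \<in> carrier (gr P i)" for i x by (rule lin_closed[OF gl that])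
    have "degree_map A P M' 0 (\<lambda>i x. \<phi>M i (g i x))"
      unfolding degree_map_def
    proof (intro conjI allI ballI)
      show "(\<lambda>x. \<phi>M i (g i x)) \<in> linear_maps (gr P i) (gr M' (i + 0))" for i
        using lin_comp[OF gl dg_hom_linear[OF \<phi>M]] by simp
      show "\<phi>M (i + j) (g (i + j) (act P i j x a)) = act M' (i + 0) j (\<phi>M i (g i x)) a"
        if "x \<in> carrier (gr P i)" "a \<in> carrier (gr A j)" for i j x a
        using dg_hom_act[OF \<phi>M gc[OF that(1)] that(2)] degree_map_act[OF g that] by simp
    qed
    moreover have "u i x = dif M' i (\<phi>M i (g i x)) - \<phi>M (i + 1) (g (i + 1) (dif P i x))"
      if x: "x \<in> carrier (gr P i)" for i x
    proof -
      note c1 = Mi.M.dif_closed[OF gc[OF x]] and c2 = gc[OF P.M.dif_closed[OF x]]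
      have "u i x = \<phi>M (i + 1) (\<psi>M (i + 1) (u i x))" using uc[OF x] by (simp add: gM \<phi>\<psi>M)
      also have "\<dots> = \<phi>M (i + 1) (dif M i (g i x)) + (- 1) *\<^sub>C \<phi>M (i + 1) (g (i + 1) (dif P i x))"
        unfolding ug[OF x] using lin_add[OF dg_hom_linear[OF \<phi>M] c1 vs_smult[OF Mi.M.vector_space c2]]
          lin_smult[OF dg_hom_linear[OF \<phi>M] c2] by (simp add: gM)
      finally show ?thesis using dg_hom_dif[OF \<phi>M gc[OF x]] by (simp add: scaleC_minus_one)
    qed
    ultimately show ?thesis by blast
  qed
  obtain q D h where q: "dg_hom A P M' q" and D: "W.connection_along P M' q D"
    and hc: "\<And>i x. x \<in> carrier (gr P i) \<Longrightarrow> h i x \<in> ?SM (i - 1)"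
    and h0: "\<And>i. h i \<zero>\<^bsub>gr P i\<^esub> = 0"
    and hom: "\<And>i x. x \<in> carrier (gr P i) \<Longrightarrow> \<phi>M i (p i x) = q i x - dif M' (i - 1) (h i x) - h (i + 1) (dif P i x)"
    by (rule W.atiyah_lift[OF P M' p' e4 rigid]) (assumption, assumption, rule that)
  \<comment> \<open>\<open>q\<close> is homotopic to a quasi-isomorphism\<close>
  have qb: "cohomology_bijective P M' q"
  proof -
    note B = concrete_coboundaries_subspace[OF M']
    have diff: "q i x - \<phi>M i (p i x) \<in> coboundaries M' i" if x: "x \<in> cocycles P i" for i x
    proof -
      have xc: "x \<in> carrier (gr P i)" "dif P i x = \<zero>\<^bsub>gr P (i + 1)\<^esub>" using x by (auto simp: cocycles_def)
      have "q i x - \<phi>M i (p i x) = dif M' (i - 1) (h i x)" using hom[OF xc(1)] xc(2) h0 by simp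
      then show ?thesis using concrete_coboundariesI[OF M' hc[OF xc(1)]] by simp
    qed
    show ?thesis
      unfolding cohomology_bijective_def
    proof (intro conjI allI ballI impI)
      fix i x assume x: "x \<in> cocycles P i" "q i x \<in> coboundaries M' i"
      have "\<phi>M i (p i x) \<in> coboundaries M' i" using subspace_diff[OF B x(2) diff[OF x(1)]] by simp
      then show "x \<in> coboundaries P i" using pb' x(1) unfolding cohomology_bijective_def by blast
    next
      fix i y assume "y \<in> cocycles M' i"
      then obtain x b where x: "x \<in> cocycles P i" and b: "b \<in> coboundaries M' i" and y: "y = b + \<phi>M i (p i x)"
        using pb' unfolding cohomology_bijective_def gM space_on_simps by blast
      have "b - (q i x - \<phi>M i (p i x)) \<in> coboundaries M' i" by (rule subspace_diff[OF B b diff[OF x]])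
      moreover have "y = (b - (q i x - \<phi>M i (p i x))) \<oplus>\<^bsub>gr M' i\<^esub> q i x" by (simp add: y gM)
      ultimately show "\<exists>x\<in>cocycles P i. \<exists>b\<in>coboundaries M' i. y = b \<oplus>\<^bsub>gr M' i\<^esub> q i x" using x by blast
    qed
  qed
  have \<psi>Pb: "cohomology_bijective P' P \<psi>P"
    by (rule cohomology_bijective_inverse[OF Pm' Pm \<psi>P \<phi>P]) (simp_all add: gP \<phi>\<psi>P \<psi>\<phi>P)
  have q': "dg_hom A P' M' (\<lambda>i y. q i (\<psi>P i y))" by (rule dg_hom_comp[OF \<psi>P q])
  have qb': "cohomology_bijective P' M' (\<lambda>i y. q i (\<psi>P i y))"
    by (rule cohomology_bijective_comp[OF Pm' Pm Mm' \<psi>P \<psi>Pb q qb])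
  have D': "W.connection_along P' M' (\<lambda>i y. q i (\<psi>P i y)) (\<lambda>i y. D i (\<psi>P i y))"
    unfolding W.connection_along_def
  proof (intro conjI allI ballI)
    show "(\<lambda>y. D i (\<psi>P i y)) \<in> linear_maps (gr P' i) (gr M' i)" for i
      using D by (intro lin_comp[OF dg_hom_linear[OF \<psi>P]]) (simp add: W.connection_along_def)
    show "D (i + 1) (\<psi>P (i + 1) (dif P' i y)) = dif M' i (D i (\<psi>P i y))" if "y \<in> carrier (gr P' i)" for i y
      using D dg_hom_dif[OF \<psi>P that] dg_hom_closed[OF \<psi>P that] by (simp add: W.connection_along_def)
    show "D (i + j) (\<psi>P (i + j) (act P' i j y a)) = act M' i j (D i (\<psi>P i y)) a + W.euler_act M' i j (q i (\<psi>P i y)) a"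
      if "y \<in> carrier (gr P' i)" "a \<in> carrier (gr A j)" for i j y a
      using D dg_hom_act[OF \<psi>P that] dg_hom_closed[OF \<psi>P that(1)] that(2) by (simp add: W.connection_along_def)
  qed
  have "finite_cohomology M" by (rule perfect_finite_cohomology[OF assms(1,2,5)])
  then have "finite_cohomology P" using quasi_isomorphism_finite[OF Pm M p] by simp
  then have fin: "finite_cohomology P'"
    using quasi_isomorphism_finite[OF Pm' Pm] quasi_isomorphism_iff[OF Pm' Pm] \<psi>P \<psi>Pb by blast
  have "\<exists>e. inj_on (e :: (complex \<times> nat \<Rightarrow> 'u \<Rightarrow> complex) \<times> (complex \<times> nat \<Rightarrow> 'u \<Rightarrow> complex) \<Rightarrow> 'u)
      (exp_poly (?SP i) \<times> exp_poly (?SM (i - 1)))" for i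
  proof -
    obtain e1 :: "(complex \<times> nat \<Rightarrow> 'u \<Rightarrow> complex) \<Rightarrow> 'u" where e1: "inj_on e1 (exp_poly (?SP i))"
      using exp_poly_embeds[OF \<kappa> pr \<psi>Pinj] by blast
    obtain e2 :: "(complex \<times> nat \<Rightarrow> 'u \<Rightarrow> complex) \<Rightarrow> 'u" where e2: "inj_on e2 (exp_poly (?SM (i - 1)))"
      using exp_poly_embeds[OF \<kappa> pr \<psi>Minj] by blast
    have "inj_on (\<lambda>(y, y'). pr (e1 y, e2 y')) (exp_poly (?SP i) \<times> exp_poly (?SM (i - 1)))"
      by (rule inj_onI) (auto dest!: injD[OF pr] dest: inj_onD[OF e1] inj_onD[OF e2])
    then show ?thesis by blast
  qed
  then have "\<exists>e. \<forall>i. inj_on (e i :: (complex \<times> nat \<Rightarrow> 'u \<Rightarrow> complex) \<times> (complex \<times> nat \<Rightarrow> 'u \<Rightarrow> complex) \<Rightarrow> 'u)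
      (exp_poly (?SP i) \<times> exp_poly (?SM (i - 1)))" by (intro choice allI)
  then obtain e where e: "inj_on (e i :: (complex \<times> nat \<Rightarrow> 'u \<Rightarrow> complex) \<times> (complex \<times> nat \<Rightarrow> 'u \<Rightarrow> complex) \<Rightarrow> 'u)
      (exp_poly (?SP i) \<times> exp_poly (?SM (i - 1)))" for i by blast
  obtain N :: "('u, 'u) dg_module" and t f where N: "equivariant_dg_module A r N t"
    and f: "dg_hom A N P' f" "cohomology_bijective N P' f"
    using W.equivariant_model[OF P' M' q' D' qb' fin e] by blast
  have Nm: "dg_module A N" using N by (simp add: equivariant_dg_module_def)
  have "quasi_isomorphism A N P (\<lambda>i x. \<psi>P i (f i x))"
    using dg_hom_comp[OF f(1) \<psi>P] cohomology_bijective_comp[OF Nm Pm' Pm f \<psi>P \<psi>Pb] quasi_isomorphism_iff[OF Nm Pm] by blast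
  then have "quasi_isomorphic A N P" and "quasi_isomorphic A P M"
    unfolding quasi_isomorphic_def using Nm Pm M p by (blast intro: r_into_equivclp)+
  then have "quasi_isomorphic A M N"
    unfolding quasi_isomorphic_def by (blast intro: equivclp_sym equivclp_trans)
  with N show ?thesis by blast
qed

end
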